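(* Let $\mathbf u$ be a strong solution of the LLBE with initial datum $\mathbf u_0$, and let $p\in[2,\infty]$. Then for all $t\in[0,\infty)$, $$\|\mathbf u(t)\|_{\mathbb L^p}\le e^{-\kappa_2 t}\,\|\mathbf u_0\|_{\mathbb L^p}.$$
   Context: Domain: $d\in\{1,2,3\}$ and $\mathscr D\subset\mathbb R^d$ is a bounded polytopal domain (a bounded interval if $d=1$, a polygon, possibly non-convex, if $d=2$, a convex polyhedron if $d=3$). If $\mathscr D$ is non-convex ($d=2$), it has exactly one re-entrant corner, of angle $\omega\in(\pi,2\pi)$, and $\alpha_0:=\pi/\omega\in(\tfrac12,1)$. An exponent $\alpha$ is admissible if $\tfrac12<\alpha<\alpha_0$ when $\mathscr D$ is non-convex, and $\alpha=1$ when $\mathscr D$ is convex. Spaces: $\mathbb L^p,\mathbb H^s$ are the Lebesgue and (fractional) Sobolev spaces of $\mathbb R^3$-valued functions on $\mathscr D$. $\mathbb H^1_\Delta:=\{\mathbf v\in\mathbb H^1:\Delta\mathbf v\in\mathbb L^2\}$ with norm $\|\mathbf v\|_{\mathbb H^1}+\|\Delta\mathbf v\|_{\mathbb L^2}$. $L^q_T(X)=L^q(0,T;X)$, $W^{1,q}_T(X)=W^{1,q}(0,T;X)$. $\langle\mathbf u\times\nabla\mathbf v,\nabla\mathbf w\rangle_{\mathbb L^2}=\sum_{j=1}^d\int_{\mathscr D}(\mathbf u\times\partial_j\mathbf v)\cdot\partial_j\mathbf w\,dx$. LLBE (Landau--Lifshitz--Bloch equation): with constants $\kappa_1,\kappa_2,\mu>0$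 and a real constant $\gamma$ (of either sign): $\partial_t\mathbf u=\kappa_1\Delta\mathbf u+\gamma\,\mathbf u\times\Delta\mathbf u-\kappa_2(1+\mu|\mathbf u|^2)\mathbf u$ in $(0,T)\times\mathscr D$, $\mathbf u(0)=\mathbf u_0$, $\partial\mathbf u/\partial\boldsymbol\nu=0$ on $\partial\mathscr D$. Weak solution (for $\mathbf u_0\in\mathbb H^1$): for admissible $\alpha$, $\mathbf u\in W^{1,4/3}_T(\mathbb L^2)\cap L^\infty_T(\mathbb H^1)\cap L^2_T(\mathbb H^{1+\alpha})$ with $\mathbf u(0)=\mathbf u_0$ and, for all $t\in(0,T)$ and $\mathbf v\in\mathbb H^1$, $$\langle\mathbf u(t),\mathbf v\rangle_{\mathbb L^2}+\kappa_1\!\int_0^t\!\langle\nabla\mathbf u,\nabla\mathbf v\rangle_{\mathbb L^2}ds+\gamma\!\int_0^t\!\langle\mathbf u\times\nabla\mathbf u,\nabla\mathbf v\rangle_{\mathbb L^2}ds+\kappa_2\!\int_0^t\!\langle(1+\mu|\mathbf u|^2)\mathbf u,\mathbf v\rangle_{\mathbb L^2}ds=\langle\mathbf u_0,\mathbf v\rangle_{\mathbb L^2}.$$ Strong solution: a weak solution with in addition $\mathbf u\in W^{1,\infty}_T(\mathbb L^2)\cap L^\infty_T(\mathbb H^1_\Delta)$; the equation then holds in $\mathbb L^2$. *)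

theory Defs
  imports "HOL-Analysis.Analysis" "HOL-Probability.Essential_Supremum"
begin

section \<open>Polytopal domains\<close>

text \<open>
  Near the boundary point \<^term>\<open>x\<close> the planar set \<^term>\<open>D\<close> is a circular sector with apex
  \<^term>\<open>x\<close> and opening angle \<^term>\<open>\<omega>\<close>; the orthonormal pair \<^term>\<open>e1\<close>, \<^term>\<open>e2\<close> fixes
  the position of the sector. The value \<^term>\<open>pi\<close> is attained at the points of the open edges.
\<close>

definition interior_angle :: "'a::euclidean_space set \<Rightarrow> 'a \<Rightarrow> real \<Rightarrow> bool" where
  "interior_angle D x \<omega> \<longleftrightarrow> 0 < \<omega> \<and> \<omega> < 2 * pi \<and>
     (\<exists>e1 e2 \<epsilon>. norm e1 = 1 \<and> norm e2 = 1 \<and> e1 \<bullet> e2 = 0 \<and> 0 < \<epsilon> \<and>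
        D \<inter> ball x \<epsilon> =
          {x + r *\<^sub>R (cos \<theta> *\<^sub>R e1 + sin \<theta> *\<^sub>R e2) | r \<theta>. 0 < r \<and> r < \<epsilon> \<and> 0 < \<theta> \<and> \<theta> < \<omega>})"

text \<open>
  The boundary is compact and, near each of its points, consists of two straight segments
  issuing from that point. Hence it is a finite union of segments and has only finitely many
  corners.
\<close>

definition polygonal_domain :: "'a::euclidean_space set \<Rightarrow> bool" where
  "polygonal_domain D \<longleftrightarrow> DIM('a) = 2 \<and> open D \<and> connected D \<and> bounded D \<and> D \<noteq> {} \<and>
     (\<forall>x\<in>frontier D. \<exists>\<omega>. interior_angle D x \<omega>)"

definition reentrant_corner :: "'a::euclidean_space set \<Rightarrow> 'a \<Rightarrow> real \<Rightarrow> bool" where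
  "reentrant_corner D x \<omega> \<longleftrightarrow> x \<in> frontier D \<and> interior_angle D x \<omega> \<and> pi < \<omega>"

definition polytopal_domain :: "'a::euclidean_space set \<Rightarrow> bool" where
  "polytopal_domain D \<longleftrightarrow>
     (DIM('a) = 1 \<and> (\<exists>a b. box a b \<noteq> {} \<and> D = box a b)) \<or>
     (DIM('a) = 2 \<and> polygonal_domain D \<and>
        (\<not> convex D \<longrightarrow> (\<exists>!x. \<exists>\<omega>. reentrant_corner D x \<omega>))) \<or>
     (DIM('a) = 3 \<and> (\<exists>P. polytope P \<and> D = interior P \<and> D \<noteq> {}))"

definition admissible :: "'a::euclidean_space set \<Rightarrow> real \<Rightarrow> bool" where
  "admissible D \<alpha> \<longleftrightarrow>
     (if convex D then \<alpha> = 1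
      else \<exists>x \<omega>. reentrant_corner D x \<omega> \<and> 1 / 2 < \<alpha> \<and> \<alpha> < pi / \<omega>)"


section \<open>Lebesgue spaces\<close>

text \<open>
  Elements of the function spaces are represented by functions rather than by classes modulo
  equality almost everywhere. Norms take values in \<^typ>\<open>ennreal\<close>. Only exponents
  \<open>r > 0\<close> are used in \<open>epow\<close>.
\<close>

definition epow :: "ennreal \<Rightarrow> real \<Rightarrow> ennreal" where
  "epow z r = (if z = top then top else ennreal (enn2real z powr r))"

definition eLp :: "'x measure \<Rightarrow> ennreal \<Rightarrow> ('x \<Rightarrow> ennreal) \<Rightarrow> ennreal" where
  "eLp M p g =
     (if p = top then esssup M g
      else epow (\<integral>\<^sup>+x. epow (g x) (enn2real p) \<partial>M) (1 / enn2real p))"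

definition Lp_norm ::
  "'a::euclidean_space set \<Rightarrow> ennreal \<Rightarrow> ('a \<Rightarrow> 'b::euclidean_space) \<Rightarrow> ennreal" where
  "Lp_norm D p f = eLp (lebesgue_on D) p (\<lambda>x. ennreal (norm (f x)))"

definition Lp_space ::
  "'a::euclidean_space set \<Rightarrow> ennreal \<Rightarrow> ('a \<Rightarrow> 'b::euclidean_space) set" where
  "Lp_space D p = {f \<in> borel_measurable (lebesgue_on D). Lp_norm D p f < top}"

definition L2_inner ::
  "'a::euclidean_space set \<Rightarrow> ('a \<Rightarrow> 'b::euclidean_space) \<Rightarrow> ('a \<Rightarrow> 'b) \<Rightarrow> real" where
  "L2_inner D f g = (LINT x|lebesgue_on D. f x \<bullet> g x)"


section \<open>Weak derivatives and Sobolev spaces\<close>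

definition dirderiv :: "'a::euclidean_space \<Rightarrow> ('a \<Rightarrow> real) \<Rightarrow> 'a \<Rightarrow> real" where
  "dirderiv b \<phi> = (\<lambda>x. frechet_derivative \<phi> (at x) b)"

fun Ck :: "nat \<Rightarrow> ('a::euclidean_space \<Rightarrow> real) \<Rightarrow> bool" where
  "Ck 0 \<phi> \<longleftrightarrow> continuous_on UNIV \<phi>"
| "Ck (Suc k) \<phi> \<longleftrightarrow> \<phi> differentiable_on UNIV \<and> (\<forall>b\<in>Basis. Ck k (dirderiv b \<phi>))"

definition test_function :: "'a::euclidean_space set \<Rightarrow> ('a \<Rightarrow> real) \<Rightarrow> bool" where
  "test_function D \<phi> \<longleftrightarrow> (\<forall>k. Ck k \<phi>) \<and>
     compact (closure {x. \<phi> x \<noteq> 0}) \<and> closure {x. \<phi> x \<noteq> 0} \<subseteq> D"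

definition locally_integrable ::
  "'a::euclidean_space set \<Rightarrow> ('a \<Rightarrow> 'b::euclidean_space) \<Rightarrow> bool" where
  "locally_integrable D f \<longleftrightarrow> (\<forall>K. compact K \<and> K \<subseteq> D \<longrightarrow> set_integrable lebesgue K f)"

definition has_weak_deriv ::
  "'a::euclidean_space set \<Rightarrow> 'a \<Rightarrow> ('a \<Rightarrow> 'b::euclidean_space) \<Rightarrow> ('a \<Rightarrow> 'b) \<Rightarrow> bool" where
  "has_weak_deriv D b f g \<longleftrightarrow> locally_integrable D f \<and> locally_integrable D g \<and>
     (\<forall>\<phi>. test_function D \<phi> \<longrightarrow>
        (LINT x|lebesgue_on D. dirderiv b \<phi> x *\<^sub>R f x) = - (LINT x|lebesgue_on D. \<phi> x *\<^sub>R g x))"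

definition has_weak_laplacian ::
  "'a::euclidean_space set \<Rightarrow> ('a \<Rightarrow> 'b::euclidean_space) \<Rightarrow> ('a \<Rightarrow> 'b) \<Rightarrow> bool" where
  "has_weak_laplacian D f g \<longleftrightarrow> locally_integrable D f \<and> locally_integrable D g \<and>
     (\<forall>\<phi>. test_function D \<phi> \<longrightarrow>
        (LINT x|lebesgue_on D. (\<Sum>b\<in>Basis. dirderiv b (dirderiv b \<phi>) x) *\<^sub>R f x) =
        (LINT x|lebesgue_on D. \<phi> x *\<^sub>R g x))"

text \<open>
  Representatives of the weak derivative and of the weak Laplacian; these are unique up to null
  sets and meaningful only for functions that possess them.
\<close>

definition weak_deriv ::
  "'a::euclidean_space set \<Rightarrow> 'a \<Rightarrow> ('a \<Rightarrow> 'b::euclidean_space) \<Rightarrow> 'a \<Rightarrow> 'b" where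
  "weak_deriv D b f = (SOME g. has_weak_deriv D b f g)"

definition weak_laplacian ::
  "'a::euclidean_space set \<Rightarrow> ('a \<Rightarrow> 'b::euclidean_space) \<Rightarrow> 'a \<Rightarrow> 'b" where
  "weak_laplacian D f = (SOME g. has_weak_laplacian D f g)"

definition gagliardo_sq ::
  "'a::euclidean_space set \<Rightarrow> real \<Rightarrow> ('a \<Rightarrow> 'b::euclidean_space) \<Rightarrow> ennreal" where
  "gagliardo_sq D \<sigma> f =
     (\<integral>\<^sup>+x. (\<integral>\<^sup>+y. ennreal ((norm (f x - f y))\<^sup>2 / norm (x - y) powr (real DIM('a) + 2 * \<sigma>))
        \<partial>lebesgue_on D) \<partial>lebesgue_on D)"

text \<open>
  Sobolev--Slobodeckij spaces of order \<open>k + \<sigma>\<close> with \<open>0 \<le> \<sigma> < 1\<close>: all weak derivatives up to order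
  \<open>k\<close> are square integrable and, if \<open>\<sigma> > 0\<close>, those of order \<open>k\<close> have finite Gagliardo seminorm.
  In the norm, mixed derivatives are counted once for every order of differentiation.
\<close>

fun Hks :: "'a::euclidean_space set \<Rightarrow> nat \<Rightarrow> real \<Rightarrow> ('a \<Rightarrow> 'b::euclidean_space) \<Rightarrow> bool" where
  "Hks D 0 \<sigma> f \<longleftrightarrow> f \<in> Lp_space D 2 \<and> (0 < \<sigma> \<longrightarrow> gagliardo_sq D \<sigma> f < top)"
| "Hks D (Suc k) \<sigma> f \<longleftrightarrow> f \<in> Lp_space D 2 \<and>
     (\<forall>b\<in>Basis. \<exists>g. has_weak_deriv D b f g \<and> Hks D k \<sigma> g)"

fun Hks_norm_sq ::
  "'a::euclidean_space set \<Rightarrow> nat \<Rightarrow> real \<Rightarrow> ('a \<Rightarrow> 'b::euclidean_space) \<Rightarrow> ennreal" where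
  "Hks_norm_sq D 0 \<sigma> f = (Lp_norm D 2 f)\<^sup>2 + (if 0 < \<sigma> then gagliardo_sq D \<sigma> f else 0)"
| "Hks_norm_sq D (Suc k) \<sigma> f =
     (Lp_norm D 2 f)\<^sup>2 + (\<Sum>b\<in>Basis. Hks_norm_sq D k \<sigma> (weak_deriv D b f))"

definition Hs_space ::
  "'a::euclidean_space set \<Rightarrow> real \<Rightarrow> ('a \<Rightarrow> 'b::euclidean_space) set" where
  "Hs_space D s = {f. Hks D (nat \<lfloor>s\<rfloor>) (frac s) f}"

definition Hs_norm ::
  "'a::euclidean_space set \<Rightarrow> real \<Rightarrow> ('a \<Rightarrow> 'b::euclidean_space) \<Rightarrow> ennreal" where
  "Hs_norm D s f = epow (Hks_norm_sq D (nat \<lfloor>s\<rfloor>) (frac s) f) (1 / 2)"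

definition H1_Delta_space ::
  "'a::euclidean_space set \<Rightarrow> ('a \<Rightarrow> 'b::euclidean_space) set" where
  "H1_Delta_space D = {f \<in> Hs_space D 1. \<exists>g\<in>Lp_space D 2. has_weak_laplacian D f g}"

definition H1_Delta_norm ::
  "'a::euclidean_space set \<Rightarrow> ('a \<Rightarrow> 'b::euclidean_space) \<Rightarrow> ennreal" where
  "H1_Delta_norm D f = Hs_norm D 1 f + Lp_norm D 2 (weak_laplacian D f)"


section \<open>Bochner spaces\<close>

text \<open>
  The library's Bochner integral needs a Banach space that is a type, whereas here the target
  \<open>(X, N)\<close> is a set \<^term>\<open>X\<close> of functions with a (semi)norm \<^term>\<open>N\<close> that depends on the
  domain. The definitions of strong measurability and of the integral by means of simple
  functions are therefore repeated for such targets. The integral of an \<^term>\<open>X\<close>-valued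
  simple function is the finite linear combination of its values, which the pointwise integral
  computes.
\<close>

definition strongly_measurable ::
  "real \<Rightarrow> ('a \<Rightarrow> 'b::euclidean_space) set \<Rightarrow> (('a \<Rightarrow> 'b) \<Rightarrow> ennreal) \<Rightarrow> (real \<Rightarrow> 'a \<Rightarrow> 'b) \<Rightarrow> bool"
where
  "strongly_measurable T X N f \<longleftrightarrow>
     (AE t in lebesgue_on {0<..<T}. f t \<in> X) \<and>
     (\<exists>s. (\<forall>n::nat. simple_function (lebesgue_on {0<..<T}) (s n) \<and> (\<forall>t\<in>{0<..<T}. s n t \<in> X)) \<and>
        (AE t in lebesgue_on {0<..<T}. (\<lambda>n. N (\<lambda>x. f t x - s n t x)) \<longlonglongrightarrow> 0))"

definition Bochner_space ::
  "real \<Rightarrow> ennreal \<Rightarrow> ('a \<Rightarrow> 'b::euclidean_space) set \<Rightarrow> (('a \<Rightarrow> 'b) \<Rightarrow> ennreal) \<Rightarrow>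
     (real \<Rightarrow> 'a \<Rightarrow> 'b) set"
where
  "Bochner_space T q X N =
     {f. strongly_measurable T X N f \<and> eLp (lebesgue_on {0<..<T}) q (\<lambda>t. N (f t)) < top}"

definition has_Bochner_integral_in ::
  "real \<Rightarrow> ('a \<Rightarrow> 'b::euclidean_space) set \<Rightarrow> (('a \<Rightarrow> 'b) \<Rightarrow> ennreal) \<Rightarrow>
     (real \<Rightarrow> 'a \<Rightarrow> 'b) \<Rightarrow> ('a \<Rightarrow> 'b) \<Rightarrow> bool"
where
  "has_Bochner_integral_in T X N f I \<longleftrightarrow> strongly_measurable T X N f \<and> I \<in> X \<and>
     (\<exists>s. (\<forall>n::nat. simple_function (lebesgue_on {0<..<T}) (s n) \<and> (\<forall>t\<in>{0<..<T}. s n t \<in> X)) \<and>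
        (\<lambda>n. \<integral>\<^sup>+t. N (\<lambda>x. f t x - s n t x) \<partial>lebesgue_on {0<..<T}) \<longlonglongrightarrow> 0 \<and>
        (\<lambda>n. N (\<lambda>x. I x - (LINT t|lebesgue_on {0<..<T}. s n t x))) \<longlonglongrightarrow> 0)"

definition W1_Bochner_space ::
  "real \<Rightarrow> ennreal \<Rightarrow> ('a \<Rightarrow> 'b::euclidean_space) set \<Rightarrow> (('a \<Rightarrow> 'b) \<Rightarrow> ennreal) \<Rightarrow>
     (real \<Rightarrow> 'a \<Rightarrow> 'b) set"
where
  "W1_Bochner_space T q X N =
     {f \<in> Bochner_space T q X N. \<exists>g\<in>Bochner_space T q X N.
        \<forall>\<phi>. test_function {0<..<T} \<phi> \<longrightarrow>
          (\<exists>I. has_Bochner_integral_in T X N (\<lambda>t x. dirderiv 1 \<phi> t *\<^sub>R f t x) I \<and>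
               has_Bochner_integral_in T X N (\<lambda>t x. \<phi> t *\<^sub>R g t x) (\<lambda>x. - I x))}"

definition continuous_into_L2 ::
  "real \<Rightarrow> 'a::euclidean_space set \<Rightarrow> (real \<Rightarrow> 'a \<Rightarrow> 'b::euclidean_space) \<Rightarrow> bool" where
  "continuous_into_L2 T D f \<longleftrightarrow>
     (\<forall>t\<in>{0..T}. f t \<in> Lp_space D 2 \<and>
        ((\<lambda>s. Lp_norm D 2 (\<lambda>x. f s x - f t x)) \<longlongrightarrow> 0) (at t within {0..T}))"


section \<open>The Landau--Lifshitz--Bloch equation\<close>

definition grad_inner ::
  "'a::euclidean_space set \<Rightarrow> ('a \<Rightarrow> real^3) \<Rightarrow> ('a \<Rightarrow> real^3) \<Rightarrow> real" where
  "grad_inner D v w = (\<Sum>b\<in>Basis. L2_inner D (weak_deriv D b v) (weak_deriv D b w))"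

definition cross_grad_inner ::
  "'a::euclidean_space set \<Rightarrow> ('a \<Rightarrow> real^3) \<Rightarrow> ('a \<Rightarrow> real^3) \<Rightarrow> ('a \<Rightarrow> real^3) \<Rightarrow> real" where
  "cross_grad_inner D u v w =
     (\<Sum>b\<in>Basis. L2_inner D (\<lambda>x. cross3 (u x) (weak_deriv D b v x)) (weak_deriv D b w))"

definition llb_damping :: "real \<Rightarrow> ('a \<Rightarrow> real^3) \<Rightarrow> 'a \<Rightarrow> real^3" where
  "llb_damping \<mu> u = (\<lambda>x. (1 + \<mu> * (norm (u x))\<^sup>2) *\<^sub>R u x)"

text \<open>
  The library assigns the value 0 to integrals that do not exist, so the existence of the
  integrals of the two nonlinear terms of the weak formulation is spelled out. By the Sobolev
  embeddings it is a consequence of the regularity required of a weak solution.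
\<close>

definition llb_integrals_exist ::
  "real \<Rightarrow> 'a::euclidean_space set \<Rightarrow> real \<Rightarrow> (real \<Rightarrow> 'a \<Rightarrow> real^3) \<Rightarrow> bool" where
  "llb_integrals_exist \<mu> D T u \<longleftrightarrow>
     (AE s in lebesgue_on {0<..<T}. \<forall>v\<in>Hs_space D 1.
        (\<forall>b\<in>Basis. integrable (lebesgue_on D)
           (\<lambda>x. cross3 (u s x) (weak_deriv D b (u s) x) \<bullet> weak_deriv D b v x)) \<and>
        integrable (lebesgue_on D) (\<lambda>x. llb_damping \<mu> (u s) x \<bullet> v x)) \<and>
     (\<forall>v\<in>Hs_space D 1.
        integrable (lebesgue_on {0<..<T}) (\<lambda>s. cross_grad_inner D (u s) (u s) v) \<and>
        integrable (lebesgue_on {0<..<T}) (\<lambda>s. L2_inner D (llb_damping \<mu> (u s)) v))"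

text \<open>
  A function of class \<open>W\<^sup>1\<^sup>,\<^sup>q\<close> in time with values in \<open>L\<^sup>2\<close> has a unique continuous
  representative; \<open>u\<close> is this representative, so that \<open>u t\<close> is meaningful for every time \<open>t\<close>.
\<close>

definition llb_weak_solution ::
  "real \<Rightarrow> real \<Rightarrow> real \<Rightarrow> real \<Rightarrow> 'a::euclidean_space set \<Rightarrow> real \<Rightarrow> real \<Rightarrow>
     ('a \<Rightarrow> real^3) \<Rightarrow> (real \<Rightarrow> 'a \<Rightarrow> real^3) \<Rightarrow> bool"
where
  "llb_weak_solution \<kappa>1 \<kappa>2 \<mu> \<gamma> D \<alpha> T u0 u \<longleftrightarrow>
     u0 \<in> Hs_space D 1 \<and>
     u \<in> W1_Bochner_space T (4 / 3) (Lp_space D 2) (Lp_norm D 2) \<and>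
     u \<in> Bochner_space T top (Hs_space D 1) (Hs_norm D 1) \<and>
     u \<in> Bochner_space T 2 (Hs_space D (1 + \<alpha>)) (Hs_norm D (1 + \<alpha>)) \<and>
     continuous_into_L2 T D u \<and>
     (AE x in lebesgue_on D. u 0 x = u0 x) \<and>
     llb_integrals_exist \<mu> D T u \<and>
     (\<forall>t\<in>{0<..<T}. \<forall>v\<in>Hs_space D 1.
        L2_inner D (u t) v
        + \<kappa>1 * (LINT s|lebesgue_on {0<..<t}. grad_inner D (u s) v)
        + \<gamma> * (LINT s|lebesgue_on {0<..<t}. cross_grad_inner D (u s) (u s) v)
        + \<kappa>2 * (LINT s|lebesgue_on {0<..<t}. L2_inner D (llb_damping \<mu> (u s)) v)
        = L2_inner D u0 v)"

definition llb_strong_solution ::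
  "real \<Rightarrow> real \<Rightarrow> real \<Rightarrow> real \<Rightarrow> 'a::euclidean_space set \<Rightarrow> real \<Rightarrow> real \<Rightarrow>
     ('a \<Rightarrow> real^3) \<Rightarrow> (real \<Rightarrow> 'a \<Rightarrow> real^3) \<Rightarrow> bool"
where
  "llb_strong_solution \<kappa>1 \<kappa>2 \<mu> \<gamma> D \<alpha> T u0 u \<longleftrightarrow>
     llb_weak_solution \<kappa>1 \<kappa>2 \<mu> \<gamma> D \<alpha> T u0 u \<and>
     u \<in> W1_Bochner_space T top (Lp_space D 2) (Lp_norm D 2) \<and>
     u \<in> Bochner_space T top (H1_Delta_space D) (H1_Delta_norm D)"

end

theory Submission
  imports Defs "HOL-Computational_Algebra.Polynomial"
begin

text \<open>
  Formally, testing the equation with \<open>F (w)\<close>, where \<open>w = e\<^bsup>\<kappa>2 t\<^esup> u\<close>, \<open>F z = \<beta> (\<bar>z\<bar>\<^sup>2) z\<close> and \<open>\<beta> \<ge> 0\<close>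
  is nondecreasing, kills the precession term and makes the diffusion term and the cubic damping
  term dissipative, so \<open>\<integral> B (\<bar>w\<bar>\<^sup>2)\<close> with \<open>B' = \<beta>\<close> decreases in time. Bounded weights \<open>\<beta>\<close>
  keep \<open>F (w)\<close> in \<open>H\<^sup>1\<close>; letting \<open>\<beta> q\<close> tend to \<open>(p/2) q\<^bsup>p/2-1\<^esup>\<close> gives \<open>p < \<infinity>\<close>, and
  \<open>p \<rightarrow> \<infinity>\<close> the remaining case.

  Since the weak formulation only admits test functions independent of time, the energy is
  differentiated from the left: a strong solution is Lipschitz into \<open>L\<^sup>2\<close>, the Lebesgue
  differentiation theorem applies simultaneously to a countable family of test functions, and at
  almost every time \<open>F (w)\<close> is an \<open>H\<^sup>1\<close>-limit of members of that family. The convexity of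
  \<open>B (\<bar>z\<bar>\<^sup>2)\<close> then yields a nonpositive left Dini derivative almost everywhere, which together with
  the Lipschitz bound makes the energy nonincreasing.
\<close>

subsection \<open>Smooth test functions\<close>

text \<open>Two features of the setting shape the work. The convexity inequality for
  \<open>B\<close> evaluates \<open>F\<close> at the first of its two arguments. With the later time
  there, the test function \<open>F (w t)\<close> stays fixed while the difference reaches back to
  \<open>t - h\<close>; hence derivatives from the left. Moreover, the notion of solution guarantees
  only that the nonlinear pairings with elements of H1 exist. To pass from \<open>F (w t)\<close> to
  nearby test functions these pairings must be continuous on H1; since they exist for every element,
  a Baire argument on series in H1 supplies the continuity.

  The countable family comes from strong measurability: simple functions in time approximate
  \<open>u\<close> in H1, and each has finitely many values. The factor
  \<open>exp (\<kappa>2 * t)\<close> runs through a continuum and is therefore replaced by nearby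
  rationals. That \<open>F (w t)\<close> belongs to H1 and depends continuously on
  \<open>w t\<close> rests on a chain rule for weak derivatives, for which mollification is
  developed below.\<close>

lemma dirderiv_eqI:
  "(\<phi> has_derivative \<phi>') (at x) \<Longrightarrow> dirderiv b \<phi> x = \<phi>' b"
  by (simp add: dirderiv_def frechet_derivative_at[symmetric])

lemma Ck_Suc_differentiable: "Ck (Suc k) \<phi> \<Longrightarrow> \<phi> differentiable (at x)"
  by (simp add: differentiable_on_def)

lemma Ck_continuous: "Ck k \<phi> \<Longrightarrow> continuous_on UNIV \<phi>"
  by (cases k) (auto simp: differentiable_imp_continuous_on)

lemma Ck_Suc_imp: "Ck (Suc k) \<phi> \<Longrightarrow> Ck k \<phi>"
proof (induction k arbitrary: \<phi>)
  case 0
  then show ?case by (simp add: differentiable_imp_continuous_on)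
qed auto

lemma dirderiv_mult:
  assumes "f differentiable (at x)" "g differentiable (at x)"
  shows "dirderiv b (\<lambda>x. f x * g x) x = f x * dirderiv b g x + dirderiv b f x * g x"
proof -
  have "((\<lambda>x. f x * g x) has_derivative
      (\<lambda>h. f x * frechet_derivative g (at x) h + frechet_derivative f (at x) h * g x)) (at x)"
    using assms by (intro has_derivative_mult) (auto simp: frechet_derivative_works)
  from dirderiv_eqI[OF this] show ?thesis by (simp add: dirderiv_def)
qed

lemma dirderiv_add:
  assumes "f differentiable (at x)" "g differentiable (at x)"
  shows "dirderiv b (\<lambda>x. f x + g x) x = dirderiv b f x + dirderiv b g x"
proof -
  have "((\<lambda>x. f x + g x) has_derivative
      (\<lambda>h. frechet_derivative f (at x) h + frechet_derivative g (at x) h)) (at x)"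
    using assms by (intro has_derivative_add) (auto simp: frechet_derivative_works)
  from dirderiv_eqI[OF this] show ?thesis by (simp add: dirderiv_def)
qed

lemma Ck_add: "Ck k f \<Longrightarrow> Ck k g \<Longrightarrow> Ck k (\<lambda>x. f x + g x)"
proof (induction k arbitrary: f g)
  case 0
  then show ?case by (auto intro: continuous_intros)
next
  case (Suc k)
  have *: "dirderiv b (\<lambda>x. f x + g x) = (\<lambda>x. dirderiv b f x + dirderiv b g x)" for b
    using Suc.prems by (intro ext dirderiv_add Ck_Suc_differentiable)
  show ?case
    unfolding Ck.simps * using Suc.prems by (intro conjI ballI Suc.IH differentiable_on_add) simp_all
qed

lemma Ck_mult: "Ck k f \<Longrightarrow> Ck k g \<Longrightarrow> Ck k (\<lambda>x. f x * g x)"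
proof (induction k arbitrary: f g)
  case 0
  then show ?case by (auto intro: continuous_intros)
next
  case (Suc k)
  have *: "dirderiv b (\<lambda>x. f x * g x) = (\<lambda>x. f x * dirderiv b g x + dirderiv b f x * g x)" for b
    using Suc.prems by (intro ext dirderiv_mult Ck_Suc_differentiable)
  have "Ck k f" "Ck k g" using Suc.prems by (auto dest: Ck_Suc_imp simp del: Ck.simps)
  with Suc.prems show ?case
    unfolding Ck.simps * by (intro conjI ballI Ck_add Suc.IH differentiable_on_mult) simp_all
qed

lemma Ck_const: "Ck k (\<lambda>x. c)"
proof (induction k arbitrary: c)
  case (Suc k)
  have "dirderiv b (\<lambda>x. c) = (\<lambda>x. 0)" for b :: 'a
    by (intro ext) (rule dirderiv_eqI, auto intro: derivative_eq_intros)
  with Suc.IH show ?case by simp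
qed simp

lemma Ck_inner: "Ck k (\<lambda>x. x \<bullet> a)"
proof (cases k)
  case (Suc l)
  have "dirderiv b (\<lambda>x. x \<bullet> a) = (\<lambda>x. b \<bullet> a)" for b
    by (intro ext) (rule dirderiv_eqI, auto intro!: derivative_eq_intros)
  moreover have "(\<lambda>x. x \<bullet> a) differentiable_on UNIV"
    by (auto simp: differentiable_on_def intro!: derivative_intros)
  ultimately show ?thesis using Suc Ck_const by auto
qed (auto intro: continuous_intros)

lemma dirderiv_reflect:
  assumes "\<phi> differentiable (at (x - y))"
  shows "dirderiv b (\<lambda>y. \<phi> (x - y)) y = - dirderiv b \<phi> (x - y)"
proof -
  have d: "(\<phi> has_derivative frechet_derivative \<phi> (at (x - y))) (at (x - y))"
    using assms by (simp add: frechet_derivative_works)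
  have "((\<lambda>y. \<phi> (x - y)) has_derivative (\<lambda>h. frechet_derivative \<phi> (at (x - y)) (- h))) (at y)"
    by (rule has_derivative_compose[where f = "\<lambda>y. x - y" and f' = "\<lambda>h. - h", OF _ d])
       (auto intro!: derivative_eq_intros)
  from dirderiv_eqI[OF this] show ?thesis
    using linear_neg[OF has_derivative_linear[OF d]] by (simp add: dirderiv_def)
qed

lemma Ck_reflect: "Ck k \<phi> \<Longrightarrow> Ck k (\<lambda>y. \<phi> (x - y))"
proof (induction k arbitrary: \<phi>)
  case 0
  then show ?case by (auto intro!: continuous_intros continuous_on_compose2[of UNIV \<phi>])
next
  case (Suc k)
  have "dirderiv b (\<lambda>y. \<phi> (x - y)) = (\<lambda>y. - 1 * dirderiv b \<phi> (x - y))" for b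
    using Suc.prems by (auto simp: dirderiv_reflect Ck_Suc_differentiable)
  moreover have "Ck k (\<lambda>y. - 1 * dirderiv b \<phi> (x - y))" if "b \<in> Basis" for b
    by (intro Ck_mult Ck_const Suc.IH) (use Suc.prems that in auto)
  moreover have "(\<lambda>y. \<phi> (x - y)) differentiable_on UNIV"
    unfolding differentiable_on_def
    by (intro ballI differentiable_compose[of \<phi> "\<lambda>y. x - y"] derivative_intros)
       (use Ck_Suc_differentiable[OF Suc.prems] in \<open>auto\<close>)
  ultimately show ?case by auto
qed

text \<open>The derivatives of \<open>t \<mapsto> exp (-1/t)\<close>, extended by zero to \<open>t \<le> 0\<close>, all have the form
  \<open>P (1/t) exp (-1/t)\<close> with a polynomial \<open>P\<close>.\<close>

definition flat_exp :: "real poly \<Rightarrow> real \<Rightarrow> real" where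
  "flat_exp P t = (if 0 < t then poly P (1 / t) * exp (- 1 / t) else 0)"

lemma poly_exp_tendsto_0: "((\<lambda>s. poly P s * exp (- s)) \<longlongrightarrow> (0::real)) at_top"
proof -
  have "((\<lambda>s. \<Sum>i\<le>degree P. coeff P i * (s ^ i / exp s)) \<longlongrightarrow> (\<Sum>i\<le>degree P. coeff P i * 0)) at_top"
    by (intro tendsto_sum tendsto_mult tendsto_const tendsto_power_div_exp_0)
  then show ?thesis
    by (simp add: poly_altdef sum_distrib_right exp_minus divide_inverse mult.assoc)
qed

text \<open>With \<open>s = 1 / t\<close> the derivative of \<open>P(s) exp (- s)\<close> in
  \<open>t\<close> is \<open>s^2 (P(s) - P'(s)) exp (- s)\<close>, and \<open>[:0, 0, 1:]\<close> is
  the polynomial \<open>s^2\<close>. At \<open>t = 0\<close> the right difference quotient is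
  \<open>s P(s) exp (- s)\<close>, which tends to 0 as \<open>s\<close> grows; the left one is
  0.\<close>

lemma flat_exp_derivative:
  "(flat_exp P has_real_derivative flat_exp ([:0, 0, 1:] * (P - pderiv P)) t) (at t)"
proof -
  consider "t < 0" | "t = 0" | "0 < t" by linarith
  then show ?thesis
  proof cases
    case 1
    have "((\<lambda>_. 0) has_real_derivative 0) (at t)" by simp
    then have "(flat_exp P has_real_derivative 0) (at t)"
      by (rule has_field_derivative_transform_within_open[of _ _ _ "{..<0}"])
         (use 1 in \<open>auto simp: flat_exp_def\<close>)
    with 1 show ?thesis by (simp add: flat_exp_def)
  next
    case 2
    have "((\<lambda>h. flat_exp P h / h) \<longlongrightarrow> 0) (at_right 0)"
    proof -
      have "((\<lambda>h. poly ([:0, 1:] * P) (inverse h) * exp (- inverse h)) \<longlongrightarrow> 0) (at_right (0::real))"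
        by (rule filterlim_compose[OF poly_exp_tendsto_0 filterlim_inverse_at_top_right])
      moreover have "\<forall>\<^sub>F h in at_right 0. poly ([:0, 1:] * P) (inverse h) * exp (- inverse h) = flat_exp P h / h"
        using eventually_at_right_less[of "0::real"]
        by eventually_elim (simp add: flat_exp_def divide_inverse)
      ultimately show ?thesis by (rule Lim_transform_eventually)
    qed
    moreover have "((\<lambda>h. flat_exp P h / h) \<longlongrightarrow> 0) (at_left 0)"
    proof -
      have "\<forall>\<^sub>F h in at_left 0. 0 = flat_exp P h / h"
        unfolding eventually_at_filter by (rule always_eventually) (simp add: flat_exp_def)
      with tendsto_const show ?thesis by (rule Lim_transform_eventually)
    qed
    ultimately have "((\<lambda>h. flat_exp P h / h) \<longlongrightarrow> 0) (at 0)"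
      by (intro filterlim_split_at_real)
    then show ?thesis using 2
      by (simp add: DERIV_def flat_exp_def[of _ 0])
  next
    case 3
    have "((\<lambda>t. poly P (1 / t)) has_real_derivative poly (pderiv P) (1 / t) * (- (1 / t^2))) (at t)"
      by (rule DERIV_chain2[OF poly_DERIV])
         (use 3 in \<open>auto intro!: derivative_eq_intros simp: power2_eq_square\<close>)
    moreover have "((\<lambda>t. exp (- 1 / t)) has_real_derivative exp (- 1 / t) * (1 / t^2)) (at t)"
      by (rule DERIV_chain2[OF DERIV_exp])
         (use 3 in \<open>auto intro!: derivative_eq_intros simp: power2_eq_square\<close>)
    ultimately have "((\<lambda>t. poly P (1 / t) * exp (- 1 / t)) has_real_derivative
        poly (pderiv P) (1 / t) * (- (1 / t^2)) * exp (- 1 / t) + exp (- 1 / t) * (1 / t^2) * poly P (1 / t)) (at t)"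
      by (rule DERIV_mult)
    also have "poly (pderiv P) (1 / t) * (- (1 / t^2)) * exp (- 1 / t) + exp (- 1 / t) * (1 / t^2) * poly P (1 / t) =
        flat_exp ([:0, 0, 1:] * (P - pderiv P)) t"
    proof -
      have *: "a * (- k) * e + e * k * p = k * (p - a) * e" for a k e p :: real
        by algebra
      have "poly ([:0, 0, 1:] * (P - pderiv P)) (1 / t) = 1 / t\<^sup>2 * (poly P (1 / t) - poly (pderiv P) (1 / t))"
        by (simp add: power2_eq_square)
      with 3 show ?thesis unfolding * flat_exp_def by (simp only: if_True)
    qed
    finally show ?thesis
      by (rule has_field_derivative_transform_within_open[of _ _ _ "{0<..}"])
         (use 3 in \<open>auto simp: flat_exp_def\<close>)
  qed
qed

text \<open>The induction on \<open>k\<close> ranges over all \<open>P\<close> at once: a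
  directional derivative is a linear factor times a function of the same form with another
  polynomial.\<close>

lemma Ck_flat_exp_ball: "Ck k (\<lambda>x::'a::euclidean_space. flat_exp P (r - x \<bullet> x))"
proof (induction k arbitrary: P)
  case 0
  have "continuous_on UNIV (flat_exp P)"
    using flat_exp_derivative by (intro DERIV_continuous_on) (auto intro: has_field_derivative_at_within)
  then show ?case
    by (auto intro!: continuous_intros continuous_on_compose2[of UNIV "flat_exp P"])
next
  case (Suc k)
  let ?P = "[:0, 0, 1:] * (P - pderiv P)"
  have d: "((\<lambda>x::'a. flat_exp P (r - x \<bullet> x)) has_derivative
      (\<lambda>h. ((- 2) * (x \<bullet> h)) * flat_exp ?P (r - x \<bullet> x))) (at x)" for x :: 'a
  proof -
    have "((\<lambda>x. r - x \<bullet> x) has_derivative (\<lambda>h. - 2 * (x \<bullet> h))) (at x)"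
      by (auto intro!: derivative_eq_intros simp: inner_commute)
    from DERIV_compose_FDERIV[OF flat_exp_derivative this]
    show ?thesis by (simp add: mult.commute)
  qed
  have "dirderiv b (\<lambda>x::'a. flat_exp P (r - x \<bullet> x)) = (\<lambda>x::'a. ((- 2) * (x \<bullet> b)) * flat_exp ?P (r - x \<bullet> x))" for b
    using dirderiv_eqI[OF d] by blast
  moreover have "Ck k (\<lambda>x::'a. ((- 2) * (x \<bullet> b)) * flat_exp ?P (r - x \<bullet> x))" for b
    by (intro Ck_mult Ck_const Ck_inner Suc.IH)
  moreover have "(\<lambda>x::'a. flat_exp P (r - x \<bullet> x)) differentiable_on UNIV"
    using d by (auto simp: differentiable_on_def differentiable_def)
  ultimately show ?case unfolding Ck.simps by metis
qed

text \<open>The radius \<open>r\<close> only bounds the support, so a mollifier of radius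
  \<open>r\<close> is also one of every larger radius; this lets a single kernel meet several
  smallness conditions. Stating the mass by the nonnegative integral makes integrability a
  consequence.\<close>

definition is_mollifier :: "real \<Rightarrow> ('a::euclidean_space \<Rightarrow> real) \<Rightarrow> bool" where
  "is_mollifier r \<rho> \<longleftrightarrow> (\<forall>k. Ck k \<rho>) \<and> (\<forall>x. 0 \<le> \<rho> x) \<and> (\<forall>x. r \<le> norm x \<longrightarrow> \<rho> x = 0) \<and>
     (\<integral>\<^sup>+x. ennreal (\<rho> x) \<partial>lborel) = 1"

lemma mollifier_exists:
  assumes "0 < r"
  obtains \<rho> :: "'a::euclidean_space \<Rightarrow> real" where "is_mollifier r \<rho>"
proof -
  define \<eta> :: "'a \<Rightarrow> real" where "\<eta> x = flat_exp 1 (r\<^sup>2 - x \<bullet> x)" for x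
  have C: "Ck k \<eta>" for k unfolding \<eta>_def by (rule Ck_flat_exp_ball)
  have cont: "continuous_on UNIV \<eta>" using C Ck_continuous by blast
  then have [measurable]: "\<eta> \<in> borel_measurable borel"
    by (simp add: borel_measurable_continuous_onI)
  have lt: "r\<^sup>2 - x \<bullet> x > 0 \<longleftrightarrow> norm x < r" for x :: 'a
    using assms by (metis diff_gt_0_iff_gt dot_square_norm norm_ge_zero power_less_imp_less_base
        power_strict_mono less_imp_le zero_less_numeral)
  have nn: "0 \<le> \<eta> x" and z: "r \<le> norm x \<Longrightarrow> \<eta> x = 0" and pos: "norm x < r \<Longrightarrow> 0 < \<eta> x" for x
    using lt[of x] by (auto simp: \<eta>_def flat_exp_def)
  have "integrable lborel (\<lambda>x. indicator (cball 0 r) x *\<^sub>R \<eta> x)"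
    by (rule borel_integrable_compact) (auto intro: continuous_on_subset[OF cont])
  moreover have "(\<lambda>x. indicator (cball 0 r) x *\<^sub>R \<eta> x) = \<eta>"
    using z by (auto simp: indicator_def fun_eq_iff)
  ultimately have int: "integrable lborel \<eta>" by simp
  define c where "c = integral\<^sup>L lborel \<eta>"
  have I: "(\<integral>\<^sup>+x. ennreal (\<eta> x) \<partial>lborel) = ennreal c"
    unfolding c_def using int nn by (intro nn_integral_eq_integral) auto
  have "c \<noteq> 0"
  proof
    assume "c = 0"
    then have "AE x in lborel. \<eta> x = 0"
      using integral_nonneg_eq_0_iff_AE[OF int] nn by (auto simp: c_def)
    then have "AE x in lborel. x \<notin> ball (0::'a) r"
    proof eventually_elim
      case (elim x)
      with pos[of x] show ?case by force
    qed
    then have "emeasure lborel (ball (0::'a) r) = 0"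
      by (subst (asm) AE_iff_measurable[of "ball 0 r"]) auto
    then show False using assms unit_ball_vol_pos[of "real DIM('a)"] by (simp add: emeasure_ball)
  qed
  moreover have "0 \<le> c" unfolding c_def using nn by simp
  ultimately have c: "0 < c" by simp
  have "is_mollifier r (\<lambda>x. inverse c * \<eta> x)"
    unfolding is_mollifier_def
  proof (intro conjI allI impI)
    fix k show "Ck k (\<lambda>x. inverse c * \<eta> x)" by (intro Ck_mult Ck_const C)
    have "(\<integral>\<^sup>+x. ennreal (inverse c * \<eta> x) \<partial>lborel) = ennreal (inverse c) * (\<integral>\<^sup>+x. ennreal (\<eta> x) \<partial>lborel)"
      using c nn by (simp add: ennreal_mult nn_integral_cmult)
    also have "\<dots> = ennreal (inverse c * c)" using c by (subst ennreal_mult) (simp_all add: I)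
    finally show "(\<integral>\<^sup>+x. ennreal (inverse c * \<eta> x) \<partial>lborel) = 1" using c by simp
  qed (use c nn z in auto)
  then show ?thesis by (rule that)
qed

lemma compact_support_mollifier:
  assumes "\<And>x. r \<le> norm x \<Longrightarrow> \<rho> x = (0::real)"
  shows "closure {y. \<rho> (x - y) \<noteq> 0} \<subseteq> cball x r"
proof -
  have "{y. \<rho> (x - y) \<noteq> 0} \<subseteq> cball x r"
    using assms by (auto simp: dist_norm) (meson less_imp_le not_le)
  then show ?thesis by (simp add: closure_minimal)
qed

text \<open>Convolution with \<open>\<rho>\<close> at \<open>x\<close> is the pairing with this
  function. Weak identities tested with it become pointwise identities for mollified
  functions.\<close>

lemma test_function_mollifier:
  assumes "is_mollifier r \<rho>" "cball x r \<subseteq> D"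
  shows "test_function D (\<lambda>y. \<rho> (x - y))"
proof -
  have sub: "closure {y. \<rho> (x - y) \<noteq> 0} \<subseteq> cball x r"
    using assms(1) by (intro compact_support_mollifier) (auto simp: is_mollifier_def)
  then have "compact (closure {y. \<rho> (x - y) \<noteq> 0})"
    by (metis bounded_cball bounded_subset closed_closure compact_eq_bounded_closed)
  with sub assms show ?thesis
    by (auto simp: test_function_def is_mollifier_def intro: Ck_reflect)
qed

subsection \<open>Mollification in \<open>L\<^sup>1\<close>\<close>

lemma nn_integral_lborel_shift:
  fixes f :: "'a::euclidean_space \<Rightarrow> ennreal"
  assumes [measurable]: "f \<in> borel_measurable borel"
  shows "(\<integral>\<^sup>+x. f (x + y) \<partial>lborel) = (\<integral>\<^sup>+x. f x \<partial>lborel)"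
  by (subst (2) lborel_distr_plus[of y, symmetric], subst nn_integral_distr) (simp_all add: add.commute)

lemma lborel_distr_reflect: "distr lborel borel (\<lambda>y. x - y) = (lborel :: 'a::euclidean_space measure)"
  by (subst (2) lborel_affine[of "-1" x]) (simp_all add: density_1)

lemma integral_lborel_reflect:
  fixes f :: "'a::euclidean_space \<Rightarrow> 'b::{banach, second_countable_topology}"
  assumes [measurable]: "f \<in> borel_measurable borel"
  shows "(\<integral>y. f (x - y) \<partial>lborel) = (\<integral>y. f y \<partial>lborel)"
  by (subst (2) lborel_distr_reflect[of x, symmetric], subst integral_distr) simp_all

lemma integrable_lborel_reflect:
  fixes f :: "'a::euclidean_space \<Rightarrow> 'b::{banach, second_countable_topology}"
  assumes "integrable lborel f"
  shows "integrable lborel (\<lambda>y. f (x - y))"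
proof -
  have "integrable (distr lborel borel (\<lambda>y. x - y)) f"
    using assms by (simp add: lborel_distr_reflect)
  then show ?thesis by (rule integrable_distr[rotated]) simp
qed

lemma integral_lborel_shift:
  fixes f :: "'a::euclidean_space \<Rightarrow> 'b::{banach, second_countable_topology}"
  assumes [measurable]: "f \<in> borel_measurable borel"
  shows "(\<integral>x. f (x + y) \<partial>lborel) = (\<integral>x. f x \<partial>lborel)"
  by (subst (2) lborel_distr_plus[of y, symmetric], subst integral_distr) (simp_all add: add.commute)

text \<open>By regularity there are a compact \<open>K\<close> inside \<open>A\<close> and an open
  \<open>U\<close> around \<open>K\<close> such that \<open>A - K\<close> and \<open>U - K\<close>
  have small measure. A shift shorter than the distance margin \<open>d\<close> moves
  \<open>K\<close> within \<open>U\<close>, so the mismatch is confined to these two small sets and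
  their translates.\<close>

lemma indicator_shift_L1:
  fixes A :: "'a::euclidean_space set"
  assumes A: "A \<in> sets borel" "emeasure lborel A < \<infinity>" and e: "0 < e"
  shows "\<exists>d>0. \<forall>y. norm y < d \<longrightarrow>
    (\<integral>\<^sup>+x. ennreal \<bar>indicator A (x + y) - indicator A x :: real\<bar> \<partial>lborel) \<le> ennreal e"
proof -
  \<comment> \<open>Inner regularity is applied to a finite measure, hence the restriction of
    \<open>lborel\<close> to \<open>A\<close>.\<close>
  let ?M = "density lborel (indicator A :: 'a \<Rightarrow> ennreal)"
  have M: "emeasure ?M B = emeasure lborel (A \<inter> B)" if "B \<in> sets borel" for B
    using that A by (simp add: emeasure_density nn_integral_set_ennreal flip: indicator_inter_arith)
  have "emeasure ?M A = (SUP K \<in> {K. K \<subseteq> A \<and> compact K}. emeasure ?M K)"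
    by (rule inner_regular) (use A M[of UNIV] in auto)
  then have SUP: "emeasure lborel A = (SUP K \<in> {K. K \<subseteq> A \<and> compact K}. emeasure ?M K)"
    using M[OF A(1)] by simp
  obtain K where K: "K \<subseteq> A" "compact K" "emeasure lborel (A - K) < ennreal (e / 4)"
  proof (cases "emeasure lborel A = 0")
    case True
    show ?thesis by (rule that[of "{}"]) (use True e in auto)
  next
    case False
    have "emeasure lborel A - ennreal (e / 4) < emeasure lborel A"
      using False A e by (intro ennreal_between) (auto simp: pos_less_divide_eq zero_less_iff_neq_zero)
    then have "emeasure lborel A - ennreal (e / 4) < (SUP K \<in> {K. K \<subseteq> A \<and> compact K}. emeasure ?M K)"
      using SUP by metis
    then obtain K where K: "K \<subseteq> A" "compact K" "emeasure lborel A - ennreal (e / 4) < emeasure ?M K"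
      unfolding less_SUP_iff by auto
    have Kb: "K \<in> sets borel" using K by (auto intro: borel_compact)
    have *: "emeasure lborel (A - K) = emeasure lborel A - emeasure lborel K"
      using K A Kb by (intro emeasure_Diff) (auto dest: emeasure_mono[of K A lborel])
    have le: "emeasure lborel K \<le> emeasure lborel A" using K A by (intro emeasure_mono) auto
    have "emeasure lborel A - ennreal (e / 4) < emeasure lborel K"
      using K M[OF Kb] by (simp add: Int_absorb1)
    then have "emeasure lborel (A - K) < ennreal (e / 4)"
      unfolding * using le A(2) e
    proof (cases "emeasure lborel A"; cases "emeasure lborel K")
      fix a k assume ak: "emeasure lborel A = ennreal a" "emeasure lborel K = ennreal k" "0 \<le> a" "0 \<le> k"
      assume "emeasure lborel A - ennreal (e / 4) < emeasure lborel K" "emeasure lborel K \<le> emeasure lborel A" "0 < e"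
      moreover from this have "a - e / 4 < k"
        using ak by (cases "0 \<le> a - e / 4") (auto simp: ennreal_minus ennreal_less_iff)
      ultimately show "emeasure lborel A - emeasure lborel K < ennreal (e / 4)"
        using ak by (auto simp: ennreal_minus ennreal_less_iff)
    qed auto
    with K show ?thesis by (intro that) auto
  qed
  have Kb: "K \<in> sets borel" using K by (auto intro: borel_compact)
  then have "K \<in> sets lebesgue" by simp
  moreover have "0 < e / 4" using e by simp
  ultimately obtain U where U: "open U" "K \<subseteq> U" "emeasure lebesgue (U - K) < ennreal (e / 4)"
    by (meson sets_lebesgue_outer_open)
  have [measurable]: "U \<in> sets borel" "K \<in> sets borel" "A \<in> sets borel" using U Kb A by auto
  have UK: "emeasure lborel (U - K) < ennreal (e / 4)" using U(3) by simp
  obtain d where d: "0 < d" "(\<Union>x\<in>K. ball x d) \<subseteq> U"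
    using compact_subset_open_imp_ball_epsilon_subset[OF K(2) U(1,2)] by blast
  show ?thesis
  proof (intro exI[of _ d] conjI allI impI)
    fix y :: 'a assume y: "norm y < d"
    let ?g = "\<lambda>x. indicator (A - K) x + indicator (U - K) x :: ennreal"
    \<comment> \<open>If exactly one of \<open>x\<close> and \<open>x + y\<close> lies in
      \<open>A\<close>, that point is in \<open>A - K\<close>, or it is in \<open>K\<close> and the
      other one is in \<open>U - K\<close>. Two sets at two points give four contributions, each at
      most \<open>e / 4\<close>.\<close>
    have "ennreal \<bar>indicator A (x + y) - indicator A x :: real\<bar> \<le> ?g (x + y) + ?g x" for x
    proof -
      have "x \<in> U" if "x + y \<in> K"
        using that d y by (auto simp: dist_norm subset_eq)
      moreover have "x + y \<in> U" if "x \<in> K"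
        using that d y by (auto simp: dist_norm subset_eq)
      ultimately show ?thesis using K(1)
        by (auto simp: indicator_def)
    qed
    then have "(\<integral>\<^sup>+x. ennreal \<bar>indicator A (x + y) - indicator A x :: real\<bar> \<partial>lborel)
        \<le> (\<integral>\<^sup>+x. ?g (x + y) + ?g x \<partial>lborel)"
      by (intro nn_integral_mono) auto
    also have "\<dots> = (\<integral>\<^sup>+x. ?g (x + y) \<partial>lborel) + (\<integral>\<^sup>+x. ?g x \<partial>lborel)"
      by (rule nn_integral_add) auto
    also have "(\<integral>\<^sup>+x. ?g (x + y) \<partial>lborel) = (\<integral>\<^sup>+x. ?g x \<partial>lborel)"
      by (rule nn_integral_lborel_shift) auto
    also have "(\<integral>\<^sup>+x. ?g x \<partial>lborel) = emeasure lborel (A - K) + emeasure lborel (U - K)"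
      by (subst nn_integral_add) auto
    also have "\<dots> + (emeasure lborel (A - K) + emeasure lborel (U - K)) \<le>
       (ennreal (e/4) + ennreal (e/4)) + (ennreal (e/4) + ennreal (e/4))"
      using K(3) UK by (intro add_mono) auto
    also have "\<dots> = ennreal e" using e by (simp flip: ennreal_plus)
    finally show "(\<integral>\<^sup>+x. ennreal \<bar>indicator A (x + y) - indicator A x :: real\<bar> \<partial>lborel) \<le> ennreal e" .
  qed fact
qed

text \<open>The property holds for indicators by regularity, is additive, and survives L1 limits
  because translation is an L1 isometry.\<close>

lemma translation_L1_continuous:
  fixes f :: "'a::euclidean_space \<Rightarrow> 'b::{banach, second_countable_topology}"
  assumes "integrable lborel f" "0 < e"
  shows "\<exists>d>0. \<forall>y. norm y < d \<longrightarrow> (\<integral>\<^sup>+x. ennreal (norm (f (x + y) - f x)) \<partial>lborel) \<le> ennreal e"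
  using assms
proof (induction arbitrary: e rule: integrable_induct)
  case (base A c)
  \<comment> \<open>The summand 1 in the denominator covers \<open>c = 0\<close>.\<close>
  obtain d where d: "0 < d" "\<And>y. norm y < d \<Longrightarrow>
      (\<integral>\<^sup>+x. ennreal \<bar>indicator A (x + y) - indicator A x :: real\<bar> \<partial>lborel) \<le> ennreal (e / (1 + norm c))"
    using indicator_shift_L1[of A "e / (1 + norm c)"] base by (force simp: add_pos_nonneg)
  have [measurable]: "A \<in> sets borel" using base by simp
  have "(\<integral>\<^sup>+x. ennreal (norm (indicator A (x + y) *\<^sub>R c - indicator A x *\<^sub>R c)) \<partial>lborel) \<le> ennreal e"
    if "norm y < d" for y
  proof -
    have "(\<integral>\<^sup>+x. ennreal (norm (indicator A (x + y) *\<^sub>R c - indicator A x *\<^sub>R c)) \<partial>lborel) =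
      (\<integral>\<^sup>+x. ennreal (norm c) * ennreal \<bar>indicator A (x + y) - indicator A x :: real\<bar> \<partial>lborel)"
      by (intro nn_integral_cong) (simp flip: scaleR_left_diff_distrib ennreal_mult add: mult.commute)
    also have "\<dots> = ennreal (norm c) * (\<integral>\<^sup>+x. ennreal \<bar>indicator A (x + y) - indicator A x :: real\<bar> \<partial>lborel)"
      by (rule nn_integral_cmult) auto
    also have "\<dots> \<le> ennreal (norm c) * ennreal (e / (1 + norm c))"
      using d that by (intro mult_left_mono) auto
    also have "\<dots> = ennreal (norm c * (e / (1 + norm c)))"
      using base by (intro ennreal_mult[symmetric]) auto
    also have "\<dots> \<le> ennreal e"
      using base by (intro ennreal_leI) (simp add: field_simps add_pos_nonneg)
    finally show ?thesis .
  qed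
  with d show ?case by blast
next
  case (add f g)
  obtain d where d: "0 < d" "\<And>y. norm y < d \<Longrightarrow> (\<integral>\<^sup>+x. ennreal (norm (f (x + y) - f x)) \<partial>lborel) \<le> ennreal (e / 2)"
    using add.IH(1)[of "e / 2"] add.prems by auto
  obtain d' where d': "0 < d'" "\<And>y. norm y < d' \<Longrightarrow> (\<integral>\<^sup>+x. ennreal (norm (g (x + y) - g x)) \<partial>lborel) \<le> ennreal (e / 2)"
    using add.IH(2)[of "e / 2"] add.prems by auto
  have [measurable]: "f \<in> borel_measurable borel" "g \<in> borel_measurable borel"
    using add.hyps by (auto dest: borel_measurable_integrable)
  have "(\<integral>\<^sup>+x. ennreal (norm (f (x + y) + g (x + y) - (f x + g x))) \<partial>lborel) \<le> ennreal e"
    if "norm y < min d d'" for y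
  proof -
    have "(\<integral>\<^sup>+x. ennreal (norm (f (x + y) + g (x + y) - (f x + g x))) \<partial>lborel)
      \<le> (\<integral>\<^sup>+x. ennreal (norm (f (x + y) - f x)) + ennreal (norm (g (x + y) - g x)) \<partial>lborel)"
      by (intro nn_integral_mono) (metis add_diff_add ennreal_leI ennreal_plus norm_ge_zero norm_triangle_ineq)
    also have "\<dots> = (\<integral>\<^sup>+x. ennreal (norm (f (x + y) - f x)) \<partial>lborel) + (\<integral>\<^sup>+x. ennreal (norm (g (x + y) - g x)) \<partial>lborel)"
      by (rule nn_integral_add) auto
    also have "\<dots> \<le> ennreal (e / 2) + ennreal (e / 2)"
      using d d' that by (intro add_mono) auto
    also have "\<dots> = ennreal e" using add.prems by (simp flip: ennreal_plus)
    finally show ?thesis .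
  qed
  with d d' show ?case by (intro exI[of _ "min d d'"]) auto
next
  case (lim f s)
  have [measurable]: "f \<in> borel_measurable borel" "\<And>i. s i \<in> borel_measurable borel"
    using lim.hyps by (auto dest: borel_measurable_integrable)
  have "(\<integral>\<^sup>+x. ennreal (2 * norm (f x)) \<partial>lborel) < \<infinity>"
    using lim.hyps by (simp add: integrable_iff_bounded nn_integral_cmult ennreal_mult ennreal_mult_less_top)
  then have "(\<lambda>i. (\<integral>\<^sup>+x. norm (f x - s i x) \<partial>lborel)) \<longlonglongrightarrow> 0"
    by (intro nn_integral_dominated_convergence_norm[where w = "\<lambda>x. 2 * norm (f x)"]) (use lim.hyps in auto)
  then have "\<forall>\<^sub>F i in sequentially. (\<integral>\<^sup>+x. norm (f x - s i x) \<partial>lborel) < ennreal (e / 3)"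
    using lim.prems by (intro order_tendstoD) auto
  then obtain i where i: "(\<integral>\<^sup>+x. norm (f x - s i x) \<partial>lborel) < ennreal (e / 3)"
    by (auto simp: eventually_sequentially)
  obtain d where d: "0 < d" "\<And>y. norm y < d \<Longrightarrow> (\<integral>\<^sup>+x. ennreal (norm (s i (x + y) - s i x)) \<partial>lborel) \<le> ennreal (e / 3)"
    using lim.IH[of "e / 3" i] lim.prems by auto
  have "(\<integral>\<^sup>+x. ennreal (norm (f (x + y) - f x)) \<partial>lborel) \<le> ennreal e"
    if "norm y < d" for y
  proof -
    let ?h = "\<lambda>x. ennreal (norm (f x - s i x))"
    have "ennreal (norm (f (x + y) - f x)) \<le> ?h (x + y) + ?h x + ennreal (norm (s i (x + y) - s i x))" for x
      by (subst ennreal_plus[symmetric], simp, simp, subst ennreal_plus[symmetric], simp, simp, rule ennreal_leI, norm)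
    then have "(\<integral>\<^sup>+x. ennreal (norm (f (x + y) - f x)) \<partial>lborel)
      \<le> (\<integral>\<^sup>+x. (?h (x + y) + ?h x) + ennreal (norm (s i (x + y) - s i x)) \<partial>lborel)"
      by (intro nn_integral_mono) auto
    also have "\<dots> = (\<integral>\<^sup>+x. ?h (x + y) \<partial>lborel) + (\<integral>\<^sup>+x. ?h x \<partial>lborel) + (\<integral>\<^sup>+x. ennreal (norm (s i (x + y) - s i x)) \<partial>lborel)"
      by (subst nn_integral_add, simp, simp, subst nn_integral_add) auto
    also have "(\<integral>\<^sup>+x. ?h (x + y) \<partial>lborel) = (\<integral>\<^sup>+x. ?h x \<partial>lborel)"
      by (rule nn_integral_lborel_shift) auto
    also have "(\<integral>\<^sup>+x. ?h x \<partial>lborel) + (\<integral>\<^sup>+x. ?h x \<partial>lborel) + (\<integral>\<^sup>+x. ennreal (norm (s i (x + y) - s i x)) \<partial>lborel)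
       \<le> ennreal (e / 3) + ennreal (e / 3) + ennreal (e / 3)"
      using i d that by (intro add_mono) auto
    also have "\<dots> = ennreal e" using lim.prems by (simp flip: ennreal_plus)
    finally show ?thesis .
  qed
  with d show ?case by blast
qed

definition mollify :: "('a::euclidean_space \<Rightarrow> real) \<Rightarrow> ('a \<Rightarrow> 'b::euclidean_space) \<Rightarrow> 'a \<Rightarrow> 'b" where
  "mollify \<rho> f x = (\<integral>y. \<rho> (x - y) *\<^sub>R f y \<partial>lborel)"

lemma mollifierD:
  assumes "is_mollifier r \<rho>"
  shows "Ck k \<rho>" "continuous_on UNIV \<rho>" "0 \<le> \<rho> x" "r \<le> norm x \<Longrightarrow> \<rho> x = 0"
    "(\<integral>\<^sup>+x. ennreal (\<rho> x) \<partial>lborel) = 1" "\<rho> \<in> borel_measurable borel"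
  using assms Ck_continuous[of 0 \<rho>] by (auto simp: is_mollifier_def borel_measurable_continuous_onI)

lemma compact_support_bounded:
  fixes h :: "'a::euclidean_space \<Rightarrow> 'b::real_normed_vector"
  assumes "continuous_on UNIV h" "\<And>x. r \<le> norm x \<Longrightarrow> h x = 0"
  obtains C where "0 \<le> C" "\<And>x. norm (h x) \<le> C"
proof -
  have "compact (h ` cball 0 r)"
    using assms(1) by (intro compact_continuous_image) (auto intro: continuous_on_subset)
  then obtain C where C: "\<forall>y \<in> h ` cball 0 r. norm y \<le> C"
    by (auto dest!: compact_imp_bounded simp: bounded_iff)
  show ?thesis
  proof (rule that[of "max C 0"])
    show "norm (h x) \<le> max C 0" for x
      using bspec[OF C, of "h x"] assms(2)[of x] by (cases "norm x \<le> r") (auto simp: le_max_iff_disj)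
  qed simp
qed

lemma integrable_bounded_scaleR:
  fixes f :: "'x \<Rightarrow> 'b::euclidean_space" and k :: "'x \<Rightarrow> real"
  assumes "integrable M f" "k \<in> borel_measurable M" "\<And>x. \<bar>k x\<bar> \<le> C"
  shows "integrable M (\<lambda>x. k x *\<^sub>R f x)"
proof (rule Bochner_Integration.integrable_bound[of _ "\<lambda>x. C * norm (f x)"])
  show "AE x in M. norm (k x *\<^sub>R f x) \<le> norm (C * norm (f x))"
  proof (rule AE_I2)
    fix x
    have "\<bar>k x\<bar> * norm (f x) \<le> C * norm (f x)" using assms(3) by (rule mult_right_mono) simp
    also have "\<dots> \<le> \<bar>C * norm (f x)\<bar>" by simp
    finally show "norm (k x *\<^sub>R f x) \<le> norm (C * norm (f x))" by simp
  qed
qed (use assms in \<open>auto dest: borel_measurable_integrable\<close>)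

text \<open>The error is the average, with weight \<open>\<rho>\<close>, of the differences between
  \<open>f\<close> and its translates. Fubini moves the norm inside the average; only shifts shorter
  than \<open>r\<close> carry weight, and the total weight is 1.\<close>

lemma mollify_L1:
  fixes f :: "'a::euclidean_space \<Rightarrow> 'b::euclidean_space"
  assumes f: "integrable lborel f" and \<rho>: "is_mollifier r \<rho>"
    and e: "\<And>y. norm y < r \<Longrightarrow> (\<integral>\<^sup>+x. ennreal (norm (f (x + y) - f x)) \<partial>lborel) \<le> e"
  shows "(\<integral>\<^sup>+x. ennreal (norm (mollify \<rho> f x - f x)) \<partial>lborel) \<le> e"
proof -
  note [measurable] = mollifierD(6)[OF \<rho>] borel_measurable_integrable[OF f, simplified]
  obtain C where C: "\<And>x. \<bar>\<rho> x\<bar> \<le> C"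
    using compact_support_bounded[OF mollifierD(2)[OF \<rho>] mollifierD(4)[OF \<rho>]] unfolding real_norm_def by metis
  have \<rho>i: "integrable lborel \<rho>" "(\<integral>y. \<rho> y \<partial>lborel) = 1"
    using mollifierD(3,5)[OF \<rho>] by (auto simp: integrable_iff_bounded integral_eq_nn_integral)
  have "ennreal (norm (mollify \<rho> f x - f x)) \<le> (\<integral>\<^sup>+y. ennreal (\<rho> y) * ennreal (norm (f (x - y) - f x)) \<partial>lborel)" for x
  proof -
    have fi: "integrable lborel (\<lambda>y. \<rho> y *\<^sub>R f (x - y))"
      by (rule integrable_bounded_scaleR[OF integrable_lborel_reflect[OF f] _ C]) auto
    have "mollify \<rho> f x = (\<integral>y. \<rho> (x - (x - y)) *\<^sub>R f (x - y) \<partial>lborel)"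
      unfolding mollify_def by (rule integral_lborel_reflect[symmetric]) auto
    then have "mollify \<rho> f x - f x = (\<integral>y. \<rho> y *\<^sub>R f (x - y) \<partial>lborel) - (\<integral>y. \<rho> y *\<^sub>R f x \<partial>lborel)"
      using \<rho>i by simp
    also have "\<dots> = (\<integral>y. \<rho> y *\<^sub>R f (x - y) - \<rho> y *\<^sub>R f x \<partial>lborel)"
      by (rule Bochner_Integration.integral_diff[symmetric]) (use fi \<rho>i in auto)
    finally have "ennreal (norm (mollify \<rho> f x - f x)) \<le> (\<integral>\<^sup>+y. norm (\<rho> y *\<^sub>R f (x - y) - \<rho> y *\<^sub>R f x) \<partial>lborel)"
      using fi \<rho>i by (simp only:) (intro integral_norm_bound_ennreal Bochner_Integration.integrable_diff, simp_all)
    also have "\<dots> = (\<integral>\<^sup>+y. ennreal (\<rho> y) * ennreal (norm (f (x - y) - f x)) \<partial>lborel)"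
      using mollifierD(3)[OF \<rho>]
      by (intro nn_integral_cong) (simp flip: scaleR_right_diff_distrib ennreal_mult)
    finally show ?thesis .
  qed
  then have "(\<integral>\<^sup>+x. ennreal (norm (mollify \<rho> f x - f x)) \<partial>lborel) \<le>
      (\<integral>\<^sup>+x. (\<integral>\<^sup>+y. ennreal (\<rho> y) * ennreal (norm (f (x - y) - f x)) \<partial>lborel) \<partial>lborel)"
    by (intro nn_integral_mono) auto
  also have "\<dots> = (\<integral>\<^sup>+y. (\<integral>\<^sup>+x. ennreal (\<rho> y) * ennreal (norm (f (x - y) - f x)) \<partial>lborel) \<partial>lborel)"
    by (rule lborel_pair.Fubini') auto
  also have "\<dots> \<le> (\<integral>\<^sup>+y. ennreal (\<rho> y) * e \<partial>lborel)"
  proof (rule nn_integral_mono)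
    fix y
    have "(\<integral>\<^sup>+x. ennreal (\<rho> y) * ennreal (norm (f (x - y) - f x)) \<partial>lborel) =
       ennreal (\<rho> y) * (\<integral>\<^sup>+x. ennreal (norm (f (x + (- y)) - f x)) \<partial>lborel)"
      by (subst nn_integral_cmult) auto
    also have "\<dots> \<le> ennreal (\<rho> y) * e"
      using mollifierD(4)[OF \<rho>, of y] e[of "- y"] by (cases "norm y < r") (auto intro: mult_left_mono)
    finally show "(\<integral>\<^sup>+x. ennreal (\<rho> y) * ennreal (norm (f (x - y) - f x)) \<partial>lborel) \<le> ennreal (\<rho> y) * e" .
  qed
  also have "\<dots> = e"
    using mollifierD(5)[OF \<rho>] by (simp add: nn_integral_multc)
  finally show ?thesis .
qed

text \<open>The sequential form makes dominated convergence applicable to difference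
  quotients.\<close>

lemma has_vector_derivative_at_0_sequentially:
  fixes f :: "real \<Rightarrow> 'b::euclidean_space"
  shows "(f has_vector_derivative D) (at 0) \<longleftrightarrow>
    (\<forall>S. (\<forall>n. S n \<noteq> 0) \<longrightarrow> S \<longlonglongrightarrow> 0 \<longrightarrow> (\<lambda>n. (f (S n) - f 0) /\<^sub>R S n) \<longlonglongrightarrow> D)"
proof -
  have "(f has_vector_derivative D) (at 0) \<longleftrightarrow> ((\<lambda>h. (f h - f 0) /\<^sub>R h - D) \<longlongrightarrow> 0) (at 0)"
  proof -
    have "norm (f h - f 0 - h *\<^sub>R D) / \<bar>h\<bar> = norm ((f h - f 0) /\<^sub>R h - D)" if "h \<noteq> 0" for h
    proof -
      have "(f h - f 0) /\<^sub>R h - D = (f h - f 0 - h *\<^sub>R D) /\<^sub>R h"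
        using that by (simp add: scaleR_right_diff_distrib)
      then show ?thesis by (simp add: divide_inverse)
    qed
    then have "((\<lambda>h. norm (f h - f 0 - h *\<^sub>R D) / \<bar>h\<bar>) \<longlongrightarrow> 0) (at 0) \<longleftrightarrow>
        ((\<lambda>h. norm ((f h - f 0) /\<^sub>R h - D)) \<longlongrightarrow> 0) (at 0)"
      by (intro filterlim_cong) (auto simp: eventually_at_filter)
    then show ?thesis
      by (simp add: has_vector_derivative_def has_derivative_iff_norm bounded_linear_scaleR_left tendsto_norm_zero_iff)
  qed
  also have "\<dots> \<longleftrightarrow> ((\<lambda>h. (f h - f 0) /\<^sub>R h) \<longlongrightarrow> D) (at 0)"
    by (rule LIM_zero_iff)
  finally show ?thesis
    by (simp add: tendsto_at_iff_sequentially comp_def)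
qed

text \<open>Differentiation under the integral sign. The difference quotients are dominated only for
  \<open>\<bar>s\<bar> \<le> 1\<close>, so that for compactly supported integrands \<open>B\<close>
  can be supported in a bounded set.\<close>

lemma has_vector_derivative_integral:
  fixes G :: "real \<Rightarrow> 'x \<Rightarrow> 'b::euclidean_space"
  assumes int: "\<And>s. integrable M (G s)"
    and der: "\<And>x. x \<in> space M \<Longrightarrow> ((\<lambda>s. G s x) has_vector_derivative G' x) (at 0)"
    and bnd: "\<And>s x. x \<in> space M \<Longrightarrow> \<bar>s\<bar> \<le> 1 \<Longrightarrow> norm (G s x - G 0 x) \<le> \<bar>s\<bar> * B x"
    and B: "integrable M B"
  shows "integrable M G'" "((\<lambda>s. \<integral>x. G s x \<partial>M) has_vector_derivative (\<integral>x. G' x \<partial>M)) (at 0)"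
proof -
  have *: "integrable M G' \<and> (\<lambda>n. (\<integral>x. (G (S n) x - G 0 x) /\<^sub>R S n \<partial>M)) \<longlonglongrightarrow> (\<integral>x. G' x \<partial>M)"
    if S: "\<And>n. S n \<noteq> 0" "S \<longlonglongrightarrow> 0" "\<And>n. \<bar>S n\<bar> \<le> 1" for S :: "nat \<Rightarrow> real"
  proof -
    have lim: "(\<lambda>n. (G (S n) x - G 0 x) /\<^sub>R S n) \<longlonglongrightarrow> G' x" if "x \<in> space M" for x
      using der[OF that] S unfolding has_vector_derivative_at_0_sequentially by blast
    have [measurable]: "(\<lambda>x. (G (S n) x - G 0 x) /\<^sub>R S n) \<in> borel_measurable M" for n
      using int by (auto dest: borel_measurable_integrable)
    have m: "G' \<in> borel_measurable M"
      by (rule borel_measurable_LIMSEQ_metric[OF _ lim]) auto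
    have b: "norm ((G (S n) x - G 0 x) /\<^sub>R S n) \<le> B x" if "x \<in> space M" for n x
      using bnd[OF that S(3)[of n]] S(1)[of n] by (simp add: divide_inverse_commute[symmetric] pos_divide_le_eq mult.commute)
    show ?thesis
      using integrable_dominated_convergence[OF m _ B, of "\<lambda>n x. (G (S n) x - G 0 x) /\<^sub>R S n"]
        integral_dominated_convergence[OF m _ B, of "\<lambda>n x. (G (S n) x - G 0 x) /\<^sub>R S n"] lim b
      by auto
  qed
  \<comment> \<open>One null sequence of nonzero numbers in \<open>[-1, 1]\<close> is enough to
    identify \<open>G'\<close> as an integrable limit.\<close>
  show "integrable M G'"
    using *[of "\<lambda>n. inverse (real (Suc n))"] LIMSEQ_inverse_real_of_nat by (auto simp: inverse_le_1_iff)
  show "((\<lambda>s. \<integral>x. G s x \<partial>M) has_vector_derivative (\<integral>x. G' x \<partial>M)) (at 0)"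
    unfolding has_vector_derivative_at_0_sequentially
  proof (intro allI impI)
    fix S :: "nat \<Rightarrow> real" assume S: "\<forall>n. S n \<noteq> 0" "S \<longlonglongrightarrow> 0"
    then obtain N where N: "\<And>n. n \<ge> N \<Longrightarrow> \<bar>S n\<bar> \<le> 1"
      using LIMSEQ_D[OF S(2), of 1] by (auto intro: less_imp_le)
    have "(\<lambda>n. (\<integral>x. (G (S (n + N)) x - G 0 x) /\<^sub>R S (n + N) \<partial>M)) \<longlonglongrightarrow> (\<integral>x. G' x \<partial>M)"
      using *[of "\<lambda>n. S (n + N)"] S N LIMSEQ_ignore_initial_segment[OF S(2)] by auto
    then have "(\<lambda>n. ((\<integral>x. G (S (n + N)) x \<partial>M) - (\<integral>x. G 0 x \<partial>M)) /\<^sub>R S (n + N)) \<longlonglongrightarrow> (\<integral>x. G' x \<partial>M)"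
      using int by simp
    then show "(\<lambda>n. ((\<integral>x. G (S n) x \<partial>M) - (\<integral>x. G 0 x \<partial>M)) /\<^sub>R S n) \<longlonglongrightarrow> (\<integral>x. G' x \<partial>M)"
      by (rule LIMSEQ_offset)
  qed
qed

subsection \<open>Weak derivatives\<close>

lemma line_derivative:
  fixes \<phi> :: "'a::euclidean_space \<Rightarrow> real"
  assumes "\<phi> differentiable (at (x + s *\<^sub>R b))"
  shows "((\<lambda>s. \<phi> (x + s *\<^sub>R b)) has_vector_derivative dirderiv b \<phi> (x + s *\<^sub>R b)) (at s)"
proof -
  have d: "(\<phi> has_derivative frechet_derivative \<phi> (at (x + s *\<^sub>R b))) (at (x + s *\<^sub>R b))"
    using assms by (simp add: frechet_derivative_works)
  have "((\<lambda>s. \<phi> (x + s *\<^sub>R b)) has_derivative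
      (\<lambda>h. frechet_derivative \<phi> (at (x + s *\<^sub>R b)) (h *\<^sub>R b))) (at s)"
    by (rule has_derivative_compose[where f = "\<lambda>s. x + s *\<^sub>R b" and f' = "\<lambda>h. h *\<^sub>R b", OF _ d])
       (auto intro!: derivative_eq_intros)
  then show ?thesis
    using linear_scale[OF has_derivative_linear[OF d]]
    by (simp add: has_vector_derivative_def dirderiv_def)
qed

text \<open>The mean value inequality on a line. Derivatives at parameter 0 for all base points are
  enough, because the derivative at parameter \<open>t\<close> is the one at 0 for the base point
  \<open>x + t *\<^sub>R b\<close>.\<close>

lemma line_lipschitz:
  fixes h :: "'a::euclidean_space \<Rightarrow> 'b::euclidean_space"
  assumes "\<And>x. ((\<lambda>s. h (x + s *\<^sub>R b)) has_vector_derivative h' x) (at 0)" "\<And>x. norm (h' x) \<le> B"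
  shows "norm (h (x + s *\<^sub>R b) - h x) \<le> B * \<bar>s\<bar>"
proof -
  have "((\<lambda>s. h (x + s *\<^sub>R b)) has_derivative (\<lambda>h. h *\<^sub>R h' (x + t *\<^sub>R b))) (at t)" for t
  proof -
    have "((\<lambda>s. h ((x + t *\<^sub>R b) + s *\<^sub>R b)) has_vector_derivative h' (x + t *\<^sub>R b)) (at 0)"
      by (rule assms)
    then have "(((\<lambda>s. h (x + s *\<^sub>R b)) \<circ> (\<lambda>s. s + t)) has_vector_derivative h' (x + t *\<^sub>R b)) (at 0)"
      by (simp add: comp_def scaleR_left_distrib add.assoc add.left_commute add.commute)
    then show ?thesis
      using has_vector_derivative_shift[of "\<lambda>s. h (x + s *\<^sub>R b)"]
      by (simp add: has_vector_derivative_def has_derivative_at comp_def add.commute)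
  qed
  then have "norm (h (x + s *\<^sub>R b) - h (x + 0 *\<^sub>R b)) \<le> B * norm (s - 0)"
  proof (intro differentiable_bound[of UNIV "\<lambda>s. h (x + s *\<^sub>R b)" "\<lambda>t h. h *\<^sub>R h' (x + t *\<^sub>R b)"])
    fix t :: real
    have "onorm (\<lambda>h::real. h *\<^sub>R h' (x + t *\<^sub>R b)) \<le> norm (h' (x + t *\<^sub>R b))"
      by (rule onorm_le) (simp add: mult.commute)
    then show "onorm (\<lambda>h::real. h *\<^sub>R h' (x + t *\<^sub>R b)) \<le> B"
      using assms(2) order_trans by blast
  qed auto
  then show ?thesis by simp
qed

text \<open>By translation invariance \<open>s \<mapsto> \<integral> h (x + s b)\<close> is
  constant, and its derivative at 0 is the integral of \<open>h'\<close>. Applied to a product, this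
  is integration by parts.\<close>

lemma integral_line_derivative_zero:
  fixes h :: "'a::euclidean_space \<Rightarrow> 'b::euclidean_space"
  assumes der: "\<And>x. ((\<lambda>s. h (x + s *\<^sub>R b)) has_vector_derivative h' x) (at 0)"
    and B: "\<And>x. norm (h' x) \<le> B" and int: "integrable lborel h"
    and supp: "\<And>x. r \<le> norm x \<Longrightarrow> h x = 0"
  shows "integrable lborel h'" "(\<integral>x. h' x \<partial>lborel) = 0"
proof -
  let ?G = "\<lambda>s x. h (x + s *\<^sub>R b)"
  have 0: "0 \<le> B" using B norm_ge_zero order_trans by blast
  have [measurable]: "h \<in> borel_measurable borel"
    using int by (auto dest: borel_measurable_integrable)
  have G: "integrable lborel (?G s)" for s
    unfolding integrable_iff_bounded
  proof
    show "(\<integral>\<^sup>+x. ennreal (norm (h (x + s *\<^sub>R b))) \<partial>lborel) < \<infinity>"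
      using int by (subst nn_integral_lborel_shift[of "\<lambda>x. ennreal (norm (h x))"]) (auto simp: integrable_iff_bounded)
  qed auto
  \<comment> \<open>For \<open>\<bar>s\<bar> \<le> 1\<close> both values of \<open>h\<close> vanish
    once \<open>x\<close> leaves the ball enlarged by the length of \<open>b\<close>.\<close>
  have bnd: "norm (?G s x - ?G 0 x) \<le> \<bar>s\<bar> * (B * indicator (cball 0 (\<bar>r\<bar> + norm b)) x)" if "\<bar>s\<bar> \<le> 1" for s x
  proof (cases "norm x \<le> \<bar>r\<bar> + norm b")
    case True
    then show ?thesis using line_lipschitz[OF der B, of x s] by (simp add: mult.commute)
  next
    case False
    have "norm (s *\<^sub>R b) \<le> norm b" using that mult_right_mono[of "\<bar>s\<bar>" 1 "norm b"] by simp
    with False have "r \<le> norm (x + s *\<^sub>R b)" "r \<le> norm x"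
      using norm_triangle_ineq2[of x "- (s *\<^sub>R b)"] norm_ge_zero[of b] unfolding norm_minus_cancel diff_minus_eq_add by linarith+
    then show ?thesis using False by (simp add: supp)
  qed
  have Bint: "integrable lborel (\<lambda>x::'a. B * indicator (cball 0 (\<bar>r\<bar> + norm b)) x)"
    by (intro integrable_mult_right integrable_real_indicator) (use emeasure_bounded_finite[OF bounded_cball] in simp_all)
  note D = has_vector_derivative_integral[of lborel ?G h' "\<lambda>x. B * indicator (cball 0 (\<bar>r\<bar> + norm b)) x", OF G _ bnd Bint]
  show "integrable lborel h'" by (rule D(1)) (use der in auto)
  have "((\<lambda>s. \<integral>x. ?G s x \<partial>lborel) has_vector_derivative (\<integral>x. h' x \<partial>lborel)) (at 0)"
    by (rule D(2)) (use der in auto)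
  moreover have "(\<integral>x. ?G s x \<partial>lborel) = (\<integral>x. h x \<partial>lborel)" for s
    by (rule integral_lborel_shift) auto
  ultimately have "((\<lambda>s. (\<integral>x. h x \<partial>lborel)) has_vector_derivative (\<integral>x. h' x \<partial>lborel)) (at (0::real))"
    by simp
  then show "(\<integral>x. h' x \<partial>lborel) = 0"
    using vector_derivative_unique_at[OF _ has_vector_derivative_const] by blast
qed

section \<open>Directional derivatives of mollified functions\<close>

lemma dirderiv_outside_support:
  assumes "x \<notin> closure {x. \<phi> x \<noteq> 0}"
  shows "dirderiv b \<phi> x = 0"
proof -
  have "(\<phi> has_derivative (\<lambda>_. 0)) (at x)"
    by (rule has_derivative_transform_within_open[of "\<lambda>_. 0" _ _ _ "- closure {x. \<phi> x \<noteq> 0}"])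
       (use assms closure_subset[of "{x. \<phi> x \<noteq> 0}"] in auto)
  then show ?thesis by (rule dirderiv_eqI)
qed

text \<open>The margin 1 places \<open>x\<close> strictly outside the closed ball that contains the
  closure of the support, where \<open>\<rho>\<close> is locally zero.\<close>

lemma mollifier_dirderiv:
  assumes "is_mollifier r \<rho>" "b \<in> Basis"
  shows "continuous_on UNIV (dirderiv b \<rho>)" "r + 1 \<le> norm x \<Longrightarrow> dirderiv b \<rho> x = 0"
    "\<rho> differentiable (at x)"
proof -
  have "Ck (Suc 0) \<rho>" using mollifierD(1)[OF assms(1)] .
  then show "continuous_on UNIV (dirderiv b \<rho>)" "\<rho> differentiable (at x)"
    using assms(2) by (auto simp: differentiable_on_def)
  assume "r + 1 \<le> norm x"
  moreover have "closure {x. \<rho> x \<noteq> 0} \<subseteq> cball 0 r"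
  proof (rule closure_minimal)
    show "{x. \<rho> x \<noteq> 0} \<subseteq> cball 0 r"
    proof
      fix x assume "x \<in> {x. \<rho> x \<noteq> 0}"
      then show "x \<in> cball 0 r" using mollifierD(4)[OF assms(1), of x] by (cases "r \<le> norm x") auto
    qed
  qed simp
  ultimately show "dirderiv b \<rho> x = 0"
    by (intro dirderiv_outside_support) auto
qed

lemma mollify_bounded:
  assumes "integrable lborel f" "k \<in> borel_measurable borel" "\<And>x. \<bar>k x\<bar> \<le> C"
  shows "norm (mollify k f x) \<le> C * (\<integral>y. norm (f y) \<partial>lborel)"
proof -
  have "norm (mollify k f x) \<le> (\<integral>y. C * norm (f y) \<partial>lborel)"
    unfolding mollify_def
  proof (rule Bochner_Integration.integral_norm_bound_integral)
    show "integrable lborel (\<lambda>y. k (x - y) *\<^sub>R f y)"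
      by (rule integrable_bounded_scaleR[OF assms(1)]) (use assms in auto)
    show "norm (k (x - y) *\<^sub>R f y) \<le> C * norm (f y)" for y
      using assms(3)[of "x - y"] by (simp add: mult_right_mono)
  qed (use assms in auto)
  then show ?thesis by simp
qed

lemma mollify_measurable [measurable]:
  assumes [measurable]: "f \<in> borel_measurable borel" "k \<in> borel_measurable borel"
  shows "mollify k f \<in> borel_measurable borel"
  unfolding mollify_def by measurable

text \<open>The derivative falls on the kernel. Its Lipschitz constant along \<open>b\<close>, times
  the norm of \<open>f\<close>, dominates the difference quotients.\<close>

lemma mollify_derivative:
  fixes f :: "'a::euclidean_space \<Rightarrow> 'b::euclidean_space"
  assumes f: "integrable lborel f" and \<rho>: "is_mollifier r \<rho>" and b: "b \<in> Basis"
  shows "((\<lambda>s. mollify \<rho> f (x + s *\<^sub>R b)) has_vector_derivative mollify (dirderiv b \<rho>) f x) (at 0)"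
proof -
  note [measurable] = mollifierD(6)[OF \<rho>] borel_measurable_integrable[OF f, simplified]
  obtain C where C: "\<And>x. norm (\<rho> x) \<le> C"
    using compact_support_bounded[OF mollifierD(2)[OF \<rho>] mollifierD(4)[OF \<rho>]] by metis
  obtain C' where C': "\<And>x. norm (dirderiv b \<rho> x) \<le> C'"
    using compact_support_bounded[OF mollifier_dirderiv(1)[OF \<rho> b] mollifier_dirderiv(2)[OF \<rho> b]] by metis
  have der: "((\<lambda>s. \<rho> (z + s *\<^sub>R b)) has_vector_derivative dirderiv b \<rho> z) (at 0)" for z
    using line_derivative[of \<rho> z 0 b] mollifier_dirderiv(3)[OF \<rho> b] by simp
  show ?thesis
    unfolding mollify_def
  proof (rule has_vector_derivative_integral(2)[where B = "\<lambda>y. C' * norm (f y)"])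
    show "integrable lborel (\<lambda>y. \<rho> (x + s *\<^sub>R b - y) *\<^sub>R f y)" for s
      by (rule integrable_bounded_scaleR[OF f]) (use C in auto)
    show "((\<lambda>s. \<rho> (x + s *\<^sub>R b - y) *\<^sub>R f y) has_vector_derivative dirderiv b \<rho> (x - y) *\<^sub>R f y) (at 0)" for y
    proof -
      have "((\<lambda>s. \<rho> (x - y + s *\<^sub>R b) *\<^sub>R f y) has_vector_derivative dirderiv b \<rho> (x - y) *\<^sub>R f y) (at 0)"
        using bounded_linear.has_vector_derivative[OF bounded_linear_scaleR_left der] .
      then show ?thesis by (simp add: algebra_simps)
    qed
    show "norm (\<rho> (x + s *\<^sub>R b - y) *\<^sub>R f y - \<rho> (x + 0 *\<^sub>R b - y) *\<^sub>R f y) \<le> \<bar>s\<bar> * (C' * norm (f y))" for s y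
    proof -
      have "norm (\<rho> (x - y + s *\<^sub>R b) - \<rho> (x - y)) * norm (f y) \<le> (C' * \<bar>s\<bar>) * norm (f y)"
        by (intro mult_right_mono line_lipschitz[OF der C']) simp
      then show ?thesis by (simp add: algebra_simps flip: scaleR_left_diff_distrib)
    qed
    show "integrable lborel (\<lambda>y. C' * norm (f y))" using f by simp
  qed
qed

text \<open>The Fubini and translation arguments for convolutions are carried out over
  \<open>lborel\<close>, whereas Sobolev functions are measurable for the completion. The Borel
  representative is built coordinate by coordinate.\<close>

lemma lebesgue_ex_borel:
  fixes f :: "'a::euclidean_space \<Rightarrow> 'b::euclidean_space"
  assumes "f \<in> borel_measurable lebesgue"
  obtains f' where "f' \<in> borel_measurable borel" "AE x in lborel. f x = f' x"
proof -
  have "\<exists>g. g \<in> borel_measurable borel \<and> (AE x in lborel. f x \<bullet> i = g x)" for i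
  proof -
    have "(\<lambda>x. f x \<bullet> i) \<in> borel_measurable lebesgue" using assms by simp
    from completion_ex_borel_measurable_real[OF this] show ?thesis by auto
  qed
  then obtain g where g: "\<And>i. g i \<in> borel_measurable borel" "\<And>i. AE x in lborel. f x \<bullet> i = g i x"
    by metis
  show ?thesis
  proof (rule that[of "\<lambda>x. \<Sum>i\<in>Basis. g i x *\<^sub>R i"])
    show "(\<lambda>x. \<Sum>i\<in>Basis. g i x *\<^sub>R i) \<in> borel_measurable borel"
      by (intro borel_measurable_sum borel_measurable_scaleR g(1) borel_measurable_const)
    have "AE x in lborel. \<forall>i\<in>Basis. f x \<bullet> i = g i x"
      by (rule AE_finite_allI) (use g in auto)
    then show "AE x in lborel. f x = (\<Sum>i\<in>Basis. g i x *\<^sub>R i)"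
    proof eventually_elim
      case (elim x)
      then have "(\<Sum>i\<in>Basis. g i x *\<^sub>R i) = (\<Sum>i\<in>Basis. (f x \<bullet> i) *\<^sub>R i)" by simp
      then show ?case by (simp add: euclidean_representation)
    qed
  qed
qed

text \<open>Truncation to a compact set makes a locally integrable function globally integrable, so
  that it can be mollified.\<close>

lemma locally_integrable_borel:
  fixes f :: "'a::euclidean_space \<Rightarrow> 'b::euclidean_space"
  assumes "locally_integrable D f" "compact K" "K \<subseteq> D"
  obtains f' where "integrable lborel f'" "AE x in lborel. indicator K x *\<^sub>R f x = f' x"
proof -
  have i: "integrable lebesgue (\<lambda>x. indicator K x *\<^sub>R f x)"
    using assms by (auto simp: locally_integrable_def set_integrable_def)
  then obtain f' where f': "f' \<in> borel_measurable borel" "AE x in lborel. indicator K x *\<^sub>R f x = f' x"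
    using lebesgue_ex_borel[OF borel_measurable_integrable[OF i]] by blast
  have "integrable lebesgue f'"
    by (rule integrable_cong_AE_imp[OF i]) (use f' in \<open>auto intro: measurable_completion AE_completion\<close>)
  then show ?thesis using f' by (intro that) (auto simp: integrable_completion)
qed

text \<open>A factor \<open>\<zeta>\<close> that vanishes off \<open>K\<close> cannot distinguish
  \<open>f\<close> from the Borel representative of its truncation. This is the passage between
  integrals over \<open>D\<close> and integrals over the whole space.\<close>

lemma integral_local_eq:
  fixes f :: "'a::euclidean_space \<Rightarrow> 'b::euclidean_space"
  assumes D: "open D" and K: "K \<subseteq> D"
    and f': "integrable lborel f'" "AE x in lborel. indicator K x *\<^sub>R f x = f' x"
    and \<zeta>: "\<zeta> \<in> borel_measurable borel" "\<And>x. \<bar>\<zeta> x\<bar> \<le> C" "\<And>x. x \<notin> K \<Longrightarrow> \<zeta> x = 0"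
  shows "integrable (lebesgue_on D) (\<lambda>x. \<zeta> x *\<^sub>R f x)"
    "(LINT x|lebesgue_on D. \<zeta> x *\<^sub>R f x) = (\<integral>x. \<zeta> x *\<^sub>R f' x \<partial>lborel)"
proof -
  have Ds: "D \<in> sets lebesgue" using D by auto
  have i: "integrable lborel (\<lambda>x. \<zeta> x *\<^sub>R f' x)"
    by (rule integrable_bounded_scaleR[OF f'(1) _ \<zeta>(2)]) (use \<zeta> in auto)
  have AE: "AE x in lebesgue. \<zeta> x *\<^sub>R f' x = indicator D x *\<^sub>R (\<zeta> x *\<^sub>R f x)"
    using AE_completion[OF f'(2)]
  proof eventually_elim
    case (elim x)
    then show ?case using \<zeta>(3)[of x] K by (cases "x \<in> K") (auto simp: indicator_def)
  qed
  have im: "(\<lambda>x. \<zeta> x *\<^sub>R f' x) \<in> borel_measurable lborel"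
    using i by (rule borel_measurable_integrable)
  then have *: "integrable lebesgue (\<lambda>x. \<zeta> x *\<^sub>R f' x)" using i by (simp add: integrable_completion)
  have h: "has_bochner_integral lebesgue (\<lambda>x. indicator D x *\<^sub>R (\<zeta> x *\<^sub>R f x)) (\<integral>x. \<zeta> x *\<^sub>R f' x \<partial>lborel)"
  proof -
    have "has_bochner_integral lebesgue (\<lambda>x. \<zeta> x *\<^sub>R f' x) (\<integral>x. \<zeta> x *\<^sub>R f' x \<partial>lborel)"
      using * integral_completion[OF im] by (simp add: has_bochner_integral_iff)
    moreover have "(\<lambda>x. indicator D x *\<^sub>R (\<zeta> x *\<^sub>R f x)) \<in> borel_measurable lebesgue"
      by (rule borel_measurable_AE[OF measurable_completion[OF im] AE])
    ultimately show ?thesis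
      using AE has_bochner_integral_cong_AE[OF borel_measurable_integrable[OF *]] by blast
  qed
  then show "integrable (lebesgue_on D) (\<lambda>x. \<zeta> x *\<^sub>R f x)"
    "(LINT x|lebesgue_on D. \<zeta> x *\<^sub>R f x) = (\<integral>x. \<zeta> x *\<^sub>R f' x \<partial>lborel)"
    using Ds by (auto simp: has_bochner_integral_iff integrable_restrict_space integral_restrict_space)
qed

lemma test_functionD:
  assumes "test_function D \<phi>"
  shows "compact (closure {x. \<phi> x \<noteq> 0})" "closure {x. \<phi> x \<noteq> 0} \<subseteq> D"
    "x \<notin> closure {x. \<phi> x \<noteq> 0} \<Longrightarrow> \<phi> x = 0" "\<phi> \<in> borel_measurable borel"
    "b \<in> Basis \<Longrightarrow> dirderiv b \<phi> \<in> borel_measurable borel"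
    "\<exists>C. \<forall>x. \<bar>\<phi> x\<bar> \<le> C" "b \<in> Basis \<Longrightarrow> \<exists>C. \<forall>x. \<bar>dirderiv b \<phi> x\<bar> \<le> C"
    "\<phi> differentiable (at x)"
proof -
  show c: "compact (closure {x. \<phi> x \<noteq> 0})" and "closure {x. \<phi> x \<noteq> 0} \<subseteq> D"
    using assms by (auto simp: test_function_def)
  show z: "\<phi> x = 0" if "x \<notin> closure {x. \<phi> x \<noteq> 0}" for x
    using that closure_subset[of "{x. \<phi> x \<noteq> 0}"] by blast
  have C1: "Ck (Suc 0) \<phi>" using assms unfolding test_function_def by blast
  then show "\<phi> differentiable (at x)" by (rule Ck_Suc_differentiable)
  have c0: "continuous_on UNIV \<phi>" using C1 by (rule Ck_continuous)
  then show "\<phi> \<in> borel_measurable borel" by (rule borel_measurable_continuous_onI)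
  obtain r where r: "\<And>x. x \<in> closure {x. \<phi> x \<noteq> 0} \<Longrightarrow> norm x < r"
    using compact_imp_bounded[OF c] unfolding bounded_pos_less by blast
  have out: "x \<notin> closure {x. \<phi> x \<noteq> 0}" if "r \<le> norm x" for x
    using r that by (meson not_le)
  have z0: "\<phi> x = 0" if "r \<le> norm x" for x
    using out[OF that] z by blast
  obtain C where "\<And>x. norm (\<phi> x) \<le> C"
    using compact_support_bounded[OF c0 z0] by blast
  then show "\<exists>C. \<forall>x. \<bar>\<phi> x\<bar> \<le> C" by auto
  assume "b \<in> Basis"
  with C1 have c1: "continuous_on UNIV (dirderiv b \<phi>)" by auto
  then show "dirderiv b \<phi> \<in> borel_measurable borel" by (rule borel_measurable_continuous_onI)
  have z1: "dirderiv b \<phi> x = 0" if "r \<le> norm x" for x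
    using out[OF that] by (rule dirderiv_outside_support)
  obtain C where "\<And>x. norm (dirderiv b \<phi> x) \<le> C"
    using compact_support_bounded[OF c1 z1] by blast
  then show "\<exists>C. \<forall>x. \<bar>dirderiv b \<phi> x\<bar> \<le> C" by auto
qed

lemma integrable_test:
  assumes "open D" "locally_integrable D f" "test_function D \<phi>"
  shows "integrable (lebesgue_on D) (\<lambda>x. \<phi> x *\<^sub>R f x)"
    "b \<in> Basis \<Longrightarrow> integrable (lebesgue_on D) (\<lambda>x. dirderiv b \<phi> x *\<^sub>R f x)"
proof -
  note t = test_functionD[OF assms(3)]
  obtain f' where f': "integrable lborel f'" "AE x in lborel. indicator (closure {x. \<phi> x \<noteq> 0}) x *\<^sub>R f x = f' x"
    using locally_integrable_borel[OF assms(2) t(1,2)] by blast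
  show "integrable (lebesgue_on D) (\<lambda>x. \<phi> x *\<^sub>R f x)"
  proof -
    obtain C where "\<And>x. \<bar>\<phi> x\<bar> \<le> C" using t(6) by blast
    then show ?thesis by (rule integral_local_eq(1)[OF assms(1) t(2) f' t(4) _ t(3)])
  qed
  show "integrable (lebesgue_on D) (\<lambda>x. dirderiv b \<phi> x *\<^sub>R f x)" if b: "b \<in> Basis"
  proof -
    obtain C where "\<And>x. \<bar>dirderiv b \<phi> x\<bar> \<le> C" using t(7)[OF b] by blast
    then show ?thesis
      by (rule integral_local_eq(1)[OF assms(1) t(2) f' t(5)[OF b] _ dirderiv_outside_support])
  qed
qed

text \<open>\<open>K'\<close> is the sum of \<open>K\<close> and a closed ball, hence compact. It
  leaves room for kernels of radius \<open>e\<close> centred in \<open>K\<close>.\<close>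

lemma compact_neighbourhood:
  fixes K :: "'a::euclidean_space set"
  assumes "compact K" "open D" "K \<subseteq> D"
  obtains e K' where "0 < e" "compact K'" "K' \<subseteq> D" "\<forall>x\<in>K. cball x e \<subseteq> K'"
proof -
  obtain e where e: "0 < e" "(\<Union>x\<in>K. cball x e) \<subseteq> D"
    using compact_subset_open_imp_cball_epsilon_subset[OF assms] by blast
  have "(\<Union>x\<in>K. cball x e) = (\<Union>x\<in>K. \<Union>y\<in>cball (0::'a) e. {x + y})"
  proof (intro SUP_cong refl)
    fix x :: 'a
    show "cball x e = (\<Union>y\<in>cball 0 e. {x + y})"
    proof (intro set_eqI iffI)
      fix z assume "z \<in> cball x e"
      then show "z \<in> (\<Union>y\<in>cball 0 e. {x + y})"
        by (intro UN_I[of "z - x"]) (auto simp: dist_norm norm_minus_commute)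
    qed (auto simp: dist_norm)
  qed
  then have "compact (\<Union>x\<in>K. cball x e)"
    using compact_sums'[OF assms(1) compact_cball[of 0 e]] by (simp only:)
  with e show ?thesis by (intro that) auto
qed

text \<open>One sequence serves both functions: a function and its weak derivative have to be
  smoothed by the same kernels for the derivative relation to survive.\<close>

lemma mollifier_sequence:
  fixes f :: "'a::euclidean_space \<Rightarrow> 'b::euclidean_space" and g :: "'a \<Rightarrow> 'b"
  assumes "integrable lborel f" "integrable lborel g" "0 < e"
  obtains \<rho> :: "nat \<Rightarrow> 'a \<Rightarrow> real" where "\<forall>n. is_mollifier e (\<rho> n)"
    "(\<lambda>n. \<integral>\<^sup>+x. ennreal (norm (mollify (\<rho> n) f x - f x)) \<partial>lborel) \<longlonglongrightarrow> 0"
    "(\<lambda>n. \<integral>\<^sup>+x. ennreal (norm (mollify (\<rho> n) g x - g x)) \<partial>lborel) \<longlonglongrightarrow> 0"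
proof -
  have "\<exists>\<rho>. is_mollifier e \<rho> \<and>
    (\<integral>\<^sup>+x. ennreal (norm (mollify \<rho> f x - f x)) \<partial>lborel) \<le> ennreal (inverse (real (Suc n))) \<and>
    (\<integral>\<^sup>+x. ennreal (norm (mollify \<rho> g x - g x)) \<partial>lborel) \<le> ennreal (inverse (real (Suc n)))" for n
  proof -
    have "0 < inverse (real (Suc n))" by simp
    from translation_L1_continuous[OF assms(1) this] translation_L1_continuous[OF assms(2) this]
    obtain d1 d2 where d: "0 < d1" "0 < d2"
      "\<forall>y. norm y < d1 \<longrightarrow> (\<integral>\<^sup>+x. ennreal (norm (f (x + y) - f x)) \<partial>lborel) \<le> ennreal (inverse (real (Suc n)))"
      "\<forall>y. norm y < d2 \<longrightarrow> (\<integral>\<^sup>+x. ennreal (norm (g (x + y) - g x)) \<partial>lborel) \<le> ennreal (inverse (real (Suc n)))"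
      by blast
    define r where "r = min (min d1 d2) e"
    have "0 < r" using d assms(3) by (simp add: r_def)
    then obtain \<rho> :: "'a \<Rightarrow> real" where \<rho>: "is_mollifier r \<rho>"
      by (rule mollifier_exists)
    have "is_mollifier e \<rho>" using \<rho> by (simp add: is_mollifier_def r_def)
    moreover have "(\<integral>\<^sup>+x. ennreal (norm (mollify \<rho> f x - f x)) \<partial>lborel) \<le> ennreal (inverse (real (Suc n)))"
      by (rule mollify_L1[OF assms(1) \<rho>]) (use d(3) in \<open>simp add: r_def\<close>)
    moreover have "(\<integral>\<^sup>+x. ennreal (norm (mollify \<rho> g x - g x)) \<partial>lborel) \<le> ennreal (inverse (real (Suc n)))"
      by (rule mollify_L1[OF assms(2) \<rho>]) (use d(4) in \<open>simp add: r_def\<close>)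
    ultimately show ?thesis by blast
  qed
  then obtain \<rho> where \<rho>: "\<And>n. is_mollifier e (\<rho> n)"
    "\<And>n. (\<integral>\<^sup>+x. ennreal (norm (mollify (\<rho> n) f x - f x)) \<partial>lborel) \<le> ennreal (inverse (real (Suc n)))"
    "\<And>n. (\<integral>\<^sup>+x. ennreal (norm (mollify (\<rho> n) g x - g x)) \<partial>lborel) \<le> ennreal (inverse (real (Suc n)))"
    by metis
  have l: "(\<lambda>n. ennreal (inverse (real (Suc n)))) \<longlonglongrightarrow> 0"
    using tendsto_ennrealI[OF LIMSEQ_inverse_real_of_nat] by simp
  show ?thesis
    by (rule that[of \<rho>, OF allI[OF \<rho>(1)]])
       (rule tendsto_sandwich[OF _ _ tendsto_const l], use \<rho>(2,3) in simp_all)+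
qed

lemma mollify_AE_subseq:
  fixes f :: "'a::euclidean_space \<Rightarrow> 'b::euclidean_space"
  assumes f: "integrable lborel f" and fn: "\<And>n. fn n \<in> borel_measurable borel"
    and lim: "(\<lambda>n. \<integral>\<^sup>+x. ennreal (norm (fn n x - f x)) \<partial>lborel) \<longlonglongrightarrow> 0"
  obtains r :: "nat \<Rightarrow> nat" where "strict_mono r" "AE x in lborel. (\<lambda>n. fn (r n) x) \<longlonglongrightarrow> f x"
proof -
  have [measurable]: "f \<in> borel_measurable borel" "\<And>n. fn n \<in> borel_measurable borel"
    using f fn by (auto dest: borel_measurable_integrable)
  \<comment> \<open>Convergence to 0 makes the integrals finite only from some index on, and the
    differences integrable only from there.\<close>
  obtain N where N: "\<And>n. n \<ge> N \<Longrightarrow> (\<integral>\<^sup>+x. ennreal (norm (fn n x - f x)) \<partial>lborel) < 1"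
    using order_tendstoD(2)[OF lim, of 1] by (auto simp: eventually_sequentially)
  have i: "integrable lborel (\<lambda>x. fn (n + N) x - f x)" for n
    using N[of "n + N"] by (auto simp: integrable_iff_bounded intro: order.strict_trans)
  have "(\<lambda>n. enn2real (\<integral>\<^sup>+x. ennreal (norm (fn (n + N) x - f x)) \<partial>lborel)) \<longlonglongrightarrow> 0"
    using LIMSEQ_ignore_initial_segment[OF lim, of N] by (intro tendsto_enn2real) simp_all
  then have "(\<lambda>n. \<integral>x. norm (fn (n + N) x - f x) \<partial>lborel) \<longlonglongrightarrow> 0"
    by (simp add: integral_eq_nn_integral)
  from tendsto_L1_AE_subseq[OF i this]
  obtain r where r: "strict_mono r" "AE x in lborel. (\<lambda>n. fn (r n + N) x - f x) \<longlonglongrightarrow> 0" by blast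
  show ?thesis
  proof (rule that[of "\<lambda>n. r n + N"])
    show "strict_mono (\<lambda>n. r n + N)" using r(1) by (auto simp: strict_mono_def)
    show "AE x in lborel. (\<lambda>n. fn (r n + N) x) \<longlonglongrightarrow> f x"
      using r(2) by eventually_elim (rule LIM_zero_cancel)
  qed
qed

lemma ennreal_squeeze_0:
  fixes f g :: "nat \<Rightarrow> ennreal"
  assumes "\<And>n. f n \<le> g n" "g \<longlonglongrightarrow> 0"
  shows "f \<longlonglongrightarrow> 0"
  by (rule tendsto_sandwich[OF _ _ tendsto_const assms(2)]) (simp_all add: assms(1))

text \<open>Where the ball of radius \<open>e\<close> stays in \<open>K'\<close>, the convolution is
  a pairing with a test function. The minus sign comes from differentiating the reflected kernel
  \<open>y \<mapsto> \<rho> (x - y)\<close> in \<open>y\<close>.\<close>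

lemma mollify_eq_0:
  fixes g :: "'a::euclidean_space \<Rightarrow> 'b::euclidean_space"
  assumes D: "open D" and K': "K' \<subseteq> D" "cball x e \<subseteq> K'"
    and g': "integrable lborel g'" "AE x in lborel. indicator K' x *\<^sub>R g x = g' x"
    and \<rho>: "is_mollifier e \<rho>"
  shows "mollify \<rho> g' x = (LINT y|lebesgue_on D. \<rho> (x - y) *\<^sub>R g y)"
    and "b \<in> Basis \<Longrightarrow> mollify (dirderiv b \<rho>) g' x = - (LINT y|lebesgue_on D. dirderiv b (\<lambda>y. \<rho> (x - y)) y *\<^sub>R g y)"
proof -
  have t: "test_function K' (\<lambda>y. \<rho> (x - y))" using \<rho> K'(2) by (rule test_function_mollifier)
  note tD = test_functionD[OF t]
  obtain C where C: "\<And>y. \<bar>\<rho> (x - y)\<bar> \<le> C" using tD(6) by blast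
  have z: "\<rho> (x - y) = 0" if "y \<notin> K'" for y using tD(2) tD(3)[of y] that by blast
  show "mollify \<rho> g' x = (LINT y|lebesgue_on D. \<rho> (x - y) *\<^sub>R g y)"
    unfolding mollify_def by (rule integral_local_eq(2)[OF D K'(1) g' tD(4) C z, symmetric])
  assume b: "b \<in> Basis"
  obtain C' where C': "\<And>y. \<bar>dirderiv b (\<lambda>y. \<rho> (x - y)) y\<bar> \<le> C'" using tD(7)[OF b] by blast
  have z': "dirderiv b (\<lambda>y. \<rho> (x - y)) y = 0" if "y \<notin> K'" for y
    by (rule dirderiv_outside_support) (use tD(2) that in blast)
  have r: "dirderiv b (\<lambda>y. \<rho> (x - y)) y = - dirderiv b \<rho> (x - y)" for y
    by (rule dirderiv_reflect) (rule mollifier_dirderiv(3)[OF \<rho> b])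
  have "(LINT y|lebesgue_on D. dirderiv b (\<lambda>y. \<rho> (x - y)) y *\<^sub>R g y) =
     (\<integral>y. dirderiv b (\<lambda>y. \<rho> (x - y)) y *\<^sub>R g' y \<partial>lborel)"
    by (rule integral_local_eq(2)[OF D K'(1) g' tD(5)[OF b] C' z'])
  then show "mollify (dirderiv b \<rho>) g' x = - (LINT y|lebesgue_on D. dirderiv b (\<lambda>y. \<rho> (x - y)) y *\<^sub>R g y)"
    by (simp add: r mollify_def)
qed

lemma AE_lebesgue_on_compacts:
  assumes "open (D :: 'a::euclidean_space set)"
    and "\<And>K. compact K \<Longrightarrow> K \<subseteq> D \<Longrightarrow> AE x in lborel. x \<in> K \<longrightarrow> P x"
  shows "AE x in lebesgue_on D. P x"
proof -
  obtain C :: "nat \<Rightarrow> 'a set" where C: "\<And>n. compact (C n)" "\<And>n. C n \<subseteq> D" "(\<Union>n. C n) = D"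
    using open_Union_compact_subsets[OF assms(1)] by metis
  have "AE x in lborel. \<forall>n. x \<in> C n \<longrightarrow> P x"
    unfolding AE_all_countable using assms(2) C by blast
  then have "AE x in lebesgue. x \<in> D \<longrightarrow> P x"
    using C(3) by (intro AE_completion) (auto elim!: eventually_mono)
  then show ?thesis using assms(1) by (simp add: AE_restrict_space_iff)
qed

text \<open>On a compact set the mollifications of \<open>g\<close> are pairings with test
  functions, hence 0; along a subsequence they also converge to \<open>g\<close> almost everywhere.
  Countably many compact sets exhaust \<open>D\<close>.\<close>

lemma fundamental_lemma:
  fixes g :: "'a::euclidean_space \<Rightarrow> 'b::euclidean_space"
  assumes D: "open D" and g: "locally_integrable D g"
    and z: "\<And>\<phi>. test_function D \<phi> \<Longrightarrow> (LINT x|lebesgue_on D. \<phi> x *\<^sub>R g x) = 0"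
  shows "AE x in lebesgue_on D. g x = 0"
proof (rule AE_lebesgue_on_compacts[OF D])
  fix K assume K: "compact K" "K \<subseteq> D"
  obtain e K' where K': "0 < e" "compact K'" "K' \<subseteq> D" "\<forall>x\<in>K. cball x e \<subseteq> K'"
    using compact_neighbourhood[OF K(1) D K(2)] .
  obtain g' where g': "integrable lborel g'" "AE x in lborel. indicator K' x *\<^sub>R g x = g' x"
    using locally_integrable_borel[OF g K'(2,3)] .
  obtain \<rho> :: "nat \<Rightarrow> 'a \<Rightarrow> real" where \<rho>a: "\<forall>n. is_mollifier e (\<rho> n)" and
    \<rho>b: "(\<lambda>n. \<integral>\<^sup>+x. ennreal (norm (mollify (\<rho> n) g' x - g' x)) \<partial>lborel) \<longlonglongrightarrow> 0"
    using mollifier_sequence[OF g'(1) g'(1) K'(1)] by blast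
  note \<rho> = spec[OF \<rho>a] \<rho>b
  have [measurable]: "g' \<in> borel_measurable borel" "\<And>n. \<rho> n \<in> borel_measurable borel"
    using g' mollifierD(6)[OF \<rho>(1)] by (auto dest: borel_measurable_integrable)
  have [measurable]: "mollify (\<rho> n) g' \<in> borel_measurable borel" for n by measurable
  obtain r where "AE x in lborel. (\<lambda>n. mollify (\<rho> (r n)) g' x) \<longlonglongrightarrow> g' x"
    using mollify_AE_subseq[OF g'(1), of "\<lambda>n. mollify (\<rho> n) g'"] \<rho>(2) by auto
  moreover have m0: "mollify (\<rho> n) g' x = 0" if "x \<in> K" for n x
  proof -
    have "test_function D (\<lambda>y. \<rho> n (x - y))"
      using test_function_mollifier[OF \<rho>(1)] K' that by (meson subset_trans)
    then show ?thesis
      using mollify_eq_0(1)[OF D K'(3) bspec[OF K'(4) that] g' \<rho>(1)] z by simp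
  qed
  ultimately show "AE x in lborel. x \<in> K \<longrightarrow> g x = 0"
    using g'(2)
  proof eventually_elim
    case (elim x)
    then have x: "x \<in> K" by simp
    then have "x \<in> K'" using K'(1) bspec[OF K'(4) x] by auto
    moreover have "g' x = 0"
      using elim by (simp add: m0[OF x] LIMSEQ_const_iff)
    ultimately show ?case using elim by simp
  qed
qed

section \<open>Uniqueness and linearity of weak derivatives\<close>

lemma locally_integrable_diff:
  assumes "locally_integrable D f" "locally_integrable D g"
  shows "locally_integrable D (\<lambda>x. f x - g x)"
  using assms by (auto simp: locally_integrable_def intro: set_integral_diff)

lemma locally_integrable_scaleR:
  assumes "locally_integrable D f"
  shows "locally_integrable D (\<lambda>x. c *\<^sub>R f x)"
  using assms by (auto simp: locally_integrable_def)

text \<open>\<open>weak_deriv\<close> is an arbitrary choice of a weak derivative; this is what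
  identifies it almost everywhere with any derivative that has been computed.\<close>

lemma has_weak_deriv_unique:
  fixes f :: "'a::euclidean_space \<Rightarrow> 'b::euclidean_space"
  assumes D: "open D" and "has_weak_deriv D b f g" "has_weak_deriv D b f h"
  shows "AE x in lebesgue_on D. g x = h x"
proof -
  have "AE x in lebesgue_on D. g x - h x = 0"
  proof (rule fundamental_lemma[OF D])
    show "locally_integrable D (\<lambda>x. g x - h x)"
      using assms by (intro locally_integrable_diff) (auto simp: has_weak_deriv_def)
    fix \<phi> :: "'a \<Rightarrow> real" assume t: "test_function D \<phi>"
    have "(LINT x|lebesgue_on D. \<phi> x *\<^sub>R (g x - h x)) =
        (LINT x|lebesgue_on D. \<phi> x *\<^sub>R g x) - (LINT x|lebesgue_on D. \<phi> x *\<^sub>R h x)"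
      unfolding scaleR_right_diff_distrib
      by (intro Bochner_Integration.integral_diff integrable_test[OF D _ t])
         (use assms in \<open>auto simp: has_weak_deriv_def\<close>)
    also have "\<dots> = 0" using assms(2,3) t by (auto simp: has_weak_deriv_def)
    finally show "(LINT x|lebesgue_on D. \<phi> x *\<^sub>R (g x - h x)) = 0" .
  qed
  then show ?thesis by (auto elim!: eventually_mono)
qed

lemma has_weak_deriv_diff:
  fixes f :: "'a::euclidean_space \<Rightarrow> 'b::euclidean_space"
  assumes D: "open D" "b \<in> Basis" and f: "has_weak_deriv D b f f'" and g: "has_weak_deriv D b g g'"
  shows "has_weak_deriv D b (\<lambda>x. f x - g x) (\<lambda>x. f' x - g' x)"
  unfolding has_weak_deriv_def
proof (intro conjI allI impI locally_integrable_diff)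
  fix \<phi> :: "'a \<Rightarrow> real" assume t: "test_function D \<phi>"
  have l: "locally_integrable D f" "locally_integrable D f'" "locally_integrable D g" "locally_integrable D g'"
    using f g by (auto simp: has_weak_deriv_def)
  show "(LINT x|lebesgue_on D. dirderiv b \<phi> x *\<^sub>R (f x - g x)) = - (LINT x|lebesgue_on D. \<phi> x *\<^sub>R (f' x - g' x))"
    using f g t integrable_test[OF D(1) l(1) t] integrable_test[OF D(1) l(2) t] integrable_test[OF D(1) l(3) t]
      integrable_test[OF D(1) l(4) t] D(2)
    by (simp add: scaleR_right_diff_distrib has_weak_deriv_def)
qed (use f g in \<open>auto simp: has_weak_deriv_def\<close>)

lemma has_weak_deriv_scaleR:
  fixes f :: "'a::euclidean_space \<Rightarrow> 'b::euclidean_space"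
  assumes "has_weak_deriv D b f f'"
  shows "has_weak_deriv D b (\<lambda>x. c *\<^sub>R f x) (\<lambda>x. c *\<^sub>R f' x)"
  using assms unfolding has_weak_deriv_def
  by (auto simp: locally_integrable_scaleR scaleR_left_commute[of _ c] simp del: scaleR_scaleR)

text \<open>Friedrichs' local approximation. \<open>f'\<close> and \<open>g'\<close> represent
  truncations to a neighbourhood of \<open>K\<close>. Testing the weak identity with
  \<open>y \<mapsto> \<rho> (x - y)\<close> shows that on \<open>K\<close> the derivative of the
  mollified \<open>f\<close> is the mollified \<open>g\<close>. Convergence almost everywhere of
  \<open>fn\<close> is provided for continuous nonlinearities of \<open>f\<close>.\<close>

lemma weak_deriv_approx:
  fixes f :: "'a::euclidean_space \<Rightarrow> 'b::euclidean_space"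
  assumes D: "open D" and b: "b \<in> Basis" and fg: "has_weak_deriv D b f g" and K: "compact K" "K \<subseteq> D"
  obtains f' g' :: "'a \<Rightarrow> 'b" and fn gn :: "nat \<Rightarrow> 'a \<Rightarrow> 'b" where
    "integrable lborel f'" "integrable lborel g'"
    "AE x in lborel. x \<in> K \<longrightarrow> f x = f' x \<and> g x = g' x"
    "\<forall>n. fn n \<in> borel_measurable borel" "\<forall>n. gn n \<in> borel_measurable borel"
    "\<forall>n. \<exists>C. \<forall>x. norm (fn n x) \<le> C" "\<forall>n. \<exists>C. \<forall>x. norm (gn n x) \<le> C"
    "\<forall>n. \<forall>x\<in>K. ((\<lambda>s. fn n (x + s *\<^sub>R b)) has_vector_derivative gn n x) (at 0)"
    "(\<lambda>n. \<integral>\<^sup>+x. ennreal (norm (fn n x - f' x)) \<partial>lborel) \<longlonglongrightarrow> 0"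
    "(\<lambda>n. \<integral>\<^sup>+x. ennreal (norm (gn n x - g' x)) \<partial>lborel) \<longlonglongrightarrow> 0"
    "AE x in lborel. (\<lambda>n. fn n x) \<longlonglongrightarrow> f' x"
proof -
  obtain e K' where K': "0 < e" "compact K'" "K' \<subseteq> D" "\<forall>x\<in>K. cball x e \<subseteq> K'"
    using compact_neighbourhood[OF K(1) D K(2)] .
  have l: "locally_integrable D f" "locally_integrable D g" using fg by (auto simp: has_weak_deriv_def)
  obtain f' where f': "integrable lborel f'" "AE x in lborel. indicator K' x *\<^sub>R f x = f' x"
    using locally_integrable_borel[OF l(1) K'(2,3)] .
  obtain g' where g': "integrable lborel g'" "AE x in lborel. indicator K' x *\<^sub>R g x = g' x"
    using locally_integrable_borel[OF l(2) K'(2,3)] .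
  obtain \<rho> :: "nat \<Rightarrow> 'a \<Rightarrow> real" where \<rho>a: "\<forall>n. is_mollifier e (\<rho> n)" and
    \<rho>b: "(\<lambda>n. \<integral>\<^sup>+x. ennreal (norm (mollify (\<rho> n) f' x - f' x)) \<partial>lborel) \<longlonglongrightarrow> 0"
    "(\<lambda>n. \<integral>\<^sup>+x. ennreal (norm (mollify (\<rho> n) g' x - g' x)) \<partial>lborel) \<longlonglongrightarrow> 0"
    using mollifier_sequence[OF f'(1) g'(1) K'(1)] .
  note \<rho> = spec[OF \<rho>a] \<rho>b
  have [measurable]: "f' \<in> borel_measurable borel" "g' \<in> borel_measurable borel" "\<And>n. \<rho> n \<in> borel_measurable borel"
    using f' g' mollifierD(6)[OF \<rho>(1)] by (auto dest: borel_measurable_integrable)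
  have m: "mollify (\<rho> n) f' \<in> borel_measurable borel" "mollify (\<rho> n) g' \<in> borel_measurable borel" for n
    by measurable
  obtain r where r: "strict_mono r" "AE x in lborel. (\<lambda>n. mollify (\<rho> (r n)) f' x) \<longlonglongrightarrow> f' x"
    using mollify_AE_subseq[OF f'(1) m(1) \<rho>(2)] .
  have bd: "\<exists>C. \<forall>x. norm (mollify (\<rho> n) h x) \<le> C" if "integrable lborel h" for n and h :: "'a \<Rightarrow> 'b"
  proof -
    obtain C where "\<And>x. norm (\<rho> n x) \<le> C"
      using compact_support_bounded[OF mollifierD(2)[OF \<rho>(1)] mollifierD(4)[OF \<rho>(1)]] by metis
    then have "norm (mollify (\<rho> n) h x) \<le> C * (\<integral>y. norm (h y) \<partial>lborel)" for x
      by (intro mollify_bounded[OF that]) auto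
    then show ?thesis by blast
  qed
  have KK': "x \<in> K'" if "x \<in> K" for x
  proof -
    have "x \<in> cball x e" using K'(1) by simp
    then show ?thesis using bspec[OF K'(4) that] by blast
  qed
  show ?thesis
  proof (rule that[OF f'(1) g'(1), of "\<lambda>n. mollify (\<rho> (r n)) f'" "\<lambda>n. mollify (\<rho> (r n)) g'"])
    show "AE x in lborel. x \<in> K \<longrightarrow> f x = f' x \<and> g x = g' x"
      using f'(2) g'(2)
    proof eventually_elim
      case (elim x)
      then show ?case using KK'[of x] by (cases "x \<in> K'") auto
    qed
    show "\<forall>n. \<forall>x\<in>K. ((\<lambda>s. mollify (\<rho> (r n)) f' (x + s *\<^sub>R b)) has_vector_derivative mollify (\<rho> (r n)) g' x) (at 0)"
    proof (intro allI ballI)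
      fix n x assume x: "x \<in> K"
      have "test_function D (\<lambda>y. \<rho> (r n) (x - y))"
        using test_function_mollifier[OF \<rho>(1)] K' x by (meson subset_trans)
      then have "mollify (dirderiv b (\<rho> (r n))) f' x = mollify (\<rho> (r n)) g' x"
        using mollify_eq_0(2)[OF D K'(3) bspec[OF K'(4) x] f' \<rho>(1) b] mollify_eq_0(1)[OF D K'(3) bspec[OF K'(4) x] g' \<rho>(1)] fg
        by (simp add: has_weak_deriv_def)
      then show "((\<lambda>s. mollify (\<rho> (r n)) f' (x + s *\<^sub>R b)) has_vector_derivative mollify (\<rho> (r n)) g' x) (at 0)"
        using mollify_derivative[OF f'(1) \<rho>(1) b, of "r n" x] by simp
    qed
    show "(\<lambda>n. \<integral>\<^sup>+x. ennreal (norm (mollify (\<rho> (r n)) f' x - f' x)) \<partial>lborel) \<longlonglongrightarrow> 0"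
      using LIMSEQ_subseq_LIMSEQ[OF \<rho>(2) r(1)] by (simp add: comp_def)
    show "(\<lambda>n. \<integral>\<^sup>+x. ennreal (norm (mollify (\<rho> (r n)) g' x - g' x)) \<partial>lborel) \<longlonglongrightarrow> 0"
      using LIMSEQ_subseq_LIMSEQ[OF \<rho>(3) r(1)] by (simp add: comp_def)
  qed (use m r bd f' g' in auto)
qed

text \<open>Continuity is assumed only in \<open>z\<close> for each fixed \<open>y\<close>;
  linearity in \<open>y\<close> expands the expression in a basis and reduces it to finitely many
  continuous functions of \<open>f x\<close>.\<close>

lemma derivative_measurable:
  fixes F' :: "'b::euclidean_space \<Rightarrow> 'b \<Rightarrow> 'c::euclidean_space"
  assumes lin: "\<And>z. linear (F' z)" and cont: "\<And>y. continuous_on UNIV (\<lambda>z. F' z y)"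
    and [measurable]: "f \<in> borel_measurable M" "g \<in> borel_measurable M"
  shows "(\<lambda>x. F' (f x) (g x)) \<in> borel_measurable M"
proof -
  have *: "F' z y = (\<Sum>i\<in>Basis. (y \<bullet> i) *\<^sub>R F' z i)" for z y
  proof -
    have "F' z y = F' z (\<Sum>i\<in>Basis. (y \<bullet> i) *\<^sub>R i)" by (simp add: euclidean_representation)
    then show ?thesis using lin[of z] by (simp add: linear_sum linear_scale)
  qed
  have [measurable]: "(\<lambda>z. F' z i) \<in> borel_measurable borel" for i
    using cont by (rule borel_measurable_continuous_onI)
  have "(\<lambda>x. F' (f x) (g x)) = (\<lambda>x. \<Sum>i\<in>Basis. (g x \<bullet> i) *\<^sub>R F' (f x) i)"
    by (rule ext) (rule *)
  also have "\<dots> \<in> borel_measurable M" by measurable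
  finally show ?thesis .
qed

lemma derivative_bound_lipschitz:
  fixes F :: "'b::euclidean_space \<Rightarrow> 'c::euclidean_space"
  assumes "\<And>z. (F has_derivative F' z) (at z)" "\<And>z y. norm (F' z y) \<le> L * norm y"
  shows "norm (F x - F y) \<le> L * norm (x - y)"
proof (rule differentiable_bound[of UNIV F F'])
  show "onorm (F' z) \<le> L" for z
    by (rule onorm_le) (rule assms)
qed (use assms in auto)

text \<open>The classical chain rule holds for the mollified \<open>fn\<close>, and integration by
  parts against \<open>\<phi>\<close> passes to the limit: \<open>F (fn)\<close> converges because
  \<open>F\<close> is Lipschitz, and \<open>F' (fn) gn\<close> because the bound \<open>L\<close>
  controls the change in \<open>gn\<close> and dominated convergence the change in
  \<open>fn\<close>.\<close>

theorem weak_chain_rule: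
  fixes f :: "'a::euclidean_space \<Rightarrow> 'b::euclidean_space" and F :: "'b \<Rightarrow> 'c::euclidean_space"
  assumes D: "open D" and b: "b \<in> Basis" and fg: "has_weak_deriv D b f g"
    and F: "\<And>z. (F has_derivative F' z) (at z)" "\<And>y. continuous_on UNIV (\<lambda>z. F' z y)"
    and L: "\<And>z y. norm (F' z y) \<le> L * norm y"
  shows "has_weak_deriv D b (\<lambda>x. F (f x)) (\<lambda>x. F' (f x) (g x))"
  unfolding has_weak_deriv_def
proof (intro conjI allI impI)
  have lip: "norm (F x - F y) \<le> L * norm (x - y)" for x y
    by (rule derivative_bound_lipschitz[OF F(1) L])
  have lin: "linear (F' z)" for z using F(1) has_derivative_linear by blast
  have L0: "0 \<le> L"
  proof -
    obtain y :: 'b where "norm y = 1" using vector_choose_size[of 1] by auto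
    then show ?thesis using order_trans[OF norm_ge_zero L[of 0 y]] by simp
  qed
  have contF: "continuous_on UNIV F"
    using F(1) by (intro has_derivative_continuous_on) (auto intro: has_derivative_at_withinI)
  then have [measurable]: "F \<in> borel_measurable borel" by (rule borel_measurable_continuous_onI)
  have l: "locally_integrable D f" "locally_integrable D g" using fg by (auto simp: has_weak_deriv_def)
  have sub: "integrable (lebesgue_on K) f" "integrable (lebesgue_on K) g" "K \<in> sets lebesgue" "finite_measure (lebesgue_on K)"
    if "compact K" "K \<subseteq> D" for K
  proof -
    show K: "K \<in> sets lebesgue" using that by (simp add: borel_compact)
    show "integrable (lebesgue_on K) f" "integrable (lebesgue_on K) g"
      using l that K by (auto simp: locally_integrable_def set_integrable_eq)
    show "finite_measure (lebesgue_on K)"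
      using that by (intro finite_measure_lebesgue_on lmeasurable_compact)
  qed
  show "locally_integrable D (\<lambda>x. F (f x))"
    unfolding locally_integrable_def
  proof (intro allI impI)
    fix K :: "'a set" assume K: "compact K \<and> K \<subseteq> D"
    then interpret finite_measure "lebesgue_on K" using sub by blast
    note [measurable] = borel_measurable_integrable[OF sub(1)[of K]] 
    have "integrable (lebesgue_on K) (\<lambda>x. F (f x))"
    proof (rule Bochner_Integration.integrable_bound)
      show "integrable (lebesgue_on K) (\<lambda>x. norm (F 0) + L * norm (f x))"
        using sub(1)[of K] K by auto
      show "(\<lambda>x. F (f x)) \<in> borel_measurable (lebesgue_on K)" using K by auto
      have "norm (F z) \<le> norm (F 0) + L * norm z" for z
        using lip[of z 0] norm_triangle_sub[of "F z" "F 0"] by simp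
      then show "AE x in lebesgue_on K. norm (F (f x)) \<le> norm (norm (F 0) + L * norm (f x))"
        using L0 by (intro AE_I2) (simp add: abs_of_nonneg)
    qed
    then show "set_integrable lebesgue K (\<lambda>x. F (f x))" using sub(3) K by (simp add: set_integrable_eq)
  qed
  show "locally_integrable D (\<lambda>x. F' (f x) (g x))"
    unfolding locally_integrable_def
  proof (intro allI impI)
    fix K :: "'a set" assume K: "compact K \<and> K \<subseteq> D"
    have "integrable (lebesgue_on K) (\<lambda>x. F' (f x) (g x))"
    proof (rule Bochner_Integration.integrable_bound)
      show "integrable (lebesgue_on K) (\<lambda>x. L * norm (g x))"
        using sub(2)[of K] K by auto
      show "(\<lambda>x. F' (f x) (g x)) \<in> borel_measurable (lebesgue_on K)"
        by (rule derivative_measurable[OF lin F(2)])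
           (use sub(1,2)[of K] K in \<open>auto dest: borel_measurable_integrable\<close>)
      show "AE x in lebesgue_on K. norm (F' (f x) (g x)) \<le> norm (L * norm (g x))"
        using L L0 by (intro AE_I2) (simp add: abs_of_nonneg)
    qed
    then show "set_integrable lebesgue K (\<lambda>x. F' (f x) (g x))" using sub(3) K by (simp add: set_integrable_eq)
  qed
  fix \<phi> :: "'a \<Rightarrow> real" assume t: "test_function D \<phi>"
  note tD = test_functionD[OF t]
  define K where "K = closure {x. \<phi> x \<noteq> 0}"
  have K: "compact K" "K \<subseteq> D" "closed K" using tD(1,2) by (simp_all add: K_def)
  have \<phi>0: "\<phi> x = 0" and d\<phi>0: "dirderiv b \<phi> x = 0" if "x \<notin> K" for x
    using that tD(3)[of x] dirderiv_outside_support[of x \<phi> b] by (simp_all add: K_def)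
  obtain C where C: "\<And>x. \<bar>\<phi> x\<bar> \<le> C" using tD(6) by blast
  obtain C' where C': "\<And>x. \<bar>dirderiv b \<phi> x\<bar> \<le> C'" using tD(7)[OF b] by blast
  have C0: "0 \<le> C" "0 \<le> C'" using order_trans[OF abs_ge_zero C] order_trans[OF abs_ge_zero C'] by simp_all
  obtain f' g' :: "'a \<Rightarrow> 'b" and fn gn :: "nat \<Rightarrow> 'a \<Rightarrow> 'b" where
    f': "integrable lborel f'" and g': "integrable lborel g'"
    and eq: "AE x in lborel. x \<in> K \<longrightarrow> f x = f' x \<and> g x = g' x"
    and m: "\<forall>n. fn n \<in> borel_measurable borel" "\<forall>n. gn n \<in> borel_measurable borel"
    and bd: "\<forall>n. \<exists>C. \<forall>x. norm (fn n x) \<le> C" "\<forall>n. \<exists>C. \<forall>x. norm (gn n x) \<le> C"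
    and der: "\<forall>n. \<forall>x\<in>K. ((\<lambda>s. fn n (x + s *\<^sub>R b)) has_vector_derivative gn n x) (at 0)"
    and lim: "(\<lambda>n. \<integral>\<^sup>+x. ennreal (norm (fn n x - f' x)) \<partial>lborel) \<longlonglongrightarrow> 0"
    "(\<lambda>n. \<integral>\<^sup>+x. ennreal (norm (gn n x - g' x)) \<partial>lborel) \<longlonglongrightarrow> 0"
    "AE x in lborel. (\<lambda>n. fn n x) \<longlonglongrightarrow> f' x"
    using weak_deriv_approx[OF D b fg K(1,2)] .
  note [measurable] = m[rule_format] tD(4) tD(5)[OF b]
  have [measurable]: "f' \<in> borel_measurable borel" "g' \<in> borel_measurable borel"
    using f' g' by (auto dest: borel_measurable_integrable)
  have F'm [measurable]: "(\<lambda>x. F' (p x) (q x)) \<in> borel_measurable borel"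
    if "p \<in> borel_measurable borel" "q \<in> borel_measurable borel" for p q :: "'a \<Rightarrow> 'b"
    by (rule derivative_measurable[OF lin F(2) that])
  have int_supp: "integrable lborel (\<lambda>x. k x *\<^sub>R p x)"
    if "k \<in> borel_measurable borel" "p \<in> borel_measurable borel" "\<And>x. x \<notin> K \<Longrightarrow> k x = 0"
      "\<And>x. \<bar>k x\<bar> \<le> c" "\<And>x. norm (p x) \<le> c'" for k and p :: "'a \<Rightarrow> 'c" and c c' :: real
  proof (rule Bochner_Integration.integrable_bound)
    show "integrable lborel (\<lambda>x. (c * c') * indicator K x)"
      using emeasure_bounded_finite[OF compact_imp_bounded[OF K(1)]] K(3)
      by (intro integrable_mult_right integrable_real_indicator) auto
    show "AE x in lborel. norm (k x *\<^sub>R p x) \<le> norm (c * c' * indicator K x)"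
    proof (rule AE_I2)
      fix x
      have "\<bar>k x\<bar> * norm (p x) \<le> c * c'" using that(4)[of x] that(5)[of x]
        by (intro mult_mono) (auto intro: order_trans[OF abs_ge_zero])
      then show "norm (k x *\<^sub>R p x) \<le> norm (c * c' * indicator K x)"
        using that(3)[of x] by (cases "x \<in> K") auto
    qed
  qed (use that in auto)
  have ibp: "(\<integral>x. dirderiv b \<phi> x *\<^sub>R F (fn n x) \<partial>lborel) = - (\<integral>x. \<phi> x *\<^sub>R F' (fn n x) (gn n x) \<partial>lborel)"
    and int1: "integrable lborel (\<lambda>x. dirderiv b \<phi> x *\<^sub>R F (fn n x))"
    and int2: "integrable lborel (\<lambda>x. \<phi> x *\<^sub>R F' (fn n x) (gn n x))" for n
  proof -
    obtain A where A: "\<And>x. norm (fn n x) \<le> A" using bd(1) by blast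
    obtain A' where A': "\<And>x. norm (gn n x) \<le> A'" using bd(2) by blast
    have FA: "norm (F (fn n x)) \<le> norm (F 0) + L * A" for x
    proof -
      have "norm (F (fn n x)) \<le> norm (F 0) + L * norm (fn n x)"
        using lip[of "fn n x" 0] norm_triangle_sub[of "F (fn n x)" "F 0"] by simp
      then show ?thesis using mult_left_mono[OF A[of x] L0] by simp
    qed
    have FA': "norm (F' (fn n x) (gn n x)) \<le> L * A'" for x
      using L[of "fn n x" "gn n x"] mult_left_mono[OF A'[of x] L0] by simp
    show int1: "integrable lborel (\<lambda>x. dirderiv b \<phi> x *\<^sub>R F (fn n x))"
      by (rule int_supp[OF _ _ d\<phi>0 C' FA]) auto
    show int2: "integrable lborel (\<lambda>x. \<phi> x *\<^sub>R F' (fn n x) (gn n x))"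
      by (rule int_supp[OF _ _ \<phi>0 C FA']) auto
    have int0: "integrable lborel (\<lambda>x. \<phi> x *\<^sub>R F (fn n x))"
      by (rule int_supp[OF _ _ \<phi>0 C FA]) auto
    obtain r where r: "\<And>x. x \<in> K \<Longrightarrow> norm x < r"
      using compact_imp_bounded[OF K(1)] unfolding bounded_pos_less by blast
    \<comment> \<open>The derivative along \<open>b\<close> of the compactly supported product of
      \<open>\<phi>\<close> and \<open>F (fn)\<close>; that its integral vanishes is integration by
      parts.\<close>
    let ?h' = "\<lambda>x. dirderiv b \<phi> x *\<^sub>R F (fn n x) + \<phi> x *\<^sub>R F' (fn n x) (gn n x)"
    have "(\<integral>x. ?h' x \<partial>lborel) = 0"
    proof (rule integral_line_derivative_zero(2)[OF _ _ int0])
      show "\<phi> x *\<^sub>R F (fn n x) = 0" if "r \<le> norm x" for x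
        using \<phi>0[of x] r[of x] that by force
      show "norm (?h' x) \<le> C' * (norm (F 0) + L * A) + C * (L * A')" for x
      proof (rule norm_triangle_mono)
        show "norm (dirderiv b \<phi> x *\<^sub>R F (fn n x)) \<le> C' * (norm (F 0) + L * A)"
          using C'[of x] FA[of x] C0 by (auto intro!: mult_mono)
        show "norm (\<phi> x *\<^sub>R F' (fn n x) (gn n x)) \<le> C * (L * A')"
          using C[of x] FA'[of x] C0 by (auto intro!: mult_mono)
      qed
      show "((\<lambda>s. \<phi> (x + s *\<^sub>R b) *\<^sub>R F (fn n (x + s *\<^sub>R b))) has_vector_derivative ?h' x) (at 0)" for x
      proof (cases "x \<in> K")
        case True
        have "((\<lambda>s. F (fn n (x + s *\<^sub>R b))) has_vector_derivative F' (fn n x) (gn n x)) (at 0)"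
          using vector_derivative_diff_chain_within[OF der[rule_format, OF True, of n], of F "F' (fn n x)"]
            has_derivative_at_withinI[OF F(1)[of "fn n x"]] by (simp add: comp_def)
        moreover have "((\<lambda>s. \<phi> (x + s *\<^sub>R b)) has_vector_derivative dirderiv b \<phi> x) (at 0)"
          using line_derivative[of \<phi> x 0 b] tD(8) by simp
        then have "((\<lambda>s. \<phi> (x + s *\<^sub>R b)) has_real_derivative dirderiv b \<phi> x) (at 0)"
          by (simp add: has_real_derivative_iff_has_vector_derivative)
        ultimately have "((\<lambda>s. \<phi> (x + s *\<^sub>R b) *\<^sub>R F (fn n (x + s *\<^sub>R b))) has_vector_derivative
            \<phi> (x + 0 *\<^sub>R b) *\<^sub>R F' (fn n x) (gn n x) + dirderiv b \<phi> x *\<^sub>R F (fn n (x + 0 *\<^sub>R b))) (at 0)"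
          by (intro has_vector_derivative_scaleR)
        then show ?thesis by (simp add: add.commute)
      next
        \<comment> \<open>The derivative of \<open>fn\<close> is identified on \<open>K\<close>
          only; off the closed set \<open>K\<close> the product is locally zero.\<close>
        case False
        have o: "open ((\<lambda>s. x + s *\<^sub>R b) -` (- K))"
          by (intro open_vimage continuous_intros) (use K in auto)
        have "((\<lambda>s. \<phi> (x + s *\<^sub>R b) *\<^sub>R F (fn n (x + s *\<^sub>R b))) has_vector_derivative 0) (at 0)"
          by (rule has_vector_derivative_transform_within_open[OF has_vector_derivative_const o])
             (use False \<phi>0 in auto)
        then show ?thesis using False \<phi>0 d\<phi>0 by simp
      qed
    qed
    then show "(\<integral>x. dirderiv b \<phi> x *\<^sub>R F (fn n x) \<partial>lborel) = - (\<integral>x. \<phi> x *\<^sub>R F' (fn n x) (gn n x) \<partial>lborel)"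
      using int1 int2 by (simp add: eq_neg_iff_add_eq_0)
  qed
  have i1: "integrable lborel (\<lambda>x. dirderiv b \<phi> x *\<^sub>R F (f' x))"
  proof (rule Bochner_Integration.integrable_bound)
    show "integrable lborel (\<lambda>x. C' * norm (F 0) * indicator K x + C' * L * norm (f' x))"
      using emeasure_bounded_finite[OF compact_imp_bounded[OF K(1)]] K(3) f'
      by (intro Bochner_Integration.integrable_add integrable_mult_right integrable_real_indicator) auto
    show "AE x in lborel. norm (dirderiv b \<phi> x *\<^sub>R F (f' x)) \<le> norm (C' * norm (F 0) * indicator K x + C' * L * norm (f' x))"
    proof (rule AE_I2)
      fix x
      have "norm (F (f' x)) \<le> norm (F 0) + L * norm (f' x)"
        using lip[of "f' x" 0] norm_triangle_sub[of "F (f' x)" "F 0"] by simp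
      then have "\<bar>dirderiv b \<phi> x\<bar> * norm (F (f' x)) \<le> C' * (norm (F 0) + L * norm (f' x))"
        using C'[of x] C0 by (intro mult_mono) auto
      then show "norm (dirderiv b \<phi> x *\<^sub>R F (f' x)) \<le> norm (C' * norm (F 0) * indicator K x + C' * L * norm (f' x))"
        using d\<phi>0[of x] C0 L0 by (cases "x \<in> K") (auto simp: algebra_simps abs_of_nonneg)
    qed
  qed auto
  have i2: "integrable lborel (\<lambda>x. \<phi> x *\<^sub>R F' (f' x) (g' x))"
  proof (rule Bochner_Integration.integrable_bound)
    show "integrable lborel (\<lambda>x. C * L * norm (g' x))" using g' by simp
    show "AE x in lborel. norm (\<phi> x *\<^sub>R F' (f' x) (g' x)) \<le> norm (C * L * norm (g' x))"
    proof (rule AE_I2)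
      fix x
      have "\<bar>\<phi> x\<bar> * norm (F' (f' x) (g' x)) \<le> C * (L * norm (g' x))"
        using C0 by (intro mult_mono C L) auto
      then show "norm (\<phi> x *\<^sub>R F' (f' x) (g' x)) \<le> norm (C * L * norm (g' x))"
        using C0 L0 by (simp add: abs_of_nonneg mult.assoc)
    qed
  qed auto
  have lim1: "(\<lambda>n. \<integral>x. dirderiv b \<phi> x *\<^sub>R F (fn n x) \<partial>lborel) \<longlonglongrightarrow> (\<integral>x. dirderiv b \<phi> x *\<^sub>R F (f' x) \<partial>lborel)"
  proof (rule tendsto_L1_int[OF int1 i1])
    have lim0: "(\<lambda>n. ennreal (C' * L) * (\<integral>\<^sup>+x. ennreal (norm (fn n x - f' x)) \<partial>lborel)) \<longlonglongrightarrow> ennreal (C' * L) * 0"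
      by (intro ennreal_tendsto_cmult lim(1)) simp
    have le: "(\<integral>\<^sup>+x. ennreal (norm (dirderiv b \<phi> x *\<^sub>R F (fn n x) - dirderiv b \<phi> x *\<^sub>R F (f' x))) \<partial>lborel)
        \<le> ennreal (C' * L) * (\<integral>\<^sup>+x. ennreal (norm (fn n x - f' x)) \<partial>lborel)" for n
    proof -
      have "norm (dirderiv b \<phi> x *\<^sub>R F (fn n x) - dirderiv b \<phi> x *\<^sub>R F (f' x)) \<le> C' * L * norm (fn n x - f' x)" for x
      proof -
        have "\<bar>dirderiv b \<phi> x\<bar> * norm (F (fn n x) - F (f' x)) \<le> C' * (L * norm (fn n x - f' x))"
          using C0 by (intro mult_mono C' lip) auto
        then show ?thesis by (simp only: norm_scaleR mult.assoc flip: scaleR_right_diff_distrib)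
      qed
      then have "(\<integral>\<^sup>+x. ennreal (norm (dirderiv b \<phi> x *\<^sub>R F (fn n x) - dirderiv b \<phi> x *\<^sub>R F (f' x))) \<partial>lborel)
        \<le> (\<integral>\<^sup>+x. ennreal (C' * L) * ennreal (norm (fn n x - f' x)) \<partial>lborel)"
        using C0 L0 by (intro nn_integral_mono) (simp add: ennreal_leI flip: ennreal_mult)
      then show ?thesis by (subst (asm) nn_integral_cmult) auto
    qed
    show "(\<lambda>n. \<integral>\<^sup>+x. ennreal (norm (dirderiv b \<phi> x *\<^sub>R F (fn n x) - dirderiv b \<phi> x *\<^sub>R F (f' x))) \<partial>lborel) \<longlonglongrightarrow> 0"
      by (rule ennreal_squeeze_0[OF le]) (use lim0 in simp)
  qed
  have lim2: "(\<lambda>n. \<integral>x. \<phi> x *\<^sub>R F' (fn n x) (gn n x) \<partial>lborel) \<longlonglongrightarrow> (\<integral>x. \<phi> x *\<^sub>R F' (f' x) (g' x) \<partial>lborel)"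
  proof (rule tendsto_L1_int[OF int2 i2])
    \<comment> \<open>Here the derivative direction is frozen at \<open>g'\<close>, so that
      \<open>L * norm (g' x)\<close> is an integrable majorant and convergence almost everywhere of
      \<open>fn\<close> suffices.\<close>
    have "(\<lambda>n. \<integral>\<^sup>+x. ennreal (norm (F' (f' x) (g' x) - F' (fn n x) (g' x))) \<partial>lborel) \<longlonglongrightarrow> 0"
    proof (rule nn_integral_dominated_convergence_norm[where w = "\<lambda>x. L * norm (g' x)"])
      show "(\<integral>\<^sup>+x. ennreal (L * norm (g' x)) \<partial>lborel) < \<infinity>"
        using g' L0 by (simp add: integrable_iff_bounded ennreal_mult nn_integral_cmult ennreal_mult_less_top)
      show "AE x in lborel. (\<lambda>n. F' (fn n x) (g' x)) \<longlonglongrightarrow> F' (f' x) (g' x)"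
        using lim(3)
      proof eventually_elim
        case (elim x)
        show ?case
          by (rule continuous_on_tendsto_compose[OF F(2)[of "g' x"] elim]) auto
      qed
    qed (use L in auto)
    then have lim0: "(\<lambda>n. ennreal C * (\<integral>\<^sup>+x. ennreal (norm (F' (f' x) (g' x) - F' (fn n x) (g' x))) \<partial>lborel)
        + ennreal (C * L) * (\<integral>\<^sup>+x. ennreal (norm (gn n x - g' x)) \<partial>lborel)) \<longlonglongrightarrow> ennreal C * 0 + ennreal (C * L) * 0"
      by (intro tendsto_add ennreal_tendsto_cmult lim(2)) simp_all
    have le: "(\<integral>\<^sup>+x. ennreal (norm (\<phi> x *\<^sub>R F' (fn n x) (gn n x) - \<phi> x *\<^sub>R F' (f' x) (g' x))) \<partial>lborel)
       \<le> ennreal C * (\<integral>\<^sup>+x. ennreal (norm (F' (f' x) (g' x) - F' (fn n x) (g' x))) \<partial>lborel)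
        + ennreal (C * L) * (\<integral>\<^sup>+x. ennreal (norm (gn n x - g' x)) \<partial>lborel)" for n
    proof -
      have "norm (\<phi> x *\<^sub>R F' (fn n x) (gn n x) - \<phi> x *\<^sub>R F' (f' x) (g' x))
        \<le> C * norm (F' (f' x) (g' x) - F' (fn n x) (g' x)) + C * L * norm (gn n x - g' x)" for x
      proof -
        \<comment> \<open>The two arguments are changed one at a time: first the direction, at the
          moving base point, then the base point, in the fixed direction.\<close>
        have "F' (fn n x) (gn n x) - F' (f' x) (g' x) =
          F' (fn n x) (gn n x - g' x) - (F' (f' x) (g' x) - F' (fn n x) (g' x))"
          using linear_diff[OF lin] by simp
        then have "norm (F' (fn n x) (gn n x) - F' (f' x) (g' x)) \<le>
          norm (F' (fn n x) (gn n x - g' x)) + norm (F' (f' x) (g' x) - F' (fn n x) (g' x))"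
          by (metis norm_triangle_ineq4)
        also have "\<dots> \<le> L * norm (gn n x - g' x) + norm (F' (f' x) (g' x) - F' (fn n x) (g' x))"
          using L by simp
        finally have "\<bar>\<phi> x\<bar> * norm (F' (fn n x) (gn n x) - F' (f' x) (g' x)) \<le>
          C * (L * norm (gn n x - g' x) + norm (F' (f' x) (g' x) - F' (fn n x) (g' x)))"
          using C[of x] C0 by (intro mult_mono) auto
        then have "norm (\<phi> x *\<^sub>R (F' (fn n x) (gn n x) - F' (f' x) (g' x))) \<le>
          C * norm (F' (f' x) (g' x) - F' (fn n x) (g' x)) + C * L * norm (gn n x - g' x)"
          by (simp only: norm_scaleR distrib_left mult.assoc add.commute)
        then show ?thesis by (simp only: scaleR_right_diff_distrib)
      qed
      then have "(\<integral>\<^sup>+x. ennreal (norm (\<phi> x *\<^sub>R F' (fn n x) (gn n x) - \<phi> x *\<^sub>R F' (f' x) (g' x))) \<partial>lborel)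
        \<le> (\<integral>\<^sup>+x. ennreal C * ennreal (norm (F' (f' x) (g' x) - F' (fn n x) (g' x))) +
           ennreal (C * L) * ennreal (norm (gn n x - g' x)) \<partial>lborel)"
        using C0 L0 by (intro nn_integral_mono) (simp add: ennreal_leI flip: ennreal_mult ennreal_plus)
      also have "\<dots> = ennreal C * (\<integral>\<^sup>+x. ennreal (norm (F' (f' x) (g' x) - F' (fn n x) (g' x))) \<partial>lborel)
        + ennreal (C * L) * (\<integral>\<^sup>+x. ennreal (norm (gn n x - g' x)) \<partial>lborel)"
        by (subst nn_integral_add) (auto simp: nn_integral_cmult)
      finally show ?thesis .
    qed
    show "(\<lambda>n. \<integral>\<^sup>+x. ennreal (norm (\<phi> x *\<^sub>R F' (fn n x) (gn n x) - \<phi> x *\<^sub>R F' (f' x) (g' x))) \<partial>lborel) \<longlonglongrightarrow> 0"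
      by (rule ennreal_squeeze_0[OF le]) (use lim0 in simp)
  qed
  have main: "(\<integral>x. dirderiv b \<phi> x *\<^sub>R F (f' x) \<partial>lborel) = - (\<integral>x. \<phi> x *\<^sub>R F' (f' x) (g' x) \<partial>lborel)"
    using LIMSEQ_unique[OF lim1] tendsto_minus[OF lim2] by (simp add: ibp)
  \<comment> \<open>Return from the Borel representatives on the whole space to the given functions
    on \<open>D\<close>.\<close>
  have conv: "(LINT x|lebesgue_on D. k x *\<^sub>R p x) = (\<integral>x. k x *\<^sub>R p' x \<partial>lborel)"
    if i: "integrable lborel (\<lambda>x. k x *\<^sub>R p' x)" and z: "\<And>x. x \<notin> K \<Longrightarrow> k x = 0"
      and e: "AE x in lborel. x \<in> K \<longrightarrow> p x = p' x" for k :: "'a \<Rightarrow> real" and p p' :: "'a \<Rightarrow> 'c"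
  proof -
    have "AE x in lborel. indicator K x *\<^sub>R (k x *\<^sub>R p x) = k x *\<^sub>R p' x"
      using e by eventually_elim (use z in \<open>auto simp: indicator_def\<close>)
    from integral_local_eq(2)[OF D K(2) i this, of "indicator K" 1] K(3)
    have "(LINT x|lebesgue_on D. indicator K x *\<^sub>R (k x *\<^sub>R p x)) = (\<integral>x. indicator K x *\<^sub>R (k x *\<^sub>R p' x) \<partial>lborel)"
      by (auto simp: indicator_def)
    moreover have "(\<lambda>x. indicator K x *\<^sub>R (k x *\<^sub>R q x)) = (\<lambda>x. k x *\<^sub>R q x)" for q :: "'a \<Rightarrow> 'c"
    proof
      fix x
      show "indicator K x *\<^sub>R (k x *\<^sub>R q x) = k x *\<^sub>R q x"
        using z[of x] by (cases "x \<in> K") simp_all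
    qed
    ultimately show ?thesis by (simp only:)
  qed
  have "(LINT x|lebesgue_on D. dirderiv b \<phi> x *\<^sub>R F (f x)) = (\<integral>x. dirderiv b \<phi> x *\<^sub>R F (f' x) \<partial>lborel)"
    by (rule conv[OF i1 d\<phi>0]) (use eq in \<open>auto elim: eventually_mono\<close>)
  moreover have "(LINT x|lebesgue_on D. \<phi> x *\<^sub>R F' (f x) (g x)) = (\<integral>x. \<phi> x *\<^sub>R F' (f' x) (g' x) \<partial>lborel)"
    by (rule conv[OF i2 \<phi>0]) (use eq in \<open>auto elim: eventually_mono\<close>)
  ultimately show "(LINT x|lebesgue_on D. dirderiv b \<phi> x *\<^sub>R F (f x)) = - (LINT x|lebesgue_on D. \<phi> x *\<^sub>R F' (f x) (g x))"
    using main by simp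
qed

subsection \<open>Square integrable functions\<close>

definition sqint :: "'x measure \<Rightarrow> ('x \<Rightarrow> 'b::euclidean_space) \<Rightarrow> bool" where
  "sqint M f \<longleftrightarrow> f \<in> borel_measurable M \<and> integrable M (\<lambda>x. (norm (f x))\<^sup>2)"

text \<open>Real valued, for arithmetic. A divergent integral has the default value 0, so this is a
  size only in combination with \<open>sqint\<close>.\<close>

definition l2n :: "'x measure \<Rightarrow> ('x \<Rightarrow> 'b::euclidean_space) \<Rightarrow> real" where
  "l2n M f = sqrt (\<integral>x. (norm (f x))\<^sup>2 \<partial>M)"

lemma l2n_nonneg [simp]: "0 \<le> l2n M f"
  by (simp add: l2n_def)

lemma l2n_sq: "(l2n M f)\<^sup>2 = (\<integral>x. (norm (f x))\<^sup>2 \<partial>M)"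
  by (simp add: l2n_def)

lemma sqint_measurable: "sqint M f \<Longrightarrow> f \<in> borel_measurable M"
  by (simp add: sqint_def)

lemma sqint_norm_mult:
  assumes "sqint M f" "sqint M g"
  shows "integrable M (\<lambda>x. norm (f x) * norm (g x))"
proof (rule Bochner_Integration.integrable_bound)
  show "integrable M (\<lambda>x. (norm (f x))\<^sup>2 + (norm (g x))\<^sup>2)"
    using assms by (auto simp: sqint_def)
  show "AE x in M. norm (norm (f x) * norm (g x)) \<le> norm ((norm (f x))\<^sup>2 + (norm (g x))\<^sup>2)"
  proof (rule AE_I2)
    fix x
    have 0: "0 \<le> norm (f x) * norm (g x)" by simp
    have "2 * (norm (f x) * norm (g x)) \<le> (norm (f x))\<^sup>2 + (norm (g x))\<^sup>2"
      using sum_squares_bound[of "norm (f x)" "norm (g x)"] by (simp add: mult.assoc)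
    with 0 have "norm (f x) * norm (g x) \<le> (norm (f x))\<^sup>2 + (norm (g x))\<^sup>2" by linarith
    then show "norm (norm (f x) * norm (g x)) \<le> norm ((norm (f x))\<^sup>2 + (norm (g x))\<^sup>2)"
      by (simp add: abs_mult)
  qed
qed (use assms in \<open>auto simp: sqint_def\<close>)

text \<open>The classical discriminant argument: the integral of \<open>(s |f| - |g|)^2\<close> is a
  nonnegative quadratic polynomial in \<open>s\<close>.\<close>

lemma sqint_norm_mult_le:
  assumes f: "sqint M f" and g: "sqint M g"
  shows "(\<integral>x. norm (f x) * norm (g x) \<partial>M) \<le> l2n M f * l2n M g"
proof -
  define I where "I = (\<integral>x. norm (f x) * norm (g x) \<partial>M)"
  have 0: "0 \<le> I" unfolding I_def by simp
  have q: "0 \<le> (l2n M f)\<^sup>2 * s\<^sup>2 - 2 * I * s + (l2n M g)\<^sup>2" for s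
  proof -
    have "0 \<le> (\<integral>x. (s * norm (f x) - norm (g x))\<^sup>2 \<partial>M)" by simp
    also have "\<dots> = (\<integral>x. s\<^sup>2 * (norm (f x))\<^sup>2 - (2 * s) * (norm (f x) * norm (g x)) + (norm (g x))\<^sup>2 \<partial>M)"
      by (rule Bochner_Integration.integral_cong) (auto simp: power2_eq_square algebra_simps)
    also have "\<dots> = s\<^sup>2 * (l2n M f)\<^sup>2 - (2 * s) * I + (l2n M g)\<^sup>2"
      using f g sqint_norm_mult[OF f g] by (simp add: sqint_def l2n_sq I_def)
    finally show ?thesis by (simp add: algebra_simps)
  qed
  have "I\<^sup>2 \<le> (l2n M f * l2n M g)\<^sup>2"
  proof (cases "l2n M f = 0")
    case True
    have "I \<le> 0"
    proof (rule ccontr)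
      assume "\<not> I \<le> 0"
      \<comment> \<open>The polynomial is now affine with slope \<open>- 2 * I\<close>; at this
        \<open>s\<close> its value is -1.\<close>
      then show False using q[of "((l2n M g)\<^sup>2 + 1) / (2 * I)"] True by (simp add: field_simps)
    qed
    with 0 True show ?thesis by simp
  next
    case False
    define F where "F = (l2n M f)\<^sup>2"
    have F: "0 < F" using False by (simp add: F_def)
    \<comment> \<open>\<open>I / F\<close> is the minimiser of the polynomial.\<close>
    have "0 \<le> F * (F * (I / F)\<^sup>2 - 2 * I * (I / F) + (l2n M g)\<^sup>2)"
      using q[of "I / F"] F by (intro mult_nonneg_nonneg) (auto simp: F_def)
    also have "\<dots> = F * (l2n M g)\<^sup>2 - I\<^sup>2"
      using F by (simp add: power2_eq_square field_simps)
    finally show ?thesis by (simp add: F_def power_mult_distrib)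
  qed
  then show ?thesis unfolding I_def by (rule power2_le_imp_le) simp
qed

lemma sqint_inner:
  assumes f: "sqint M f" and g: "sqint M g"
  shows "integrable M (\<lambda>x. f x \<bullet> g x)" "\<bar>\<integral>x. f x \<bullet> g x \<partial>M\<bar> \<le> l2n M f * l2n M g"
proof -
  show i: "integrable M (\<lambda>x. f x \<bullet> g x)"
    by (rule Bochner_Integration.integrable_bound[OF sqint_norm_mult[OF f g]])
       (use f g in \<open>auto simp: sqint_def abs_mult Cauchy_Schwarz_ineq2\<close>)
  have "\<bar>\<integral>x. f x \<bullet> g x \<partial>M\<bar> \<le> (\<integral>x. norm (f x) * norm (g x) \<partial>M)"
  proof -
    have "\<bar>\<integral>x. f x \<bullet> g x \<partial>M\<bar> \<le> (\<integral>x. \<bar>f x \<bullet> g x\<bar> \<partial>M)" by (rule integral_abs_bound)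
    also have "\<dots> \<le> (\<integral>x. norm (f x) * norm (g x) \<partial>M)"
      by (rule integral_mono) (use i sqint_norm_mult[OF f g] Cauchy_Schwarz_ineq2 in auto)
    finally show ?thesis .
  qed
  also have "\<dots> \<le> l2n M f * l2n M g" by (rule sqint_norm_mult_le[OF f g])
  finally show "\<bar>\<integral>x. f x \<bullet> g x \<partial>M\<bar> \<le> l2n M f * l2n M g" .
qed

lemma sqint_bound:
  assumes "sqint M f" "g \<in> borel_measurable M" "AE x in M. norm (g x) \<le> C * norm (f x)" "0 \<le> C"
  shows "sqint M g" "l2n M g \<le> C * l2n M f"
proof -
  have *: "AE x in M. (norm (g x))\<^sup>2 \<le> C\<^sup>2 * (norm (f x))\<^sup>2"
    using assms(3)
  proof eventually_elim
    case (elim x)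
    then have "(norm (g x))\<^sup>2 \<le> (C * norm (f x))\<^sup>2" by (intro power_mono) auto
    then show ?case by (simp add: power_mult_distrib)
  qed
  have i: "integrable M (\<lambda>x. C\<^sup>2 * (norm (f x))\<^sup>2)" using assms(1) by (simp add: sqint_def)
  show g: "sqint M g"
    unfolding sqint_def
    by (intro conjI assms(2) Bochner_Integration.integrable_bound[OF i]) (use assms(2) * in auto)
  have "(\<integral>x. (norm (g x))\<^sup>2 \<partial>M) \<le> (\<integral>x. C\<^sup>2 * (norm (f x))\<^sup>2 \<partial>M)"
    using g i * by (intro integral_mono_AE) (auto simp: sqint_def)
  then have "(l2n M g)\<^sup>2 \<le> (C * l2n M f)\<^sup>2"
    by (simp add: l2n_sq power_mult_distrib)
  then show "l2n M g \<le> C * l2n M f" by (rule power2_le_imp_le) (use assms(4) in simp)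
qed

lemma sqint_cong_AE:
  assumes "sqint M f" "g \<in> borel_measurable M" "AE x in M. f x = g x"
  shows "sqint M g" "l2n M g = l2n M f"
proof -
  have *: "AE x in M. (norm (f x))\<^sup>2 = (norm (g x))\<^sup>2" using assms(3) by auto
  have "integrable M (\<lambda>x. (norm (g x))\<^sup>2)"
    by (rule integrable_cong_AE_imp[of _ "\<lambda>x. (norm (f x))\<^sup>2"]) (use assms in \<open>auto simp: sqint_def\<close>)
  then show "sqint M g" using assms(2) by (simp add: sqint_def)
  have "(\<integral>x. (norm (g x))\<^sup>2 \<partial>M) = (\<integral>x. (norm (f x))\<^sup>2 \<partial>M)"
    by (rule integral_cong_AE) (use assms in \<open>auto simp: sqint_def\<close>)
  then show "l2n M g = l2n M f" by (simp add: l2n_def)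
qed

lemma sqint_add:
  assumes f: "sqint M f" and g: "sqint M g"
  shows "sqint M (\<lambda>x. f x + g x)" "l2n M (\<lambda>x. f x + g x) \<le> l2n M f + l2n M g"
proof -
  have le: "(norm (f x + g x))\<^sup>2 \<le> (norm (f x))\<^sup>2 + (norm (g x))\<^sup>2 + 2 * (norm (f x) * norm (g x))" for x
    using power_mono[OF norm_triangle_ineq[of "f x" "g x"], of 2] by (simp add: power2_sum mult.assoc)
  have i: "integrable M (\<lambda>x. (norm (f x))\<^sup>2 + (norm (g x))\<^sup>2 + 2 * (norm (f x) * norm (g x)))"
    using f g sqint_norm_mult[OF f g] by (simp add: sqint_def)
  have "integrable M (\<lambda>x. (norm (f x + g x))\<^sup>2)"
    by (rule Bochner_Integration.integrable_bound[OF i]) (use f g le in \<open>auto simp: sqint_def intro: order_trans[OF _ abs_ge_self]\<close>)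
  then show s: "sqint M (\<lambda>x. f x + g x)" using f g by (auto simp: sqint_def)
  have "(l2n M (\<lambda>x. f x + g x))\<^sup>2 \<le> (\<integral>x. (norm (f x))\<^sup>2 + (norm (g x))\<^sup>2 + 2 * (norm (f x) * norm (g x)) \<partial>M)"
    unfolding l2n_sq using s i le by (intro integral_mono) (auto simp: sqint_def)
  also have "\<dots> = (l2n M f)\<^sup>2 + (l2n M g)\<^sup>2 + 2 * (\<integral>x. norm (f x) * norm (g x) \<partial>M)"
    using f g sqint_norm_mult[OF f g] by (simp add: sqint_def l2n_sq)
  also have "\<dots> \<le> (l2n M f + l2n M g)\<^sup>2"
    using sqint_norm_mult_le[OF f g] by (simp add: power2_sum)
  finally show "l2n M (\<lambda>x. f x + g x) \<le> l2n M f + l2n M g"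
    by (rule power2_le_imp_le) simp
qed

lemma sqint_scaleR:
  assumes "sqint M f"
  shows "sqint M (\<lambda>x. c *\<^sub>R f x)" "l2n M (\<lambda>x. c *\<^sub>R f x) = \<bar>c\<bar> * l2n M f"
  using assms by (auto simp: sqint_def l2n_def power_mult_distrib real_sqrt_mult)

lemma l2n_minus_commute: "l2n M (\<lambda>x. f x - g x) = l2n M (\<lambda>x. g x - f x)"
  by (simp add: l2n_def norm_minus_commute)

lemma sqint_diff:
  assumes f: "sqint M f" and g: "sqint M g"
  shows "sqint M (\<lambda>x. f x - g x)" "l2n M (\<lambda>x. f x - g x) \<le> l2n M f + l2n M g"
  using sqint_add[OF f sqint_scaleR(1)[OF g, of "-1"]] sqint_scaleR(2)[OF g, of "-1"] by auto

lemma l2n_triangle: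
  assumes "sqint M f" "sqint M g" "sqint M h"
  shows "l2n M (\<lambda>x. f x - h x) \<le> l2n M (\<lambda>x. f x - g x) + l2n M (\<lambda>x. g x - h x)"
  using sqint_add(2)[OF sqint_diff(1)[OF assms(1,2)] sqint_diff(1)[OF assms(2,3)]] by simp

lemma (in finite_measure) sqint_integrable:
  assumes "sqint M f"
  shows "integrable M f"
proof (rule Bochner_Integration.integrable_bound)
  show "integrable M (\<lambda>x. 1 + (norm (f x))\<^sup>2)" using assms by (simp add: sqint_def)
  have "norm (f x) \<le> 1 + (norm (f x))\<^sup>2" for x
  proof -
    have "2 * norm (f x) \<le> 1 + (norm (f x))\<^sup>2"
      using sum_squares_bound[of 1 "norm (f x)"] by simp
    then show ?thesis using norm_ge_zero[of "f x"] by linarith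
  qed
  then show "AE x in M. norm (f x) \<le> norm (1 + (norm (f x))\<^sup>2)"
    by (intro AE_I2) (simp add: order_trans[OF _ abs_ge_self])
qed (use assms in \<open>simp add: sqint_def\<close>)

text \<open>Cauchy-Schwarz for the factors \<open>2^(- k/2)\<close> and \<open>2^(k/2) a k\<close>;
  the constant 2 is the sum of the geometric series. The weight converts a square sum into absolute
  summability.\<close>

lemma summable_weighted_sq:
  fixes a :: "nat \<Rightarrow> real"
  assumes a: "\<And>k. 0 \<le> a k" and s: "summable (\<lambda>k. 2 ^ k * (a k)\<^sup>2)"
  shows "summable a" "(suminf a)\<^sup>2 \<le> 2 * (\<Sum>k. 2 ^ k * (a k)\<^sup>2)"
proof -
  have geo: "summable (\<lambda>k. (1 / 2) ^ k :: real)" "(\<Sum>k. (1 / 2) ^ k :: real) = 2"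
    using suminf_geometric[of "1/2 :: real"] by (auto simp: summable_geometric)
  have le: "(\<Sum>k<n. a k)\<^sup>2 \<le> 2 * (\<Sum>k. 2 ^ k * (a k)\<^sup>2)" for n
  proof -
    have "a k = sqrt ((1 / 2) ^ k) * (sqrt (2 ^ k) * a k)" for k
      by (simp flip: real_sqrt_mult mult.assoc power_mult_distrib)
    then have "(\<Sum>k<n. a k)\<^sup>2 = (\<Sum>k<n. sqrt ((1 / 2) ^ k) * (sqrt (2 ^ k) * a k))\<^sup>2"
      by (intro arg_cong[where f = "\<lambda>z. z\<^sup>2"] sum.cong) auto
    also have "\<dots> \<le> (\<Sum>k<n. (sqrt ((1 / 2) ^ k))\<^sup>2) * (\<Sum>k<n. (sqrt (2 ^ k) * a k)\<^sup>2)"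
      by (rule Cauchy_Schwarz_ineq_sum)
    also have "\<dots> = (\<Sum>k<n. (1 / 2) ^ k) * (\<Sum>k<n. 2 ^ k * (a k)\<^sup>2)"
      by (simp add: power_mult_distrib)
    also have "\<dots> \<le> 2 * (\<Sum>k. 2 ^ k * (a k)\<^sup>2)"
      using sum_le_suminf[OF geo(1), of "{..<n}"] sum_le_suminf[OF s, of "{..<n}"] geo(2)
      by (intro mult_mono) (auto intro!: sum_nonneg)
    finally show ?thesis .
  qed
  have nn: "0 \<le> (\<Sum>k. 2 ^ k * (a k)\<^sup>2)" by (intro suminf_nonneg s) simp
  have "(\<Sum>k<n. a k) \<le> sqrt (2 * (\<Sum>k. 2 ^ k * (a k)\<^sup>2))" for n
    using le[of n] by (rule real_le_rsqrt)
  then show sa: "summable a" by (intro summableI_nonneg_bounded a)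
  have "(\<lambda>n. (\<Sum>k<n. a k)\<^sup>2) \<longlonglongrightarrow> (suminf a)\<^sup>2"
    by (intro tendsto_power summable_LIMSEQ sa)
  then show "(suminf a)\<^sup>2 \<le> 2 * (\<Sum>k. 2 ^ k * (a k)\<^sup>2)"
    by (rule LIMSEQ_le_const2) (use le in auto)
qed

text \<open>Monotone convergence makes the weighted sum of squares integrable. It is finite almost
  everywhere and, up to the factor 2, bounds the square of the sum of the norms.\<close>

lemma sqint_series:
  fixes w :: "nat \<Rightarrow> 'x \<Rightarrow> 'b::euclidean_space"
  assumes w: "\<And>k. sqint M (w k)" and s: "summable (\<lambda>k. 2 ^ k * (l2n M (w k))\<^sup>2)"
  shows "AE x in M. summable (\<lambda>k. norm (w k x))" "sqint M (\<lambda>x. \<Sum>k. norm (w k x))"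
proof -
  note [measurable] = sqint_measurable[OF w]
  have i: "integrable M (\<lambda>x. 2 ^ k * (norm (w k x))\<^sup>2)" for k
    using w[of k] by (simp add: sqint_def)
  have Ik: "(\<integral>x. 2 ^ k * (norm (w k x))\<^sup>2 \<partial>M) = 2 ^ k * (l2n M (w k))\<^sup>2" for k
    by (simp add: l2n_sq)
  have "(\<integral>\<^sup>+x. (\<Sum>k. ennreal (2 ^ k * (norm (w k x))\<^sup>2)) \<partial>M) = (\<Sum>k. \<integral>\<^sup>+x. ennreal (2 ^ k * (norm (w k x))\<^sup>2) \<partial>M)"
    by (rule nn_integral_suminf) measurable
  also have "\<dots> = (\<Sum>k. ennreal (2 ^ k * (l2n M (w k))\<^sup>2))"
  proof (rule suminf_cong)
    show "(\<integral>\<^sup>+x. ennreal (2 ^ k * (norm (w k x))\<^sup>2) \<partial>M) = ennreal (2 ^ k * (l2n M (w k))\<^sup>2)" for k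
      unfolding Ik[symmetric] by (rule nn_integral_eq_integral[OF i]) simp
  qed
  also have "\<dots> \<noteq> \<infinity>"
    unfolding infinity_ennreal_def by (rule ennreal_suminf_neq_top[OF s]) simp
  finally have "AE x in M. (\<Sum>k. ennreal (2 ^ k * (norm (w k x))\<^sup>2)) \<noteq> \<infinity>"
    by (intro nn_integral_PInf_AE) measurable
  then have S: "AE x in M. summable (\<lambda>k. 2 ^ k * (norm (w k x))\<^sup>2)"
    by eventually_elim (rule summable_suminf_not_top, simp, simp)
  then show sa: "AE x in M. summable (\<lambda>k. norm (w k x))"
    by eventually_elim (rule summable_weighted_sq(1), simp, simp)
  have q: "integrable M (\<lambda>x. \<Sum>k. 2 ^ k * (norm (w k x))\<^sup>2)"
  proof (rule integrable_suminf[OF i])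
    show "AE x in M. summable (\<lambda>k. norm (2 ^ k * (norm (w k x))\<^sup>2))" using S by simp
    show "summable (\<lambda>k. \<integral>x. norm (2 ^ k * (norm (w k x))\<^sup>2) \<partial>M)" using s by (simp add: l2n_sq)
  qed
  have m: "(\<lambda>x. \<Sum>k. norm (w k x)) \<in> borel_measurable M" by measurable
  have "integrable M (\<lambda>x. (norm (\<Sum>k. norm (w k x)))\<^sup>2)"
  proof (rule Bochner_Integration.integrable_bound)
    show "integrable M (\<lambda>x. 2 * (\<Sum>k. 2 ^ k * (norm (w k x))\<^sup>2))" using q by simp
    show "AE x in M. norm ((norm (\<Sum>k. norm (w k x)))\<^sup>2) \<le> norm (2 * (\<Sum>k. 2 ^ k * (norm (w k x))\<^sup>2))"
      using S
    proof eventually_elim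
      case (elim x)
      then show ?case using summable_weighted_sq(2)[of "\<lambda>k. norm (w k x)"] by (simp add: order_trans[OF _ abs_ge_self])
    qed
  qed (use m in measurable)
  with m show "sqint M (\<lambda>x. \<Sum>k. norm (w k x))" by (simp add: sqint_def)
qed

text \<open>The sets on which the functional is bounded by \<open>m\<close> are closed by Fatou's lemma and exhaust the
  space of coefficient sequences, so by Baire's theorem one of them contains a basic open set, which
  leaves all but finitely many coefficients free.\<close>

lemma Baire_uniform_bound:
  fixes g :: "nat \<Rightarrow> 'x \<Rightarrow> 'b::euclidean_space" and A :: "'x \<Rightarrow> 'b"
  assumes A [measurable]: "A \<in> borel_measurable M" and g [measurable]: "\<And>k. g k \<in> borel_measurable M"
    and summ: "AE x in M. summable (\<lambda>k. norm (g k x))"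
    and int: "\<And>c. (\<And>k. \<bar>c k\<bar> \<le> 1) \<Longrightarrow> integrable M (\<lambda>x. A x \<bullet> (\<Sum>k. c k *\<^sub>R g k x))"
  obtains B :: real and N :: nat where "\<forall>k\<ge>N. (\<integral>\<^sup>+x. ennreal \<bar>A x \<bullet> g k x\<bar> \<partial>M) \<le> ennreal B"
proof -
  \<comment> \<open>Clamping to \<open>[-1, 1]\<close> turns every real sequence into admissible
    coefficients, so the whole product space, which is completely metrizable, can be used.\<close>
  define cl :: "real \<Rightarrow> real" where "cl t = max (- 1) (min 1 t)" for t
  have cl: "\<bar>cl t\<bar> \<le> 1" for t by (auto simp: cl_def)
  define G where "G a x = (\<Sum>k. cl (a k) *\<^sub>R g k x)" for a x
  have Gm [measurable]: "G a \<in> borel_measurable M" for a unfolding G_def by measurable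
  define T where "T m = {a :: nat \<Rightarrow> real. (\<integral>\<^sup>+x. ennreal \<bar>A x \<bullet> G a x\<bar> \<partial>M) \<le> ennreal (real m)}" for m :: nat
  have coord: "(\<lambda>j. a j k) \<longlonglongrightarrow> b k" if "a \<longlonglongrightarrow> b" for a :: "nat \<Rightarrow> nat \<Rightarrow> real" and b k
    using continuous_on_tendsto_compose[OF continuous_on_product_coordinates[of k] that] by auto
  have closed: "closed (T m)" for m
    unfolding closed_sequential_limits
  proof (intro allI impI, elim conjE)
    fix a b assume a: "\<forall>n. a n \<in> T m" "a \<longlonglongrightarrow> b"
    have "AE x in M. (\<lambda>n. ennreal \<bar>A x \<bullet> G (a n) x\<bar>) \<longlonglongrightarrow> ennreal \<bar>A x \<bullet> G b x\<bar>"
      using summ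
    proof eventually_elim
      case (elim x)
      have c1: "norm (cl t *\<^sub>R g k x) \<le> norm (g k x)" for t k
        using mult_right_mono[OF cl[of t], of "norm (g k x)"] by simp
      have eq: "A x \<bullet> G a x = (\<Sum>k. cl (a k) * (A x \<bullet> g k x))" for a
      proof -
        have "summable (\<lambda>k. cl (a k) *\<^sub>R g k x)"
          by (rule summable_comparison_test'[OF elim, of 0]) (rule c1)
        from bounded_linear.suminf[OF bounded_linear_inner_right this, of "A x"]
        show ?thesis by (simp add: G_def)
      qed
      have s: "summable (\<lambda>k. norm (A x) * norm (g k x))" using elim by (rule summable_mult)
      have "(\<lambda>n. cl (a n k) * (A x \<bullet> g k x)) \<longlonglongrightarrow> cl (b k) * (A x \<bullet> g k x)" for k
        unfolding cl_def by (intro tendsto_intros coord a(2))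
      moreover have "norm (cl t * (A x \<bullet> g k x)) \<le> norm (A x) * norm (g k x)" for t k
        using mult_mono[OF cl[of t] Cauchy_Schwarz_ineq2[of "A x" "g k x"]] by (simp add: abs_mult)
      then have "\<forall>\<^sub>F (k, n) in at_top \<times>\<^sub>F sequentially. norm (cl (a n k) * (A x \<bullet> g k x)) \<le> norm (A x) * norm (g k x)"
        by (intro always_eventually) auto
      \<comment> \<open>Tannery's theorem exchanges limit and series: coordinates converge one by
        one, and the summable norms dominate.\<close>
      ultimately have "(\<lambda>n. A x \<bullet> G (a n) x) \<longlonglongrightarrow> A x \<bullet> G b x"
        unfolding eq by (rule tannerys_theorem[OF _ _ s sequentially_bot, THEN conjunct2, THEN conjunct2])
      then show ?case by (intro tendsto_ennrealI tendsto_rabs)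
    qed
    then have "AE x in M. ennreal \<bar>A x \<bullet> G b x\<bar> = liminf (\<lambda>n. ennreal \<bar>A x \<bullet> G (a n) x\<bar>)"
      by eventually_elim (rule lim_imp_Liminf[symmetric, OF sequentially_bot])
    then have "(\<integral>\<^sup>+x. ennreal \<bar>A x \<bullet> G b x\<bar> \<partial>M) = (\<integral>\<^sup>+x. liminf (\<lambda>n. ennreal \<bar>A x \<bullet> G (a n) x\<bar>) \<partial>M)"
      by (rule nn_integral_cong_AE)
    also have "\<dots> \<le> liminf (\<lambda>n. \<integral>\<^sup>+x. ennreal \<bar>A x \<bullet> G (a n) x\<bar> \<partial>M)"
      by (rule nn_integral_liminf) measurable
    also have "\<dots> \<le> ennreal (real m)"
      using a(1) by (intro Liminf_le) (auto simp: T_def)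
    finally show "b \<in> T m" by (simp add: T_def)
  qed
  have cover: "(\<Union>m. T m) = UNIV"
  proof (intro equalityI subset_UNIV subsetI)
    fix a :: "nat \<Rightarrow> real"
    have "integrable M (\<lambda>x. A x \<bullet> G a x)" unfolding G_def by (rule int) (rule cl)
    then have "(\<integral>\<^sup>+x. ennreal \<bar>A x \<bullet> G a x\<bar> \<partial>M) < \<infinity>" by (simp add: integrable_iff_bounded)
    then obtain r where "(\<integral>\<^sup>+x. ennreal \<bar>A x \<bullet> G a x\<bar> \<partial>M) = ennreal r" "0 \<le> r"
      by (cases "\<integral>\<^sup>+x. ennreal \<bar>A x \<bullet> G a x\<bar> \<partial>M") auto
    moreover obtain m where "r \<le> real m" using real_arch_simple by blast
    ultimately show "a \<in> (\<Union>m. T m)" by (auto simp: T_def intro!: exI[of _ m] ennreal_leI)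
  qed
  \<comment> \<open>The closed sets \<open>T m\<close> cover a nonempty completely metrizable space,
    so not all of them have empty interior.\<close>
  obtain m where m: "interior (T m) \<noteq> {}"
  proof -
    have "euclidean interior_of \<Union>(range T) = {}" if "\<And>m. interior (T m) = {}"
      using completely_metrizable_space_euclidean closed that
      by (intro Baire_category_alt) auto
    with cover that show ?thesis by auto
  qed
  then obtain a0 where a0: "a0 \<in> interior (T m)" by blast
  \<comment> \<open>In the product topology a change in coordinate \<open>k\<close> alone disappears
    as \<open>k\<close> grows; hence \<open>a0(k := 0)\<close> and \<open>a0(k := 1)\<close> both
    lie in the open set for large \<open>k\<close>.\<close>
  have upd: "(\<lambda>k. a0(k := t)) \<longlonglongrightarrow> a0" for t
  proof -
    have "limitin (product_topology (\<lambda>i. euclidean) UNIV) (\<lambda>k. a0(k := t)) a0 sequentially"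
      unfolding limitin_componentwise
    proof (intro conjI ballI)
      fix i :: nat
      have "\<forall>\<^sub>F k in sequentially. a0 i = (a0(k := t)) i"
        using eventually_gt_at_top[of i] by eventually_elim auto
      then have "(\<lambda>k. (a0(k := t)) i) \<longlonglongrightarrow> a0 i"
        by (rule Lim_transform_eventually[OF tendsto_const])
      then show "limitin euclidean (\<lambda>k. (a0(k := t)) i) (a0 i) sequentially" by simp
    qed auto
    then show ?thesis by (simp add: euclidean_product_topology)
  qed
  have ev: "\<forall>\<^sub>F k in sequentially. a0(k := t) \<in> T m" for t
  proof -
    have "\<forall>\<^sub>F k in sequentially. a0(k := t) \<in> interior (T m)"
      using upd a0 by (rule topological_tendstoD[OF _ open_interior])
    then show ?thesis by eventually_elim (use interior_subset in blast)
  qed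
  have "\<forall>\<^sub>F k in sequentially. (\<integral>\<^sup>+x. ennreal \<bar>A x \<bullet> g k x\<bar> \<partial>M) \<le> ennreal (2 * real m)"
    using ev[of 1] ev[of 0]
  proof eventually_elim
    case (elim k)
    have "AE x in M. ennreal \<bar>A x \<bullet> g k x\<bar> \<le> ennreal \<bar>A x \<bullet> G (a0(k := 1)) x\<bar> + ennreal \<bar>A x \<bullet> G (a0(k := 0)) x\<bar>"
      using summ
    proof eventually_elim
      case (elim x)
      have s: "summable (\<lambda>j. cl (a j) *\<^sub>R g j x)" for a
      proof (rule summable_comparison_test'[OF elim, of 0])
        show "norm (cl (a j) *\<^sub>R g j x) \<le> norm (g j x)" for j
          using mult_right_mono[OF cl[of "a j"], of "norm (g j x)"] by simp
      qed
      \<comment> \<open>The two sequences differ in coordinate \<open>k\<close> only, and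
        \<open>cl\<close> fixes 0 and 1. The difference of the series is therefore
        \<open>g k x\<close>, at the price of two bounds \<open>m\<close>.\<close>
      have "G (a0(k := 1)) x - G (a0(k := 0)) x =
          (\<Sum>j. cl ((a0(k := 1)) j) *\<^sub>R g j x - cl ((a0(k := 0)) j) *\<^sub>R g j x)"
        unfolding G_def by (rule suminf_diff[OF s s])
      also have "\<dots> = (\<Sum>j\<in>{k}. cl ((a0(k := 1)) j) *\<^sub>R g j x - cl ((a0(k := 0)) j) *\<^sub>R g j x)"
        by (rule suminf_finite) auto
      also have "\<dots> = g k x" by (simp add: cl_def)
      finally have "A x \<bullet> g k x = A x \<bullet> G (a0(k := 1)) x - A x \<bullet> G (a0(k := 0)) x"
        by (metis inner_diff_right)
      then show ?case by (simp flip: ennreal_plus add: ennreal_leI)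
    qed
    then have "(\<integral>\<^sup>+x. ennreal \<bar>A x \<bullet> g k x\<bar> \<partial>M) \<le>
       (\<integral>\<^sup>+x. ennreal \<bar>A x \<bullet> G (a0(k := 1)) x\<bar> + ennreal \<bar>A x \<bullet> G (a0(k := 0)) x\<bar> \<partial>M)"
      by (rule nn_integral_mono_AE)
    also have "\<dots> = (\<integral>\<^sup>+x. ennreal \<bar>A x \<bullet> G (a0(k := 1)) x\<bar> \<partial>M) + (\<integral>\<^sup>+x. ennreal \<bar>A x \<bullet> G (a0(k := 0)) x\<bar> \<partial>M)"
      by (rule nn_integral_add) measurable
    also have "\<dots> \<le> ennreal (real m) + ennreal (real m)"
      using elim by (intro add_mono) (auto simp: T_def)
    also have "\<dots> = ennreal (2 * real m)" by (simp flip: ennreal_plus)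
    finally show ?case .
  qed
  then show ?thesis using that by (auto simp: eventually_sequentially)
qed

subsection \<open>The Sobolev space \<open>H\<^sup>1\<close>\<close>

lemma eLp_2_eq:
  assumes "g \<in> borel_measurable M" "\<And>x. 0 \<le> g x"
  shows "eLp M 2 (\<lambda>x. ennreal (g x)) = epow (\<integral>\<^sup>+x. ennreal ((g x)\<^sup>2) \<partial>M) (1 / 2)"
proof -
  have "epow (ennreal (g x)) 2 = ennreal ((g x)\<^sup>2)" for x
    using assms(2)[of x] by (simp add: epow_def powr_numeral)
  then show ?thesis by (simp add: eLp_def)
qed

lemma Lp2_iff: "f \<in> Lp_space D 2 \<longleftrightarrow> sqint (lebesgue_on D) f"
proof (cases "f \<in> borel_measurable (lebesgue_on D)")
  case True
  have "epow z (1 / 2) < top \<longleftrightarrow> z < top" for z by (auto simp: epow_def less_top[symmetric])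
  then show ?thesis
    using True by (simp add: Lp_space_def Lp_norm_def eLp_2_eq sqint_def integrable_iff_bounded)
qed (auto simp: Lp_space_def sqint_def)

lemma Lp2_norm:
  assumes "sqint (lebesgue_on D) f"
  shows "Lp_norm D 2 f = ennreal (l2n (lebesgue_on D) f)"
proof -
  have "Lp_norm D 2 f = epow (\<integral>\<^sup>+x. ennreal ((norm (f x))\<^sup>2) \<partial>lebesgue_on D) (1 / 2)"
    unfolding Lp_norm_def by (rule eLp_2_eq) (use assms in \<open>auto simp: sqint_def\<close>)
  also have "(\<integral>\<^sup>+x. ennreal ((norm (f x))\<^sup>2) \<partial>lebesgue_on D) = ennreal ((l2n (lebesgue_on D) f)\<^sup>2)"
    unfolding l2n_sq using assms by (intro nn_integral_eq_integral) (auto simp: sqint_def)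
  finally show ?thesis by (simp add: epow_def powr_half_sqrt)
qed

text \<open>Holds because Lebesgue measure is complete; it is used for \<open>weak_deriv\<close> and
  for limits in time, which are determined only almost everywhere.\<close>

lemma measurable_lebesgue_on_AE:
  fixes f g :: "'a::euclidean_space \<Rightarrow> 'b::euclidean_space"
  assumes S: "S \<in> sets lebesgue" and f: "f \<in> borel_measurable (lebesgue_on S)"
    and eq: "AE x in lebesgue_on S. f x = g x"
  shows "g \<in> borel_measurable (lebesgue_on S)"
proof -
  have "(\<lambda>x. indicator S x *\<^sub>R f x) \<in> borel_measurable lebesgue"
    using f S by (simp add: borel_measurable_restrict_space_iff)
  moreover have "AE x in lebesgue. indicator S x *\<^sub>R f x = indicator S x *\<^sub>R g x"
    using eq S by (simp add: AE_restrict_space_iff) (auto elim!: eventually_mono simp: indicator_def)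
  ultimately have "(\<lambda>x. indicator S x *\<^sub>R g x) \<in> borel_measurable lebesgue"
    by (rule borel_measurable_AE)
  then show ?thesis using S by (simp add: borel_measurable_restrict_space_iff)
qed

lemma Hs1_iff:
  "f \<in> Hs_space D 1 \<longleftrightarrow> sqint (lebesgue_on D) f \<and>
     (\<forall>b\<in>Basis. \<exists>g. has_weak_deriv D b f g \<and> sqint (lebesgue_on D) g)"
  by (simp add: Hs_space_def Lp2_iff)

text \<open>Openness serves weak derivatives and mollification. Boundedness makes \<open>M\<close>
  finite, so that square integrable functions are integrable.\<close>

locale bounded_open =
  fixes D :: "'a::euclidean_space set"
  assumes open_D: "open D" and bounded_D: "bounded D"
begin

abbreviation "M \<equiv> lebesgue_on D"
abbreviation "wd \<equiv> weak_deriv D"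

lemma D_sets: "D \<in> sets lebesgue"
  using open_D by auto

sublocale M: finite_measure M
  by (rule finite_measure_lebesgue_on[OF lmeasurable_open[OF bounded_D open_D]])

text \<open>The real counterpart of \<open>Hs_norm D 1\<close>; the two agree on H1 by
  \<open>Hs_norm_1\<close>.\<close>

definition h1n :: "('a \<Rightarrow> 'b::euclidean_space) \<Rightarrow> real" where
  "h1n f = sqrt ((l2n M f)\<^sup>2 + (\<Sum>b\<in>Basis. (l2n M (wd b f))\<^sup>2))"

lemma sqint_locally_integrable:
  assumes "sqint M f"
  shows "locally_integrable D f"
  unfolding locally_integrable_def
proof (intro allI impI)
  fix K assume K: "compact K \<and> K \<subseteq> D"
  have "integrable lebesgue (\<lambda>x. indicator D x *\<^sub>R f x)"
    using M.sqint_integrable[OF assms] D_sets by (simp add: integrable_restrict_space)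
  then have "integrable lebesgue (\<lambda>x. indicator K x *\<^sub>R (indicator D x *\<^sub>R f x))"
    using K by (intro integrable_mult_indicator[of K lebesgue "\<lambda>x. indicator D x *\<^sub>R f x"]) (auto simp: borel_compact)
  moreover have "indicator K x *\<^sub>R (indicator D x *\<^sub>R f x) = indicator K x *\<^sub>R f x" for x
    using K by (auto simp: indicator_def)
  ultimately show "set_integrable lebesgue K f" by (simp only: set_integrable_def)
qed

lemma H1_sqint: "f \<in> Hs_space D 1 \<Longrightarrow> sqint M f"
  by (simp add: Hs1_iff)

text \<open>Membership in H1 provides some square integrable weak derivative; by uniqueness the one
  chosen by \<open>weak_deriv\<close> agrees with it almost everywhere and inherits the
  integrability.\<close>

lemma H1_wd:
  assumes "f \<in> Hs_space D 1" "b \<in> Basis"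
  shows "has_weak_deriv D b f (wd b f)" "sqint M (wd b f)"
proof -
  obtain g where g: "has_weak_deriv D b f g" "sqint M g"
    using assms by (auto simp: Hs1_iff)
  show w: "has_weak_deriv D b f (wd b f)"
    using someI[of "has_weak_deriv D b f", OF g(1)] by (simp only: weak_deriv_def)
  have eq: "AE x in M. g x = wd b f x" by (rule has_weak_deriv_unique[OF open_D g(1) w])
  show "sqint M (wd b f)"
    using sqint_cong_AE(1)[OF g(2) measurable_lebesgue_on_AE[OF D_sets sqint_measurable[OF g(2)] eq] eq] .
qed

lemma H1_wd_eq:
  assumes "f \<in> Hs_space D 1" "b \<in> Basis" "has_weak_deriv D b f g"
  shows "AE x in M. wd b f x = g x"
  by (rule has_weak_deriv_unique[OF open_D H1_wd(1)[OF assms(1,2)] assms(3)])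

lemma H1I:
  assumes "sqint M f" "\<And>b. b \<in> Basis \<Longrightarrow> has_weak_deriv D b f (g b)" "\<And>b. b \<in> Basis \<Longrightarrow> sqint M (g b)"
  shows "f \<in> Hs_space D 1"
  unfolding Hs1_iff
proof (intro conjI ballI)
  fix b :: 'a assume "b \<in> Basis"
  then show "\<exists>g. has_weak_deriv D b f g \<and> sqint M g" using assms(2,3) by blast
qed (rule assms)

lemma h1n_nonneg [simp]: "0 \<le> h1n f"
  by (simp add: h1n_def sum_nonneg)

lemma l2n_le_h1n: "l2n M f \<le> h1n f" "b \<in> Basis \<Longrightarrow> l2n M (wd b f) \<le> h1n f"
proof -
  show "l2n M f \<le> h1n f"
    unfolding h1n_def by (rule real_le_rsqrt) (simp add: sum_nonneg)
  assume b: "b \<in> Basis"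
  have "(l2n M (wd b f))\<^sup>2 \<le> (\<Sum>b\<in>Basis. (l2n M (wd b f))\<^sup>2)"
    using b by (intro member_le_sum) auto
  also have "\<dots> \<le> (l2n M f)\<^sup>2 + (\<Sum>b\<in>Basis. (l2n M (wd b f))\<^sup>2)" by simp
  finally show "l2n M (wd b f) \<le> h1n f" unfolding h1n_def by (rule real_le_rsqrt)
qed

lemma h1n_tendsto_0:
  assumes "(\<lambda>n. l2n M (f n)) \<longlonglongrightarrow> 0" "\<And>b. b \<in> Basis \<Longrightarrow> (\<lambda>n. l2n M (wd b (f n))) \<longlonglongrightarrow> 0"
  shows "(\<lambda>n. h1n (f n)) \<longlonglongrightarrow> 0"
proof -
  have "(\<lambda>n. h1n (f n)) \<longlonglongrightarrow> sqrt (0\<^sup>2 + (\<Sum>b\<in>(Basis::'a set). 0\<^sup>2))"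
    unfolding h1n_def by (intro tendsto_intros assms)
  then show ?thesis by simp
qed

lemma Hs_norm_1:
  assumes "f \<in> Hs_space D 1"
  shows "Hs_norm D 1 f = ennreal (h1n f)"
proof -
  have "Hks_norm_sq D (Suc 0) 0 f = (ennreal (l2n M f))\<^sup>2 + (\<Sum>b\<in>Basis. (ennreal (l2n M (wd b f)))\<^sup>2)"
    using H1_sqint[OF assms] H1_wd(2)[OF assms] by (simp add: Lp2_norm)
  also have "\<dots> = ennreal ((l2n M f)\<^sup>2 + (\<Sum>b\<in>Basis. (l2n M (wd b f))\<^sup>2))"
    by (simp add: ennreal_power sum_nonneg)
  finally have "Hks_norm_sq D (Suc 0) 0 f = ennreal ((h1n f)\<^sup>2)"
    by (simp add: h1n_def sum_nonneg)
  then show ?thesis by (simp add: Hs_norm_def epow_def powr_half_sqrt del: Hks_norm_sq.simps)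
qed

section \<open>Linear operations, composition and series in H1\<close>

lemma H1_diff:
  assumes "f \<in> Hs_space D 1" "g \<in> Hs_space D 1"
  shows "(\<lambda>x. f x - g x) \<in> Hs_space D 1"
    and "b \<in> Basis \<Longrightarrow> AE x in M. wd b (\<lambda>x. f x - g x) x = wd b f x - wd b g x"
proof -
  have w: "has_weak_deriv D b (\<lambda>x. f x - g x) (\<lambda>x. wd b f x - wd b g x)" if "b \<in> Basis" for b
    by (intro has_weak_deriv_diff open_D that H1_wd assms)
  show 1: "(\<lambda>x. f x - g x) \<in> Hs_space D 1"
    by (rule H1I[OF _ w]) (intro sqint_diff H1_sqint H1_wd assms | assumption)+
  show "AE x in M. wd b (\<lambda>x. f x - g x) x = wd b f x - wd b g x" if "b \<in> Basis"
    by (rule H1_wd_eq[OF 1 that w[OF that]])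
qed

lemma H1_scaleR:
  assumes "f \<in> Hs_space D 1"
  shows "(\<lambda>x. c *\<^sub>R f x) \<in> Hs_space D 1"
    and "b \<in> Basis \<Longrightarrow> AE x in M. wd b (\<lambda>x. c *\<^sub>R f x) x = c *\<^sub>R wd b f x"
proof -
  have w: "has_weak_deriv D b (\<lambda>x. c *\<^sub>R f x) (\<lambda>x. c *\<^sub>R wd b f x)" if "b \<in> Basis" for b
    by (intro has_weak_deriv_scaleR that H1_wd assms)
  show 1: "(\<lambda>x. c *\<^sub>R f x) \<in> Hs_space D 1"
    by (rule H1I[OF _ w]) (intro sqint_scaleR H1_sqint H1_wd assms | assumption)+
  show "AE x in M. wd b (\<lambda>x. c *\<^sub>R f x) x = c *\<^sub>R wd b f x" if "b \<in> Basis"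
    by (rule H1_wd_eq[OF 1 that w[OF that]])
qed

lemma H1_wd_diff_l2n:
  assumes "f \<in> Hs_space D 1" "g \<in> Hs_space D 1" "b \<in> Basis"
  shows "l2n M (wd b (\<lambda>x. f x - g x)) = l2n M (\<lambda>x. wd b f x - wd b g x)"
  using sqint_cong_AE(2)[OF H1_wd(2)[OF H1_diff(1)[OF assms(1,2)] assms(3)] _ H1_diff(2)[OF assms]]
    sqint_measurable[OF sqint_diff(1)[OF H1_wd(2)[OF assms(1,3)] H1_wd(2)[OF assms(2,3)]]] by simp

lemma h1n_scaleR:
  assumes "f \<in> Hs_space D 1"
  shows "h1n (\<lambda>x. c *\<^sub>R f x) = \<bar>c\<bar> * h1n f"
proof -
  have "l2n M (wd b (\<lambda>x. c *\<^sub>R f x)) = \<bar>c\<bar> * l2n M (wd b f)" if b: "b \<in> Basis" for b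
    using sqint_cong_AE(2)[OF H1_wd(2)[OF H1_scaleR(1)[OF assms] b] _ H1_scaleR(2)[OF assms b]]
      sqint_scaleR[OF H1_wd(2)[OF assms b], of c] by (simp add: sqint_measurable)
  then have "(l2n M (\<lambda>x. c *\<^sub>R f x))\<^sup>2 + (\<Sum>b\<in>Basis. (l2n M (wd b (\<lambda>x. c *\<^sub>R f x)))\<^sup>2)
     = c\<^sup>2 * ((l2n M f)\<^sup>2 + (\<Sum>b\<in>Basis. (l2n M (wd b f))\<^sup>2))"
    using sqint_scaleR(2)[OF H1_sqint[OF assms]]
    by (simp add: power_mult_distrib sum_distrib_left distrib_left)
  then show ?thesis by (simp add: h1n_def real_sqrt_mult)
qed

text \<open>\<open>F 0 = 0\<close> turns the Lipschitz bound into
  \<open>norm (F z) \<le> L * norm z\<close>, which makes \<open>F (f)\<close> square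
  integrable.\<close>

lemma H1_chain:
  fixes F :: "'b::euclidean_space \<Rightarrow> 'c::euclidean_space"
  assumes f: "f \<in> Hs_space D 1" and F: "\<And>z. (F has_derivative F' z) (at z)" "\<And>y. continuous_on UNIV (\<lambda>z. F' z y)"
    and L: "\<And>z y. norm (F' z y) \<le> L * norm y" "0 \<le> L" and F0: "F 0 = 0"
  shows "(\<lambda>x. F (f x)) \<in> Hs_space D 1"
    and "b \<in> Basis \<Longrightarrow> AE x in M. wd b (\<lambda>x. F (f x)) x = F' (f x) (wd b f x)"
proof -
  have w: "has_weak_deriv D b (\<lambda>x. F (f x)) (\<lambda>x. F' (f x) (wd b f x))" if "b \<in> Basis" for b
    by (rule weak_chain_rule[OF open_D that H1_wd(1)[OF f that] F L(1)])
  have "continuous_on UNIV F"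
    using F(1) by (intro has_derivative_continuous_on) (auto intro: has_derivative_at_withinI)
  then have "F \<in> borel_measurable borel" by (rule borel_measurable_continuous_onI)
  then have m: "(\<lambda>x. F (f x)) \<in> borel_measurable M"
    using sqint_measurable[OF H1_sqint[OF f]] by measurable
  have "norm (F z) \<le> L * norm z" for z
    using derivative_bound_lipschitz[of F F' L z 0] F(1) L(1) F0 by simp
  then have s: "sqint M (\<lambda>x. F (f x))"
    by (intro sqint_bound(1)[OF H1_sqint[OF f] m _ L(2)]) simp
  have s': "sqint M (\<lambda>x. F' (f x) (wd b f x))" if b: "b \<in> Basis" for b
  proof (rule sqint_bound(1)[OF H1_wd(2)[OF f b] _ _ L(2)])
    show "(\<lambda>x. F' (f x) (wd b f x)) \<in> borel_measurable M"
      by (rule derivative_measurable[OF has_derivative_linear[OF F(1)] F(2)])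
         (use sqint_measurable H1_sqint[OF f] H1_wd(2)[OF f b] in blast)+
  qed (use L(1) in simp)
  show 1: "(\<lambda>x. F (f x)) \<in> Hs_space D 1" by (rule H1I[OF s w s'])
  show "AE x in M. wd b (\<lambda>x. F (f x)) x = F' (f x) (wd b f x)" if "b \<in> Basis"
    by (rule H1_wd_eq[OF 1 that w[OF that]])
qed

lemma H1_finite_sum:
  fixes n :: nat
  assumes y: "\<And>k. y k \<in> Hs_space D 1" and b: "b \<in> Basis"
  shows "has_weak_deriv D b (\<lambda>x. \<Sum>k<n. c k *\<^sub>R y k x) (\<lambda>x. \<Sum>k<n. c k *\<^sub>R wd b (y k) x)"
proof (induction n)
  case 0
  show ?case by (simp add: has_weak_deriv_def locally_integrable_def set_integrable_def)
next
  case (Suc n)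
  \<comment> \<open>The new summand is subtracted with the opposite sign, so that the difference
    rule applies.\<close>
  have "has_weak_deriv D b (\<lambda>x. (- c n) *\<^sub>R y n x) (\<lambda>x. (- c n) *\<^sub>R wd b (y n) x)"
    by (intro has_weak_deriv_scaleR H1_wd y b)
  from has_weak_deriv_diff[OF open_D b Suc.IH this] show ?case by simp
qed

text \<open>A concrete form of completeness of H1: the weak derivative identity for the partial sums
  passes to the limit. Coefficients in \<open>[-1, 1]\<close> are carried along because the Baire
  argument varies them.\<close>

lemma H1_series:
  fixes y :: "nat \<Rightarrow> 'a \<Rightarrow> 'b::euclidean_space"
  assumes y: "\<And>k. y k \<in> Hs_space D 1" and s: "summable (\<lambda>k. 2 ^ k * (h1n (y k))\<^sup>2)"
    and c: "\<And>k. \<bar>c k\<bar> \<le> 1"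
  shows "(\<lambda>x. \<Sum>k. c k *\<^sub>R y k x) \<in> Hs_space D 1"
    and "AE x in M. summable (\<lambda>k. norm (y k x))"
    and "b \<in> Basis \<Longrightarrow> AE x in M. summable (\<lambda>k. norm (wd b (y k) x))"
    and "b \<in> Basis \<Longrightarrow> AE x in M. wd b (\<lambda>x. \<Sum>k. c k *\<^sub>R y k x) x = (\<Sum>k. c k *\<^sub>R wd b (y k) x)"
proof -
  have series: "(AE x in M. summable (\<lambda>k. norm (w k x))) \<and> sqint M (\<lambda>x. \<Sum>k. norm (w k x)) \<and>
      sqint M (\<lambda>x. \<Sum>k. c k *\<^sub>R w k x)"
    if w: "\<And>k. sqint M (w k)" and le: "\<And>k. l2n M (w k) \<le> h1n (y k)" for w :: "nat \<Rightarrow> 'a \<Rightarrow> 'b"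
  proof -
    have sw: "summable (\<lambda>k. 2 ^ k * (l2n M (w k))\<^sup>2)"
      by (rule summable_comparison_test'[OF s, of 0]) (use le in \<open>simp add: power_mono\<close>)
    note S = sqint_series[OF w sw]
    note [measurable] = sqint_measurable[OF w]
    have "AE x in M. norm (\<Sum>k. c k *\<^sub>R w k x) \<le> 1 * norm (\<Sum>k. norm (w k x))"
      using S(1)
    proof eventually_elim
      case (elim x)
      have le: "norm (c k *\<^sub>R w k x) \<le> norm (w k x)" for k
        using mult_right_mono[OF c[of k], of "norm (w k x)"] by simp
      have n: "summable (\<lambda>k. norm (c k *\<^sub>R w k x))"
        by (rule summable_comparison_test'[OF elim, of 0]) (use le in simp)
      have "norm (\<Sum>k. c k *\<^sub>R w k x) \<le> (\<Sum>k. norm (c k *\<^sub>R w k x))" by (rule summable_norm[OF n])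
      also have "\<dots> \<le> (\<Sum>k. norm (w k x))" by (rule suminf_le[OF le n elim])
      finally show ?case by (simp add: suminf_nonneg[OF elim])
    qed
    then have "sqint M (\<lambda>x. \<Sum>k. c k *\<^sub>R w k x)"
      by (intro sqint_bound(1)[OF S(2), of _ 1]) auto
    with S show ?thesis by blast
  qed
  note S0 = series[OF H1_sqint[OF y] l2n_le_h1n(1)]
  note Sb = series[OF H1_wd(2)[OF y] l2n_le_h1n(2)]
  show "AE x in M. summable (\<lambda>k. norm (y k x))" using S0 by blast
  show "AE x in M. summable (\<lambda>k. norm (wd b (y k) x))" if "b \<in> Basis" using Sb[OF that that] by blast
  \<comment> \<open>The sum of the norms is square integrable, hence integrable on the finite
    measure, and dominates all partial sums.\<close>
  have lim: "(\<lambda>n. LINT x|M. \<zeta> x *\<^sub>R (\<Sum>k<n. c k *\<^sub>R w k x)) \<longlonglongrightarrow> (LINT x|M. \<zeta> x *\<^sub>R (\<Sum>k. c k *\<^sub>R w k x))"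
    if w: "\<And>k. sqint M (w k)" and le: "\<And>k. l2n M (w k) \<le> h1n (y k)"
      and [measurable]: "\<zeta> \<in> borel_measurable borel" and C: "\<And>x. \<bar>\<zeta> x\<bar> \<le> C"
    for w :: "nat \<Rightarrow> 'a \<Rightarrow> 'b" and \<zeta> :: "'a \<Rightarrow> real" and C
  proof (rule integral_dominated_convergence[where w = "\<lambda>x. C * (\<Sum>k. norm (w k x))"])
    note S = series[OF w le]
    note [measurable] = sqint_measurable[OF w]
    have z [measurable]: "\<zeta> \<in> borel_measurable M"
      using that(3) by (simp add: measurable_completion measurable_restrict_space1)
    show "integrable M (\<lambda>x. C * (\<Sum>k. norm (w k x)))"
      using M.sqint_integrable S by (intro integrable_mult_right) blast
    have 0: "0 \<le> C" using order_trans[OF abs_ge_zero C] .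
    show "AE x in M. (\<lambda>n. \<zeta> x *\<^sub>R (\<Sum>k<n. c k *\<^sub>R w k x)) \<longlonglongrightarrow> \<zeta> x *\<^sub>R (\<Sum>k. c k *\<^sub>R w k x)"
      using S[THEN conjunct1]
    proof eventually_elim
      case (elim x)
      have "norm (c k *\<^sub>R w k x) \<le> norm (w k x)" for k
        using mult_right_mono[OF c[of k], of "norm (w k x)"] by simp
      then have "summable (\<lambda>k. c k *\<^sub>R w k x)"
        by (intro summable_comparison_test'[OF elim, of 0])
      then show ?case by (intro tendsto_scaleR tendsto_const summable_LIMSEQ)
    qed
    show "AE x in M. norm (\<zeta> x *\<^sub>R (\<Sum>k<n. c k *\<^sub>R w k x)) \<le> C * (\<Sum>k. norm (w k x))" for n
      using S[THEN conjunct1]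
    proof eventually_elim
      case (elim x)
      have "norm (\<Sum>k<n. c k *\<^sub>R w k x) \<le> (\<Sum>k<n. norm (w k x))"
        using mult_right_mono[OF c] by (intro sum_norm_le) simp
      also have "\<dots> \<le> (\<Sum>k. norm (w k x))" by (rule sum_le_suminf[OF elim]) auto
      finally show ?case using C[of x] 0 by (simp add: mult_mono)
    qed
    show "(\<lambda>x. \<zeta> x *\<^sub>R (\<Sum>k. c k *\<^sub>R w k x)) \<in> borel_measurable M" by measurable
    show "(\<lambda>x. \<zeta> x *\<^sub>R (\<Sum>k<n. c k *\<^sub>R w k x)) \<in> borel_measurable M" for n by measurable
  qed
  have wk: "has_weak_deriv D b (\<lambda>x. \<Sum>k. c k *\<^sub>R y k x) (\<lambda>x. \<Sum>k. c k *\<^sub>R wd b (y k) x)"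
    if b: "b \<in> Basis" for b
    unfolding has_weak_deriv_def
  proof (intro conjI allI impI sqint_locally_integrable)
    show "sqint M (\<lambda>x. \<Sum>k. c k *\<^sub>R y k x)" using S0 by blast
    show "sqint M (\<lambda>x. \<Sum>k. c k *\<^sub>R wd b (y k) x)" using Sb[OF b b] by blast
    fix \<phi> :: "'a \<Rightarrow> real" assume t: "test_function D \<phi>"
    note tD = test_functionD[OF t]
    obtain C where C: "\<And>x. \<bar>\<phi> x\<bar> \<le> C" using tD(6) by blast
    obtain C' where C': "\<And>x. \<bar>dirderiv b \<phi> x\<bar> \<le> C'" using tD(7)[OF b] by blast
    have l1: "(\<lambda>n. LINT x|M. dirderiv b \<phi> x *\<^sub>R (\<Sum>k<n. c k *\<^sub>R y k x)) \<longlonglongrightarrow>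
        (LINT x|M. dirderiv b \<phi> x *\<^sub>R (\<Sum>k. c k *\<^sub>R y k x))"
      by (rule lim[OF H1_sqint[OF y] l2n_le_h1n(1) tD(5)[OF b] C'])
    have "(\<lambda>n. LINT x|M. \<phi> x *\<^sub>R (\<Sum>k<n. c k *\<^sub>R wd b (y k) x)) \<longlonglongrightarrow>
        (LINT x|M. \<phi> x *\<^sub>R (\<Sum>k. c k *\<^sub>R wd b (y k) x))"
      by (rule lim[OF H1_wd(2)[OF y b] l2n_le_h1n(2)[OF b] tD(4) C])
    from tendsto_minus[OF this] have l2: "(\<lambda>n. LINT x|M. dirderiv b \<phi> x *\<^sub>R (\<Sum>k<n. c k *\<^sub>R y k x)) \<longlonglongrightarrow>
        - (LINT x|M. \<phi> x *\<^sub>R (\<Sum>k. c k *\<^sub>R wd b (y k) x))"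
      using H1_finite_sum[OF y b, of c] t by (simp only: has_weak_deriv_def)
    show "(LINT x|M. dirderiv b \<phi> x *\<^sub>R (\<Sum>k. c k *\<^sub>R y k x)) = - (LINT x|M. \<phi> x *\<^sub>R (\<Sum>k. c k *\<^sub>R wd b (y k) x))"
      by (rule LIMSEQ_unique[OF l1 l2])
  qed
  show 1: "(\<lambda>x. \<Sum>k. c k *\<^sub>R y k x) \<in> Hs_space D 1"
  proof (rule H1I[OF _ wk])
    show "sqint M (\<lambda>x. \<Sum>k. c k *\<^sub>R y k x)" using S0 by blast
    show "sqint M (\<lambda>x. \<Sum>k. c k *\<^sub>R wd b (y k) x)" if "b \<in> Basis" for b using Sb[OF that that] by blast
  qed
  show "AE x in M. wd b (\<lambda>x. \<Sum>k. c k *\<^sub>R y k x) x = (\<Sum>k. c k *\<^sub>R wd b (y k) x)" if "b \<in> Basis"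
    by (rule H1_wd_eq[OF 1 that wk[OF that]])
qed

text \<open>A pairing that exists for every element of \<open>H\<^sup>1\<close> is automatically continuous; this replaces the
  Sobolev embeddings that would bound the nonlinear terms.\<close>

lemma pairing_tendsto_0:
  fixes y :: "nat \<Rightarrow> 'a \<Rightarrow> 'b::euclidean_space" and A :: "'a \<Rightarrow> 'b"
  assumes T: "T = (\<lambda>v. v) \<or> (\<exists>b\<in>Basis. T = wd b)"
    and A: "A \<in> borel_measurable M" and int: "\<And>v. v \<in> Hs_space D 1 \<Longrightarrow> integrable M (\<lambda>x. A x \<bullet> T v x)"
    and y: "\<And>n. y n \<in> Hs_space D 1" and lim: "(\<lambda>n. h1n (y n)) \<longlonglongrightarrow> 0"
  shows "(\<lambda>n. \<integral>x. A x \<bullet> T (y n) x \<partial>M) \<longlonglongrightarrow> 0"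
proof (rule ccontr)
  have Tm: "T v \<in> borel_measurable M" if "v \<in> Hs_space D 1" for v
    using T H1_sqint[OF that] H1_wd(2)[OF that] by (auto simp: sqint_measurable)
  have Ts: "AE x in M. T (\<lambda>x. c *\<^sub>R v x) x = c *\<^sub>R T v x" if "v \<in> Hs_space D 1" for v c
    using T H1_scaleR(2)[OF that] by auto
  have Tsum: "AE x in M. summable (\<lambda>k. norm (T (z k) x))"
    if "\<And>k. z k \<in> Hs_space D 1" "summable (\<lambda>k. 2 ^ k * (h1n (z k))\<^sup>2)" for z
    using T
  proof (elim disjE bexE)
    assume "T = (\<lambda>v. v)"
    then show ?thesis using H1_series(2)[OF that, of "\<lambda>_. 0"] by simp
  next
    fix b :: 'a assume "b \<in> Basis" "T = wd b"
    then show ?thesis using H1_series(3)[OF that, of "\<lambda>_. 0" b] by simp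
  qed
  have Tser: "AE x in M. T (\<lambda>x. \<Sum>k. c k *\<^sub>R z k x) x = (\<Sum>k. c k *\<^sub>R T (z k) x)"
    if "\<And>k. z k \<in> Hs_space D 1" "summable (\<lambda>k. 2 ^ k * (h1n (z k))\<^sup>2)" "\<And>k. \<bar>c k\<bar> \<le> 1" for z c
    using T H1_series(4)[OF that] by auto
  let ?I = "\<lambda>n. \<integral>x. A x \<bullet> T (y n) x \<partial>M"
  assume "\<not> ?I \<longlonglongrightarrow> 0"
  then obtain \<delta> where \<delta>: "0 < \<delta>" "\<And>N. \<exists>n\<ge>N. \<delta> \<le> \<bar>?I n\<bar>"
    unfolding LIMSEQ_def by (auto simp: dist_real_def not_less)
  \<comment> \<open>If the pairings did not vanish, elements of norm at most \<open>4^(-k)\<close>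
    would keep pairings of size at least \<open>\<delta>\<close>.\<close>
  have "\<exists>n. h1n (y n) \<le> (1 / 4) ^ k \<and> \<delta> \<le> \<bar>?I n\<bar>" for k :: nat
  proof -
    have "\<forall>\<^sub>F n in sequentially. h1n (y n) < (1 / 4) ^ k"
      by (rule order_tendstoD(2)[OF lim]) simp
    then obtain N where "\<And>n. n \<ge> N \<Longrightarrow> h1n (y n) < (1 / 4) ^ k" by (auto simp: eventually_sequentially)
    with \<delta>(2)[of N] show ?thesis by (meson less_imp_le)
  qed
  then obtain r where r: "\<And>k. h1n (y (r k)) \<le> (1 / 4) ^ k" "\<And>k. \<delta> \<le> \<bar>?I (r k)\<bar>" by metis
  \<comment> \<open>Scaling by \<open>2^k\<close> leaves norms at most \<open>2^(-k)\<close>, so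
    that the weighted squares required by \<open>H1_series\<close> are summable, while the pairings
    are at least \<open>2^k * \<delta>\<close>. This contradicts the uniform bound
    \<open>B\<close>.\<close>
  define z where "z k = (\<lambda>x. (2 ^ k) *\<^sub>R y (r k) x)" for k :: nat
  have z: "z k \<in> Hs_space D 1" for k unfolding z_def by (rule H1_scaleR(1)[OF y])
  have "2 ^ k * (h1n (z k))\<^sup>2 \<le> (1 / 2) ^ k" for k
  proof -
    have "h1n (z k) \<le> 2 ^ k * (1 / 4) ^ k"
      unfolding z_def h1n_scaleR[OF y] using r(1)[of k] by simp
    also have "\<dots> = (1 / 2) ^ k" by (simp flip: power_mult_distrib)
    finally have "(h1n (z k))\<^sup>2 \<le> ((1 / 2) ^ k)\<^sup>2" by (intro power_mono) simp_all
    then have "2 ^ k * (h1n (z k))\<^sup>2 \<le> 2 ^ k * ((1 / 2) ^ k)\<^sup>2" by simp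
    also have "\<dots> = (1 / 2) ^ k" by (simp add: power2_eq_square flip: power_mult_distrib mult.assoc)
    finally show ?thesis .
  qed
  then have s: "summable (\<lambda>k. 2 ^ k * (h1n (z k))\<^sup>2)"
    by (intro summable_comparison_test'[OF summable_geometric[of "1/2 :: real"], of 0]) simp_all
  obtain B N where BN: "\<forall>k\<ge>N. (\<integral>\<^sup>+x. ennreal \<bar>A x \<bullet> T (z k) x\<bar> \<partial>M) \<le> ennreal B"
  proof (rule Baire_uniform_bound[OF A Tm[OF z] Tsum[OF z s]])
    fix c :: "nat \<Rightarrow> real" assume c: "\<And>k. \<bar>c k\<bar> \<le> 1"
    have "integrable M (\<lambda>x. A x \<bullet> T (\<lambda>x. \<Sum>k. c k *\<^sub>R z k x) x)"
      by (rule int[OF H1_series(1)[OF z s c]])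
    then show "integrable M (\<lambda>x. A x \<bullet> (\<Sum>k. c k *\<^sub>R T (z k) x))"
    proof (rule integrable_cong_AE_imp)
      show "AE x in M. A x \<bullet> T (\<lambda>x. \<Sum>k. c k *\<^sub>R z k x) x = A x \<bullet> (\<Sum>k. c k *\<^sub>R T (z k) x)"
        using Tser[of z c, OF z s c] by eventually_elim simp
      show "(\<lambda>x. A x \<bullet> (\<Sum>k. c k *\<^sub>R T (z k) x)) \<in> borel_measurable M"
        using A Tm[OF z] by measurable
    qed
  qed
  have le: "2 ^ k * \<delta> \<le> \<bar>B\<bar>" if "k \<ge> N" for k
  proof -
    have "\<bar>\<integral>x. A x \<bullet> T (z k) x \<partial>M\<bar> = 2 ^ k * \<bar>?I (r k)\<bar>"
    proof -
      have "(\<integral>x. A x \<bullet> T (z k) x \<partial>M) = (\<integral>x. 2 ^ k * (A x \<bullet> T (y (r k)) x) \<partial>M)"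
        by (rule integral_cong_AE) (use Ts[OF y, of "2 ^ k" "r k"] A Tm[OF z] Tm[OF y] in \<open>auto simp: z_def elim!: eventually_mono\<close>)
      then show ?thesis by (simp add: abs_mult)
    qed
    moreover have "ennreal \<bar>\<integral>x. A x \<bullet> T (z k) x \<partial>M\<bar> \<le> ennreal B"
      using integral_norm_bound_ennreal[OF int[OF z[of k]]] BN that by (auto intro: order_trans)
    then have "\<bar>\<integral>x. A x \<bullet> T (z k) x \<partial>M\<bar> \<le> \<bar>B\<bar>"
      by (meson abs_ge_self abs_ge_zero dual_order.trans ennreal_leI ennreal_le_iff)
    moreover have "2 ^ k * \<delta> \<le> 2 ^ k * \<bar>?I (r k)\<bar>" by (intro mult_left_mono r(2)) simp
    ultimately show ?thesis by linarith
  qed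
  obtain k where k: "\<bar>B\<bar> / \<delta> < 2 ^ k" using real_arch_pow[of 2 "\<bar>B\<bar> / \<delta>"] by auto
  have "2 ^ k * \<delta> \<le> 2 ^ max k N * \<delta>" using \<delta>(1) by (intro mult_right_mono power_increasing) auto
  also have "\<dots> \<le> \<bar>B\<bar>" by (rule le) simp
  also have "\<dots> < 2 ^ k * \<delta>" using k \<delta>(1) by (simp add: field_simps)
  finally show False by simp
qed

lemma pairing_continuous:
  fixes y :: "nat \<Rightarrow> 'a \<Rightarrow> 'b::euclidean_space" and A :: "'a \<Rightarrow> 'b"
  assumes T: "T = (\<lambda>v. v) \<or> (\<exists>b\<in>Basis. T = wd b)"
    and A: "A \<in> borel_measurable M" and int: "\<And>v. v \<in> Hs_space D 1 \<Longrightarrow> integrable M (\<lambda>x. A x \<bullet> T v x)"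
    and y: "\<And>n. y n \<in> Hs_space D 1" "v \<in> Hs_space D 1" and lim: "(\<lambda>n. h1n (\<lambda>x. y n x - v x)) \<longlonglongrightarrow> 0"
  shows "(\<lambda>n. \<integral>x. A x \<bullet> T (y n) x \<partial>M) \<longlonglongrightarrow> (\<integral>x. A x \<bullet> T v x \<partial>M)"
proof -
  have Tm: "T v \<in> borel_measurable M" if "v \<in> Hs_space D 1" for v
    using T H1_sqint[OF that] H1_wd(2)[OF that] by (auto simp: sqint_measurable)
  have d: "(\<lambda>x. y n x - v x) \<in> Hs_space D 1" for n by (rule H1_diff(1)[OF y])
  have "(\<integral>x. A x \<bullet> T (\<lambda>x. y n x - v x) x \<partial>M) = (\<integral>x. A x \<bullet> T (y n) x \<partial>M) - (\<integral>x. A x \<bullet> T v x \<partial>M)" for n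
  proof -
    have "AE x in M. T (\<lambda>x. y n x - v x) x = T (y n) x - T v x"
      using T H1_diff(2)[OF y] by auto
    then have "(\<integral>x. A x \<bullet> T (\<lambda>x. y n x - v x) x \<partial>M) = (\<integral>x. A x \<bullet> T (y n) x - A x \<bullet> T v x \<partial>M)"
      using A Tm[OF d] Tm[OF y(1)] Tm[OF y(2)]
      by (intro integral_cong_AE) (auto elim!: eventually_mono simp: inner_diff_right)
    then show ?thesis using int[OF y(1)] int[OF y(2)] by simp
  qed
  then show ?thesis using pairing_tendsto_0[OF T A int d lim] by (simp add: LIM_zero_iff)
qed

lemma l2n_AE_subseq:
  fixes f :: "nat \<Rightarrow> 'a \<Rightarrow> 'b::euclidean_space"
  assumes "\<And>n. sqint M (f n)" "(\<lambda>n. l2n M (f n)) \<longlonglongrightarrow> 0"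
  obtains r :: "nat \<Rightarrow> nat" where "strict_mono r" "AE x in M. (\<lambda>n. f (r n) x) \<longlonglongrightarrow> 0"
proof -
  have i: "integrable M (\<lambda>x. (norm (f n x))\<^sup>2)" for n using assms(1) by (simp add: sqint_def)
  have "(\<lambda>n. (l2n M (f n))\<^sup>2) \<longlonglongrightarrow> 0\<^sup>2" by (intro tendsto_power assms(2))
  then have "(\<lambda>n. \<integral>x. norm ((norm (f n x))\<^sup>2) \<partial>M) \<longlonglongrightarrow> 0" by (simp add: l2n_sq)
  from tendsto_L1_AE_subseq[OF i this]
  obtain r where r: "strict_mono r" "AE x in M. (\<lambda>n. (norm (f (r n) x))\<^sup>2) \<longlonglongrightarrow> 0" by blast
  have "AE x in M. (\<lambda>n. f (r n) x) \<longlonglongrightarrow> 0"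
    using r(2)
  proof eventually_elim
    case (elim x)
    have "(\<lambda>n. sqrt ((norm (f (r n) x))\<^sup>2)) \<longlonglongrightarrow> sqrt 0" by (rule tendsto_real_sqrt[OF elim])
    then show ?case by (simp add: tendsto_norm_zero_iff)
  qed
  with r(1) show ?thesis by (rule that)
qed

text \<open>Continuity of the superposition \<open>w \<mapsto> F (w)\<close> on H1, stated along a
  subsequence: the part of the derivative in which the base point changes needs convergence almost
  everywhere.\<close>

lemma H1_chain_continuous:
  fixes F :: "'b::euclidean_space \<Rightarrow> 'c::euclidean_space"
  assumes F: "\<And>z. (F has_derivative F' z) (at z)" "\<And>y. continuous_on UNIV (\<lambda>z. F' z y)"
    and L: "\<And>z y. norm (F' z y) \<le> L * norm y" "0 \<le> L" and F0: "F 0 = 0"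
    and c: "\<And>n. c n \<in> Hs_space D 1" "w \<in> Hs_space D 1" and lim: "(\<lambda>n. h1n (\<lambda>x. c n x - w x)) \<longlonglongrightarrow> 0"
  obtains r :: "nat \<Rightarrow> nat" where "strict_mono r" "(\<lambda>n. h1n (\<lambda>x. F (c (r n) x) - F (w x))) \<longlonglongrightarrow> 0"
proof -
  note chain = H1_chain[OF _ F L F0]
  have lin: "linear (F' z)" for z using F(1) has_derivative_linear by blast
  have d: "(\<lambda>x. c n x - w x) \<in> Hs_space D 1" for n by (rule H1_diff(1)[OF c])
  have l0: "(\<lambda>n. l2n M (\<lambda>x. c n x - w x)) \<longlonglongrightarrow> 0"
    by (rule tendsto_sandwich[OF _ _ tendsto_const lim]) (simp_all add: l2n_le_h1n)
  have l1: "(\<lambda>n. l2n M (\<lambda>x. wd b (c n) x - wd b w x)) \<longlonglongrightarrow> 0" if b: "b \<in> Basis" for b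
  proof (rule tendsto_sandwich[OF _ _ tendsto_const lim])
    show "\<forall>\<^sub>F n in sequentially. l2n M (\<lambda>x. wd b (c n) x - wd b w x) \<le> h1n (\<lambda>x. c n x - w x)"
      unfolding H1_wd_diff_l2n[OF c b, symmetric] by (intro always_eventually allI l2n_le_h1n(2) b)
  qed simp
  obtain r where r: "strict_mono r" "AE x in M. (\<lambda>n. c (r n) x - w x) \<longlonglongrightarrow> 0"
    by (rule l2n_AE_subseq[OF H1_sqint[OF d] l0])
  have r': "AE x in M. (\<lambda>n. c (r n) x) \<longlonglongrightarrow> w x"
    using r(2) by eventually_elim (rule LIM_zero_cancel)
  have lr: "(\<lambda>n. X (r n)) \<longlonglongrightarrow> 0" if "X \<longlonglongrightarrow> (0::real)" for X
    using LIMSEQ_subseq_LIMSEQ[OF that r(1)] by (simp add: comp_def)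
  let ?z = "\<lambda>n x. F (c (r n) x) - F (w x)"
  have zH: "?z n \<in> Hs_space D 1" for n by (intro H1_diff chain c)
  have "(\<lambda>n. l2n M (?z n)) \<longlonglongrightarrow> 0"
  proof (rule tendsto_sandwich[OF _ _ tendsto_const])
    show "(\<lambda>n. L * l2n M (\<lambda>x. c (r n) x - w x)) \<longlonglongrightarrow> 0"
      using tendsto_mult_left[OF lr[OF l0], of L] by simp
    show "\<forall>\<^sub>F n in sequentially. l2n M (?z n) \<le> L * l2n M (\<lambda>x. c (r n) x - w x)"
    proof (intro always_eventually allI)
      fix n
      have "AE x in M. norm (?z n x) \<le> L * norm (c (r n) x - w x)"
        using derivative_bound_lipschitz[of F F' L] F(1) L(1) by simp
      then show "l2n M (?z n) \<le> L * l2n M (\<lambda>x. c (r n) x - w x)"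
        by (rule sqint_bound(2)[OF H1_sqint[OF d] sqint_measurable[OF H1_sqint[OF zH]] _ L(2)])
    qed
  qed simp
  moreover have "(\<lambda>n. l2n M (wd b (?z n))) \<longlonglongrightarrow> 0" if b: "b \<in> Basis" for b
  proof -
    have mF: "(\<lambda>x. F' (f x) (g x)) \<in> borel_measurable M" if "sqint M f" "sqint M g" for f g
      by (rule derivative_measurable[OF lin F(2) sqint_measurable[OF that(1)] sqint_measurable[OF that(2)]])
    have sF: "sqint M (\<lambda>x. F' (f x) (g x))" "l2n M (\<lambda>x. F' (f x) (g x)) \<le> L * l2n M g" if "sqint M f" "sqint M g" for f g
      using sqint_bound[OF that(2) mF[OF that] _ L(2)] L(1) by auto
    \<comment> \<open>\<open>p\<close> changes the direction at the moving base point and is bounded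
      by \<open>L\<close>; \<open>q\<close> changes the base point in the fixed direction
      \<open>wd b w\<close> and tends to 0 by dominated convergence.\<close>
    define p where "p n x = F' (c (r n) x) (wd b (c (r n)) x - wd b w x)" for n x
    define q where "q n x = F' (c (r n) x) (wd b w x) - F' (w x) (wd b w x)" for n x
    note cs = H1_sqint[OF c(1)] and ws = H1_sqint[OF c(2)] and cb = H1_wd(2)[OF c(1) b] and wb = H1_wd(2)[OF c(2) b]
    have p: "sqint M (p n)" "l2n M (p n) \<le> L * l2n M (\<lambda>x. wd b (c (r n)) x - wd b w x)" for n
      unfolding p_def by (rule sF[OF cs sqint_diff(1)[OF cb wb]])+
    have q: "sqint M (q n)" for n
      unfolding q_def by (intro sqint_diff sF cs ws wb)
    have "(\<lambda>n. \<integral>x. (norm (q n x))\<^sup>2 \<partial>M) \<longlonglongrightarrow> (\<integral>x. 0 \<partial>M)"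
    proof (rule integral_dominated_convergence[where w = "\<lambda>x. (2 * L * norm (wd b w x))\<^sup>2"])
      show "integrable M (\<lambda>x. (2 * L * norm (wd b w x))\<^sup>2)"
        using wb by (simp add: sqint_def power_mult_distrib)
      show "(\<lambda>x. (norm (q n x))\<^sup>2) \<in> borel_measurable M" for n
        using q[of n] unfolding sqint_def by (blast dest: borel_measurable_integrable)
      show "AE x in M. (\<lambda>n. (norm (q n x))\<^sup>2) \<longlonglongrightarrow> 0"
        using r'
      proof eventually_elim
        case (elim x)
        have "(\<lambda>n. F' (c (r n) x) (wd b w x)) \<longlonglongrightarrow> F' (w x) (wd b w x)"
          by (rule continuous_on_tendsto_compose[OF F(2) elim]) auto
        then have "(\<lambda>n. (norm (F' (c (r n) x) (wd b w x) - F' (w x) (wd b w x)))\<^sup>2) \<longlonglongrightarrow>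
            (norm (F' (w x) (wd b w x) - F' (w x) (wd b w x)))\<^sup>2"
          by (intro tendsto_intros)
        then show ?case by (simp add: q_def)
      qed
      show "AE x in M. norm ((norm (q n x))\<^sup>2) \<le> (2 * L * norm (wd b w x))\<^sup>2" for n
      proof (rule AE_I2)
        fix x
        have "norm (q n x) \<le> norm (F' (c (r n) x) (wd b w x)) + norm (F' (w x) (wd b w x))"
          unfolding q_def by (rule norm_triangle_ineq4)
        also have "\<dots> \<le> 2 * L * norm (wd b w x)"
          using L(1)[of "c (r n) x" "wd b w x"] L(1)[of "w x" "wd b w x"] by linarith
        finally show "norm ((norm (q n x))\<^sup>2) \<le> (2 * L * norm (wd b w x))\<^sup>2"
          by (simp add: power_mono)
      qed
    qed simp
    then have "(\<lambda>n. sqrt (\<integral>x. (norm (q n x))\<^sup>2 \<partial>M)) \<longlonglongrightarrow> sqrt 0" by (intro tendsto_real_sqrt) simp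
    then have ql: "(\<lambda>n. l2n M (q n)) \<longlonglongrightarrow> 0" by (simp add: l2n_def)
    show ?thesis
    proof (rule tendsto_sandwich[OF _ _ tendsto_const])
      show "(\<lambda>n. L * l2n M (\<lambda>x. wd b (c (r n)) x - wd b w x) + l2n M (q n)) \<longlonglongrightarrow> 0"
        using tendsto_add[OF tendsto_mult_left[OF lr[OF l1[OF b]], of L] ql] by simp
      show "\<forall>\<^sub>F n in sequentially. l2n M (wd b (?z n)) \<le> L * l2n M (\<lambda>x. wd b (c (r n)) x - wd b w x) + l2n M (q n)"
      proof (intro always_eventually allI)
        fix n
        have "AE x in M. wd b (?z n) x = p n x + q n x"
          using H1_diff(2)[OF chain(1)[OF c(1)] chain(1)[OF c(2)] b, of "r n"]
            chain(2)[OF c(1) b, of "r n"] chain(2)[OF c(2) b]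
        proof eventually_elim
          case (elim x)
          then show ?case by (simp add: p_def q_def linear_diff[OF lin])
        qed
        then have "l2n M (\<lambda>x. p n x + q n x) = l2n M (wd b (?z n))"
          by (rule sqint_cong_AE(2)[OF H1_wd(2)[OF zH b] sqint_measurable[OF sqint_add(1)[OF p(1) q]]])
        then show "l2n M (wd b (?z n)) \<le> L * l2n M (\<lambda>x. wd b (c (r n)) x - wd b w x) + l2n M (q n)"
          using sqint_add(2)[OF p(1)[of n] q[of n]] p(2)[of n] by linarith
      qed
    qed simp
  qed
  ultimately show ?thesis by (intro that[OF r(1)] h1n_tendsto_0)
qed

end

subsection \<open>Functions of time\<close>

text \<open>For \<open>e > 0\<close> the set of \<open>x\<close> with
  \<open>f t - f x \<le> e * (t - x)\<close> is closed and contains \<open>t\<close>. The Dini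
  condition at its infimum would produce a smaller element unless the infimum is \<open>s\<close>.
  Then \<open>e\<close> tends to 0.\<close>

lemma nonincreasing_if_left_Dini:
  fixes f :: "real \<Rightarrow> real"
  assumes st: "s \<le> t" and cont: "continuous_on {s..t} f"
    and dini: "\<And>x e. s < x \<Longrightarrow> x \<le> t \<Longrightarrow> 0 < e \<Longrightarrow> \<exists>h>0. h \<le> x - s \<and> f x - f (x - h) \<le> e * h"
  shows "f t \<le> f s"
proof -
  have "f t - f s \<le> e * (t - s)" if e: "0 < e" for e
  proof -
    define S where "S = {x \<in> {s..t}. f t - f x - e * (t - x) \<le> 0}"
    have "S = {s..t} \<inter> (\<lambda>x. f t - f x - e * (t - x)) -` {..0}" by (auto simp: S_def)
    moreover have "closed ({s..t} \<inter> (\<lambda>x. f t - f x - e * (t - x)) -` {..0})"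
      by (intro continuous_closed_preimage continuous_intros cont)
    ultimately have "closed S" by simp
    have t: "t \<in> S" using st by (simp add: S_def)
    have bdd: "bdd_below S" by (auto simp: S_def intro: bdd_belowI[of _ s])
    have m: "Inf S \<in> S" using closed_contains_Inf[OF _ bdd \<open>closed S\<close>] t by auto
    have "Inf S = s"
    proof (rule ccontr)
      assume "Inf S \<noteq> s"
      with m have "s < Inf S" "Inf S \<le> t" by (auto simp: S_def)
      then obtain h where h: "0 < h" "h \<le> Inf S - s" "f (Inf S) - f (Inf S - h) \<le> e * h"
        using dini e by blast
      have "Inf S - h \<in> S" using h m by (auto simp: S_def algebra_simps)
      then have "Inf S \<le> Inf S - h" by (rule cInf_lower[OF _ bdd])
      with h show False by simp
    qed
    with m show ?thesis by (simp add: S_def)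
  qed
  then have "f t - f s \<le> 0 + e" if "0 < e" for e
  proof (cases "s = t")
    case False
    with st have "s < t" by simp
    with \<open>\<And>e. 0 < e \<Longrightarrow> f t - f s \<le> e * (t - s)\<close>[of "e / (t - s)"] that show ?thesis by simp
  qed (use that in simp)
  then show ?thesis using field_le_epsilon[of "f t - f s" 0] by simp
qed

text \<open>The exceptional null set is covered by an open set of small measure, whose distribution function
  absorbs the growth of \<open>f\<close> there.\<close>

lemma nonincreasing_if_left_Dini_AE:
  fixes f :: "real \<Rightarrow> real"
  assumes st: "s \<le> t" and cont: "continuous_on {s..t} f"
    and lip: "\<And>x y. s \<le> y \<Longrightarrow> y < x \<Longrightarrow> x \<le> t \<Longrightarrow> f x - f y \<le> K * (x - y)" and K: "0 \<le> K"
    and N: "N \<in> null_sets lebesgue"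
    and dini: "\<And>x e. s < x \<Longrightarrow> x \<le> t \<Longrightarrow> x \<notin> N \<Longrightarrow> 0 < e \<Longrightarrow> \<exists>h>0. h \<le> x - s \<and> f x - f (x - h) \<le> e * h"
  shows "f t \<le> f s"
proof -
  have main: "f t \<le> f s + K * \<epsilon>" if \<epsilon>: "0 < \<epsilon>" for \<epsilon>
  proof -
    have "N \<in> sets lebesgue" using N by auto
    then obtain O' where O': "open O'" "N \<subseteq> O'" "emeasure lebesgue (O' - N) < ennreal \<epsilon>"
      using sets_lebesgue_outer_open \<epsilon> by metis
    have Os: "O' \<in> sets lebesgue" using O'(1) by auto
    have "emeasure lebesgue O' = emeasure lebesgue (O' - N)"
      by (rule emeasure_Diff_null_set[symmetric, OF N Os])
    with O'(3) have Oe: "emeasure lebesgue O' < ennreal \<epsilon>" by simp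
    then have Ol: "O' \<in> lmeasurable" using Os by (auto intro!: fmeasurableI intro: order.strict_trans)
    define g where "g x = measure lebesgue (O' \<inter> {s..x})" for x
    have Ol': "O' \<inter> {a..b} \<in> lmeasurable" for a b :: real
      using Ol by (intro fmeasurable_Int_fmeasurable) auto
    have gd: "g x - g y = measure lebesgue (O' \<inter> {y<..x})" if "s \<le> y" "y \<le> x" for x y
    proof -
      have "O' \<inter> {s..x} = (O' \<inter> {s..y}) \<union> (O' \<inter> {y<..x})" using that by auto
      moreover have "O' \<inter> {y<..x} \<in> lmeasurable"
        using Ol by (intro fmeasurable_Int_fmeasurable) simp_all
      ultimately have "g x = g y + measure lebesgue (O' \<inter> {y<..x})"
        unfolding g_def using Ol'[of s y] by (auto intro!: measure_Union simp: fmeasurable_def less_top)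
      then show ?thesis by simp
    qed
    have g_lip: "0 \<le> g x - g y" "g x - g y \<le> x - y" if "s \<le> y" "y \<le> x" for x y
    proof -
      show "0 \<le> g x - g y" unfolding gd[OF that] by simp
      have "measure lebesgue (O' \<inter> {y<..x}) \<le> measure lebesgue {y<..x}"
        using Os by (intro measure_mono_fmeasurable bounded_set_imp_lmeasurable) auto
      then show "g x - g y \<le> x - y" unfolding gd[OF that] using that by simp
    qed
    have g_cont: "continuous_on {s..t} g"
    proof (rule lipschitz_on_continuous_on[of 1], rule lipschitz_onI)
      fix x y assume "x \<in> {s..t}" "y \<in> {s..t}"
      then show "dist (g x) (g y) \<le> 1 * dist x y"
        using g_lip[of x y] g_lip[of y x] by (cases "x \<le> y") (auto simp: dist_real_def)
    qed simp
    \<comment> \<open>At a point of \<open>N\<close> a left neighbourhood lies in \<open>O'\<close>,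
      where \<open>K * g\<close> has slope \<open>K\<close> and outweighs the growth of
      \<open>f\<close>. Elsewhere subtracting the nondecreasing \<open>K * g\<close> preserves the
      Dini bound. The total correction is at most \<open>K * \<epsilon>\<close>.\<close>
    have "f t - K * g t \<le> f s - K * g s"
    proof (rule nonincreasing_if_left_Dini[OF st])
      show "continuous_on {s..t} (\<lambda>x. f x - K * g x)" by (intro continuous_intros cont g_cont)
      fix x e :: real assume x: "s < x" "x \<le> t" and e: "0 < e"
      show "\<exists>h>0. h \<le> x - s \<and> (f x - K * g x) - (f (x - h) - K * g (x - h)) \<le> e * h"
      proof (cases "x \<in> N")
        case True
        then obtain d where d: "0 < d" "ball x d \<subseteq> O'" using O' open_contains_ball by blast
        define h where "h = min (d / 2) (x - s)"
        have h: "0 < h" "h \<le> x - s" "h < d" using d x by (auto simp: h_def)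
        have "{x - h<..x} \<subseteq> O'" using d(2) h by (auto simp: subset_eq dist_real_def)
        then have "O' \<inter> {x - h<..x} = {x - h<..x}" by auto
        then have "g x - g (x - h) = h" using gd[of "x - h" x] h by simp
        then have "K * g x - K * g (x - h) = K * h" by (metis right_diff_distrib)
        moreover have "f x - f (x - h) \<le> K * h" using lip[of "x - h" x] h x by simp
        ultimately have "(f x - K * g x) - (f (x - h) - K * g (x - h)) \<le> 0"
          by linarith
        also have "0 \<le> e * h" using e h by simp
        finally show ?thesis using h by blast
      next
        case False
        then obtain h where h: "0 < h" "h \<le> x - s" "f x - f (x - h) \<le> e * h" using dini x e by blast
        have "K * g (x - h) \<le> K * g x" using g_lip(1)[of "x - h" x] h K by (intro mult_left_mono) auto
        with h show ?thesis by (intro exI[of _ h]) auto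
      qed
    qed
    moreover have "K * g t \<le> K * \<epsilon>"
    proof (intro mult_left_mono K)
      have "g t \<le> measure lebesgue O'" unfolding g_def using Os Ol Ol'[of s t]
        by (intro measure_mono_fmeasurable) auto
      also have "\<dots> \<le> \<epsilon>" using Oe \<epsilon> Ol by (simp add: emeasure_eq_measure2 fmeasurableD ennreal_less_iff)
      finally show "g t \<le> \<epsilon>" .
    qed
    moreover have "0 \<le> K * g s" using K by (simp add: g_def)
    ultimately show ?thesis by linarith
  qed
  have "f t \<le> f s + e" if "0 < e" for e
  proof (cases "K = 0")
    case True
    with main[of 1] that show ?thesis by simp
  next
    case False
    with main[of "e / K"] that K show ?thesis by simp
  qed
  then show ?thesis by (rule field_le_epsilon)
qed

lemma integrable_lebesgue_on_subset:
  fixes f :: "'a::euclidean_space \<Rightarrow> 'b::euclidean_space"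
  assumes "integrable (lebesgue_on S) f" "S \<in> sets lebesgue" "R \<in> sets lebesgue" "R \<subseteq> S"
  shows "integrable (lebesgue_on R) f"
  using set_integrable_subset[of lebesgue S f R] assms by (simp add: set_integrable_eq)

text \<open>The differentiation theorem is used for intervals to the right of a point, so it is
  applied to the reflected function, and its negligible exceptional set is reflected back.\<close>

lemma left_Lebesgue_point:
  fixes f :: "real \<Rightarrow> real"
  assumes f: "integrable (lebesgue_on {0<..<T}) f"
  shows "AE t in lebesgue_on {0<..<T}. \<forall>e>0. \<exists>d>0. \<forall>h. 0 < h \<and> h < d \<longrightarrow>
    \<bar>(LINT r|lebesgue_on {0<..<t}. f r) - (LINT r|lebesgue_on {0<..<t - h}. f r) - h * f t\<bar> \<le> e * h"
proof -
  define F where "F x = indicator {0<..<T} x * f x" for x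
  have Fi: "integrable lebesgue F"
    using f by (simp add: F_def[abs_def] integrable_restrict_space)
  have FHK: "F integrable_on {a..b}" for a b
  proof -
    have "F integrable_on UNIV" using Fi by (rule integrable_on_lebesgue)
    then show ?thesis by (rule integrable_on_subinterval) auto
  qed
  have "(\<lambda>x. F (- x)) integrable_on cbox a b" for a b :: real
    using FHK[of "- b" "- a"] Henstock_Kurzweil_Integration.integrable_reflect_real[where f = F and a = "- b" and b = "- a"] by simp
  then obtain N where N: "negligible N"
    "\<And>x e. x \<notin> N \<Longrightarrow> 0 < e \<Longrightarrow> \<exists>d>0. \<forall>h. 0 < h \<and> h < d \<longrightarrow>
       norm (integral (cbox x (x + h *\<^sub>R One)) (\<lambda>x. F (- x)) /\<^sub>R h ^ DIM(real) - F (- x)) < e"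
    by (rule integrable_ccontinuous_explicit[of "\<lambda>x::real. F (- x)"]) blast
  have "negligible (uminus ` N)"
    using N(1) by (intro negligible_differentiable_image_negligible) (auto intro!: derivative_intros)
  then have "uminus ` N \<in> null_sets lebesgue" by (simp add: negligible_iff_null_sets)
  then have "AE t in lebesgue. t \<notin> uminus ` N" by (rule AE_not_in)
  moreover have "\<forall>e>0. \<exists>d>0. \<forall>h. 0 < h \<and> h < d \<longrightarrow>
    \<bar>(LINT r|lebesgue_on {0<..<t}. f r) - (LINT r|lebesgue_on {0<..<t - h}. f r) - h * f t\<bar> \<le> e * h"
    if t: "t \<notin> uminus ` N" "t \<in> {0<..<T}" for t
  proof (intro allI impI)
    fix e :: real assume e: "0 < e"
    have "- t \<notin> N" using t(1) by (metis image_eqI minus_minus)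
    from N(2)[OF this e] obtain d where d: "0 < d" "\<And>h. 0 < h \<and> h < d \<Longrightarrow>
       norm (integral (cbox (- t) (- t + h *\<^sub>R One)) (\<lambda>x. F (- x)) /\<^sub>R h ^ DIM(real) - F t) < e" by auto
    have I: "(LINT r|lebesgue_on {0<..<s}. f r) = integral {0..s} F" if "s \<in> {0<..<T}" for s
    proof -
      have "(LINT r|lebesgue_on {0<..<s}. f r) = (LINT r|lebesgue_on {0<..<s}. F r)"
        using that by (intro Bochner_Integration.integral_cong) (auto simp: F_def)
      also have "\<dots> = integral {0<..<s} F"
        using integrable_lebesgue_on_subset[of UNIV F "{0<..<s}"] Fi
        by (intro lebesgue_integral_eq_integral) (auto simp: lebesgue_on_UNIV_eq)
      also have "\<dots> = integral {0..s} F" by (rule integral_open_interval_real[symmetric])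
      finally show ?thesis .
    qed
    show "\<exists>d>0. \<forall>h. 0 < h \<and> h < d \<longrightarrow>
      \<bar>(LINT r|lebesgue_on {0<..<t}. f r) - (LINT r|lebesgue_on {0<..<t - h}. f r) - h * f t\<bar> \<le> e * h"
    proof (intro exI[of _ "min d t"] conjI allI impI)
      show "0 < min d t" using d t by simp
      fix h assume "0 < h \<and> h < min d t"
      then have h: "0 < h" "h < d" "h < t" by auto
      have "integral {0..t - h} F + integral {t - h..t} F = integral {0..t} F"
        by (rule Henstock_Kurzweil_Integration.integral_combine) (use h FHK in auto)
      moreover have "integral (cbox (- t) (- t + h *\<^sub>R One)) (\<lambda>x. F (- x)) = integral {t - h..t} F"
        using Henstock_Kurzweil_Integration.integral_reflect_real[where f = F and a = "t - h" and b = t] by simp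
      moreover have "F t = f t" using t by (simp add: F_def)
      moreover from calculation have "integral {0..t} F - integral {0..t - h} F = integral {t - h..t} F" by linarith
      ultimately have "\<bar>((LINT r|lebesgue_on {0<..<t}. f r) - (LINT r|lebesgue_on {0<..<t - h}. f r)) / h - f t\<bar> < e"
        using d(2)[of h] h t by (simp add: I divide_inverse mult.commute)
      moreover have "(LINT r|lebesgue_on {0<..<t}. f r) - (LINT r|lebesgue_on {0<..<t - h}. f r) - h * f t =
         h * (((LINT r|lebesgue_on {0<..<t}. f r) - (LINT r|lebesgue_on {0<..<t - h}. f r)) / h - f t)"
        using h by (simp add: field_simps)
      ultimately show "\<bar>(LINT r|lebesgue_on {0<..<t}. f r) - (LINT r|lebesgue_on {0<..<t - h}. f r) - h * f t\<bar> \<le> e * h"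
        using h by (simp add: abs_mult mult.commute mult_left_mono)
    qed
  qed
  ultimately have "AE t in lebesgue. t \<in> {0<..<T} \<longrightarrow> (\<forall>e>0. \<exists>d>0. \<forall>h. 0 < h \<and> h < d \<longrightarrow>
    \<bar>(LINT r|lebesgue_on {0<..<t}. f r) - (LINT r|lebesgue_on {0<..<t - h}. f r) - h * f t\<bar> \<le> e * h)"
    by (auto elim!: eventually_mono)
  then show ?thesis by (simp add: AE_restrict_space_iff)
qed

text \<open>\<open>h\<close> is arbitrary, since a simple function takes finitely many values on
  measurable sets. The instances are evaluation at a point and the pairing with a fixed
  function.\<close>

lemma integral_simple_function_compose:
  fixes h :: "'c \<Rightarrow> 'd::{banach, second_countable_topology}"
  assumes "finite_measure N" "simple_function N s"
  shows "integrable N (\<lambda>t. h (s t))"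
    "(\<integral>t. h (s t) \<partial>N) = (\<Sum>c\<in>s ` space N. measure N (s -` {c} \<inter> space N) *\<^sub>R h c)"
proof -
  interpret finite_measure N by fact
  have fin: "finite (s ` space N)" and m: "\<And>c. c \<in> s ` space N \<Longrightarrow> s -` {c} \<inter> space N \<in> sets N"
    using assms(2) by (auto simp: simple_function_def)
  have eq: "h (s t) = (\<Sum>c\<in>s ` space N. indicator (s -` {c} \<inter> space N) t *\<^sub>R h c)" if "t \<in> space N" for t
  proof -
    have "(\<Sum>c\<in>s ` space N. indicator (s -` {c} \<inter> space N) t *\<^sub>R h c) =
       (\<Sum>c\<in>s ` space N. if c = s t then h c else 0)"
      using that by (intro sum.cong) (auto simp: indicator_def)
    also have "\<dots> = h (s t)" using fin that by simp
    finally show ?thesis by simp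
  qed
  have i: "integrable N (\<lambda>t. indicator (s -` {c} \<inter> space N) t *\<^sub>R h c)" if "c \<in> s ` space N" for c
    using m[OF that] by (intro integrable_scaleR_left) (simp add: integrable_indicator_iff emeasure_finite less_top[symmetric])
  have "integrable N (\<lambda>t. \<Sum>c\<in>s ` space N. indicator (s -` {c} \<inter> space N) t *\<^sub>R h c)"
    by (rule Bochner_Integration.integrable_sum) (rule i)
  then show "integrable N (\<lambda>t. h (s t))"
    using eq by (subst Bochner_Integration.integrable_cong[OF refl eq])
  have "(\<integral>t. h (s t) \<partial>N) = (\<integral>t. (\<Sum>c\<in>s ` space N. indicator (s -` {c} \<inter> space N) t *\<^sub>R h c) \<partial>N)"
    by (rule Bochner_Integration.integral_cong) (auto simp: eq)
  also have "\<dots> = (\<Sum>c\<in>s ` space N. (\<integral>t. indicator (s -` {c} \<inter> space N) t *\<^sub>R h c \<partial>N))"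
    by (rule Bochner_Integration.integral_sum) (rule i)
  also have "\<dots> = (\<Sum>c\<in>s ` space N. measure N (s -` {c} \<inter> space N) *\<^sub>R h c)"
    using m by (intro sum.cong refl) (simp add: integrable_indicator_iff emeasure_finite less_top[symmetric] Int_absorb2)
  finally show "(\<integral>t. h (s t) \<partial>N) = (\<Sum>c\<in>s ` space N. measure N (s -` {c} \<inter> space N) *\<^sub>R h c)" .
qed

lemma esssup_bound:
  assumes "eLp N top g < top"
  obtains K where "0 \<le> K" "AE t in N. g t \<le> ennreal K"
proof -
  have e: "esssup N g < top" using assms by (simp add: eLp_def)
  then obtain K where K: "0 \<le> K" "esssup N g = ennreal K"
    by (cases "esssup N g") auto
  have "AE t in N. g t \<le> ennreal K" unfolding K(2)[symmetric] by (rule esssup_AE)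
  with K(1) show ?thesis by (rule that)
qed

section \<open>Bochner integrals tested against a fixed function\<close>

abbreviation "time_interval T \<equiv> lebesgue_on {0<..<T::real}"

lemma finite_time_interval: "finite_measure (time_interval T)"
  by (rule finite_measure_lebesgue_on) simp

context bounded_open
begin

lemma continuous_into_L2D:
  assumes "continuous_into_L2 T D u" "t \<in> {0..T}"
  shows "sqint M (u t)" "((\<lambda>s. l2n M (\<lambda>x. u s x - u t x)) \<longlongrightarrow> 0) (at t within {0..T})"
proof -
  have s: "sqint M (u s)" if "s \<in> {0..T}" for s
    using assms(1) that by (simp add: continuous_into_L2_def Lp2_iff)
  show "sqint M (u t)" using s assms(2) .
  have "((\<lambda>s. Lp_norm D 2 (\<lambda>x. u s x - u t x)) \<longlongrightarrow> 0) (at t within {0..T})"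
    using assms by (simp add: continuous_into_L2_def)
  moreover have "\<forall>\<^sub>F s in at t within {0..T}. Lp_norm D 2 (\<lambda>x. u s x - u t x) = ennreal (l2n M (\<lambda>x. u s x - u t x))"
    unfolding eventually_at_filter
    by (intro always_eventually allI impI Lp2_norm sqint_diff(1) s assms(2))
  ultimately have "((\<lambda>s. ennreal (l2n M (\<lambda>x. u s x - u t x))) \<longlongrightarrow> 0) (at t within {0..T})"
    by (rule Lim_transform_eventually)
  from tendsto_enn2real[of _ 0, simplified, OF this]
  show "((\<lambda>s. l2n M (\<lambda>x. u s x - u t x)) \<longlongrightarrow> 0) (at t within {0..T})"
    by simp
qed

lemma L2_inner_diff:
  assumes "sqint M f" "sqint M g" "sqint M v"
  shows "L2_inner D (\<lambda>x. f x - g x) v = L2_inner D f v - L2_inner D g v"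
    "L2_inner D v (\<lambda>x. f x - g x) = L2_inner D v f - L2_inner D v g"
  using sqint_inner(1)[OF assms(1,3)] sqint_inner(1)[OF assms(2,3)]
    sqint_inner(1)[OF assms(3,1)] sqint_inner(1)[OF assms(3,2)]
  by (simp_all add: L2_inner_def inner_diff_left inner_diff_right)

lemma L2_inner_le:
  assumes "sqint M f" "sqint M g"
  shows "\<bar>L2_inner D f g\<bar> \<le> l2n M f * l2n M g"
  unfolding L2_inner_def by (rule sqint_inner(2)[OF assms])

lemma l2n_diff_le:
  assumes "sqint M f" "sqint M g"
  shows "\<bar>l2n M f - l2n M g\<bar> \<le> l2n M (\<lambda>x. f x - g x)"
  using sqint_add(2)[OF sqint_diff(1)[OF assms] assms(2)]
    sqint_add(2)[OF sqint_diff(1)[OF assms(2,1)] assms(1)] l2n_minus_commute[of M f g] by simp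

text \<open>The definition of the Bochner integral involves the integral in time of this distance.
  It is almost everywhere the limit of distances between simple functions, hence measurable.\<close>

lemma strongly_measurable_dist:
  fixes f :: "real \<Rightarrow> 'a \<Rightarrow> 'b::euclidean_space"
  assumes f: "strongly_measurable T (Lp_space D 2) (Lp_norm D 2) f"
    and s: "simple_function (time_interval T) s" "\<forall>t\<in>{0<..<T}. s t \<in> Lp_space D 2"
  shows "(\<lambda>t. l2n M (\<lambda>x. f t x - s t x)) \<in> borel_measurable (time_interval T)"
proof -
  obtain s' where s': "\<And>n::nat. simple_function (time_interval T) (s' n)"
    "\<And>n t. t \<in> {0<..<T} \<Longrightarrow> s' n t \<in> Lp_space D 2"
    "AE t in time_interval T. (\<lambda>n. Lp_norm D 2 (\<lambda>x. f t x - s' n t x)) \<longlonglongrightarrow> 0"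
    and fL: "AE t in time_interval T. f t \<in> Lp_space D 2"
    using f unfolding strongly_measurable_def by blast
  define G where "G n t = l2n M (\<lambda>x. s' n t x - s t x)" for n t
  have [measurable]: "G n \<in> borel_measurable (time_interval T)" for n
    unfolding G_def
    by (rule borel_measurable_simple_function[OF simple_function_compose2[OF s'(1) s(1)]])
  have H: "(\<lambda>t. lim (\<lambda>n. G n t)) \<in> borel_measurable (time_interval T)" by measurable
  have E: "AE t in time_interval T. lim (\<lambda>n. G n t) = l2n M (\<lambda>x. f t x - s t x)"
    using s'(3) fL AE_space
  proof eventually_elim
    case (elim t)
    then have ft: "sqint M (f t)" and sn: "\<And>n. sqint M (s' n t)" and st: "sqint M (s t)"
      using s'(2) s(2) by (auto simp: Lp2_iff)
    have l: "(\<lambda>n. l2n M (\<lambda>x. f t x - s' n t x)) \<longlonglongrightarrow> 0"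
      using elim(1) by (simp add: Lp2_norm[OF sqint_diff(1)[OF ft sn]] ennreal_tendsto_0_iff)
    have "\<bar>G n t - l2n M (\<lambda>x. f t x - s t x)\<bar> \<le> l2n M (\<lambda>x. f t x - s' n t x)" for n
    proof -
      have "\<bar>l2n M (\<lambda>x. f t x - s t x) - G n t\<bar> \<le> l2n M (\<lambda>x. (f t x - s t x) - (s' n t x - s t x))"
        unfolding G_def by (rule l2n_diff_le[OF sqint_diff(1)[OF ft st] sqint_diff(1)[OF sn st]])
      then show ?thesis by (simp add: abs_minus_commute)
    qed
    then have "(\<lambda>n. G n t - l2n M (\<lambda>x. f t x - s t x)) \<longlonglongrightarrow> 0"
      by (intro Lim_null_comparison[OF _ l] always_eventually) simp
    then have "(\<lambda>n. G n t) \<longlonglongrightarrow> l2n M (\<lambda>x. f t x - s t x)" by (rule LIM_zero_cancel)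
    then show ?case by (rule limI)
  qed
  show ?thesis by (rule measurable_lebesgue_on_AE[OF _ H E]) simp
qed

lemma simple_pairing:
  fixes s :: "real \<Rightarrow> 'a \<Rightarrow> 'b::euclidean_space"
  assumes s: "simple_function (time_interval T) s" "\<forall>t\<in>{0<..<T}. s t \<in> Lp_space D 2" and v: "sqint M v"
  shows "sqint M (\<lambda>x. LINT t|time_interval T. s t x)"
    "L2_inner D (\<lambda>x. LINT t|time_interval T. s t x) v = (LINT t|time_interval T. L2_inner D (s t) v)"
    "integrable (time_interval T) (\<lambda>t. L2_inner D (s t) v)"
proof -
  let ?N = "time_interval T"
  let ?m = "\<lambda>c. measure ?N (s -` {c} \<inter> space ?N)"
  note I = integral_simple_function_compose[OF finite_time_interval s(1)]
  have c: "sqint M c" if "c \<in> s ` space ?N" for c using that s(2) by (auto simp: Lp2_iff)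
  have eq: "(\<lambda>x. LINT t|?N. s t x) = (\<lambda>x. \<Sum>c\<in>s ` space ?N. ?m c *\<^sub>R c x)"
    by (rule ext) (rule I(2)[of "\<lambda>c. c x" for x])
  have fin: "finite (s ` space ?N)" using s(1) by (simp add: simple_function_def)
  have "sqint M (\<lambda>x. \<Sum>c\<in>A. ?m c *\<^sub>R c x)" if "finite A" "A \<subseteq> s ` space ?N" for A
    using that
  proof (induction A rule: finite_induct)
    case empty
    show ?case by (simp add: sqint_def)
  next
    case (insert a A)
    have "sqint M (\<lambda>x. ?m a *\<^sub>R a x + (\<Sum>c\<in>A. ?m c *\<^sub>R c x))"
      by (rule sqint_add(1)[OF sqint_scaleR(1)[OF c] insert.IH]) (use insert.prems in auto)
    then show ?case using insert by simp
  qed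
  then show "sqint M (\<lambda>x. LINT t|?N. s t x)" unfolding eq using fin by blast
  show "integrable ?N (\<lambda>t. L2_inner D (s t) v)" by (rule I(1))
  have "L2_inner D (\<lambda>x. LINT t|?N. s t x) v = (\<integral>x. (\<Sum>c\<in>s ` space ?N. ?m c *\<^sub>R (c x \<bullet> v x)) \<partial>M)"
    unfolding eq L2_inner_def by (simp add: inner_sum_left)
  also have "\<dots> = (\<Sum>c\<in>s ` space ?N. \<integral>x. ?m c *\<^sub>R (c x \<bullet> v x) \<partial>M)"
    by (rule Bochner_Integration.integral_sum) (intro integrable_scaleR_right sqint_inner c v)
  also have "\<dots> = (\<Sum>c\<in>s ` space ?N. ?m c *\<^sub>R L2_inner D c v)" by (simp add: L2_inner_def)
  also have "\<dots> = (LINT t|?N. L2_inner D (s t) v)" by (rule I(2)[symmetric])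
  finally show "L2_inner D (\<lambda>x. LINT t|?N. s t x) v = (LINT t|?N. L2_inner D (s t) v)" .
qed

text \<open>Both parts pass to the limit along the simple functions of the definition. The second
  works with a majorant of the norms and does not presuppose that the pairing is measurable in time;
  it is meant for the weak time derivative.\<close>

lemma Bochner_pairing:
  fixes f :: "real \<Rightarrow> 'a \<Rightarrow> 'b::euclidean_space"
  assumes B: "has_Bochner_integral_in T (Lp_space D 2) (Lp_norm D 2) f I" and v: "sqint M v"
  shows "integrable (time_interval T) (\<lambda>t. L2_inner D (f t) v) \<Longrightarrow>
      L2_inner D I v = (LINT t|time_interval T. L2_inner D (f t) v)"
    and "\<lbrakk>integrable (time_interval T) m; AE t in time_interval T. l2n M (f t) \<le> m t\<rbrakk> \<Longrightarrow>
      \<bar>L2_inner D I v\<bar> \<le> (LINT t|time_interval T. m t) * l2n M v"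
proof -
  let ?N = "time_interval T"
  have sm: "strongly_measurable T (Lp_space D 2) (Lp_norm D 2) f" and IL: "sqint M I"
    using B by (auto simp: has_Bochner_integral_in_def Lp2_iff)
  have fL: "AE t in ?N. sqint M (f t)" using sm by (simp add: strongly_measurable_def Lp2_iff)
  obtain s where s: "\<And>n::nat. simple_function ?N (s n)" "\<And>n. \<forall>t\<in>{0<..<T}. s n t \<in> Lp_space D 2"
    and lim: "(\<lambda>n. \<integral>\<^sup>+t. Lp_norm D 2 (\<lambda>x. f t x - s n t x) \<partial>?N) \<longlonglongrightarrow> 0"
      "(\<lambda>n. Lp_norm D 2 (\<lambda>x. I x - (LINT t|?N. s n t x))) \<longlonglongrightarrow> 0"
    using B unfolding has_Bochner_integral_in_def by blast
  note sp = simple_pairing[OF s v]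
  define \<delta> where "\<delta> n t = l2n M (\<lambda>x. f t x - s n t x)" for n t
  have [measurable]: "\<delta> n \<in> borel_measurable ?N" for n
    unfolding \<delta>_def by (rule strongly_measurable_dist[OF sm s])
  have sn: "sqint M (s n t)" if "t \<in> {0<..<T}" for n t using s(2) that by (auto simp: Lp2_iff)
  have "(\<integral>\<^sup>+t. Lp_norm D 2 (\<lambda>x. f t x - s n t x) \<partial>?N) = (\<integral>\<^sup>+t. ennreal (\<delta> n t) \<partial>?N)" for n
  proof (rule nn_integral_cong_AE)
    show "AE t in ?N. Lp_norm D 2 (\<lambda>x. f t x - s n t x) = ennreal (\<delta> n t)"
      using fL AE_space
    proof eventually_elim
      case (elim t)
      then show ?case unfolding \<delta>_def by (intro Lp2_norm sqint_diff(1) sn) auto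
    qed
  qed
  then have lim\<delta>: "(\<lambda>n. \<integral>\<^sup>+t. ennreal (\<delta> n t) \<partial>?N) \<longlonglongrightarrow> 0" using lim(1) by simp
  let ?S = "\<lambda>n. LINT t|?N. L2_inner D (s n t) v"
  have limI: "?S \<longlonglongrightarrow> L2_inner D I v"
  proof -
    have l: "(\<lambda>n. l2n M (\<lambda>x. I x - (LINT t|?N. s n t x))) \<longlonglongrightarrow> 0"
      using lim(2) by (simp add: Lp2_norm[OF sqint_diff(1)[OF IL sp(1)]] ennreal_tendsto_0_iff)
    have le: "\<bar>?S n - L2_inner D I v\<bar> \<le> l2n M (\<lambda>x. I x - (LINT t|?N. s n t x)) * l2n M v" for n
      unfolding sp(2)[symmetric]
      using L2_inner_le[OF sqint_diff(1)[OF IL sp(1)[of n]] v] L2_inner_diff(1)[OF IL sp(1) v, of n]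
      by (simp add: abs_minus_commute)
    have "(\<lambda>n. l2n M (\<lambda>x. I x - (LINT t|?N. s n t x)) * l2n M v) \<longlonglongrightarrow> 0"
      using tendsto_mult_right[OF l, of "l2n M v"] by simp
    then have "(\<lambda>n. ?S n - L2_inner D I v) \<longlonglongrightarrow> 0"
      by (rule Lim_null_comparison[rotated]) (unfold real_norm_def, intro always_eventually allI le)
    then show ?thesis by (rule LIM_zero_cancel)
  qed
  have d: "AE t in ?N. \<bar>L2_inner D (s n t) v - L2_inner D (f t) v\<bar> \<le> \<delta> n t * l2n M v" for n
    using fL AE_space
  proof eventually_elim
    case (elim t)
    then have st: "sqint M (s n t)" using sn by simp
    then show ?case
      using L2_inner_le[OF sqint_diff(1)[OF elim(1) st] v] L2_inner_diff(1)[OF elim(1) st v]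
      by (simp add: \<delta>_def abs_minus_commute)
  qed
  {
    assume i: "integrable ?N (\<lambda>t. L2_inner D (f t) v)"
    have "(\<lambda>n. ?S n) \<longlonglongrightarrow> (LINT t|?N. L2_inner D (f t) v)"
    proof (rule tendsto_L1_int[OF sp(3) i])
      have "(\<lambda>n. ennreal (l2n M v) * (\<integral>\<^sup>+t. ennreal (\<delta> n t) \<partial>?N)) \<longlonglongrightarrow> ennreal (l2n M v) * 0"
        by (rule ennreal_tendsto_cmult[OF _ lim\<delta>]) simp
      then have l: "(\<lambda>n. (\<integral>\<^sup>+t. ennreal (\<delta> n t) \<partial>?N) * ennreal (l2n M v)) \<longlonglongrightarrow> 0" by (simp add: mult.commute)
      show "(\<lambda>n. \<integral>\<^sup>+t. ennreal (norm (L2_inner D (s n t) v - L2_inner D (f t) v)) \<partial>?N) \<longlonglongrightarrow> 0"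
      proof (rule ennreal_squeeze_0[OF _ l])
        fix n
        have "(\<integral>\<^sup>+t. ennreal (norm (L2_inner D (s n t) v - L2_inner D (f t) v)) \<partial>?N) \<le>
          (\<integral>\<^sup>+t. ennreal (\<delta> n t) * ennreal (l2n M v) \<partial>?N)"
          by (rule nn_integral_mono_AE)
             (use d[of n] in \<open>auto elim!: eventually_mono simp: \<delta>_def ennreal_leI simp flip: ennreal_mult\<close>)
        also have "\<dots> = (\<integral>\<^sup>+t. ennreal (\<delta> n t) \<partial>?N) * ennreal (l2n M v)"
          by (rule nn_integral_multc) measurable
        finally show "(\<integral>\<^sup>+t. ennreal (norm (L2_inner D (s n t) v - L2_inner D (f t) v)) \<partial>?N) \<le>
          (\<integral>\<^sup>+t. ennreal (\<delta> n t) \<partial>?N) * ennreal (l2n M v)" .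
      qed
    qed
    then show "L2_inner D I v = (LINT t|?N. L2_inner D (f t) v)" by (rule LIMSEQ_unique[OF limI])
  }
  {
    assume m: "integrable ?N m" and le: "AE t in ?N. l2n M (f t) \<le> m t"
    have [measurable]: "m \<in> borel_measurable ?N" using m by (rule borel_measurable_integrable)
    have m0: "AE t in ?N. 0 \<le> m t" using le by eventually_elim (rule order_trans[OF l2n_nonneg])
    have Im: "(\<integral>\<^sup>+t. ennreal (m t) \<partial>?N) = ennreal (LINT t|?N. m t)"
      by (rule nn_integral_eq_integral[OF m m0])
    have "ennreal \<bar>?S n\<bar> \<le> ((\<integral>\<^sup>+t. ennreal (\<delta> n t) \<partial>?N) + ennreal (LINT t|?N. m t)) * ennreal (l2n M v)" for n
    proof -
      have "ennreal \<bar>?S n\<bar> \<le> (\<integral>\<^sup>+t. ennreal \<bar>L2_inner D (s n t) v\<bar> \<partial>?N)"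
        using integral_norm_bound_ennreal[OF sp(3)] by simp
      also have "\<dots> \<le> (\<integral>\<^sup>+t. (ennreal (\<delta> n t) + ennreal (m t)) * ennreal (l2n M v) \<partial>?N)"
      proof (rule nn_integral_mono_AE)
        show "AE t in ?N. ennreal \<bar>L2_inner D (s n t) v\<bar> \<le> (ennreal (\<delta> n t) + ennreal (m t)) * ennreal (l2n M v)"
          using fL le AE_space
        proof eventually_elim
          case (elim t)
          then have st: "sqint M (s n t)" using sn by simp
          have "l2n M (s n t) \<le> \<delta> n t + m t"
            using l2n_diff_le[OF elim(1) st] elim(2) unfolding \<delta>_def by linarith
          then have "\<bar>L2_inner D (s n t) v\<bar> \<le> (\<delta> n t + m t) * l2n M v"
            using L2_inner_le[OF st v] by (meson l2n_nonneg mult_right_mono order_trans)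
          moreover have "0 \<le> m t" using elim(2) l2n_nonneg order_trans by blast
          ultimately show ?case
            by (simp add: \<delta>_def ennreal_leI flip: ennreal_plus ennreal_mult)
        qed
      qed
      also have "\<dots> = (\<integral>\<^sup>+t. ennreal (\<delta> n t) + ennreal (m t) \<partial>?N) * ennreal (l2n M v)"
        by (rule nn_integral_multc) measurable
      also have "(\<integral>\<^sup>+t. ennreal (\<delta> n t) + ennreal (m t) \<partial>?N) = (\<integral>\<^sup>+t. ennreal (\<delta> n t) \<partial>?N) + ennreal (LINT t|?N. m t)"
        unfolding Im[symmetric] by (rule nn_integral_add) measurable
      finally show ?thesis .
    qed
    moreover have "(\<lambda>n. ((\<integral>\<^sup>+t. ennreal (\<delta> n t) \<partial>?N) + ennreal (LINT t|?N. m t)) * ennreal (l2n M v))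
        \<longlonglongrightarrow> (0 + ennreal (LINT t|?N. m t)) * ennreal (l2n M v)"
      unfolding mult.commute[of _ "ennreal (l2n M v)"]
      by (rule ennreal_tendsto_cmult[OF _ tendsto_add[OF lim\<delta> tendsto_const]]) simp
    moreover have "(\<lambda>n. ennreal \<bar>?S n\<bar>) \<longlonglongrightarrow> ennreal \<bar>L2_inner D I v\<bar>"
      by (intro tendsto_ennrealI tendsto_rabs limI)
    ultimately have "ennreal \<bar>L2_inner D I v\<bar> \<le> (0 + ennreal (LINT t|?N. m t)) * ennreal (l2n M v)"
      using LIMSEQ_le by blast
    moreover have "0 \<le> (LINT t|?N. m t)" using m0 by (rule integral_nonneg_AE)
    ultimately show "\<bar>L2_inner D I v\<bar> \<le> (LINT t|?N. m t) * l2n M v"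
      by (simp flip: ennreal_mult)
  }
qed

text \<open>The derivative of the mollified \<open>a\<close> is a pairing of \<open>a\<close> with
  the derivative of a test function of mass 1, so by \<open>weak\<close> it is at most
  \<open>K\<close>. The mollified functions are therefore \<open>K\<close>-Lipschitz and converge to
  \<open>a\<close> at \<open>s\<close> and \<open>t\<close> by continuity.\<close>

lemma weakly_Lipschitz:
  fixes a :: "real \<Rightarrow> real"
  assumes cont: "continuous_on {0<..<T} a" and K: "0 \<le> K"
    and weak: "\<And>\<phi>. test_function {0<..<T} \<phi> \<Longrightarrow>
      \<bar>LINT t|time_interval T. dirderiv 1 \<phi> t * a t\<bar> \<le> K * (LINT t|time_interval T. \<bar>\<phi> t\<bar>)"
    and st: "0 < s" "s \<le> t" "t < T"
  shows "\<bar>a t - a s\<bar> \<le> K * (t - s)"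
proof -
  \<comment> \<open>Half the distance to the ends of the interval, so that kernels centred in
    \<open>[s, t]\<close> are supported inside \<open>(0, T)\<close>.\<close>
  define r0 where "r0 = min (s / 2) ((T - t) / 2)"
  have "r0 \<le> s / 2" "r0 \<le> (T - t) / 2" unfolding r0_def by (rule min.cobounded1, rule min.cobounded2)
  with st have "r0 < s" "t + r0 < T" by (simp_all add: field_simps)
  moreover have "0 < r0" using st by (simp add: r0_def)
  ultimately have r0: "0 < r0" "r0 < s" "t + r0 < T" by blast+
  define g where "g x = indicator {s - r0..t + r0} x *\<^sub>R a x" for x
  have sub: "{s - r0..t + r0} \<subseteq> {0<..<T}" using r0 by auto
  have gi: "integrable lborel g"
    unfolding g_def by (rule borel_integrable_compact) (auto intro: continuous_on_subset[OF cont sub])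
  then have gm [measurable]: "g \<in> borel_measurable borel" by (auto dest: borel_measurable_integrable)
  have bound: "\<bar>mollify \<rho> g t - mollify \<rho> g s\<bar> \<le> K * (t - s)" if \<rho>: "is_mollifier r \<rho>" "0 < r" "r \<le> r0" for \<rho> r
  proof -
    have der: "((\<lambda>x. mollify \<rho> g x) has_vector_derivative mollify (dirderiv 1 \<rho>) g x) (at x)" for x
    proof -
      have "((\<lambda>h. mollify \<rho> g (x + h)) has_vector_derivative mollify (dirderiv 1 \<rho>) g x) (at 0)"
        using mollify_derivative[OF gi \<rho>(1), of 1 x] by simp
      then have "((mollify \<rho> g \<circ> (\<lambda>h. h + x)) has_vector_derivative mollify (dirderiv 1 \<rho>) g x) (at 0)"
        by (simp add: comp_def add.commute)
      then show ?thesis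
        by (simp add: has_vector_derivative_def has_derivative_at comp_def add.commute)
    qed
    have le: "\<bar>mollify (dirderiv 1 \<rho>) g x\<bar> \<le> K" if x: "x \<in> {s..t}" for x
    proof -
      have cb: "cball x r \<subseteq> {s - r0..t + r0}" using x \<rho> by (auto simp: dist_real_def)
      have t: "test_function {0<..<T} (\<lambda>y. \<rho> (x - y))"
        using test_function_mollifier[OF \<rho>(1)] cb sub by (meson subset_trans)
      have ae: "AE x in lborel. indicator {s - r0..t + r0} x *\<^sub>R a x = g x" by (simp add: g_def)
      have "mollify (dirderiv 1 \<rho>) g x = - (LINT y|time_interval T. dirderiv 1 (\<lambda>y. \<rho> (x - y)) y *\<^sub>R a y)"
        by (rule mollify_eq_0(2)[OF _ sub cb gi ae \<rho>(1)]) auto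
      then have "\<bar>mollify (dirderiv 1 \<rho>) g x\<bar> \<le> K * (LINT y|time_interval T. \<bar>\<rho> (x - y)\<bar>)"
        using weak[OF t] by simp
      also have "(LINT y|time_interval T. \<bar>\<rho> (x - y)\<bar>) \<le> 1"
      proof -
        note [measurable] = mollifierD(6)[OF \<rho>(1)]
        have "(LINT y|time_interval T. \<bar>\<rho> (x - y)\<bar>) = (LINT y|lebesgue. indicator {0<..<T} y *\<^sub>R \<bar>\<rho> (x - y)\<bar>)"
          by (rule integral_restrict_space) auto
        also have "\<dots> = (LINT y|lborel. indicator {0<..<T} y *\<^sub>R \<bar>\<rho> (x - y)\<bar>)"
          by (rule integral_completion) measurable
        also have "\<dots> \<le> (LINT y|lborel. \<rho> (x - y))"
        proof (rule integral_mono')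
          have "integrable lborel \<rho>"
            using mollifierD(3,5)[OF \<rho>(1)] by (auto simp: integrable_iff_bounded)
          then show "integrable lborel (\<lambda>y. \<rho> (x - y))" by (rule integrable_lborel_reflect)
        qed (use mollifierD(3)[OF \<rho>(1)] in \<open>auto simp: indicator_def\<close>)
        also have "\<dots> = (LINT y|lborel. \<rho> y)" by (rule integral_lborel_reflect) measurable
        also have "\<dots> = 1" using mollifierD(3,5)[OF \<rho>(1)] by (simp add: integral_eq_nn_integral)
        finally show ?thesis .
      qed
      finally show ?thesis using K mult_left_mono by force
    qed
    have "norm (mollify \<rho> g t - mollify \<rho> g s) \<le> K * norm (t - s)"
    proof (rule differentiable_bound[of "{s..t}"])
      show "(mollify \<rho> g has_derivative (\<lambda>h. h *\<^sub>R mollify (dirderiv 1 \<rho>) g x)) (at x within {s..t})" for x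
        using der[of x] by (auto simp: has_vector_derivative_def intro: has_derivative_at_withinI)
      show "onorm (\<lambda>h. h *\<^sub>R mollify (dirderiv 1 \<rho>) g x) \<le> K" if "x \<in> {s..t}" for x
      proof (rule onorm_le)
        fix h :: real
        show "norm (h *\<^sub>R mollify (dirderiv 1 \<rho>) g x) \<le> K * norm h"
          using mult_right_mono[OF le[OF that], of "\<bar>h\<bar>"] by (simp add: abs_mult mult.commute)
      qed
    qed (use st in auto)
    then show ?thesis using st by simp
  qed
  have approx: "\<exists>r. 0 < r \<and> r \<le> r0 \<and> (\<forall>\<rho>. is_mollifier r \<rho> \<longrightarrow> \<bar>mollify \<rho> g x - a x\<bar> \<le> e)"
    if x: "x \<in> {s..t}" and e: "0 < e" for x e
  proof -
    have "x \<in> {0<..<T}" using x st by auto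
    then have "isCont a x" using cont by (simp add: continuous_on_eq_continuous_at)
    then have "\<exists>d>0. \<forall>y. dist y x < d \<longrightarrow> dist (a y) (a x) < e"
      using e by (simp add: continuous_at_eps_delta)
    then obtain d where d: "0 < d" "\<And>y. dist y x < d \<Longrightarrow> dist (a y) (a x) < e" by metis
    define r where "r = min (d / 2) r0"
    have r: "0 < r" "r \<le> r0" "r < d" using d r0 by (auto simp: r_def)
    have "\<bar>mollify \<rho> g x - a x\<bar> \<le> e" if \<rho>: "is_mollifier r \<rho>" for \<rho>
    proof -
      note [measurable] = mollifierD(6)[OF \<rho>]
      have \<rho>i: "integrable lborel \<rho>" "(LINT y|lborel. \<rho> y) = 1"
        using mollifierD(3,5)[OF \<rho>] by (auto simp: integrable_iff_bounded integral_eq_nn_integral)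
      have \<rho>x: "integrable lborel (\<lambda>y. \<rho> (x - y))" "(LINT y|lborel. \<rho> (x - y)) = 1"
        using integrable_lborel_reflect[OF \<rho>i(1)] integral_lborel_reflect[of \<rho> x] \<rho>i(2) by auto
      obtain C where C: "\<And>x. norm (\<rho> x) \<le> C"
        using compact_support_bounded[OF mollifierD(2)[OF \<rho>] mollifierD(4)[OF \<rho>]] by metis
      have gi': "integrable lborel (\<lambda>y. \<rho> (x - y) *\<^sub>R g y)"
        by (rule integrable_bounded_scaleR[OF gi, of _ C]) (use C in auto)
      have "mollify \<rho> g x - a x = (LINT y|lborel. \<rho> (x - y) *\<^sub>R g y) - (LINT y|lborel. \<rho> (x - y) * a x)"
        using \<rho>x by (simp add: mollify_def)
      also have "\<dots> = (LINT y|lborel. \<rho> (x - y) *\<^sub>R g y - \<rho> (x - y) * a x)"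
        using gi' \<rho>x by (intro Bochner_Integration.integral_diff[symmetric]) auto
      finally have "\<bar>mollify \<rho> g x - a x\<bar> \<le> (LINT y|lborel. \<bar>\<rho> (x - y) *\<^sub>R g y - \<rho> (x - y) * a x\<bar>)"
        by (simp only: integral_abs_bound)
      also have "\<dots> \<le> (LINT y|lborel. \<rho> (x - y) * e)"
      proof (rule integral_mono)
        fix y
        show "\<bar>\<rho> (x - y) *\<^sub>R g y - \<rho> (x - y) * a x\<bar> \<le> \<rho> (x - y) * e"
        proof (cases "r \<le> norm (x - y)")
          case True
          then show ?thesis using mollifierD(4)[OF \<rho>] by simp
        next
          case False
          then have "y \<in> {s - r0..t + r0}" "dist y x < d" using x r by (auto simp: dist_real_def)
          then have "\<bar>g y - a x\<bar> \<le> e" using d(2)[of y] by (simp add: g_def dist_real_def)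
          then have "\<rho> (x - y) * \<bar>g y - a x\<bar> \<le> \<rho> (x - y) * e"
            using mollifierD(3)[OF \<rho>] by (intro mult_left_mono)
          then show ?thesis using mollifierD(3)[OF \<rho>, of "x - y"] by (simp add: abs_mult flip: right_diff_distrib)
        qed
      qed (use gi' \<rho>x in auto)
      also have "\<dots> = e" using \<rho>x by simp
      finally show ?thesis .
    qed
    with r show ?thesis by blast
  qed
  have "\<bar>a t - a s\<bar> \<le> K * (t - s) + e" if e: "0 < e" for e
  proof -
    obtain r1 where r1: "0 < r1" "r1 \<le> r0" "\<And>\<rho>. is_mollifier r1 \<rho> \<Longrightarrow> \<bar>mollify \<rho> g t - a t\<bar> \<le> e / 2"
      using approx[of t "e / 2"] st e by auto
    obtain r2 where r2: "0 < r2" "r2 \<le> r0" "\<And>\<rho>. is_mollifier r2 \<rho> \<Longrightarrow> \<bar>mollify \<rho> g s - a s\<bar> \<le> e / 2"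
      using approx[of s "e / 2"] st e by auto
    \<comment> \<open>A kernel of the smaller radius satisfies the approximation condition at both
      end points.\<close>
    have "0 < min r1 r2" using r1 r2 by simp
    then obtain \<rho> :: "real \<Rightarrow> real" where \<rho>: "is_mollifier (min r1 r2) \<rho>" by (rule mollifier_exists)
    then have "is_mollifier r1 \<rho>" "is_mollifier r2 \<rho>" by (simp_all add: is_mollifier_def)
    with r1(3) r2(3) have "\<bar>mollify \<rho> g t - a t\<bar> \<le> e / 2" "\<bar>mollify \<rho> g s - a s\<bar> \<le> e / 2" by auto
    moreover have "\<bar>mollify \<rho> g t - mollify \<rho> g s\<bar> \<le> K * (t - s)"
      by (rule bound[OF \<rho>]) (use r1 r2 in auto)
    ultimately show ?thesis by linarith
  qed
  then show ?thesis by (rule field_le_epsilon)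
qed

text \<open>\<open>K\<close> is an essential bound of the weak time derivative. The scalar functions
  \<open>t \<mapsto> L2_inner D (u t) v\<close> are Lipschitz with constant
  \<open>K * l2n M v\<close>; choosing \<open>v\<close> as the increment itself and cancelling one
  factor \<open>l2n M v\<close> bounds its norm.\<close>

lemma W1_Lipschitz:
  fixes u :: "real \<Rightarrow> 'a \<Rightarrow> 'b::euclidean_space"
  assumes W: "u \<in> W1_Bochner_space T top (Lp_space D 2) (Lp_norm D 2)"
    and c: "continuous_into_L2 T D u"
  obtains K where "0 \<le> K" "\<forall>s t. 0 < s \<and> s \<le> t \<and> t < T \<longrightarrow> l2n M (\<lambda>x. u t x - u s x) \<le> K * (t - s)"
proof -
  let ?N = "time_interval T"
  interpret N: finite_measure ?N by (rule finite_time_interval)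
  obtain g where g: "g \<in> Bochner_space T top (Lp_space D 2) (Lp_norm D 2)"
    and gw: "\<And>\<phi>. test_function {0<..<T} \<phi> \<Longrightarrow>
      \<exists>I. has_Bochner_integral_in T (Lp_space D 2) (Lp_norm D 2) (\<lambda>t x. dirderiv 1 \<phi> t *\<^sub>R u t x) I \<and>
          has_Bochner_integral_in T (Lp_space D 2) (Lp_norm D 2) (\<lambda>t x. \<phi> t *\<^sub>R g t x) (\<lambda>x. - I x)"
    using W unfolding W1_Bochner_space_def by blast
  obtain K where K: "0 \<le> K" "AE t in ?N. Lp_norm D 2 (g t) \<le> ennreal K"
    using g esssup_bound unfolding Bochner_space_def by blast
  have gL: "AE t in ?N. sqint M (g t)"
    using g by (simp add: Bochner_space_def strongly_measurable_def Lp2_iff)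
  have gK: "AE t in ?N. l2n M (g t) \<le> K"
    using K(2) gL by eventually_elim (use K(1) in \<open>simp add: Lp2_norm\<close>)
  have us: "sqint M (u t)" if "t \<in> {0..T}" for t by (rule continuous_into_L2D(1)[OF c that])
  have inner_cont: "continuous_on {0..T} (\<lambda>t. L2_inner D (u t) v)" if v: "sqint M v" for v
    unfolding continuous_on_def
  proof
    fix t assume t: "t \<in> {0..T}"
    have lim0: "((\<lambda>s. l2n M (\<lambda>x. u s x - u t x) * l2n M v) \<longlongrightarrow> 0) (at t within {0..T})"
      using tendsto_mult_right[OF continuous_into_L2D(2)[OF c t], of "l2n M v"] by simp
    have le: "\<forall>\<^sub>F s in at t within {0..T}. norm (L2_inner D (u s) v - L2_inner D (u t) v) \<le> l2n M (\<lambda>x. u s x - u t x) * l2n M v"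
      unfolding eventually_at_filter
    proof (intro always_eventually allI impI)
      fix s assume "s \<in> {0..T}"
      then show "norm (L2_inner D (u s) v - L2_inner D (u t) v) \<le> l2n M (\<lambda>x. u s x - u t x) * l2n M v"
        using L2_inner_le[OF sqint_diff(1)[OF us us] v] L2_inner_diff(1)[OF us us v] t by simp
    qed
    have "((\<lambda>s. L2_inner D (u s) v - L2_inner D (u t) v) \<longlongrightarrow> 0) (at t within {0..T})"
      by (rule Lim_null_comparison[OF le lim0])
    then show "((\<lambda>s. L2_inner D (u s) v) \<longlongrightarrow> L2_inner D (u t) v) (at t within {0..T})"
      by (rule LIM_zero_cancel)
  qed
  have lip: "\<bar>L2_inner D (u t) v - L2_inner D (u s) v\<bar> \<le> (K * l2n M v) * (t - s)"
    if v: "sqint M v" and st: "0 < s" "s \<le> t" "t < T" for v s t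
  proof (rule weakly_Lipschitz[where T = T])
    show "continuous_on {0<..<T} (\<lambda>t. L2_inner D (u t) v)"
      using inner_cont[OF v] by (rule continuous_on_subset) auto
    show "0 \<le> K * l2n M v" using K by simp
    fix \<phi> :: "real \<Rightarrow> real" assume t: "test_function {0<..<T} \<phi>"
    note tD = test_functionD[OF t]
    have m1: "\<phi> \<in> borel_measurable ?N" "dirderiv 1 \<phi> \<in> borel_measurable ?N"
      using tD(4) tD(5)[of 1] by (auto intro!: measurable_completion measurable_restrict_space1)
    obtain C where C: "\<And>x. \<bar>\<phi> x\<bar> \<le> C" using tD(6) by blast
    obtain C' where C': "\<And>x. \<bar>dirderiv 1 \<phi> x\<bar> \<le> C'" using tD(7)[of 1] by auto
    obtain I where I: "has_Bochner_integral_in T (Lp_space D 2) (Lp_norm D 2) (\<lambda>t x. dirderiv 1 \<phi> t *\<^sub>R u t x) I"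
      "has_Bochner_integral_in T (Lp_space D 2) (Lp_norm D 2) (\<lambda>t x. \<phi> t *\<^sub>R g t x) (\<lambda>x. - I x)"
      using gw[OF t] by blast
    have e: "L2_inner D (\<lambda>x. dirderiv 1 \<phi> t *\<^sub>R u t x) v = dirderiv 1 \<phi> t * L2_inner D (u t) v" for t
      by (simp add: L2_inner_def)
    have ai: "integrable ?N (\<lambda>t. L2_inner D (u t) v)"
    proof -
      have "set_integrable lebesgue {0..T} (\<lambda>t. L2_inner D (u t) v)"
        using inner_cont[OF v] continuous_imp_integrable_real absolutely_integrable_continuous_real by blast
      then have "integrable (lebesgue_on {0..T}) (\<lambda>t. L2_inner D (u t) v)" by (simp add: set_integrable_eq)
      then show ?thesis by (rule integrable_lebesgue_on_subset) auto
    qed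
    have "integrable ?N (\<lambda>t. dirderiv 1 \<phi> t *\<^sub>R L2_inner D (u t) v)"
      by (rule integrable_bounded_scaleR[OF ai m1(2) C'])
    then have 1: "L2_inner D I v = (LINT t|?N. dirderiv 1 \<phi> t * L2_inner D (u t) v)"
      using Bochner_pairing(1)[OF I(1) v] by (simp add: e)
    have 2: "\<bar>L2_inner D (\<lambda>x. - I x) v\<bar> \<le> (LINT t|?N. K * \<bar>\<phi> t\<bar>) * l2n M v"
    proof (rule Bochner_pairing(2)[OF I(2) v])
      have "integrable ?N \<phi>"
        by (rule N.integrable_const_bound[of _ C]) (use C m1 in auto)
      then show "integrable ?N (\<lambda>t. K * \<bar>\<phi> t\<bar>)" by simp
      show "AE t in ?N. l2n M (\<lambda>x. \<phi> t *\<^sub>R g t x) \<le> K * \<bar>\<phi> t\<bar>"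
        using gL gK
      proof eventually_elim
        case (elim t)
        show ?case using mult_left_mono[OF elim(2), of "\<bar>\<phi> t\<bar>"] by (simp add: sqint_scaleR(2)[OF elim(1)] mult.commute)
      qed
    qed
    have "L2_inner D (\<lambda>x. - I x) v = - L2_inner D I v" by (simp add: L2_inner_def)
    with 1 2 show "\<bar>LINT t|?N. dirderiv 1 \<phi> t * L2_inner D (u t) v\<bar> \<le> K * l2n M v * (LINT t|?N. \<bar>\<phi> t\<bar>)"
      by (simp add: mult.assoc mult.commute mult.left_commute)
  qed (use st in auto)
  have "l2n M (\<lambda>x. u t x - u s x) \<le> K * (t - s)" if st: "0 < s" "s \<le> t" "t < T" for s t
  proof -
    have u: "sqint M (u t)" "sqint M (u s)" using us st by auto
    define v where "v = (\<lambda>x. u t x - u s x)"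
    have v: "sqint M v" unfolding v_def by (rule sqint_diff(1)[OF u])
    have "(l2n M v)\<^sup>2 = L2_inner D v v" by (simp add: l2n_sq L2_inner_def power2_norm_eq_inner)
    also have "\<dots> = L2_inner D (u t) v - L2_inner D (u s) v"
      by (subst v_def) (rule L2_inner_diff(1)[OF u v])
    also have "\<dots> \<le> (K * l2n M v) * (t - s)" using lip[OF v st] by linarith
    finally have le: "l2n M v * l2n M v \<le> l2n M v * (K * (t - s))"
      by (simp add: power2_eq_square mult.assoc mult.left_commute)
    show ?thesis unfolding v_def[symmetric]
    proof (cases "l2n M v = 0")
      case True
      then show "l2n M v \<le> K * (t - s)" using K(1) st by simp
    next
      case False
      then have "0 < l2n M v" using l2n_nonneg[of M v] by linarith
      with le show "l2n M v \<le> K * (t - s)" by simp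
    qed
  qed
  with K(1) show ?thesis by (intro that) auto
qed

end

subsection \<open>The weak formulation\<close>

text \<open>The stationary form of the equation: formally the time derivative of
  \<open>L2_inner D (u t) v\<close> is \<open>- llb_form\<close> at \<open>u t\<close> and
  \<open>v\<close>.\<close>

definition llb_form ::
  "'a::euclidean_space set \<Rightarrow> real \<Rightarrow> real \<Rightarrow> real \<Rightarrow> real \<Rightarrow> ('a \<Rightarrow> real^3) \<Rightarrow> ('a \<Rightarrow> real^3) \<Rightarrow> real" where
  "llb_form D \<kappa>1 \<kappa>2 \<mu> \<gamma> w v = \<kappa>1 * grad_inner D w v + \<gamma> * cross_grad_inner D w w v
     + \<kappa>2 * L2_inner D (llb_damping \<mu> w) v"

text \<open>The spatial half of \<open>llb_integrals_exist\<close> at a single time, where the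
  continuity of the form is needed.\<close>

definition llb_pairings_exist :: "'a::euclidean_space set \<Rightarrow> real \<Rightarrow> ('a \<Rightarrow> real^3) \<Rightarrow> bool" where
  "llb_pairings_exist D \<mu> w \<longleftrightarrow> (\<forall>v\<in>Hs_space D 1.
     (\<forall>b\<in>Basis. integrable (lebesgue_on D) (\<lambda>x. cross3 (w x) (weak_deriv D b w x) \<bullet> weak_deriv D b v x)) \<and>
     integrable (lebesgue_on D) (\<lambda>x. llb_damping \<mu> w x \<bullet> v x))"

lemma borel_measurable_cross3 [measurable]:
  assumes "f \<in> borel_measurable N" "g \<in> borel_measurable N"
  shows "(\<lambda>x. cross3 (f x) (g x)) \<in> borel_measurable N"
  by (rule borel_measurable_continuous_Pair[OF assms])
     (intro continuous_on_cross continuous_intros)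

lemma borel_measurable_llb_damping:
  assumes [measurable]: "f \<in> borel_measurable N"
  shows "llb_damping \<mu> f \<in> borel_measurable N"
  unfolding llb_damping_def by measurable

context bounded_open
begin

lemma h1n_minus_commute:
  assumes "f \<in> Hs_space D 1" "g \<in> Hs_space D 1"
  shows "h1n (\<lambda>x. f x - g x) = h1n (\<lambda>x. g x - f x)"
  using h1n_scaleR[OF H1_diff(1)[OF assms], of "-1"] by simp

lemma Bochner_H1D:
  fixes u :: "real \<Rightarrow> 'a \<Rightarrow> 'b::euclidean_space"
  assumes u: "u \<in> Bochner_space T top (Hs_space D 1) (Hs_norm D 1)"
  obtains s :: "nat \<Rightarrow> real \<Rightarrow> 'a \<Rightarrow> 'b" and K where
    "\<forall>n. simple_function (time_interval T) (s n)" "\<forall>n. \<forall>t\<in>{0<..<T}. s n t \<in> Hs_space D 1" "0 \<le> K"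
    "AE t in time_interval T. u t \<in> Hs_space D 1 \<and> h1n (u t) \<le> K \<and> (\<lambda>n. h1n (\<lambda>x. s n t x - u t x)) \<longlonglongrightarrow> 0"
proof -
  obtain K where K: "0 \<le> K" "AE t in time_interval T. Hs_norm D 1 (u t) \<le> ennreal K"
    using u esssup_bound unfolding Bochner_space_def by blast
  obtain s where s: "\<forall>n::nat. simple_function (time_interval T) (s n) \<and> (\<forall>t\<in>{0<..<T}. s n t \<in> Hs_space D 1)"
    "AE t in time_interval T. (\<lambda>n. Hs_norm D 1 (\<lambda>x. u t x - s n t x)) \<longlonglongrightarrow> 0"
    and uH: "AE t in time_interval T. u t \<in> Hs_space D 1"
    using u unfolding Bochner_space_def strongly_measurable_def by blast
  show ?thesis
  proof (rule that[of s, OF _ _ K(1)])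
    show "AE t in time_interval T. u t \<in> Hs_space D 1 \<and> h1n (u t) \<le> K \<and> (\<lambda>n. h1n (\<lambda>x. s n t x - u t x)) \<longlonglongrightarrow> 0"
      using K(2) s(2) uH AE_space
    proof eventually_elim
      case (elim t)
      have sH: "s n t \<in> Hs_space D 1" for n using s(1) elim(4) by simp
      have "h1n (u t) \<le> K" using elim(1) K(1) by (simp add: Hs_norm_1[OF elim(3)])
      moreover have "(\<lambda>n. h1n (\<lambda>x. u t x - s n t x)) \<longlonglongrightarrow> 0"
        using elim(2) by (simp add: Hs_norm_1[OF H1_diff(1)[OF elim(3) sH]] ennreal_tendsto_0_iff)
      ultimately show ?case using elim(3) by (simp add: h1n_minus_commute[OF elim(3) sH])
    qed
  qed (use s(1) in auto)
qed

text \<open>\<open>llb_integrals_exist\<close> covers the two nonlinear terms; for the diffusion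
  term integrability in time follows from the essential H1 bound, with measurability obtained as a
  limit of simple functions.\<close>

lemma grad_inner_integrable:
  assumes u: "u \<in> Bochner_space T top (Hs_space D 1) (Hs_norm D 1)" and v: "v \<in> Hs_space D 1"
  shows "integrable (time_interval T) (\<lambda>t. grad_inner D (u t) v)"
proof -
  let ?N = "time_interval T"
  interpret N: finite_measure ?N by (rule finite_time_interval)
  obtain s K where s: "\<forall>n. simple_function ?N (s n)" "\<forall>n. \<forall>t\<in>{0<..<T}. s n t \<in> Hs_space D 1" and K: "0 \<le> K"
    and ae: "AE t in ?N. u t \<in> Hs_space D 1 \<and> h1n (u t) \<le> K \<and> (\<lambda>n. h1n (\<lambda>x. s n t x - u t x)) \<longlonglongrightarrow> 0"
    by (rule Bochner_H1D[OF u])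
  define C where "C = (\<Sum>b\<in>Basis. l2n M (wd b v))"
  have le: "\<bar>grad_inner D f v\<bar> \<le> h1n f * C" if f: "f \<in> Hs_space D 1" for f
  proof -
    have "\<bar>grad_inner D f v\<bar> \<le> (\<Sum>b\<in>Basis. \<bar>L2_inner D (wd b f) (wd b v)\<bar>)"
      unfolding grad_inner_def by (rule sum_abs)
    also have "\<dots> \<le> (\<Sum>b\<in>Basis. h1n f * l2n M (wd b v))"
    proof (rule sum_mono)
      fix b :: 'a assume b: "b \<in> Basis"
      have "\<bar>L2_inner D (wd b f) (wd b v)\<bar> \<le> l2n M (wd b f) * l2n M (wd b v)"
        by (rule L2_inner_le[OF H1_wd(2)[OF f b] H1_wd(2)[OF v b]])
      also have "\<dots> \<le> h1n f * l2n M (wd b v)"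
        by (intro mult_right_mono l2n_le_h1n(2) b l2n_nonneg)
      finally show "\<bar>L2_inner D (wd b f) (wd b v)\<bar> \<le> h1n f * l2n M (wd b v)" .
    qed
    finally show ?thesis by (simp add: C_def sum_distrib_left)
  qed
  have diff: "grad_inner D (\<lambda>x. f x - g x) v = grad_inner D f v - grad_inner D g v"
    if f: "f \<in> Hs_space D 1" and g: "g \<in> Hs_space D 1" for f g
  proof -
    have "L2_inner D (wd b (\<lambda>x. f x - g x)) (wd b v) = L2_inner D (wd b f) (wd b v) - L2_inner D (wd b g) (wd b v)"
      if b: "b \<in> Basis" for b
    proof -
      note m = sqint_measurable[OF H1_wd(2)[OF _ b]]
      have "L2_inner D (wd b (\<lambda>x. f x - g x)) (wd b v) = L2_inner D (\<lambda>x. wd b f x - wd b g x) (wd b v)"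
        unfolding L2_inner_def
      proof (rule integral_cong_AE)
        show "AE x in M. wd b (\<lambda>x. f x - g x) x \<bullet> wd b v x = (wd b f x - wd b g x) \<bullet> wd b v x"
          using H1_diff(2)[OF f g b] by eventually_elim simp
      qed (use m[OF v] m[OF f] m[OF g] m[OF H1_diff(1)[OF f g]] in measurable)
      also have "\<dots> = L2_inner D (wd b f) (wd b v) - L2_inner D (wd b g) (wd b v)"
        by (rule L2_inner_diff(1)[OF H1_wd(2)[OF f b] H1_wd(2)[OF g b] H1_wd(2)[OF v b]])
      finally show ?thesis .
    qed
    then show ?thesis by (simp add: grad_inner_def sum_subtractf)
  qed
  define G where "G n t = grad_inner D (s n t) v" for n t
  have [measurable]: "G n \<in> borel_measurable ?N" for n
    unfolding G_def
    by (rule borel_measurable_simple_function[OF simple_function_compose1[OF s(1)[rule_format]]])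
  have H: "(\<lambda>t. lim (\<lambda>n. G n t)) \<in> borel_measurable ?N" by measurable
  have E: "AE t in ?N. lim (\<lambda>n. G n t) = grad_inner D (u t) v"
    using ae AE_space
  proof eventually_elim
    case (elim t)
    then have uH: "u t \<in> Hs_space D 1" and sH: "\<And>n. s n t \<in> Hs_space D 1" using s(2) by auto
    have "(\<lambda>n. h1n (\<lambda>x. s n t x - u t x) * C) \<longlonglongrightarrow> 0"
      using tendsto_mult_right[of "\<lambda>n. h1n (\<lambda>x. s n t x - u t x)" 0 sequentially C] elim(1) by simp
    then have "(\<lambda>n. G n t - grad_inner D (u t) v) \<longlonglongrightarrow> 0"
    proof (rule Lim_null_comparison[rotated], intro always_eventually allI)
      fix n
      show "norm (G n t - grad_inner D (u t) v) \<le> h1n (\<lambda>x. s n t x - u t x) * C"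
        using le[OF H1_diff(1)[OF sH uH], of n] by (simp add: G_def diff[OF sH uH])
    qed
    then have "(\<lambda>n. G n t) \<longlonglongrightarrow> grad_inner D (u t) v" by (rule LIM_zero_cancel)
    then show ?case by (rule limI)
  qed
  have m: "(\<lambda>t. grad_inner D (u t) v) \<in> borel_measurable ?N"
    by (rule measurable_lebesgue_on_AE[OF _ H E]) simp
  have "0 \<le> C" by (simp add: C_def sum_nonneg)
  show ?thesis
  proof (rule N.integrable_const_bound[OF _ m])
    show "AE t in ?N. norm (grad_inner D (u t) v) \<le> K * C"
      using ae
    proof eventually_elim
      case (elim t)
      then have "\<bar>grad_inner D (u t) v\<bar> \<le> h1n (u t) * C" using le by blast
      also have "\<dots> \<le> K * C" using elim \<open>0 \<le> C\<close> by (intro mult_right_mono) auto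
      finally show ?case by simp
    qed
  qed
qed

text \<open>The weak identities at \<open>t\<close> and \<open>t - h\<close> are subtracted at a
  left Lebesgue point of the form. The exceptional null set depends on \<open>v\<close>, so only
  countably many \<open>v\<close> can be treated together.\<close>

lemma weak_solution_left_derivative:
  assumes u: "llb_weak_solution \<kappa>1 \<kappa>2 \<mu> \<gamma> D \<alpha> T u0 u" and v: "v \<in> Hs_space D 1"
  shows "AE t in time_interval T. \<forall>e>0. \<exists>d>0. \<forall>h. 0 < h \<and> h < d \<longrightarrow>
    \<bar>L2_inner D (u t) v - L2_inner D (u (t - h)) v + h * llb_form D \<kappa>1 \<kappa>2 \<mu> \<gamma> (u t) v\<bar> \<le> e * h"
proof -
  let ?N = "time_interval T"
  let ?P = "\<lambda>t. llb_form D \<kappa>1 \<kappa>2 \<mu> \<gamma> (u t) v"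
  have i1: "integrable ?N (\<lambda>t. grad_inner D (u t) v)"
    using u v by (intro grad_inner_integrable) (simp add: llb_weak_solution_def)
  have i2: "integrable ?N (\<lambda>t. cross_grad_inner D (u t) (u t) v)"
    and i3: "integrable ?N (\<lambda>t. L2_inner D (llb_damping \<mu> (u t)) v)"
    using u v by (auto simp: llb_weak_solution_def llb_integrals_exist_def)
  have iP: "integrable ?N ?P" unfolding llb_form_def using i1 i2 i3 by simp
  have weak: "L2_inner D (u t) v = L2_inner D u0 v - (LINT r|lebesgue_on {0<..<t}. ?P r)" if t: "t \<in> {0<..<T}" for t
  proof -
    have sub: "integrable (lebesgue_on {0<..<t}) f" if "integrable ?N f" for f :: "real \<Rightarrow> real"
      by (rule integrable_lebesgue_on_subset[OF that]) (use t in auto)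
    have "(LINT r|lebesgue_on {0<..<t}. ?P r) = \<kappa>1 * (LINT s|lebesgue_on {0<..<t}. grad_inner D (u s) v)
        + \<gamma> * (LINT s|lebesgue_on {0<..<t}. cross_grad_inner D (u s) (u s) v)
        + \<kappa>2 * (LINT s|lebesgue_on {0<..<t}. L2_inner D (llb_damping \<mu> (u s)) v)"
      unfolding llb_form_def using sub[OF i1] sub[OF i2] sub[OF i3] by simp
    moreover have "L2_inner D (u t) v
        + \<kappa>1 * (LINT s|lebesgue_on {0<..<t}. grad_inner D (u s) v)
        + \<gamma> * (LINT s|lebesgue_on {0<..<t}. cross_grad_inner D (u s) (u s) v)
        + \<kappa>2 * (LINT s|lebesgue_on {0<..<t}. L2_inner D (llb_damping \<mu> (u s)) v)
        = L2_inner D u0 v"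
      using u t v unfolding llb_weak_solution_def by blast
    ultimately show ?thesis by linarith
  qed
  show ?thesis
    using left_Lebesgue_point[OF iP] AE_space
  proof eventually_elim
    case (elim t)
    then have t: "t \<in> {0<..<T}" by simp
    show ?case
    proof (intro allI impI)
      fix e :: real assume "0 < e"
      with elim(1) obtain d where d: "0 < d" "\<And>h. 0 < h \<and> h < d \<Longrightarrow>
        \<bar>(LINT r|lebesgue_on {0<..<t}. ?P r) - (LINT r|lebesgue_on {0<..<t - h}. ?P r) - h * ?P t\<bar> \<le> e * h"
        by meson
      show "\<exists>d>0. \<forall>h. 0 < h \<and> h < d \<longrightarrow> \<bar>L2_inner D (u t) v - L2_inner D (u (t - h)) v + h * ?P t\<bar> \<le> e * h"
      proof (intro exI[of _ "min d t"] conjI allI impI)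
        show "0 < min d t" using d t by simp
        fix h assume h: "0 < h \<and> h < min d t"
        then have "t - h \<in> {0<..<T}" using t by auto
        with d(2)[of h] h weak[OF t] weak[of "t - h"]
        show "\<bar>L2_inner D (u t) v - L2_inner D (u (t - h)) v + h * ?P t\<bar> \<le> e * h" by auto
      qed
    qed
  qed
qed

text \<open>All three terms are pairings defined on the whole of H1: the diffusion term by
  Cauchy-Schwarz, the others by \<open>ex\<close>. \<open>pairing_continuous\<close> then applies to
  each.\<close>

lemma llb_form_continuous:
  assumes w: "w \<in> Hs_space D 1" and ex: "llb_pairings_exist D \<mu> w"
    and y: "\<And>n. y n \<in> Hs_space D 1" "v \<in> Hs_space D 1" and lim: "(\<lambda>n. h1n (\<lambda>x. y n x - v x)) \<longlonglongrightarrow> 0"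
  shows "(\<lambda>n. llb_form D \<kappa>1 \<kappa>2 \<mu> \<gamma> w (y n)) \<longlonglongrightarrow> llb_form D \<kappa>1 \<kappa>2 \<mu> \<gamma> w v"
proof -
  note wm = sqint_measurable[OF H1_sqint[OF w]]
  have 1: "(\<lambda>n. grad_inner D w (y n)) \<longlonglongrightarrow> grad_inner D w v"
    unfolding grad_inner_def L2_inner_def
  proof (rule tendsto_sum)
    fix b :: 'a assume b: "b \<in> Basis"
    show "(\<lambda>n. \<integral>x. wd b w x \<bullet> wd b (y n) x \<partial>M) \<longlonglongrightarrow> (\<integral>x. wd b w x \<bullet> wd b v x \<partial>M)"
    proof (rule pairing_continuous[OF _ _ _ y lim])
      show "wd b = (\<lambda>v. v) \<or> (\<exists>b'\<in>Basis. wd b = wd b')" using b by blast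
      show "wd b w \<in> borel_measurable M" by (rule sqint_measurable[OF H1_wd(2)[OF w b]])
      show "integrable M (\<lambda>x. wd b w x \<bullet> wd b v' x)" if v': "v' \<in> Hs_space D 1" for v'
        by (rule sqint_inner(1)[OF H1_wd(2)[OF w b] H1_wd(2)[OF v' b]])
    qed
  qed
  have 2: "(\<lambda>n. cross_grad_inner D w w (y n)) \<longlonglongrightarrow> cross_grad_inner D w w v"
    unfolding cross_grad_inner_def L2_inner_def
  proof (rule tendsto_sum)
    fix b :: 'a assume b: "b \<in> Basis"
    show "(\<lambda>n. \<integral>x. cross3 (w x) (wd b w x) \<bullet> wd b (y n) x \<partial>M) \<longlonglongrightarrow> (\<integral>x. cross3 (w x) (wd b w x) \<bullet> wd b v x \<partial>M)"
    proof (rule pairing_continuous[OF _ _ _ y lim])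
      show "wd b = (\<lambda>v. v) \<or> (\<exists>b'\<in>Basis. wd b = wd b')" using b by blast
      show "(\<lambda>x. cross3 (w x) (wd b w x)) \<in> borel_measurable M"
        by (rule borel_measurable_cross3[OF wm sqint_measurable[OF H1_wd(2)[OF w b]]])
      show "integrable M (\<lambda>x. cross3 (w x) (wd b w x) \<bullet> wd b v' x)" if v': "v' \<in> Hs_space D 1" for v'
        using ex v' b by (simp add: llb_pairings_exist_def)
    qed
  qed
  have 3: "(\<lambda>n. L2_inner D (llb_damping \<mu> w) (y n)) \<longlonglongrightarrow> L2_inner D (llb_damping \<mu> w) v"
    unfolding L2_inner_def
  proof (rule pairing_continuous[where T = "\<lambda>v. v", OF _ _ _ y lim])
    show "integrable M (\<lambda>x. llb_damping \<mu> w x \<bullet> v' x)" if v': "v' \<in> Hs_space D 1" for v'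
      using ex v' by (simp add: llb_pairings_exist_def)
  qed (simp, rule borel_measurable_llb_damping[OF wm])
  show ?thesis unfolding llb_form_def by (intro tendsto_add tendsto_mult_left 1 2 3)
qed

end

subsection \<open>Decay of convex radial energies\<close>

text \<open>The argument \<open>q\<close> is a squared norm. \<open>C\<close> bounds
  \<open>\<beta>\<close> and \<open>2 * q * \<beta>'\<close>, the sizes of the two parts of the
  derivative of \<open>F\<close>, so \<open>F\<close> is globally Lipschitz. \<open>B\<close> enters
  as a convex antiderivative of \<open>\<beta>\<close>, through the tangent inequality
  \<open>B_diff\<close>.\<close>

locale radial_weight =
  fixes \<beta> \<beta>' B :: "real \<Rightarrow> real" and C :: real
  assumes der: "0 \<le> q \<Longrightarrow> (\<beta> has_real_derivative \<beta>' q) (at q)"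
    and cont': "continuous_on {0..} \<beta>'"
    and \<beta>_nonneg: "0 \<le> q \<Longrightarrow> 0 \<le> \<beta> q" and \<beta>_le: "0 \<le> q \<Longrightarrow> \<beta> q \<le> C"
    and \<beta>'_nonneg: "0 \<le> q \<Longrightarrow> 0 \<le> \<beta>' q" and \<beta>'_le: "0 \<le> q \<Longrightarrow> 2 * q * \<beta>' q \<le> C"
    and B_diff: "0 \<le> p \<Longrightarrow> 0 \<le> q \<Longrightarrow> B p - B q \<le> \<beta> p * (p - q)"
    and B_0: "B 0 = 0" and B_cont: "continuous_on {0..} B"
begin

definition F :: "'b::euclidean_space \<Rightarrow> 'b" where
  "F z = \<beta> (z \<bullet> z) *\<^sub>R z"

definition F' :: "'b::euclidean_space \<Rightarrow> 'b \<Rightarrow> 'b" where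
  "F' z y = \<beta> (z \<bullet> z) *\<^sub>R y + (2 * \<beta>' (z \<bullet> z) * (z \<bullet> y)) *\<^sub>R z"

lemma C_nonneg: "0 \<le> C"
  using \<beta>_nonneg[of 0] \<beta>_le[of 0] by simp

lemma F_has_derivative: "(F has_derivative F' z) (at z)"
proof -
  have "((\<lambda>z. z \<bullet> z) has_derivative (\<lambda>y. 2 * (z \<bullet> y))) (at z)"
    by (auto intro!: derivative_eq_intros simp: inner_commute)
  from DERIV_compose_FDERIV[OF der this]
  have "((\<lambda>z. \<beta> (z \<bullet> z)) has_derivative (\<lambda>y. 2 * (z \<bullet> y) * \<beta>' (z \<bullet> z))) (at z)"
    by simp
  from has_derivative_scaleR[OF this has_derivative_ident]
  show ?thesis
    by (simp add: F_def[abs_def] F'_def[abs_def] mult.commute mult.left_commute)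
qed

lemma F'_continuous: "continuous_on UNIV (\<lambda>z :: 'b::euclidean_space. F' z y)"
proof -
  have "continuous_on {0..} \<beta>"
    using der by (intro DERIV_continuous_on) (auto intro: has_field_derivative_at_within)
  then have "continuous_on UNIV (\<lambda>z::'b. \<beta> (z \<bullet> z))"
    by (rule continuous_on_compose2) (auto intro!: continuous_intros)
  moreover have "continuous_on UNIV (\<lambda>z::'b. \<beta>' (z \<bullet> z))"
    by (rule continuous_on_compose2[OF cont']) (auto intro!: continuous_intros)
  ultimately show ?thesis unfolding F'_def by (intro continuous_intros)
qed

lemma F'_bound: "norm (F' z y) \<le> (2 * C) * norm y"
proof -
  have "norm (F' z y) \<le> norm (\<beta> (z \<bullet> z) *\<^sub>R y) + norm ((2 * \<beta>' (z \<bullet> z) * (z \<bullet> y)) *\<^sub>R z)"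
    unfolding F'_def by (rule norm_triangle_ineq)
  also have "norm (\<beta> (z \<bullet> z) *\<^sub>R y) \<le> C * norm y"
    using \<beta>_nonneg[of "z \<bullet> z"] \<beta>_le[of "z \<bullet> z"] by (simp add: mult_right_mono)
  also have "norm ((2 * \<beta>' (z \<bullet> z) * (z \<bullet> y)) *\<^sub>R z) \<le> C * norm y"
  proof -
    have "norm ((2 * \<beta>' (z \<bullet> z) * (z \<bullet> y)) *\<^sub>R z) = 2 * \<beta>' (z \<bullet> z) * (\<bar>z \<bullet> y\<bar> * norm z)"
      using \<beta>'_nonneg[of "z \<bullet> z"] by (simp add: abs_mult)
    also have "\<dots> \<le> 2 * \<beta>' (z \<bullet> z) * ((norm z * norm y) * norm z)"
      using \<beta>'_nonneg[of "z \<bullet> z"] by (intro mult_left_mono mult_right_mono Cauchy_Schwarz_ineq2) auto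
    also have "\<dots> = (2 * (z \<bullet> z) * \<beta>' (z \<bullet> z)) * norm y"
      by (simp add: dot_square_norm power2_eq_square)
    also have "\<dots> \<le> C * norm y" using \<beta>'_le[of "z \<bullet> z"] by (intro mult_right_mono) auto
    finally show ?thesis .
  qed
  finally show ?thesis by simp
qed

lemma F_0: "F 0 = 0"
  by (simp add: F_def)

lemma F_norm: "norm (F z) \<le> C * norm z"
  using \<beta>_nonneg[of "z \<bullet> z"] \<beta>_le[of "z \<bullet> z"] by (simp add: F_def mult_right_mono)

lemma F_continuous: "continuous_on UNIV F"
  using F_has_derivative by (intro has_derivative_continuous_on) (auto intro: has_derivative_at_withinI)

lemma B_bounds: assumes "0 \<le> q" shows "0 \<le> B q" "B q \<le> C * q"
proof -
  have "B 0 - B q \<le> \<beta> 0 * (0 - q)" by (rule B_diff) (use assms in auto)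
  also have "\<dots> \<le> 0" using \<beta>_nonneg[of 0] assms by (simp add: mult_nonneg_nonneg)
  finally show "0 \<le> B q" using B_0 by simp
  have "B q - B 0 \<le> \<beta> q * (q - 0)" by (rule B_diff) (use assms in auto)
  also have "\<dots> \<le> C * q" using \<beta>_le[OF assms] assms by (simp add: mult_right_mono)
  finally show "B q \<le> C * q" using B_0 by simp
qed

text \<open>\<open>f \<bullet> f - g \<bullet> g\<close> is \<open>2 * (f \<bullet> (f - g))\<close>
  minus the squared norm of \<open>f - g\<close>, which is dropped because \<open>\<beta>\<close> is
  nonnegative.\<close>

lemma B_convex: "B (f \<bullet> f) - B (g \<bullet> g) \<le> 2 * (F f \<bullet> (f - g))"
proof -
  have "B (f \<bullet> f) - B (g \<bullet> g) \<le> \<beta> (f \<bullet> f) * (f \<bullet> f - g \<bullet> g)" by (rule B_diff) auto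
  also have "\<dots> \<le> \<beta> (f \<bullet> f) * (2 * (f \<bullet> (f - g)))"
  proof (intro mult_left_mono \<beta>_nonneg)
    have "0 \<le> (f - g) \<bullet> (f - g)" by simp
    then show "f \<bullet> f - g \<bullet> g \<le> 2 * (f \<bullet> (f - g))"
      by (simp add: inner_diff_left inner_diff_right inner_commute)
  qed simp
  finally show ?thesis by (simp add: F_def mult.left_commute)
qed

end

locale bounded_open_weight = bounded_open D + radial_weight \<beta> \<beta>' B C
  for D :: "'a::euclidean_space set" and \<beta> \<beta>' B C
begin

definition energy :: "('a \<Rightarrow> real^3) \<Rightarrow> real" where
  "energy f = (\<integral>x. B (f x \<bullet> f x) \<partial>M)"

lemma sqint_F:
  assumes "sqint M f"
  shows "sqint M (\<lambda>x. F (f x))" "l2n M (\<lambda>x. F (f x)) \<le> C * l2n M f"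
proof -
  have "(\<lambda>x. F (f x)) \<in> borel_measurable M"
    using borel_measurable_continuous_onI[OF F_continuous] sqint_measurable[OF assms] by measurable
  then show "sqint M (\<lambda>x. F (f x))" "l2n M (\<lambda>x. F (f x)) \<le> C * l2n M f"
    using sqint_bound[OF assms _ _ C_nonneg] F_norm by auto
qed

lemma energy_integrable:
  assumes f: "sqint M f"
  shows "integrable M (\<lambda>x. B (f x \<bullet> f x))"
proof (rule Bochner_Integration.integrable_bound)
  show "integrable M (\<lambda>x. C * (norm (f x))\<^sup>2)" using f by (simp add: sqint_def)
  have "continuous_on UNIV (\<lambda>z::'b. B (z \<bullet> z))"
    by (rule continuous_on_compose2[OF B_cont]) (auto intro!: continuous_intros)
  from borel_measurable_continuous_onI[OF this] sqint_measurable[OF f]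
  show "(\<lambda>x. B (f x \<bullet> f x)) \<in> borel_measurable M" by measurable
  show "AE x in M. norm (B (f x \<bullet> f x)) \<le> norm (C * (norm (f x))\<^sup>2)"
  proof (rule AE_I2)
    fix x
    show "norm (B (f x \<bullet> f x)) \<le> norm (C * (norm (f x))\<^sup>2)"
      using B_bounds[of "f x \<bullet> f x"] C_nonneg by (simp add: dot_square_norm)
  qed
qed

lemma energy_diff:
  assumes f: "sqint M f" and g: "sqint M g"
  shows "energy f - energy g \<le> 2 * L2_inner D (\<lambda>x. F (f x)) (\<lambda>x. f x - g x)"
proof -
  note i = sqint_inner(1)[OF sqint_F(1)[OF f] sqint_diff(1)[OF f g]]
  have "energy f - energy g = (\<integral>x. B (f x \<bullet> f x) - B (g x \<bullet> g x) \<partial>M)"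
    unfolding energy_def using energy_integrable[OF f] energy_integrable[OF g] by simp
  also have "\<dots> \<le> (\<integral>x. 2 * (F (f x) \<bullet> (f x - g x)) \<partial>M)"
    using energy_integrable[OF f] energy_integrable[OF g] i
    by (intro integral_mono B_convex) auto
  finally show ?thesis by (simp add: L2_inner_def)
qed

lemma energy_diff_le:
  assumes f: "sqint M f" and g: "sqint M g"
  shows "energy f - energy g \<le> 2 * (C * l2n M f) * l2n M (\<lambda>x. f x - g x)"
proof -
  have "L2_inner D (\<lambda>x. F (f x)) (\<lambda>x. f x - g x) \<le> l2n M (\<lambda>x. F (f x)) * l2n M (\<lambda>x. f x - g x)"
    using L2_inner_le[OF sqint_F(1)[OF f] sqint_diff(1)[OF f g]] by linarith
  also have "\<dots> \<le> (C * l2n M f) * l2n M (\<lambda>x. f x - g x)"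
    by (intro mult_right_mono sqint_F(2) f) simp
  finally show ?thesis using energy_diff[OF f g] by linarith
qed

text \<open>Tested with \<open>F (E w)\<close>, the diffusion is nonnegative because \<open>F\<close> is the gradient of a convex
  function, and the precession vanishes because \<open>F' z y\<close> lies in the span of \<open>z\<close> and \<open>y\<close>.\<close>

lemma llb_form_lower:
  assumes w: "w \<in> Hs_space D 1" and ex: "llb_pairings_exist D \<mu> w" and E: "0 < E"
    and \<kappa>: "0 \<le> \<kappa>1" "0 \<le> \<kappa>2" "0 \<le> \<mu>"
  shows "(\<lambda>x. F (E *\<^sub>R w x)) \<in> Hs_space D 1"
    "\<kappa>2 * L2_inner D w (\<lambda>x. F (E *\<^sub>R w x)) \<le> llb_form D \<kappa>1 \<kappa>2 \<mu> \<gamma> w (\<lambda>x. F (E *\<^sub>R w x))"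
proof -
  let ?V = "\<lambda>x. F (E *\<^sub>R w x)"
  note W = H1_scaleR[OF w, where c = E]
  note chain = H1_chain[OF W(1) F_has_derivative F'_continuous F'_bound _ F_0]
  have C2: "0 \<le> 2 * C" using C_nonneg by simp
  show V: "?V \<in> Hs_space D 1" by (rule chain(1)[OF C2])
  have wdV: "AE x in M. wd b ?V x = F' (E *\<^sub>R w x) (E *\<^sub>R wd b w x)" if b: "b \<in> Basis" for b
    using chain(2)[OF C2 b] W(2)[OF b] by eventually_elim simp
  have "0 \<le> grad_inner D w ?V"
    unfolding grad_inner_def L2_inner_def
  proof (intro sum_nonneg integral_nonneg_AE)
    fix b :: 'a assume b: "b \<in> Basis"
    show "AE x in M. 0 \<le> wd b w x \<bullet> wd b ?V x"
      using wdV[OF b]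
    proof eventually_elim
      case (elim x)
      let ?z = "E *\<^sub>R w x" and ?y = "wd b w x"
      have "?y \<bullet> F' ?z (E *\<^sub>R ?y) = E * (\<beta> (?z \<bullet> ?z) * (?y \<bullet> ?y)) + 2 * \<beta>' (?z \<bullet> ?z) * E * ((?z \<bullet> ?y) * (?z \<bullet> ?y))"
        unfolding F'_def inner_add_right inner_scaleR_right inner_scaleR_left inner_commute[of ?y "w x"] by algebra
      also have "0 \<le> \<dots>"
      proof (rule add_nonneg_nonneg)
        show "0 \<le> E * (\<beta> (?z \<bullet> ?z) * (?y \<bullet> ?y))"
          using E \<beta>_nonneg[of "?z \<bullet> ?z"] by simp
        have "0 \<le> 2 * \<beta>' (?z \<bullet> ?z) * E" using E \<beta>'_nonneg[of "?z \<bullet> ?z"] by simp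
        then show "0 \<le> 2 * \<beta>' (?z \<bullet> ?z) * E * ((?z \<bullet> ?y) * (?z \<bullet> ?y))"
          by (rule mult_nonneg_nonneg) (rule zero_le_square)
      qed
      finally show ?case by (simp only: elim)
    qed
  qed
  moreover have "cross_grad_inner D w w ?V = 0"
    unfolding cross_grad_inner_def L2_inner_def
  proof (intro sum.neutral ballI integral_eq_zero_AE)
    fix b :: 'a assume b: "b \<in> Basis"
    show "AE x in M. cross3 (w x) (wd b w x) \<bullet> wd b ?V x = 0"
      using wdV[OF b]
    proof eventually_elim
      case (elim x)
      show ?case by (simp add: elim F'_def inner_add_right dot_cross_self)
    qed
  qed
  moreover have "L2_inner D w ?V \<le> L2_inner D (llb_damping \<mu> w) ?V"
    unfolding L2_inner_def
  proof (rule integral_mono)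
    show "integrable M (\<lambda>x. w x \<bullet> ?V x)"
      by (rule sqint_inner(1)[OF H1_sqint[OF w] H1_sqint[OF V]])
    show "integrable M (\<lambda>x. llb_damping \<mu> w x \<bullet> ?V x)"
      using ex V by (simp add: llb_pairings_exist_def)
    fix x
    have "0 \<le> w x \<bullet> ?V x" using E \<beta>_nonneg[of "(E *\<^sub>R w x) \<bullet> (E *\<^sub>R w x)"] by (simp add: F_def)
    \<comment> \<open>The cubic part is dropped by its sign. The linear part keeps its exact
      constant, since it has to cancel the derivative of the exponential factor.\<close>
    then have "1 * (w x \<bullet> ?V x) \<le> (1 + \<mu> * (norm (w x))\<^sup>2) * (w x \<bullet> ?V x)"
      using \<kappa> by (intro mult_right_mono) auto
    then show "w x \<bullet> ?V x \<le> llb_damping \<mu> w x \<bullet> ?V x" by (simp add: llb_damping_def)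
  qed
  then have "\<kappa>2 * L2_inner D w ?V \<le> \<kappa>2 * L2_inner D (llb_damping \<mu> w) ?V"
    using \<kappa> by (intro mult_left_mono)
  moreover have "0 \<le> \<kappa>1 * grad_inner D w ?V"
    using \<kappa>(1) \<open>0 \<le> grad_inner D w ?V\<close> by (rule mult_nonneg_nonneg)
  ultimately show "\<kappa>2 * L2_inner D w ?V \<le> llb_form D \<kappa>1 \<kappa>2 \<mu> \<gamma> w ?V"
    by (simp add: llb_form_def)
qed

lemma l2n_scaled_tendsto:
  fixes f :: "nat \<Rightarrow> 'a \<Rightarrow> 'b::euclidean_space"
  assumes f: "\<And>n. sqint M (f n)" and g: "sqint M g"
    and l: "(\<lambda>n. l2n M (\<lambda>x. f n x - g x)) \<longlonglongrightarrow> 0" and q: "q \<longlonglongrightarrow> E"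
  shows "(\<lambda>n. l2n M (\<lambda>x. q n *\<^sub>R f n x - E *\<^sub>R g x)) \<longlonglongrightarrow> 0"
proof (rule tendsto_sandwich[OF _ _ tendsto_const])
  show "(\<lambda>n. \<bar>q n\<bar> * l2n M (\<lambda>x. f n x - g x) + \<bar>q n - E\<bar> * l2n M g) \<longlonglongrightarrow> 0"
  proof -
    have "(\<lambda>n. \<bar>q n\<bar> * l2n M (\<lambda>x. f n x - g x) + \<bar>q n - E\<bar> * l2n M g) \<longlonglongrightarrow> \<bar>E\<bar> * 0 + \<bar>E - E\<bar> * l2n M g"
      by (intro tendsto_intros l q)
    then show ?thesis by simp
  qed
  show "\<forall>\<^sub>F n in sequentially. l2n M (\<lambda>x. q n *\<^sub>R f n x - E *\<^sub>R g x) \<le> \<bar>q n\<bar> * l2n M (\<lambda>x. f n x - g x) + \<bar>q n - E\<bar> * l2n M g"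
  proof (intro always_eventually allI)
    fix n
    note d = sqint_diff(1)[OF f g, of n]
    have "(\<lambda>x. q n *\<^sub>R f n x - E *\<^sub>R g x) = (\<lambda>x. q n *\<^sub>R (f n x - g x) + (q n - E) *\<^sub>R g x)"
      by (simp add: algebra_simps fun_eq_iff)
    then show "l2n M (\<lambda>x. q n *\<^sub>R f n x - E *\<^sub>R g x) \<le> \<bar>q n\<bar> * l2n M (\<lambda>x. f n x - g x) + \<bar>q n - E\<bar> * l2n M g"
      using sqint_add(2)[OF sqint_scaleR(1)[OF d, of "q n"] sqint_scaleR(1)[OF g, of "q n - E"]]
      by (simp add: sqint_scaleR(2)[OF d] sqint_scaleR(2)[OF g])
  qed
qed simp

lemma h1n_scaled_tendsto:
  fixes f :: "nat \<Rightarrow> 'a \<Rightarrow> 'b::euclidean_space"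
  assumes f: "\<And>n. f n \<in> Hs_space D 1" and g: "g \<in> Hs_space D 1"
    and l: "(\<lambda>n. h1n (\<lambda>x. f n x - g x)) \<longlonglongrightarrow> 0" and q: "q \<longlonglongrightarrow> E"
  shows "(\<lambda>n. h1n (\<lambda>x. q n *\<^sub>R f n x - E *\<^sub>R g x)) \<longlonglongrightarrow> 0"
proof (rule h1n_tendsto_0)
  have "(\<lambda>n. l2n M (\<lambda>x. f n x - g x)) \<longlonglongrightarrow> 0"
    by (rule tendsto_sandwich[OF _ _ tendsto_const l]) (simp_all add: l2n_le_h1n)
  then show "(\<lambda>n. l2n M (\<lambda>x. q n *\<^sub>R f n x - E *\<^sub>R g x)) \<longlonglongrightarrow> 0"
    by (intro l2n_scaled_tendsto H1_sqint f g q)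
  fix b :: 'a assume b: "b \<in> Basis"
  have "(\<lambda>n. l2n M (\<lambda>x. wd b (f n) x - wd b g x)) \<longlonglongrightarrow> 0"
  proof (rule tendsto_sandwich[OF _ _ tendsto_const l])
    show "\<forall>\<^sub>F n in sequentially. l2n M (\<lambda>x. wd b (f n) x - wd b g x) \<le> h1n (\<lambda>x. f n x - g x)"
      unfolding H1_wd_diff_l2n[OF f g b, symmetric] by (intro always_eventually allI l2n_le_h1n(2) b)
  qed simp
  then have "(\<lambda>n. l2n M (\<lambda>x. q n *\<^sub>R wd b (f n) x - E *\<^sub>R wd b g x)) \<longlonglongrightarrow> 0"
    by (intro l2n_scaled_tendsto H1_wd f g q b)
  moreover have "l2n M (wd b (\<lambda>x. q n *\<^sub>R f n x - E *\<^sub>R g x)) = l2n M (\<lambda>x. q n *\<^sub>R wd b (f n) x - E *\<^sub>R wd b g x)" for n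
  proof -
    note sf = H1_scaleR[OF f[of n], where c = "q n"] and sg = H1_scaleR[OF g, where c = E]
    have s: "sqint M (\<lambda>x. q n *\<^sub>R wd b (f n) x - E *\<^sub>R wd b g x)"
      by (intro sqint_diff(1) sqint_scaleR(1) H1_wd(2) f g b)
    have "AE x in M. wd b (\<lambda>x. q n *\<^sub>R f n x - E *\<^sub>R g x) x = q n *\<^sub>R wd b (f n) x - E *\<^sub>R wd b g x"
      using H1_diff(2)[OF sf(1) sg(1) b] sf(2)[OF b] sg(2)[OF b] by eventually_elim simp
    from sqint_cong_AE(2)[OF H1_wd(2)[OF H1_diff(1)[OF sf(1) sg(1)] b] sqint_measurable[OF s] this]
    show ?thesis by simp
  qed
  ultimately show "(\<lambda>n. l2n M (wd b (\<lambda>x. q n *\<^sub>R f n x - E *\<^sub>R g x))) \<longlonglongrightarrow> 0" by simp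
qed

text \<open>The rational factor keeps the family of test functions countable.\<close>

lemma approximate_test:
  assumes w: "w \<in> Hs_space D 1" and ex: "llb_pairings_exist D \<mu> w" and E: "0 < E"
    and \<kappa>: "0 \<le> \<kappa>1" "0 \<le> \<kappa>2" "0 \<le> \<mu>"
    and s: "\<And>n. s n \<in> Hs_space D 1" and lim: "(\<lambda>n. h1n (\<lambda>x. s n x - w x)) \<longlonglongrightarrow> 0" and \<eta>: "0 < \<eta>"
  shows "\<exists>q\<in>\<rat>. \<exists>n. (\<lambda>x. F (q *\<^sub>R s n x)) \<in> Hs_space D 1 \<and>
     \<kappa>2 * L2_inner D w (\<lambda>x. F (E *\<^sub>R w x)) - \<eta> \<le> llb_form D \<kappa>1 \<kappa>2 \<mu> \<gamma> w (\<lambda>x. F (q *\<^sub>R s n x)) \<and>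
     l2n M (\<lambda>x. F (E *\<^sub>R w x) - F (q *\<^sub>R s n x)) \<le> \<eta>"
proof -
  let ?V = "\<lambda>x. F (E *\<^sub>R w x)"
  have "\<exists>q\<in>\<rat>. E < q \<and> q < E + inverse (real (Suc n))" for n
    using Rats_dense_in_real[of E "E + inverse (real (Suc n))"] by simp
  then obtain q where q: "\<And>n. q n \<in> \<rat>" "\<And>n. E < q n" "\<And>n. q n < E + inverse (real (Suc n))" by metis
  have "(\<lambda>n. E + inverse (real (Suc n))) \<longlonglongrightarrow> E + 0"
    by (rule tendsto_add[OF tendsto_const LIMSEQ_inverse_real_of_nat])
  then have qE': "(\<lambda>n. E + inverse (real (Suc n))) \<longlonglongrightarrow> E" by simp
  have qE: "q \<longlonglongrightarrow> E"
  proof (rule tendsto_sandwich[OF _ _ tendsto_const qE'])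
    show "\<forall>\<^sub>F n in sequentially. E \<le> q n"
      by (intro always_eventually allI less_imp_le q(2))
    show "\<forall>\<^sub>F n in sequentially. q n \<le> E + inverse (real (Suc n))"
      by (intro always_eventually allI less_imp_le q(3))
  qed
  define c where "c n = (\<lambda>x. q n *\<^sub>R s n x)" for n
  have cH: "c n \<in> Hs_space D 1" for n unfolding c_def by (rule H1_scaleR(1)[OF s])
  have cl: "(\<lambda>n. h1n (\<lambda>x. c n x - E *\<^sub>R w x)) \<longlonglongrightarrow> 0"
    unfolding c_def by (rule h1n_scaled_tendsto[OF s w lim qE])
  have C2: "0 \<le> 2 * C" using C_nonneg by simp
  \<comment> \<open>Convergence along a subsequence suffices, as a single index is sought.\<close>
  obtain r where r: "strict_mono r" "(\<lambda>n. h1n (\<lambda>x. F (c (r n) x) - ?V x)) \<longlonglongrightarrow> 0"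
    by (rule H1_chain_continuous[OF F_has_derivative F'_continuous F'_bound C2 F_0 cH H1_scaleR(1)[OF w] cl])
  note V = llb_form_lower[OF w ex E \<kappa>]
  have vH: "(\<lambda>x. F (c (r n) x)) \<in> Hs_space D 1" for n
    by (rule H1_chain(1)[OF cH F_has_derivative F'_continuous F'_bound C2 F_0])
  have "(\<lambda>n. llb_form D \<kappa>1 \<kappa>2 \<mu> \<gamma> w (\<lambda>x. F (c (r n) x))) \<longlonglongrightarrow> llb_form D \<kappa>1 \<kappa>2 \<mu> \<gamma> w ?V"
    by (rule llb_form_continuous[OF w ex vH V(1) r(2)])
  moreover have "\<kappa>2 * L2_inner D w ?V - \<eta> < llb_form D \<kappa>1 \<kappa>2 \<mu> \<gamma> w ?V" using V(2)[of \<gamma>] \<eta> by linarith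
  ultimately have "\<forall>\<^sub>F n in sequentially. \<kappa>2 * L2_inner D w ?V - \<eta> < llb_form D \<kappa>1 \<kappa>2 \<mu> \<gamma> w (\<lambda>x. F (c (r n) x))"
    by (rule order_tendstoD(1))
  moreover have "\<forall>\<^sub>F n in sequentially. h1n (\<lambda>x. F (c (r n) x) - ?V x) < \<eta>"
    by (rule order_tendstoD(2)[OF r(2) \<eta>])
  ultimately have "\<forall>\<^sub>F n in sequentially. \<kappa>2 * L2_inner D w ?V - \<eta> < llb_form D \<kappa>1 \<kappa>2 \<mu> \<gamma> w (\<lambda>x. F (c (r n) x))
      \<and> h1n (\<lambda>x. F (c (r n) x) - ?V x) < \<eta>" by (rule eventually_conj)
  then obtain n where n: "\<kappa>2 * L2_inner D w ?V - \<eta> < llb_form D \<kappa>1 \<kappa>2 \<mu> \<gamma> w (\<lambda>x. F (c (r n) x))"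
    "h1n (\<lambda>x. F (c (r n) x) - ?V x) < \<eta>"
    by (metis (no_types, lifting) eventually_sequentially order_refl)
  have "l2n M (\<lambda>x. ?V x - F (c (r n) x)) \<le> \<eta>"
    using l2n_le_h1n(1)[of "\<lambda>x. F (c (r n) x) - ?V x"] n(2) l2n_minus_commute[of M ?V] by simp
  then have "(\<lambda>x. F (q (r n) *\<^sub>R s (r n) x)) \<in> Hs_space D 1 \<and>
     \<kappa>2 * L2_inner D w ?V - \<eta> \<le> llb_form D \<kappa>1 \<kappa>2 \<mu> \<gamma> w (\<lambda>x. F (q (r n) *\<^sub>R s (r n) x)) \<and>
     l2n M (\<lambda>x. ?V x - F (q (r n) *\<^sub>R s (r n) x)) \<le> \<eta>"
    using n(1) vH[of n] by (simp add: c_def)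
  then show ?thesis using q(1)[of "r n"] by blast
qed

text \<open>Write \<open>E\<close> and \<open>Eh\<close> for the exponential factors at
  \<open>t\<close> and \<open>t - h\<close>. By convexity the energy difference is at most
  \<open>2 * (E * A + (E - Eh) * (X - A))\<close>. The equation makes \<open>E * A\<close> about
  \<open>- h * \<kappa>2 * E * X\<close>, while \<open>(E - Eh) * X\<close> is at most
  \<open>\<kappa>2 * E * h * X\<close>: the leading terms cancel and the rest is small compared with
  \<open>h\<close>. In \<open>app\<close>, \<open>v\<close> is a nearby admissible test function and
  \<open>p\<close> its left derivative with the sign reversed.\<close>

lemma left_Dini_energy:
  fixes u :: "real \<Rightarrow> 'a \<Rightarrow> real^3"
  assumes us: "\<And>s. s \<in> {0<..<T} \<Longrightarrow> sqint M (u s)" and t: "t \<in> {0<..<T}"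
    and K: "0 \<le> K" "\<And>s. 0 < s \<Longrightarrow> s \<le> t \<Longrightarrow> l2n M (\<lambda>x. u t x - u s x) \<le> K * (t - s)"
    and \<kappa>2: "0 \<le> \<kappa>2"
    and app: "\<And>\<eta>. 0 < \<eta> \<Longrightarrow> \<exists>v p. sqint M v \<and> \<kappa>2 * L2_inner D (u t) (\<lambda>x. F (exp (\<kappa>2 * t) *\<^sub>R u t x)) - \<eta> \<le> p \<and>
       l2n M (\<lambda>x. F (exp (\<kappa>2 * t) *\<^sub>R u t x) - v x) \<le> \<eta> \<and>
       (\<forall>e>0. \<exists>d>0. \<forall>h. 0 < h \<and> h < d \<longrightarrow> \<bar>L2_inner D (u t) v - L2_inner D (u (t - h)) v + h * p\<bar> \<le> e * h)"
    and e: "0 < e"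
  shows "\<exists>d>0. \<forall>h. 0 < h \<and> h < d \<longrightarrow>
    energy (\<lambda>x. exp (\<kappa>2 * t) *\<^sub>R u t x) - energy (\<lambda>x. exp (\<kappa>2 * (t - h)) *\<^sub>R u (t - h) x) \<le> e * h"
proof -
  define E where "E = exp (\<kappa>2 * t)"
  define V where "V = (\<lambda>x. F (E *\<^sub>R u t x))"
  define X where "X = L2_inner D (u t) V"
  have E: "0 < E" by (simp add: E_def)
  have ut: "sqint M (u t)" using us t .
  have V: "sqint M V" unfolding V_def by (rule sqint_F(1)[OF sqint_scaleR(1)[OF ut]])
  have X: "0 \<le> X"
    unfolding X_def L2_inner_def V_def using E \<beta>_nonneg by (intro integral_nonneg_AE AE_I2) (simp add: F_def)
  \<comment> \<open>Chosen so that the collected errors \<open>(E * (2 + K) + 1) * \<eta>\<close>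
    amount to \<open>e / 2\<close>; the factor 2 in \<open>energy_diff\<close> makes it
    \<open>e\<close>.\<close>
  define \<eta> where "\<eta> = e / (2 * (E * (2 + K) + 1))"
  have den: "0 < 2 * (E * (2 + K) + 1)" using E K(1) by (simp add: add_nonneg_pos)
  have \<eta>: "0 < \<eta>" using e den by (simp add: \<eta>_def)
  obtain v p d0 where v: "sqint M v" and p: "\<kappa>2 * X - \<eta> \<le> p" and vV: "l2n M (\<lambda>x. V x - v x) \<le> \<eta>"
    and d0: "0 < d0" "\<And>h. 0 < h \<and> h < d0 \<Longrightarrow> \<bar>L2_inner D (u t) v - L2_inner D (u (t - h)) v + h * p\<bar> \<le> \<eta> * h"
    using app[OF \<eta>] \<eta> unfolding X_def V_def E_def by meson
  \<comment> \<open>Coefficient of the second-order term \<open>(E - Eh) * \<bar>A\<bar>\<close>;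
    for \<open>h < d\<close> it contributes at most \<open>\<eta> * h\<close>.\<close>
  define S where "S = \<kappa>2 * E * (l2n M V * K)"
  have S: "0 \<le> S" unfolding S_def using \<kappa>2 E K(1) by simp
  define d where "d = min (min d0 t) (\<eta> / (S + 1))"
  have d: "0 < d" using d0 t \<eta> S by (simp add: d_def)
  have "energy (\<lambda>x. E *\<^sub>R u t x) - energy (\<lambda>x. exp (\<kappa>2 * (t - h)) *\<^sub>R u (t - h) x) \<le> e * h"
    if h: "0 < h \<and> h < d" for h
  proof -
    have h': "0 < h" "h < d0" "h < t" "h < \<eta> / (S + 1)" using h by (auto simp: d_def)
    have th: "t - h \<in> {0<..<T}" using t h' by auto
    note uth = us[OF th]
    define Eh where "Eh = exp (\<kappa>2 * (t - h))"
    have EE: "0 \<le> E - Eh" "E - Eh \<le> \<kappa>2 * E * h"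
    proof -
      have "Eh = E * exp (- (\<kappa>2 * h))" by (simp add: E_def Eh_def algebra_simps flip: exp_add)
      moreover have "1 - \<kappa>2 * h \<le> exp (- (\<kappa>2 * h))" using exp_ge_add_one_self[of "- (\<kappa>2 * h)"] by simp
      then have "E * (1 - \<kappa>2 * h) \<le> E * exp (- (\<kappa>2 * h))" using E by (intro mult_left_mono) auto
      ultimately show "E - Eh \<le> \<kappa>2 * E * h" by (simp add: algebra_simps)
      show "0 \<le> E - Eh" using \<kappa>2 h' by (simp add: E_def Eh_def mult_left_mono)
    qed
    define A where "A = L2_inner D V (\<lambda>x. u t x - u (t - h) x)"
    have sd: "sqint M (\<lambda>x. u t x - u (t - h) x)" by (rule sqint_diff(1)[OF ut uth])
    have lK: "l2n M (\<lambda>x. u t x - u (t - h) x) \<le> K * h" using K(2)[of "t - h"] h' by simp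
    have Aabs: "\<bar>A\<bar> \<le> l2n M V * (K * h)"
      unfolding A_def using L2_inner_le[OF V sd] mult_left_mono[OF lK l2n_nonneg] by (rule order_trans)
    \<comment> \<open>Three errors: \<open>\<eta>\<close> from the lower bound on \<open>p\<close>,
      \<open>\<eta>\<close> from the difference quotient, and \<open>K * \<eta>\<close> from
      replacing \<open>V\<close> by \<open>v\<close> against an increment of norm at most
      \<open>K * h\<close>.\<close>
    have A: "A \<le> h * (- (\<kappa>2 * X) + (2 + K) * \<eta>)"
    proof -
      have "A = L2_inner D (\<lambda>x. V x - v x) (\<lambda>x. u t x - u (t - h) x) + L2_inner D v (\<lambda>x. u t x - u (t - h) x)"
        unfolding A_def using L2_inner_diff(1)[OF V v sd] by simp
      moreover have "L2_inner D (\<lambda>x. V x - v x) (\<lambda>x. u t x - u (t - h) x) \<le> \<eta> * (K * h)"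
      proof -
        have "L2_inner D (\<lambda>x. V x - v x) (\<lambda>x. u t x - u (t - h) x) \<le> l2n M (\<lambda>x. V x - v x) * l2n M (\<lambda>x. u t x - u (t - h) x)"
          using L2_inner_le[OF sqint_diff(1)[OF V v] sd] by linarith
        also have "\<dots> \<le> \<eta> * (K * h)" using \<eta> by (intro mult_mono vV lK) auto
        finally show ?thesis .
      qed
      moreover have "L2_inner D v (\<lambda>x. u t x - u (t - h) x) = L2_inner D (u t) v - L2_inner D (u (t - h)) v"
        using L2_inner_diff(2)[OF ut uth v] by (simp add: L2_inner_def inner_commute)
      moreover have "L2_inner D (u t) v - L2_inner D (u (t - h)) v \<le> \<eta> * h - h * p"
        using d0(2)[of h] h' by (simp add: abs_le_iff)
      moreover have "h * (\<kappa>2 * X - \<eta>) \<le> h * p" using p h' by (intro mult_left_mono) auto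
      ultimately show ?thesis by (simp add: algebra_simps)
    qed
    have split: "L2_inner D V (\<lambda>x. E *\<^sub>R u t x - Eh *\<^sub>R u (t - h) x) = E * A + (E - Eh) * (X - A)"
    proof -
      have XA: "L2_inner D V (u (t - h)) = X - A"
        unfolding A_def X_def using L2_inner_diff(2)[OF ut uth V] by (simp add: L2_inner_def inner_commute)
      have Xc: "L2_inner D V (u t) = X" unfolding X_def by (simp add: L2_inner_def inner_commute)
      have "L2_inner D V (\<lambda>x. E *\<^sub>R u t x - Eh *\<^sub>R u (t - h) x) = E * L2_inner D V (u t) - Eh * L2_inner D V (u (t - h))"
        using L2_inner_diff(2)[OF sqint_scaleR(1)[OF ut] sqint_scaleR(1)[OF uth] V, of E Eh] by (simp add: L2_inner_def)
      then show ?thesis by (simp add: XA Xc algebra_simps)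
    qed
    have "(E - Eh) * (X - A) \<le> \<kappa>2 * E * h * X + \<eta> * h"
    proof -
      have "(E - Eh) * (X - A) \<le> (E - Eh) * X + (E - Eh) * \<bar>A\<bar>"
        using EE mult_left_mono[of "- A" "\<bar>A\<bar>" "E - Eh"] by (simp add: algebra_simps)
      also have "(E - Eh) * X \<le> \<kappa>2 * E * h * X" using EE X by (intro mult_right_mono) auto
      also have "(E - Eh) * \<bar>A\<bar> \<le> (\<kappa>2 * E * h) * (l2n M V * (K * h))"
        using EE Aabs \<kappa>2 E h' by (intro mult_mono) auto
      also have "\<dots> = (S * h) * h" by (simp add: S_def algebra_simps)
      also have "\<dots> \<le> \<eta> * h"
      proof -
        have "S * h \<le> (S + 1) * h" using h' by (simp add: algebra_simps)
        also have "\<dots> \<le> \<eta>" using h'(4) S by (simp add: pos_less_divide_eq mult.commute)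
        finally show ?thesis using h' by (intro mult_right_mono) auto
      qed
      finally show ?thesis by simp
    qed
    moreover have "E * A \<le> E * (h * (- (\<kappa>2 * X) + (2 + K) * \<eta>))" using A E by (intro mult_left_mono) auto
    ultimately have "E * A + (E - Eh) * (X - A) \<le> h * ((E * (2 + K) + 1) * \<eta>)" by (simp add: algebra_simps)
    also have "(E * (2 + K) + 1) * \<eta> = e / 2" using den by (simp add: \<eta>_def field_simps)
    finally have "2 * L2_inner D V (\<lambda>x. E *\<^sub>R u t x - Eh *\<^sub>R u (t - h) x) \<le> e * h"
      unfolding split by (simp add: mult.commute)
    moreover have "energy (\<lambda>x. E *\<^sub>R u t x) - energy (\<lambda>x. Eh *\<^sub>R u (t - h) x)
        \<le> 2 * L2_inner D V (\<lambda>x. E *\<^sub>R u t x - Eh *\<^sub>R u (t - h) x)"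
      unfolding V_def by (rule energy_diff[OF sqint_scaleR(1)[OF ut] sqint_scaleR(1)[OF uth]])
    ultimately show ?thesis by (simp add: Eh_def)
  qed
  with d show ?thesis unfolding E_def by blast
qed

end

text \<open>The weak time derivative gives the bound inside the open interval; continuity at 0
  extends it to the initial time, where the comparison starts.\<close>

lemma (in bounded_open) W1_Lipschitz_0:
  fixes u :: "real \<Rightarrow> 'a \<Rightarrow> 'b::euclidean_space"
  assumes W: "u \<in> W1_Bochner_space T top (Lp_space D 2) (Lp_norm D 2)"
    and c: "continuous_into_L2 T D u"
  obtains K where "0 \<le> K" "\<forall>s r. 0 \<le> s \<and> s \<le> r \<and> r < T \<longrightarrow> l2n M (\<lambda>x. u r x - u s x) \<le> K * (r - s)"
proof -
  obtain K where K: "0 \<le> K" "\<forall>s t. 0 < s \<and> s \<le> t \<and> t < T \<longrightarrow> l2n M (\<lambda>x. u t x - u s x) \<le> K * (t - s)"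
    by (rule W1_Lipschitz[OF W c])
  show ?thesis
  proof (rule that[OF K(1)], intro allI impI)
    fix s r :: real assume "0 \<le> s \<and> s \<le> r \<and> r < T"
    then have sr: "0 \<le> s" "s \<le> r" "r < T" by auto
    consider "0 < s" | "r = 0" "s = 0" | "s = 0" "0 < r" using sr by linarith
    then show "l2n M (\<lambda>x. u r x - u s x) \<le> K * (r - s)"
    proof cases
      case 1
      then show ?thesis using K(2) sr by blast
    next
      case 2
      then show ?thesis by (simp add: l2n_def)
    next
      case 3
      have su: "sqint M (u q)" if "0 \<le> q" "q \<le> T" for q
        using continuous_into_L2D(1)[OF c] that by simp
      have "((\<lambda>q. l2n M (\<lambda>x. u q x - u 0 x)) \<longlongrightarrow> 0) (at 0 within {0..T})"
        by (rule continuous_into_L2D(2)[OF c]) (use sr in simp)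
      note lim = this
      show ?thesis
      proof (rule field_le_epsilon)
        fix e :: real assume e: "0 < e"
        obtain d where d: "0 < d" "\<forall>q\<in>{0..T}. q \<noteq> 0 \<and> dist q 0 < d \<longrightarrow> l2n M (\<lambda>x. u q x - u 0 x) < e"
          using order_tendstoD(2)[OF lim e] unfolding eventually_at by blast
        define q where "q = min (d / 2) r"
        have q: "0 < q" "q \<le> r" "q < d" using d(1) 3 by (auto simp: q_def)
        have "l2n M (\<lambda>x. u q x - u 0 x) < e"
          by (rule d(2)[rule_format]) (use q sr in auto)
        moreover have "l2n M (\<lambda>x. u r x - u q x) \<le> K * (r - q)" using K(2) q sr by blast
        moreover have "K * (r - q) \<le> K * r" using K(1) q by (intro mult_left_mono) auto
        moreover have "l2n M (\<lambda>x. u r x - u 0 x) \<le> l2n M (\<lambda>x. u r x - u q x) + l2n M (\<lambda>x. u q x - u 0 x)"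
          by (intro l2n_triangle su) (use sr q in auto)
        ultimately show "l2n M (\<lambda>x. u r x - u s x) \<le> K * (r - s) + e" using 3 by simp
      qed
    qed
  qed
qed

context bounded_open_weight
begin

text \<open>The Dini argument needs this twice: as continuity and as the growth bound at exceptional
  times. On \<open>[0, t]\<close> the norms of \<open>u\<close> are at most \<open>U\<close> and the
  exponential factor is at most \<open>X\<close>.\<close>

lemma energy_Lipschitz:
  fixes u :: "real \<Rightarrow> 'a \<Rightarrow> real^3"
  assumes us: "\<And>r. 0 \<le> r \<Longrightarrow> r \<le> t \<Longrightarrow> sqint M (u r)" and \<kappa>2: "0 \<le> \<kappa>2" and t: "0 \<le> t"
    and K: "0 \<le> K" "\<And>s r. 0 \<le> s \<Longrightarrow> s \<le> r \<Longrightarrow> r \<le> t \<Longrightarrow> l2n M (\<lambda>x. u r x - u s x) \<le> K * (r - s)"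
  obtains L where "0 \<le> L" "\<forall>s r. 0 \<le> s \<and> s \<le> r \<and> r \<le> t \<longrightarrow>
    \<bar>energy (\<lambda>x. exp (\<kappa>2 * r) *\<^sub>R u r x) - energy (\<lambda>x. exp (\<kappa>2 * s) *\<^sub>R u s x)\<bar> \<le> L * (r - s)"
proof -
  define w where "w r = (\<lambda>x. exp (\<kappa>2 * r) *\<^sub>R u r x)" for r
  define X where "X = exp (\<kappa>2 * t)"
  define U where "U = l2n M (u 0) + K * t"
  have X: "0 \<le> X" by (simp add: X_def)
  have U: "0 \<le> U" using K(1) t by (simp add: U_def)
  have ws: "sqint M (w r)" if "0 \<le> r" "r \<le> t" for r
    unfolding w_def by (rule sqint_scaleR(1)[OF us[OF that]])
  have eX: "exp (\<kappa>2 * r) \<le> X" if "r \<le> t" for r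
    using \<kappa>2 that by (simp add: X_def mult_left_mono)
  have uU: "l2n M (u r) \<le> U" if r: "0 \<le> r" "r \<le> t" for r
  proof -
    have "l2n M (u r) - l2n M (u 0) \<le> l2n M (\<lambda>x. u r x - u 0 x)"
      using l2n_diff_le[OF us[OF r] us[of 0]] t by (simp add: abs_le_iff)
    also have "\<dots> \<le> K * (r - 0)" by (rule K(2)) (use r in auto)
    also have "\<dots> \<le> K * t" using K(1) r by (simp add: mult_left_mono)
    finally show ?thesis by (simp add: U_def)
  qed
  have wU: "l2n M (w r) \<le> X * U" if r: "0 \<le> r" "r \<le> t" for r
    unfolding w_def sqint_scaleR(2)[OF us[OF r]] abs_exp_cancel
    by (intro mult_mono eX uU r X l2n_nonneg)
  \<comment> \<open>Product rule for the exponential times \<open>u\<close>: \<open>X * K\<close>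
    from the increment of \<open>u\<close>, the rest from that of the exponential.\<close>
  define L where "L = X * K + (\<kappa>2 * X) * U"
  have L: "0 \<le> L" using X K(1) U \<kappa>2 by (simp add: L_def)
  have wL: "l2n M (\<lambda>x. w r x - w s x) \<le> L * (r - s)" if s: "0 \<le> s" "s \<le> r" "r \<le> t" for r s
  proof -
    have r0: "0 \<le> r" and st: "s \<le> t" using s by auto
    note d = sqint_diff(1)[OF us[OF r0 s(3)] us[OF s(1) st]]
    have "exp (\<kappa>2 * s) = exp (\<kappa>2 * r) * exp (- (\<kappa>2 * (r - s)))" by (simp add: algebra_simps flip: exp_add)
    moreover have "exp (\<kappa>2 * r) * (1 - \<kappa>2 * (r - s)) \<le> exp (\<kappa>2 * r) * exp (- (\<kappa>2 * (r - s)))"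
      using exp_ge_add_one_self[of "- (\<kappa>2 * (r - s))"] by (intro mult_left_mono) auto
    ultimately have "exp (\<kappa>2 * r) - exp (\<kappa>2 * s) \<le> exp (\<kappa>2 * r) * (\<kappa>2 * (r - s))" by (simp add: algebra_simps)
    also have "\<dots> \<le> X * (\<kappa>2 * (r - s))" using \<kappa>2 s by (intro mult_right_mono eX) auto
    finally have E1: "exp (\<kappa>2 * r) - exp (\<kappa>2 * s) \<le> X * (\<kappa>2 * (r - s))" .
    have E0: "0 \<le> exp (\<kappa>2 * r) - exp (\<kappa>2 * s)" using \<kappa>2 s by (simp add: mult_left_mono)
    have "(\<lambda>x. w r x - w s x) = (\<lambda>x. exp (\<kappa>2 * r) *\<^sub>R (u r x - u s x) + (exp (\<kappa>2 * r) - exp (\<kappa>2 * s)) *\<^sub>R u s x)"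
      by (simp add: w_def algebra_simps fun_eq_iff)
    then have "l2n M (\<lambda>x. w r x - w s x) \<le> exp (\<kappa>2 * r) * l2n M (\<lambda>x. u r x - u s x)
        + (exp (\<kappa>2 * r) - exp (\<kappa>2 * s)) * l2n M (u s)"
      using sqint_add(2)[OF sqint_scaleR(1)[OF d, of "exp (\<kappa>2 * r)"]
          sqint_scaleR(1)[OF us[OF s(1) st], of "exp (\<kappa>2 * r) - exp (\<kappa>2 * s)"]] E0
      by (simp add: sqint_scaleR(2)[OF d] sqint_scaleR(2)[OF us[OF s(1) st]])
    also have "exp (\<kappa>2 * r) * l2n M (\<lambda>x. u r x - u s x) \<le> X * (K * (r - s))"
      by (intro mult_mono eX K(2) s X l2n_nonneg)
    also have "(exp (\<kappa>2 * r) - exp (\<kappa>2 * s)) * l2n M (u s) \<le> (X * (\<kappa>2 * (r - s))) * U"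
      using X \<kappa>2 s by (intro mult_mono E1 uU s(1) st l2n_nonneg) auto
    finally show ?thesis by (simp add: L_def algebra_simps)
  qed
  have side: "energy (w a) - energy (w b) \<le> (2 * (C * (X * U)) * L) * \<bar>a - b\<bar>"
    if a: "0 \<le> a" "a \<le> t" and b: "0 \<le> b" "b \<le> t" for a b
  proof -
    have le: "l2n M (\<lambda>x. w a x - w b x) \<le> L * \<bar>a - b\<bar>"
    proof (cases "b \<le> a")
      case True
      then show ?thesis using wL[OF b(1) True a(2)] by simp
    next
      case False
      then show ?thesis using wL[OF a(1) _ b(2)] l2n_minus_commute[of M "w a" "w b"] by simp
    qed
    have "energy (w a) - energy (w b) \<le> (2 * (C * l2n M (w a))) * l2n M (\<lambda>x. w a x - w b x)"
      using energy_diff_le[OF ws[OF a] ws[OF b]] by simp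
    also have "\<dots> \<le> (2 * (C * (X * U))) * (L * \<bar>a - b\<bar>)"
      using C_nonneg X U by (intro mult_mono mult_left_mono wU a le l2n_nonneg mult_nonneg_nonneg) auto
    finally show ?thesis by (simp add: mult.assoc)
  qed
  show ?thesis
  proof (rule that[of "2 * (C * (X * U)) * L"], goal_cases)
    case 1
    show "0 \<le> 2 * (C * (X * U)) * L" using C_nonneg X U L by simp
  next
    case 2
    show ?case
    proof (intro allI impI)
      fix s r :: real assume "0 \<le> s \<and> s \<le> r \<and> r \<le> t"
      then have s: "0 \<le> s" "s \<le> r" "r \<le> t" by auto
      then have r: "0 \<le> r" "s \<le> t" "\<bar>r - s\<bar> = r - s" "\<bar>s - r\<bar> = r - s" by auto
      show "\<bar>energy (\<lambda>x. exp (\<kappa>2 * r) *\<^sub>R u r x) - energy (\<lambda>x. exp (\<kappa>2 * s) *\<^sub>R u s x)\<bar> \<le> 2 * (C * (X * U)) * L * (r - s)"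
        using side[OF r(1) s(3) s(1) r(2)] side[OF s(1) r(2) r(1) s(3)]
        unfolding w_def r(3,4) by (simp add: abs_le_iff)
    qed
  qed
qed

text \<open>The exceptional sets for the H1 approximation, for the existence of the pairings and for
  the countably many left derivatives are merged into one null set \<open>N\<close>; off
  \<open>N\<close> the Dini estimate holds, and the Lipschitz bound takes care of
  \<open>N\<close>.\<close>

lemma energy_decay:
  fixes u :: "real \<Rightarrow> 'a \<Rightarrow> real^3"
  assumes u: "llb_strong_solution \<kappa>1 \<kappa>2 \<mu> \<gamma> D \<alpha> T u0 u"
    and \<kappa>: "0 \<le> \<kappa>1" "0 \<le> \<kappa>2" "0 \<le> \<mu>" and t: "0 \<le> t" "t < T"
  shows "energy (\<lambda>x. exp (\<kappa>2 * t) *\<^sub>R u t x) \<le> energy u0"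
proof -
  let ?N = "time_interval T"
  have wk: "llb_weak_solution \<kappa>1 \<kappa>2 \<mu> \<gamma> D \<alpha> T u0 u" using u by (simp add: llb_strong_solution_def)
  have c: "continuous_into_L2 T D u" and uB: "u \<in> Bochner_space T top (Hs_space D 1) (Hs_norm D 1)"
    and init: "AE x in M. u 0 x = u0 x" and u0: "u0 \<in> Hs_space D 1"
    and ie: "llb_integrals_exist \<mu> D T u"
    using wk by (auto simp: llb_weak_solution_def)
  have uW: "u \<in> W1_Bochner_space T top (Lp_space D 2) (Lp_norm D 2)"
    using u by (simp add: llb_strong_solution_def)
  have us: "sqint M (u r)" if "0 \<le> r" "r \<le> T" for r
    using continuous_into_L2D(1)[OF c] that by simp
  obtain K where K: "0 \<le> K" "\<forall>s r. 0 \<le> s \<and> s \<le> r \<and> r < T \<longrightarrow> l2n M (\<lambda>x. u r x - u s x) \<le> K * (r - s)"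
    by (rule W1_Lipschitz_0[OF uW c])
  obtain s :: "nat \<Rightarrow> real \<Rightarrow> 'a \<Rightarrow> real^3" and K' where s: "\<forall>n. simple_function ?N (s n)"
      "\<forall>n. \<forall>t\<in>{0<..<T}. s n t \<in> Hs_space D 1"
    and sl: "AE t in ?N. u t \<in> Hs_space D 1 \<and> h1n (u t) \<le> K' \<and> (\<lambda>n. h1n (\<lambda>x. s n t x - u t x)) \<longlonglongrightarrow> 0"
    by (rule Bochner_H1D[OF uB]) 
  have pe: "AE t in ?N. llb_pairings_exist D \<mu> (u t)"
    using ie unfolding llb_integrals_exist_def llb_pairings_exist_def by blast
  define der where "der v t \<longleftrightarrow> (\<forall>e>0. \<exists>d>0. \<forall>h. 0 < h \<and> h < d \<longrightarrow>
    \<bar>L2_inner D (u t) v - L2_inner D (u (t - h)) v + h * llb_form D \<kappa>1 \<kappa>2 \<mu> \<gamma> (u t) v\<bar> \<le> e * h)" for v t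
  \<comment> \<open>The test functions are \<open>F (q c)\<close> with \<open>q\<close> rational and
    \<open>c\<close> a value of some simple function \<open>s n\<close>: a countable family, fixed
    before the time is chosen.\<close>
  have dv: "AE t in ?N. \<forall>q\<in>\<rat>. \<forall>n. \<forall>c\<in>s n ` {0<..<T}. (\<lambda>x. F (q *\<^sub>R c x)) \<in> Hs_space D 1 \<longrightarrow> der (\<lambda>x. F (q *\<^sub>R c x)) t"
  proof -
    have fin: "countable (s n ` {0<..<T})" for n
      using simple_functionD(1)[OF s(1)[rule_format, of n]] by (simp add: countable_finite)
    have one: "AE t in ?N. v \<in> Hs_space D 1 \<longrightarrow> der v t" for v
    proof (cases "v \<in> Hs_space D 1")
      case True
      from weak_solution_left_derivative[OF wk True] show ?thesis
        unfolding der_def by eventually_elim simp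
    qed simp
    show ?thesis
      unfolding AE_ball_countable[OF countable_rat] AE_all_countable AE_ball_countable[OF fin]
      by (intro ballI allI one)
  qed
  define good where "good t \<longleftrightarrow> u t \<in> Hs_space D 1 \<and> (\<lambda>n. h1n (\<lambda>x. s n t x - u t x)) \<longlonglongrightarrow> 0 \<and>
     llb_pairings_exist D \<mu> (u t) \<and>
     (\<forall>q\<in>\<rat>. \<forall>n. \<forall>c\<in>s n ` {0<..<T}. (\<lambda>x. F (q *\<^sub>R c x)) \<in> Hs_space D 1 \<longrightarrow> der (\<lambda>x. F (q *\<^sub>R c x)) t)" for t
  have "AE t in ?N. good t" using sl pe dv by eventually_elim (simp add: good_def)
  then have "AE t in lebesgue. t \<in> {0<..<T} \<longrightarrow> good t" by (subst (asm) AE_restrict_space_iff) auto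
  then obtain N where N: "N \<in> null_sets lebesgue" "{t \<in> space lebesgue. \<not> (t \<in> {0<..<T} \<longrightarrow> good t)} \<subseteq> N"
    unfolding eventually_ae_filter by blast
  have good: "good r" if "0 < r" "r < T" "r \<notin> N" for r using N(2) that by auto
  let ?e = "\<lambda>r. energy (\<lambda>x. exp (\<kappa>2 * r) *\<^sub>R u r x)"
  have ust: "sqint M (u r)" if "0 \<le> r" "r \<le> t" for r using us that t by simp
  have Kt: "l2n M (\<lambda>x. u r x - u q x) \<le> K * (r - q)" if "0 \<le> q" "q \<le> r" "r \<le> t" for q r
    by (rule K(2)[rule_format]) (use that t in auto)
  obtain L where L: "0 \<le> L" "\<forall>q r. 0 \<le> q \<and> q \<le> r \<and> r \<le> t \<longrightarrow> \<bar>?e r - ?e q\<bar> \<le> L * (r - q)"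
    by (rule energy_Lipschitz[OF ust \<kappa>(2) t(1) K(1) Kt])
  have "?e t \<le> ?e 0"
  proof (rule nonincreasing_if_left_Dini_AE[OF t(1) _ _ L(1) N(1)])
    have "L-lipschitz_on {0..t} ?e"
    proof (rule lipschitz_onI[OF _ L(1)])
      fix x y assume "x \<in> {0..t}" "y \<in> {0..t}"
      then show "dist (?e x) (?e y) \<le> L * dist x y"
        using L(2)[rule_format, of x y] L(2)[rule_format, of y x] by (cases "x \<le> y") (auto simp: dist_real_def abs_minus_commute)
    qed
    then show "continuous_on {0..t} ?e" by (rule lipschitz_on_continuous_on)
    show "?e x - ?e y \<le> L * (x - y)" if "0 \<le> y" "y < x" "x \<le> t" for x y
      using L(2)[rule_format, of y x] that by simp
    fix x e :: real assume x: "0 < x" "x \<le> t" "x \<notin> N" and e: "0 < e"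
    have xT: "x \<in> {0<..<T}" using x t by auto
    have g: "good x" by (rule good) (use x t in auto)
    have app: "\<exists>v p. sqint M v \<and> \<kappa>2 * L2_inner D (u x) (\<lambda>y. F (exp (\<kappa>2 * x) *\<^sub>R u x y)) - \<eta> \<le> p \<and>
       l2n M (\<lambda>y. F (exp (\<kappa>2 * x) *\<^sub>R u x y) - v y) \<le> \<eta> \<and>
       (\<forall>e>0. \<exists>d>0. \<forall>h. 0 < h \<and> h < d \<longrightarrow> \<bar>L2_inner D (u x) v - L2_inner D (u (x - h)) v + h * p\<bar> \<le> e * h)"
      if \<eta>: "0 < \<eta>" for \<eta>
    proof -
      have H: "s n x \<in> Hs_space D 1" for n using s(2) xT by blast
      have g1: "u x \<in> Hs_space D 1" and g2: "(\<lambda>n. h1n (\<lambda>y. s n x y - u x y)) \<longlonglongrightarrow> 0"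
        and g3: "llb_pairings_exist D \<mu> (u x)"
        and g4: "\<And>q n. q \<in> \<rat> \<Longrightarrow> (\<lambda>y. F (q *\<^sub>R s n x y)) \<in> Hs_space D 1 \<Longrightarrow> der (\<lambda>y. F (q *\<^sub>R s n x y)) x"
        using g xT unfolding good_def by auto
      obtain q n where q: "q \<in> \<rat>" and v: "(\<lambda>y. F (q *\<^sub>R s n x y)) \<in> Hs_space D 1"
        and 1: "\<kappa>2 * L2_inner D (u x) (\<lambda>y. F (exp (\<kappa>2 * x) *\<^sub>R u x y)) - \<eta>
             \<le> llb_form D \<kappa>1 \<kappa>2 \<mu> \<gamma> (u x) (\<lambda>y. F (q *\<^sub>R s n x y))"
        and 2: "l2n M (\<lambda>y. F (exp (\<kappa>2 * x) *\<^sub>R u x y) - F (q *\<^sub>R s n x y)) \<le> \<eta>"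
        using approximate_test[OF g1 g3 exp_gt_zero \<kappa> H g2 \<eta>] by blast
      show ?thesis
        by (rule exI[of _ "\<lambda>y. F (q *\<^sub>R s n x y)"], rule exI[of _ "llb_form D \<kappa>1 \<kappa>2 \<mu> \<gamma> (u x) (\<lambda>y. F (q *\<^sub>R s n x y))"],
            intro conjI H1_sqint[OF v] 1 2 g4[OF q v, unfolded der_def])
    qed
    have usT: "sqint M (u r)" if "r \<in> {0<..<T}" for r using us that by simp
    have Kx: "l2n M (\<lambda>y. u x y - u r y) \<le> K * (x - r)" if "0 < r" "r \<le> x" for r
      by (rule K(2)[rule_format]) (use that x t in auto)
    obtain d where d: "0 < d" "\<forall>h. 0 < h \<and> h < d \<longrightarrow> ?e x - ?e (x - h) \<le> e * h"
      using left_Dini_energy[OF usT xT K(1) Kx \<kappa>(2) app e] by blast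
    \<comment> \<open>Halving \<open>d\<close> makes the inequality strict, and the minimum with
      \<open>x\<close> keeps \<open>x - h\<close> nonnegative.\<close>
    show "\<exists>h>0. h \<le> x - 0 \<and> ?e x - ?e (x - h) \<le> e * h"
      by (rule exI[of _ "min (d / 2) x"]) (use d x in \<open>auto simp: min_def\<close>)
  qed
  also have "?e 0 = energy u0"
  proof -
    have m: "u 0 \<in> borel_measurable M" "u0 \<in> borel_measurable M"
      using sqint_measurable[OF us[of 0]] sqint_measurable[OF H1_sqint[OF u0]] t by auto
    have "continuous_on UNIV (\<lambda>z::real^3. B (z \<bullet> z))"
      by (rule continuous_on_compose2[OF B_cont]) (auto intro!: continuous_intros)
    note Bm = borel_measurable_continuous_onI[OF this]
    have "(\<integral>x. B (u 0 x \<bullet> u 0 x) \<partial>M) = (\<integral>x. B (u0 x \<bullet> u0 x) \<partial>M)"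
    proof (rule integral_cong_AE)
      show "(\<lambda>x. B (u 0 x \<bullet> u 0 x)) \<in> borel_measurable M" using Bm m(1) by measurable
      show "(\<lambda>x. B (u0 x \<bullet> u0 x)) \<in> borel_measurable M" using Bm m(2) by measurable
      show "AE x in M. B (u 0 x \<bullet> u 0 x) = B (u0 x \<bullet> u0 x)" using init by eventually_elim simp
    qed
    then show ?thesis by (simp add: energy_def)
  qed
  finally show ?thesis .
qed

end

subsection \<open>Truncated powers as weights\<close>

text \<open>The tangent inequality for the convex antiderivative: between \<open>p\<close> and
  \<open>q\<close> the integrand is compared with its value at \<open>p\<close>.\<close>

lemma integral_diff_le_if_mono:
  fixes \<beta> :: "real \<Rightarrow> real"
  assumes cont: "continuous_on {0..} \<beta>" and mono: "\<And>p q. 0 \<le> p \<Longrightarrow> p \<le> q \<Longrightarrow> \<beta> p \<le> \<beta> q"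
    and pq: "0 \<le> p" "0 \<le> q"
  shows "integral {0..p} \<beta> - integral {0..q} \<beta> \<le> \<beta> p * (p - q)"
proof -
  have int: "\<beta> integrable_on {a..b}" if "0 \<le> a" for a b
    by (rule integrable_continuous_interval) (rule continuous_on_subset[OF cont], use that in auto)
  show ?thesis
  proof (cases "q \<le> p")
    case True
    have "integral {0..q} \<beta> + integral {q..p} \<beta> = integral {0..p} \<beta>"
      by (rule Henstock_Kurzweil_Integration.integral_combine[OF pq(2) True int]) simp
    moreover have "integral {q..p} \<beta> \<le> integral {q..p} (\<lambda>_. \<beta> p)"
      by (rule integral_le) (use pq in \<open>auto intro!: int mono\<close>)
    ultimately show ?thesis using True by (simp add: mult.commute)
  next
    case False
    have "integral {0..p} \<beta> + integral {p..q} \<beta> = integral {0..q} \<beta>"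
      by (rule Henstock_Kurzweil_Integration.integral_combine[OF pq(1) _ int]) (use False in simp_all)
    moreover have "integral {p..q} (\<lambda>_. \<beta> p) \<le> integral {p..q} \<beta>"
      by (rule integral_le) (use pq in \<open>auto intro!: int mono\<close>)
    ultimately show ?thesis using False by (simp add: algebra_simps)
  qed
qed

lemma continuous_on_integral_upper:
  fixes \<beta> :: "real \<Rightarrow> real"
  assumes cont: "continuous_on {0..} \<beta>" and mono: "\<And>p q. 0 \<le> p \<Longrightarrow> p \<le> q \<Longrightarrow> \<beta> p \<le> \<beta> q"
    and bd: "\<And>q. 0 \<le> q \<Longrightarrow> 0 \<le> \<beta> q" "\<And>q. 0 \<le> q \<Longrightarrow> \<beta> q \<le> C"
  shows "continuous_on {0..} (\<lambda>q. integral {0..q} \<beta>)"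
proof -
  have C: "0 \<le> C" using bd(1)[of 0] bd(2)[of 0] by simp
  have le: "integral {0..p} \<beta> - integral {0..q} \<beta> \<le> C * \<bar>p - q\<bar>" if "0 \<le> p" "0 \<le> q" for p q
  proof -
    have "\<beta> p * (p - q) \<le> \<beta> p * \<bar>p - q\<bar>" using bd(1)[OF that(1)] by (intro mult_left_mono) auto
    also have "\<dots> \<le> C * \<bar>p - q\<bar>" using bd(2)[OF that(1)] by (intro mult_right_mono) auto
    finally show ?thesis using integral_diff_le_if_mono[OF cont mono that] by linarith
  qed
  have "C-lipschitz_on {0..} (\<lambda>q. integral {0..q} \<beta>)"
  proof (rule lipschitz_onI[OF _ C])
    fix x y :: real assume "x \<in> {0..}" "y \<in> {0..}"
    then show "dist (integral {0..x} \<beta>) (integral {0..y} \<beta>) \<le> C * dist x y"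
      using le[of x y] le[of y x] by (simp add: dist_real_def abs_le_iff abs_minus_commute)
  qed
  then show ?thesis by (rule lipschitz_on_continuous_on)
qed

text \<open>A bounded substitute for \<open>(a + 1) * q powr a\<close>, the derivative of
  \<open>q powr (a + 1)\<close>; later \<open>a + 1\<close> is half the Lebesgue exponent. The
  \<epsilon> in the numerator keeps the base positive, so that the power is differentiable at 0; the
  one in the denominator keeps the base below \<open>1 / \<epsilon>\<close>.\<close>

definition truncated_power :: "real \<Rightarrow> real \<Rightarrow> real \<Rightarrow> real" where
  "truncated_power \<epsilon> a q = (a + 1) * ((q + \<epsilon>) / (1 + \<epsilon> * q)) powr a"

text \<open>The base is a fractional linear function, increasing because \<epsilon> is below 1. The
  last constant dominates both \<open>(a + 1) * (1 / \<epsilon>) powr a\<close>, for the weight, and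
  \<open>2 * a * (a + 1) * (1 / \<epsilon>) powr a\<close>, for \<open>2 * q\<close> times its
  derivative.\<close>

lemma radial_weight_truncated_power:
  assumes \<epsilon>: "0 < \<epsilon>" "\<epsilon> < 1" and a: "0 \<le> a"
  shows "radial_weight (truncated_power \<epsilon> a)
    (\<lambda>q. (a + 1) * (a * ((q + \<epsilon>) / (1 + \<epsilon> * q)) powr (a - 1) * ((1 - \<epsilon>\<^sup>2) / (1 + \<epsilon> * q)\<^sup>2)))
    (\<lambda>q. integral {0..q} (truncated_power \<epsilon> a)) ((a + 1) * (1 + 2 * a) * (1 / \<epsilon>) powr a)"
proof -
  let ?g = "\<lambda>q. (q + \<epsilon>) / (1 + \<epsilon> * q)"
  let ?\<beta> = "truncated_power \<epsilon> a" and ?C = "(a + 1) * (1 + 2 * a) * (1 / \<epsilon>) powr a"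
  let ?\<beta>' = "\<lambda>q. (a + 1) * (a * ((q + \<epsilon>) / (1 + \<epsilon> * q)) powr (a - 1) * ((1 - \<epsilon>\<^sup>2) / (1 + \<epsilon> * q)\<^sup>2))"
  have den: "0 < 1 + \<epsilon> * q" if "0 \<le> q" for q using \<epsilon> that by (simp add: add_pos_nonneg)
  have g: "0 < ?g q" if "0 \<le> q" for q using \<epsilon> den[OF that] that by simp
  have \<epsilon>2: "0 \<le> 1 - \<epsilon>\<^sup>2" using \<epsilon> by (simp add: power_le_one)
  have gmono: "?g p \<le> ?g q" if "0 \<le> p" "p \<le> q" for p q
  proof -
    have "0 \<le> (1 - \<epsilon>\<^sup>2) * (q - p)" using \<epsilon>2 that by simp
    then have "(p + \<epsilon>) * (1 + \<epsilon> * q) \<le> (q + \<epsilon>) * (1 + \<epsilon> * p)"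
      by (simp add: algebra_simps power2_eq_square)
    then show ?thesis using den[of p] den[of q] that by (simp add: divide_le_eq le_divide_eq mult.commute)
  qed
  have gle: "?g q \<le> 1 / \<epsilon>" if "0 \<le> q" for q
  proof -
    have "\<epsilon> * \<epsilon> \<le> 1 * 1" using \<epsilon> by (intro mult_mono) auto
    then show ?thesis using den[OF that] \<epsilon> by (simp add: field_simps)
  qed
  have gp: "?g q powr a \<le> (1 / \<epsilon>) powr a" if "0 \<le> q" for q
    using g[OF that] gle[OF that] a by (intro powr_mono2) auto
  have mono: "?\<beta> p \<le> ?\<beta> q" if "0 \<le> p" "p \<le> q" for p q
    unfolding truncated_power_def using gmono[OF that] g[OF that(1)] a by (intro mult_left_mono powr_mono2) auto
  have nonneg: "0 \<le> ?\<beta> q" for q using a by (simp add: truncated_power_def)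
  have C1: "(a + 1) * (1 / \<epsilon>) powr a \<le> ?C"
  proof -
    have "(a + 1) * 1 * (1 / \<epsilon>) powr a \<le> ?C" using a by (intro mult_right_mono mult_left_mono) auto
    then show ?thesis by simp
  qed
  have le: "?\<beta> q \<le> ?C" if "0 \<le> q" for q
    using order_trans[OF mult_left_mono[OF gp[OF that]] C1] a by (simp add: truncated_power_def)
  have der: "(?\<beta> has_real_derivative ?\<beta>' q) (at q)" if q: "0 \<le> q" for q
  proof -
    have "(?g has_real_derivative (1 * (1 + \<epsilon> * q) - (q + \<epsilon>) * \<epsilon>) / ((1 + \<epsilon> * q) * (1 + \<epsilon> * q))) (at q)"
      using den[OF q] by (auto intro!: derivative_eq_intros)
    moreover have "(1 * (1 + \<epsilon> * q) - (q + \<epsilon>) * \<epsilon>) / ((1 + \<epsilon> * q) * (1 + \<epsilon> * q)) = (1 - \<epsilon>\<^sup>2) / (1 + \<epsilon> * q)\<^sup>2"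
      by (simp add: power2_eq_square algebra_simps)
    ultimately have "(?g has_real_derivative (1 - \<epsilon>\<^sup>2) / (1 + \<epsilon> * q)\<^sup>2) (at q)" by simp
    from DERIV_cmult[OF DERIV_fun_powr[OF this g[OF q], of a], of "a + 1"]
    show ?thesis by (simp add: truncated_power_def[abs_def] mult.assoc)
  qed
  have cont: "continuous_on {0..} ?\<beta>"
    using der by (intro DERIV_continuous_on) (auto intro: has_field_derivative_at_within)
  show ?thesis
  proof
    show "(?\<beta> has_real_derivative ?\<beta>' q) (at q)" if "0 \<le> q" for q by (rule der[OF that])
    show "continuous_on {0..} ?\<beta>'"
    proof -
      have "1 + \<epsilon> * q \<noteq> 0" "q + \<epsilon> \<noteq> 0" if "q \<in> {0..}" for q using den[of q] \<epsilon> that by auto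
      then show ?thesis by (intro continuous_intros) auto
    qed
    show "0 \<le> ?\<beta> q" for q by (rule nonneg)
    show "?\<beta> q \<le> ?C" if "0 \<le> q" for q by (rule le[OF that])
    show "0 \<le> ?\<beta>' q" for q using a \<epsilon>2 by simp
    show "2 * q * ?\<beta>' q \<le> ?C" if q: "0 \<le> q" for q
    proof -
      \<comment> \<open>For the base \<open>g\<close> this says \<open>q * g' \<le> g\<close>, so
        one factor of \<open>g\<close> restores the exponent \<open>a\<close>.\<close>
      have "q * ((1 - \<epsilon>\<^sup>2) / (1 + \<epsilon> * q)\<^sup>2) \<le> ?g q"
      proof -
        have "0 \<le> \<epsilon> * q\<^sup>2 + \<epsilon> + 2 * (\<epsilon>\<^sup>2 * q)" using \<epsilon> q by simp
        then have "q * (1 - \<epsilon>\<^sup>2) \<le> (q + \<epsilon>) * (1 + \<epsilon> * q)"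
          by (simp add: algebra_simps power2_eq_square)
        then have "q * (1 - \<epsilon>\<^sup>2) / (1 + \<epsilon> * q)\<^sup>2 \<le> (q + \<epsilon>) * (1 + \<epsilon> * q) / (1 + \<epsilon> * q)\<^sup>2"
          by (rule divide_right_mono) simp
        also have "\<dots> = ?g q" using den[OF q] by (simp add: power2_eq_square)
        finally show ?thesis by simp
      qed
      then have "?g q powr (a - 1) * (q * ((1 - \<epsilon>\<^sup>2) / (1 + \<epsilon> * q)\<^sup>2)) \<le> ?g q powr (a - 1) * ?g q"
        by (rule mult_left_mono) simp
      also have "\<dots> = ?g q powr a" using g[OF q] q \<epsilon> den[OF q] powr_add[of "?g q" "a - 1" 1] by simp
      also have "\<dots> \<le> (1 / \<epsilon>) powr a" by (rule gp[OF q])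
      finally have "(2 * a * (a + 1)) * (?g q powr (a - 1) * (q * ((1 - \<epsilon>\<^sup>2) / (1 + \<epsilon> * q)\<^sup>2)))
          \<le> (2 * a * (a + 1)) * (1 / \<epsilon>) powr a" using a by (intro mult_left_mono) auto
      also have "\<dots> \<le> ((a + 1) * (1 + 2 * a)) * (1 / \<epsilon>) powr a"
        using a by (intro mult_right_mono) (auto simp: algebra_simps)
      finally show ?thesis by (simp only: ac_simps)
    qed
    show "integral {0..p} ?\<beta> - integral {0..q} ?\<beta> \<le> ?\<beta> p * (p - q)" if "0 \<le> p" "0 \<le> q" for p q
      by (rule integral_diff_le_if_mono[OF cont mono that])
    show "integral {0..0} ?\<beta> = 0" by simp
    show "continuous_on {0..} (\<lambda>q. integral {0..q} ?\<beta>)"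
      by (rule continuous_on_integral_upper[OF cont mono nonneg le])
  qed
qed

text \<open>For \<open>x\<close> in \<open>[0, q]\<close> the base lies between
  \<open>x / (1 + \<epsilon> * q)\<close> and \<open>x + \<epsilon>\<close>, and both comparison
  powers have explicit integrals. Both bounds tend to \<open>q powr (a + 1)\<close> as \<epsilon>
  tends to 0.\<close>

lemma integral_truncated_power_bounds:
  assumes \<epsilon>: "0 < \<epsilon>" "\<epsilon> < 1" and a: "0 \<le> a" and q: "0 \<le> q"
  shows "q powr (a + 1) / (1 + \<epsilon> * q) powr a \<le> integral {0..q} (truncated_power \<epsilon> a)"
    and "integral {0..q} (truncated_power \<epsilon> a) \<le> (q + \<epsilon>) powr (a + 1)"
proof -
  interpret radial_weight "truncated_power \<epsilon> a"
    "\<lambda>q. (a + 1) * (a * ((q + \<epsilon>) / (1 + \<epsilon> * q)) powr (a - 1) * ((1 - \<epsilon>\<^sup>2) / (1 + \<epsilon> * q)\<^sup>2))"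
    "\<lambda>q. integral {0..q} (truncated_power \<epsilon> a)" "(a + 1) * (1 + 2 * a) * (1 / \<epsilon>) powr a"
    by (rule radial_weight_truncated_power[OF \<epsilon> a])
  have cont: "continuous_on {0..} (truncated_power \<epsilon> a)"
    using der by (intro DERIV_continuous_on) (auto intro: has_field_derivative_at_within)
  have int: "(truncated_power \<epsilon> a has_integral integral {0..q} (truncated_power \<epsilon> a)) {0..q}"
    by (intro integrable_integral integrable_continuous_interval) (rule continuous_on_subset[OF cont], auto)
  have den: "0 < 1 + \<epsilon> * r" if "0 \<le> r" for r using \<epsilon> that by (simp add: add_pos_nonneg)
  have "((\<lambda>x. x powr a) has_integral (q powr (a + 1) / (a + 1))) {0..q}"
    using a q by (intro has_integral_powr_from_0) auto
  from has_integral_mult_right[OF this, of "(a + 1) / (1 + \<epsilon> * q) powr a"]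
  have lo: "((\<lambda>x. (a + 1) / (1 + \<epsilon> * q) powr a * x powr a) has_integral
      q powr (a + 1) / (1 + \<epsilon> * q) powr a) {0..q}" using a by simp
  show "q powr (a + 1) / (1 + \<epsilon> * q) powr a \<le> integral {0..q} (truncated_power \<epsilon> a)"
  proof (rule has_integral_le[OF lo int])
    fix x assume x: "x \<in> {0..q}"
    have "x / (1 + \<epsilon> * q) \<le> (x + \<epsilon>) / (1 + \<epsilon> * x)"
      using x \<epsilon> den[of x] by (intro frac_le) (auto intro: mult_left_mono)
    then have "(x / (1 + \<epsilon> * q)) powr a \<le> ((x + \<epsilon>) / (1 + \<epsilon> * x)) powr a"
      using a x den[OF q] by (intro powr_mono2) auto
    then have "(a + 1) * (x powr a / (1 + \<epsilon> * q) powr a) \<le> (a + 1) * ((x + \<epsilon>) / (1 + \<epsilon> * x)) powr a"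
      using a x den[OF q] by (intro mult_left_mono) (auto simp: powr_divide)
    then show "(a + 1) / (1 + \<epsilon> * q) powr a * x powr a \<le> truncated_power \<epsilon> a x"
      by (simp add: truncated_power_def)
  qed
  have up: "((\<lambda>x. (a + 1) * (x + \<epsilon>) powr a) has_integral ((q + \<epsilon>) powr (a + 1) - (0 + \<epsilon>) powr (a + 1))) {0..q}"
  proof (rule fundamental_theorem_of_calculus[OF q])
    fix x assume x: "x \<in> {0..q}"
    have "((\<lambda>x. (x + \<epsilon>) powr (a + 1)) has_real_derivative (a + 1) * (x + \<epsilon>) powr a) (at x)"
      using x \<epsilon> DERIV_fun_powr[of "\<lambda>x. x + \<epsilon>" 1 x "a + 1"] by (auto intro!: derivative_eq_intros)
    then show "((\<lambda>x. (x + \<epsilon>) powr (a + 1)) has_vector_derivative (a + 1) * (x + \<epsilon>) powr a) (at x within {0..q})"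
      by (simp add: has_real_derivative_iff_has_vector_derivative[symmetric] has_field_derivative_at_within)
  qed
  have "integral {0..q} (truncated_power \<epsilon> a) \<le> (q + \<epsilon>) powr (a + 1) - (0 + \<epsilon>) powr (a + 1)"
  proof (rule has_integral_le[OF int up])
    fix x assume x: "x \<in> {0..q}"
    have "(x + \<epsilon>) / (1 + \<epsilon> * x) \<le> (x + \<epsilon>) / 1"
      using x \<epsilon> den[of x] by (intro divide_left_mono) auto
    then show "truncated_power \<epsilon> a x \<le> (a + 1) * (x + \<epsilon>) powr a"
      unfolding truncated_power_def using a x \<epsilon> den[of x] by (intro mult_left_mono powr_mono2) auto
  qed
  then show "integral {0..q} (truncated_power \<epsilon> a) \<le> (q + \<epsilon>) powr (a + 1)"
    using powr_ge_zero[of "0 + \<epsilon>" "a + 1"] by linarith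
qed

subsection \<open>Decay of the Lebesgue norms\<close>

lemma square_powr_half:
  fixes x r :: real
  assumes "0 \<le> x"
  shows "(x\<^sup>2) powr (r / 2) = x powr r"
proof (cases "x = 0")
  case False
  then have "x\<^sup>2 = x powr 2" using assms by simp
  then show ?thesis by (simp add: powr_powr)
qed simp

text \<open>The lower bound for the energy is used at time \<open>t\<close> and the upper bound at
  time 0, which leaves explicit integrands for the limit in \<epsilon>.\<close>

lemma (in bounded_open) truncated_power_decay:
  fixes u :: "real \<Rightarrow> 'a \<Rightarrow> real^3"
  assumes u: "llb_strong_solution \<kappa>1 \<kappa>2 \<mu> \<gamma> D \<alpha> T u0 u"
    and \<kappa>: "0 \<le> \<kappa>1" "0 \<le> \<kappa>2" "0 \<le> \<mu>" and t: "0 \<le> t" "t < T"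
    and us: "sqint M (\<lambda>x. exp (\<kappa>2 * t) *\<^sub>R u t x)" and u0: "sqint M u0"
    and \<epsilon>: "0 < \<epsilon>" "\<epsilon> < 1" and r: "2 \<le> r"
  shows "(\<integral>\<^sup>+x. ennreal (norm (exp (\<kappa>2 * t) *\<^sub>R u t x) powr r /
            (1 + \<epsilon> * (norm (exp (\<kappa>2 * t) *\<^sub>R u t x))\<^sup>2) powr (r / 2 - 1)) \<partial>M)
    \<le> (\<integral>\<^sup>+x. ennreal (((norm (u0 x))\<^sup>2 + \<epsilon>) powr (r / 2)) \<partial>M)"
proof -
  define w where "w = (\<lambda>x. exp (\<kappa>2 * t) *\<^sub>R u t x)"
  define a where "a = r / 2 - 1"
  have a: "0 \<le> a" and ra: "a + 1 = r / 2" using r by (auto simp: a_def)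
  interpret W: bounded_open_weight D "truncated_power \<epsilon> a"
    "\<lambda>q. (a + 1) * (a * ((q + \<epsilon>) / (1 + \<epsilon> * q)) powr (a - 1) * ((1 - \<epsilon>\<^sup>2) / (1 + \<epsilon> * q)\<^sup>2))"
    "\<lambda>q. integral {0..q} (truncated_power \<epsilon> a)" "(a + 1) * (1 + 2 * a) * (1 / \<epsilon>) powr a"
    by (intro bounded_open_weight.intro bounded_open_axioms radial_weight_truncated_power \<epsilon> a)
  let ?B = "\<lambda>q. integral {0..q} (truncated_power \<epsilon> a)"
  have nn: "(\<integral>\<^sup>+x. ennreal (?B (f x \<bullet> f x)) \<partial>M) = ennreal (W.energy f)" if "sqint M f" for f :: "'a \<Rightarrow> real^3"
    unfolding W.energy_def by (intro nn_integral_eq_integral W.energy_integrable that AE_I2 W.B_bounds(1)) simp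
  have "(\<integral>\<^sup>+x. ennreal (norm (w x) powr r / (1 + \<epsilon> * (norm (w x))\<^sup>2) powr a) \<partial>M)
      \<le> (\<integral>\<^sup>+x. ennreal (?B (w x \<bullet> w x)) \<partial>M)"
  proof (intro nn_integral_mono ennreal_leI)
    fix x
    show "norm (w x) powr r / (1 + \<epsilon> * (norm (w x))\<^sup>2) powr a \<le> ?B (w x \<bullet> w x)"
      using integral_truncated_power_bounds(1)[OF \<epsilon> a, of "w x \<bullet> w x"]
      by (simp add: ra dot_square_norm square_powr_half)
  qed
  also have "\<dots> = ennreal (W.energy w)" by (rule nn[OF us[folded w_def]])
  also have "\<dots> \<le> ennreal (W.energy u0)"
    unfolding w_def by (intro ennreal_leI W.energy_decay[OF u \<kappa> t])
  also have "\<dots> = (\<integral>\<^sup>+x. ennreal (?B (u0 x \<bullet> u0 x)) \<partial>M)" by (rule nn[OF u0, symmetric])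
  also have "\<dots> \<le> (\<integral>\<^sup>+x. ennreal (((norm (u0 x))\<^sup>2 + \<epsilon>) powr (r / 2)) \<partial>M)"
  proof (intro nn_integral_mono ennreal_leI)
    fix x
    show "?B (u0 x \<bullet> u0 x) \<le> ((norm (u0 x))\<^sup>2 + \<epsilon>) powr (r / 2)"
      using integral_truncated_power_bounds(2)[OF \<epsilon> a, of "u0 x \<bullet> u0 x"]
      by (simp add: ra dot_square_norm)
  qed
  finally show ?thesis by (simp add: w_def a_def)
qed

text \<open>As \<epsilon> tends to 0, Fatou's lemma handles the left side, where integrability is
  not yet known, and dominated convergence the right side. An infinite right side is
  trivial.\<close>

lemma (in bounded_open) integral_powr_decay:
  fixes u :: "real \<Rightarrow> 'a \<Rightarrow> real^3"
  assumes u: "llb_strong_solution \<kappa>1 \<kappa>2 \<mu> \<gamma> D \<alpha> T u0 u"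
    and \<kappa>: "0 \<le> \<kappa>1" "0 \<le> \<kappa>2" "0 \<le> \<mu>" and t: "0 \<le> t" "t < T" and r: "2 \<le> r"
  shows "(\<integral>\<^sup>+x. ennreal (norm (exp (\<kappa>2 * t) *\<^sub>R u t x) powr r) \<partial>M) \<le> (\<integral>\<^sup>+x. ennreal (norm (u0 x) powr r) \<partial>M)"
proof (cases "(\<integral>\<^sup>+x. ennreal (norm (u0 x) powr r) \<partial>M) = \<infinity>")
  case False
  then have fin: "(\<integral>\<^sup>+x. ennreal (norm (u0 x) powr r) \<partial>M) < \<infinity>" by (simp add: less_top)
  have c: "continuous_into_L2 T D u" and u0H: "u0 \<in> Hs_space D 1"
    using u by (auto simp: llb_strong_solution_def llb_weak_solution_def)
  define w where "w = (\<lambda>x. exp (\<kappa>2 * t) *\<^sub>R u t x)"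
  have ws: "sqint M w" unfolding w_def using continuous_into_L2D(1)[OF c, of t] t by (intro sqint_scaleR(1)) simp
  have u0: "sqint M u0" by (rule H1_sqint[OF u0H])
  note [measurable] = sqint_measurable[OF ws] sqint_measurable[OF u0]
  \<comment> \<open>The shift by two keeps all values strictly below 1.\<close>
  define \<epsilon> where "\<epsilon> n = inverse (real (Suc (Suc n)))" for n
  have \<epsilon>: "0 < \<epsilon> n" "\<epsilon> n < 1" for n by (simp_all add: \<epsilon>_def inverse_less_1_iff)
  have \<epsilon>0: "\<epsilon> \<longlonglongrightarrow> 0" unfolding \<epsilon>_def by (rule LIMSEQ_Suc[OF LIMSEQ_inverse_real_of_nat])
  define f where "f n x = ennreal (norm (w x) powr r / (1 + \<epsilon> n * (norm (w x))\<^sup>2) powr (r / 2 - 1))" for n x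
  define g where "g n x = ennreal (((norm (u0 x))\<^sup>2 + \<epsilon> n) powr (r / 2))" for n x
  have fm: "f n \<in> borel_measurable M" for n unfolding f_def by measurable
  have gm: "g n \<in> borel_measurable M" for n unfolding g_def by measurable
  have fg: "(\<integral>\<^sup>+x. f n x \<partial>M) \<le> (\<integral>\<^sup>+x. g n x \<partial>M)" for n
    unfolding f_def g_def w_def by (rule truncated_power_decay[OF u \<kappa> t ws[unfolded w_def] u0 \<epsilon> r])
  have flim: "(\<lambda>n. f n x) \<longlonglongrightarrow> ennreal (norm (w x) powr r)" for x
  proof -
    have "(\<lambda>n. norm (w x) powr r / (1 + \<epsilon> n * (norm (w x))\<^sup>2) powr (r / 2 - 1))
        \<longlonglongrightarrow> norm (w x) powr r / (1 + 0 * (norm (w x))\<^sup>2) powr (r / 2 - 1)"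
      by (intro tendsto_divide tendsto_const tendsto_powr tendsto_add tendsto_mult \<epsilon>0) simp_all
    then show ?thesis unfolding f_def by (intro tendsto_ennrealI) simp
  qed
  have glim: "(\<lambda>n. g n x) \<longlonglongrightarrow> ennreal (norm (u0 x) powr r)" for x
  proof -
    \<comment> \<open>The base tends to 0 where \<open>u0\<close> vanishes; the power is continuous
      there because the exponent is positive and the bases are nonnegative.\<close>
    have "(\<lambda>n. ((norm (u0 x))\<^sup>2 + \<epsilon> n) powr (r / 2)) \<longlonglongrightarrow> ((norm (u0 x))\<^sup>2 + 0) powr (r / 2)"
    proof (rule tendsto_powr')
      show "(\<lambda>n. (norm (u0 x))\<^sup>2 + \<epsilon> n) \<longlonglongrightarrow> (norm (u0 x))\<^sup>2 + 0"
        by (intro tendsto_add tendsto_const \<epsilon>0)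
      have "\<forall>\<^sub>F n in sequentially. 0 \<le> (norm (u0 x))\<^sup>2 + \<epsilon> n"
        by (intro always_eventually allI add_nonneg_nonneg zero_le_power2 less_imp_le[OF \<epsilon>(1)])
      then show "(norm (u0 x))\<^sup>2 + 0 \<noteq> 0 \<or> 0 < r / 2 \<and> (\<forall>\<^sub>F n in sequentially. 0 \<le> (norm (u0 x))\<^sup>2 + \<epsilon> n)"
        using r by simp
    qed simp
    then show ?thesis unfolding g_def by (intro tendsto_ennrealI) (simp add: square_powr_half)
  qed
  \<comment> \<open>The base is at most 2 where \<open>norm (u0 x) \<le> 1\<close>, and at most
    twice the square of the norm elsewhere. The constant 1 is integrable on the finite
    measure.\<close>
  have dom: "g n x \<le> ennreal (2 powr (r / 2)) * (ennreal (norm (u0 x) powr r) + 1)" for n x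
  proof -
    let ?q = "(norm (u0 x))\<^sup>2"
    have "(?q + \<epsilon> n) powr (r / 2) \<le> 2 powr (r / 2) * (?q powr (r / 2) + 1)"
    proof (cases "?q \<le> 1")
      case True
      have "(?q + \<epsilon> n) powr (r / 2) \<le> 2 powr (r / 2)"
        using True \<epsilon>[of n] r by (intro powr_mono2) auto
      also have "\<dots> \<le> 2 powr (r / 2) * (?q powr (r / 2) + 1)" by (simp add: algebra_simps)
      finally show ?thesis .
    next
      case False
      have "(?q + \<epsilon> n) powr (r / 2) \<le> (2 * ?q) powr (r / 2)"
        using False \<epsilon>[of n] r by (intro powr_mono2) auto
      also have "\<dots> = 2 powr (r / 2) * ?q powr (r / 2)" by (rule powr_mult)
      also have "\<dots> \<le> 2 powr (r / 2) * (?q powr (r / 2) + 1)" by (intro mult_left_mono) auto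
      finally show ?thesis .
    qed
    then have "ennreal ((?q + \<epsilon> n) powr (r / 2)) \<le> ennreal (2 powr (r / 2) * (norm (u0 x) powr r + 1))"
      by (intro ennreal_leI) (simp add: square_powr_half)
    then show ?thesis by (simp add: g_def ennreal_mult ennreal_plus)
  qed
  have "(\<lambda>n. \<integral>\<^sup>+x. g n x \<partial>M) \<longlonglongrightarrow> (\<integral>\<^sup>+x. ennreal (norm (u0 x) powr r) \<partial>M)"
  proof (rule nn_integral_dominated_convergence)
    show "AE x in M. g n x \<le> ennreal (2 powr (r / 2)) * (ennreal (norm (u0 x) powr r) + 1)" for n
      by (rule AE_I2) (rule dom)
    have "(\<integral>\<^sup>+x. ennreal (2 powr (r / 2)) * (ennreal (norm (u0 x) powr r) + 1) \<partial>M)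
        = ennreal (2 powr (r / 2)) * ((\<integral>\<^sup>+x. ennreal (norm (u0 x) powr r) \<partial>M) + emeasure M (space M))"
      by (subst nn_integral_cmult) (simp_all add: nn_integral_add)
    also have "\<dots> < \<infinity>"
      using fin M.emeasure_finite[of "space M"] by (simp add: ennreal_mult_eq_top_iff less_top[symmetric])
    finally show "(\<integral>\<^sup>+x. ennreal (2 powr (r / 2)) * (ennreal (norm (u0 x) powr r) + 1) \<partial>M) < \<infinity>" .
    show "AE x in M. (\<lambda>n. g n x) \<longlonglongrightarrow> ennreal (norm (u0 x) powr r)" by (rule AE_I2) (rule glim)
  qed (use gm in measurable)
  then have gL: "liminf (\<lambda>n. \<integral>\<^sup>+x. g n x \<partial>M) = (\<integral>\<^sup>+x. ennreal (norm (u0 x) powr r) \<partial>M)"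
    by (intro lim_imp_Liminf) simp
  have "(\<integral>\<^sup>+x. ennreal (norm (w x) powr r) \<partial>M) = (\<integral>\<^sup>+x. liminf (\<lambda>n. f n x) \<partial>M)"
    by (intro nn_integral_cong lim_imp_Liminf[symmetric] flim) simp
  also have "\<dots> \<le> liminf (\<lambda>n. \<integral>\<^sup>+x. f n x \<partial>M)" by (rule nn_integral_liminf[OF fm])
  also have "\<dots> \<le> liminf (\<lambda>n. \<integral>\<^sup>+x. g n x \<partial>M)" by (intro Liminf_mono always_eventually allI fg)
  finally show ?thesis unfolding gL w_def .
qed simp

text \<open>Chebyshev's inequality at a level \<open>c > k\<close> bounds the measure of the set
  where \<open>f\<close> is at least \<open>c\<close> by \<open>(k / c) ^ n\<close> times the total
  measure, for every \<open>n\<close> from 2 on; so the set is null. Countably many levels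
  decreasing to \<open>k\<close> finish the argument.\<close>

lemma (in finite_measure) AE_le_if_nn_integral_powr_le:
  fixes f g :: "'a \<Rightarrow> real"
  assumes f: "f \<in> borel_measurable M" and f0: "\<And>x. 0 \<le> f x" and g0: "\<And>x. 0 \<le> g x"
    and k: "0 \<le> k" "AE x in M. g x \<le> k"
    and le: "\<And>r. 2 \<le> r \<Longrightarrow> (\<integral>\<^sup>+x. ennreal (f x powr r) \<partial>M) \<le> (\<integral>\<^sup>+x. ennreal (g x powr r) \<partial>M)"
  shows "AE x in M. f x \<le> k"
proof -
  have "AE x in M. f x < c" if c: "k < c" for c
  proof -
    have c0: "0 < c" using k c by simp
    define S where "S = {x \<in> space M. c \<le> f x}"
    have S: "S \<in> sets M" unfolding S_def using f by measurable
    have main: "measure M S \<le> (k / c) ^ n * measure M (space M)" if n: "2 \<le> n" for n :: nat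
    proof -
      have "ennreal (c ^ n * measure M S) = (\<integral>\<^sup>+x. ennreal (c ^ n) * indicator S x \<partial>M)"
        using c0 S by (simp add: nn_integral_cmult_indicator emeasure_eq_measure ennreal_mult)
      also have "\<dots> \<le> (\<integral>\<^sup>+x. ennreal (f x powr real n) \<partial>M)"
      proof (rule nn_integral_mono)
        fix x
        show "ennreal (c ^ n) * indicator S x \<le> ennreal (f x powr real n)"
        proof (cases "x \<in> S")
          case True
          then have "c ^ n \<le> f x ^ n" using c0 by (intro power_mono) (auto simp: S_def)
          then show ?thesis using True n f0[of x] by (simp add: powr_realpow' ennreal_leI)
        qed simp
      qed
      also have "\<dots> \<le> (\<integral>\<^sup>+x. ennreal (g x powr real n) \<partial>M)" using n by (intro le) simp
      also have "\<dots> \<le> (\<integral>\<^sup>+x. ennreal (k ^ n) \<partial>M)"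
      proof (rule nn_integral_mono_AE)
        show "AE x in M. ennreal (g x powr real n) \<le> ennreal (k ^ n)"
          using k(2)
        proof eventually_elim
          case (elim x)
          then show ?case using g0[of x] n by (auto simp: powr_realpow' intro!: ennreal_leI power_mono)
        qed
      qed
      also have "\<dots> = ennreal (k ^ n * measure M (space M))"
        using k by (simp add: emeasure_eq_measure ennreal_mult)
      finally have "c ^ n * measure M S \<le> k ^ n * measure M (space M)"
        using k by (simp add: ennreal_le_iff)
      then show ?thesis using c0 by (simp add: power_divide field_simps)
    qed
    have "(\<lambda>n. (k / c) ^ n * measure M (space M)) \<longlonglongrightarrow> 0 * measure M (space M)"
      using k(1) c c0 by (intro tendsto_mult tendsto_const LIMSEQ_power_zero) simp
    then have "measure M S \<le> 0 * measure M (space M)"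
      by (rule LIMSEQ_le_const) (use main in blast)
    then have "emeasure M S = 0" by (simp add: emeasure_eq_measure measure_le_0_iff)
    with S have "S \<in> null_sets M" by auto
    from AE_not_in[OF this] show ?thesis
      using AE_space by eventually_elim (auto simp: S_def)
  qed
  then have "AE x in M. \<forall>n. f x < k + inverse (real (Suc n))"
    unfolding AE_all_countable by simp
  then show ?thesis
  proof eventually_elim
    case (elim x)
    show ?case
    proof (rule ccontr)
      assume "\<not> f x \<le> k"
      then obtain n where "inverse (real (Suc n)) < f x - k" using reals_Archimedean[of "f x - k"] by auto
      with elim[rule_format, of n] show False by simp
    qed
  qed
qed

lemma epow_scaled_le:
  assumes r: "0 < r" and E: "0 < E" and le: "ennreal (E powr r) * A \<le> B"
  shows "epow A (1 / r) \<le> ennreal (1 / E) * epow B (1 / r)"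
proof (cases "B = top")
  case True
  then show ?thesis using E by (simp add: epow_def ennreal_mult_top)
next
  case False
  then obtain b where b: "0 \<le> b" "B = ennreal b" by (cases B) auto
  have "A \<noteq> top"
  proof
    assume "A = top"
    then have "ennreal (E powr r) * A = top" using E by (simp add: ennreal_mult_top)
    with le b show False by (simp add: top_unique)
  qed
  then obtain a where a: "0 \<le> a" "A = ennreal a" by (cases A) auto
  have "E powr r * a \<le> b" using le a b by (simp add: ennreal_mult[symmetric] ennreal_le_iff)
  then have "(E powr r * a) powr (1 / r) \<le> b powr (1 / r)" using r a by (intro powr_mono2) auto
  moreover have "(E powr r * a) powr (1 / r) = E * a powr (1 / r)"
    using r E a by (simp add: powr_mult powr_powr)
  ultimately have "a powr (1 / r) \<le> 1 / E * b powr (1 / r)" using E by (simp add: field_simps)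
  then show ?thesis using a b E by (simp add: epow_def ennreal_mult[symmetric] ennreal_leI)
qed

lemma polytopal_domain_open_bounded:
  assumes "polytopal_domain D"
  shows "open D" "bounded D"
  using assms unfolding polytopal_domain_def polygonal_domain_def
  by (auto simp: open_box bounded_box intro: bounded_subset[OF polytope_imp_bounded interior_subset])

text \<open>For finite \<open>p\<close> the root of the integral inequality releases the factor
  \<open>1 / E\<close>. For \<open>p = top\<close> the inequalities for all finite exponents
  together carry an essential bound of \<open>u0\<close> over to
  \<open>E *\<^sub>R u t x\<close>.\<close>

lemma (in bounded_open) Lp_norm_decay:
  fixes u :: "real \<Rightarrow> 'a \<Rightarrow> real^3" and p :: ennreal
  assumes u: "llb_strong_solution \<kappa>1 \<kappa>2 \<mu> \<gamma> D \<alpha> T u0 u"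
    and \<kappa>: "0 \<le> \<kappa>1" "0 \<le> \<kappa>2" "0 \<le> \<mu>" and t: "0 \<le> t" "t < T" and p: "2 \<le> p"
  shows "Lp_norm D p (u t) \<le> ennreal (exp (- \<kappa>2 * t)) * Lp_norm D p u0"
proof -
  have c: "continuous_into_L2 T D u" and u0H: "u0 \<in> Hs_space D 1"
    using u by (auto simp: llb_strong_solution_def llb_weak_solution_def)
  have um [measurable]: "u t \<in> borel_measurable M"
    using sqint_measurable[OF continuous_into_L2D(1)[OF c]] t by simp
  have u0m [measurable]: "u0 \<in> borel_measurable M" by (rule sqint_measurable[OF H1_sqint[OF u0H]])
  define E where "E = exp (\<kappa>2 * t)"
  have E: "0 < E" "1 / E = exp (- \<kappa>2 * t)" by (simp_all add: E_def exp_minus inverse_eq_divide)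
  note decay = integral_powr_decay[OF u \<kappa> t, folded E_def]
  show ?thesis
  proof (cases "p = top")
    case False
    then obtain r where r: "0 \<le> r" "p = ennreal r" by (cases p) auto
    have "ennreal 2 \<le> ennreal r" using p r by simp
    then have r2: "2 \<le> r" using r(1) by (simp add: ennreal_le_iff del: ennreal_numeral)
    have *: "Lp_norm D p f = epow (\<integral>\<^sup>+x. ennreal (norm (f x) powr r) \<partial>M) (1 / r)" for f :: "'a \<Rightarrow> real^3"
      using r by (simp add: Lp_norm_def eLp_def epow_def)
    have "(\<integral>\<^sup>+x. ennreal (norm (E *\<^sub>R u t x) powr r) \<partial>M) = (\<integral>\<^sup>+x. ennreal (E powr r) * ennreal (norm (u t x) powr r) \<partial>M)"
      using E by (simp add: powr_mult ennreal_mult)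
    also have "\<dots> = ennreal (E powr r) * (\<integral>\<^sup>+x. ennreal (norm (u t x) powr r) \<partial>M)"
      by (rule nn_integral_cmult) measurable
    finally show ?thesis
      using epow_scaled_le[of r E] decay[OF r2] r2 E unfolding * by simp
  next
    case True
    have L: "Lp_norm D p f = esssup M (\<lambda>x. ennreal (norm (f x)))" for f :: "'a \<Rightarrow> real^3"
      using True by (simp add: Lp_norm_def eLp_def)
    show ?thesis
    proof (cases "Lp_norm D p u0 = top")
      case True
      then show ?thesis by (simp add: ennreal_mult_top)
    next
      case False
      then obtain k where k: "0 \<le> k" "Lp_norm D p u0 = ennreal k" by (cases "Lp_norm D p u0") auto
      have "AE x in M. norm (u0 x) \<le> k"
        using esssup_AE[of "\<lambda>x. ennreal (norm (u0 x))" M] k by (simp add: L ennreal_le_iff)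
      then have "AE x in M. norm (E *\<^sub>R u t x) \<le> k"
        by (rule M.AE_le_if_nn_integral_powr_le[rotated 4]) (use k decay in auto)
      then have "AE x in M. ennreal (norm (u t x)) \<le> ennreal (exp (- \<kappa>2 * t) * k)"
      proof eventually_elim
        case (elim x)
        then have "norm (u t x) \<le> 1 / E * k" using E(1) by (simp add: field_simps)
        then show ?case unfolding E(2) by (rule ennreal_leI)
      qed
      then have "esssup M (\<lambda>x. ennreal (norm (u t x))) \<le> ennreal (exp (- \<kappa>2 * t) * k)"
        by (intro esssup_I) measurable
      then show ?thesis by (simp add: L[of "u t"] k ennreal_mult)
    qed
  qed
qed

theorem theorem3p8:
  fixes D :: "'a::euclidean_space set"
    and u0 :: "'a \<Rightarrow> real^3"
    and u :: "real \<Rightarrow> 'a \<Rightarrow> real^3"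
    and \<kappa>1 \<kappa>2 \<mu> \<gamma> \<alpha> t :: real
    and p :: ennreal
  assumes "polytopal_domain D"
    and "admissible D \<alpha>"
    and "0 < \<kappa>1" and "0 < \<kappa>2" and "0 < \<mu>"
    and "\<And>T. 0 < T \<Longrightarrow> llb_strong_solution \<kappa>1 \<kappa>2 \<mu> \<gamma> D \<alpha> T u0 u"
    and "2 \<le> p"
    and "0 \<le> t"
  shows "Lp_norm D p (u t) \<le> ennreal (exp (- \<kappa>2 * t)) * Lp_norm D p u0"
proof -
  interpret bounded_open D
    using polytopal_domain_open_bounded[OF \<open>polytopal_domain D\<close>] by unfold_locales
  show ?thesis
    \<comment> \<open>Any time horizon beyond \<open>t\<close> serves; \<open>t + 1\<close> is also
      positive.\<close>
    by (rule Lp_norm_decay[of \<kappa>1 \<kappa>2 \<mu> \<gamma> \<alpha> "t + 1"]) (use assms in auto)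
qed

end
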